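(* Let $(A,[A])$ be an inflexible Poincaré dga, and let $a,a'\in\mathbb{Q}\setminus\{0\}$ with $|a|\ne|a'|$. If $M\in\mathcal{M}(A,a\cdot[A])$ and $M'\in\mathcal{M}(A,a'\cdot[A])$, then $M$ and $M'$ are not homotopy equivalent.
   Context: Dgas are (graded-commutative, cohomologically graded) differential graded algebras over $\mathbb{Q}$. A Poincaré dga of formal dimension $n$ is a simply connected dga $A$ (i.e. $H^0(A)=\mathbb{Q}$, $H^1(A)=0$) with a class $[A]\in H^n(A)$ such that $H^j(A)=0$ for $j>n$, the map $\mathbb{Q}\to H^n(A)$, $a\mapsto a[A]$ is an isomorphism, and for $0\le j\le n$ the multiplication pairing $H^j(A)\times H^{n-j}(A)\to H^n(A)\cong\mathbb{Q}$ identifies $H^j(A)$ with $\mathrm{Hom}_{\mathbb{Q}}(H^{n-j}(A),\mathbb{Q})$. It is inflexible if there is no dga endomorphism $f\colon A\to A$ with $H^*(f)([A])=\delta\cdot[A]$ for some $\delta\in\mathbb{Q}\setminus\{-1,0,1\}$. For an oriented closed simply connected manifold $M$, $A_M$ denotes its minimal (Sullivan) model over $\mathbb{Q}$, and $[A_M]\in H^*(A_M)\cong H^*(M;\mathbb{Q})$ the class dual to the rational fundamental class $[M]_{\mathbb{Q}}$. For a Poincaré dga $(A,[A])$ of formal dimension $n$, $\mathcal{M}(A,[A])$ is the class of all oriented closed simply connected $n$-manifolds $M$ that have trivial total Pontryagin class ($p_M=1\in H^{4*}(M;\mathbb{Q})$) and for which there is a dga isomorphism $A_M\cong A$ taking $[A_M]$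 to $[A]$. *)

theory Defs
  imports "HOL-Analysis.Analysis" "HOL-Homology.Homology" "HOL-Library.Function_Algebras"
begin

section \<open>Differential graded algebras over the rationals\<close>

text \<open>The underlying vector space of an algebra \<open>A\<close> is the internal direct sum of the
  subspaces \<open>gr A k\<close> (\<open>k \<ge> 0\<close>) of an ambient rational vector space; the algebra operations
  only matter on this direct sum \<open>carr A\<close>.\<close>

record 'a dg_algebra =
  scal :: "rat \<Rightarrow> 'a \<Rightarrow> 'a"
  gr   :: "nat \<Rightarrow> 'a set"
  prd  :: "'a \<Rightarrow> 'a \<Rightarrow> 'a"
  unt  :: "'a"
  dif  :: "'a \<Rightarrow> 'a"

definition carr :: "('a::ab_group_add, 'z) dg_algebra_scheme \<Rightarrow> 'a set" where
  "carr A = module.span (scal A) (\<Union>k. gr A k)"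

locale dga =
  fixes A :: "('a::ab_group_add, 'z) dg_algebra_scheme"
  assumes vector_space: "Vector_Spaces.vector_space (scal A)"
    and subspace: "module.subspace (scal A) (gr A k)"
    and direct: "\<lbrakk>finite K; \<forall>k\<in>K. a k \<in> gr A k; (\<Sum>k\<in>K. a k) = 0; k \<in> K\<rbrakk> \<Longrightarrow> a k = 0"
    and unt_gr: "unt A \<in> gr A 0"
    and prd_gr: "\<lbrakk>x \<in> gr A i; y \<in> gr A j\<rbrakk> \<Longrightarrow> prd A x y \<in> gr A (i + j)"
    and prd_assoc: "\<lbrakk>x \<in> carr A; y \<in> carr A; z \<in> carr A\<rbrakk> \<Longrightarrow>
          prd A (prd A x y) z = prd A x (prd A y z)"
    and prd_unt: "x \<in> carr A \<Longrightarrow> prd A (unt A) x = x" "x \<in> carr A \<Longrightarrow> prd A x (unt A) = x"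
    and prd_add: "\<lbrakk>x \<in> carr A; y \<in> carr A; z \<in> carr A\<rbrakk> \<Longrightarrow> prd A (x + y) z = prd A x z + prd A y z"
      "\<lbrakk>x \<in> carr A; y \<in> carr A; z \<in> carr A\<rbrakk> \<Longrightarrow> prd A x (y + z) = prd A x y + prd A x z"
    and prd_scal: "\<lbrakk>x \<in> carr A; y \<in> carr A\<rbrakk> \<Longrightarrow> prd A (scal A q x) y = scal A q (prd A x y)"
      "\<lbrakk>x \<in> carr A; y \<in> carr A\<rbrakk> \<Longrightarrow> prd A x (scal A q y) = scal A q (prd A x y)"
    and graded_comm: "\<lbrakk>x \<in> gr A i; y \<in> gr A j\<rbrakk> \<Longrightarrow> prd A x y = scal A ((-1) ^ (i * j)) (prd A y x)"
    and dif_gr: "x \<in> gr A k \<Longrightarrow> dif A x \<in> gr A (Suc k)"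
    and dif_add: "\<lbrakk>x \<in> carr A; y \<in> carr A\<rbrakk> \<Longrightarrow> dif A (x + y) = dif A x + dif A y"
    and dif_scal: "x \<in> carr A \<Longrightarrow> dif A (scal A q x) = scal A q (dif A x)"
    and dif_dif: "x \<in> carr A \<Longrightarrow> dif A (dif A x) = 0"
    and leibniz: "\<lbrakk>x \<in> gr A i; y \<in> gr A j\<rbrakk> \<Longrightarrow>
          dif A (prd A x y) = prd A (dif A x) y + scal A ((-1) ^ i) (prd A x (dif A y))"

definition dga_hom ::
  "('a::ab_group_add \<Rightarrow> 'b::ab_group_add) \<Rightarrow> 'a dg_algebra \<Rightarrow> 'b dg_algebra \<Rightarrow> bool" where
  "dga_hom f A B \<longleftrightarrow>
     (\<forall>k. f ` gr A k \<subseteq> gr B k) \<and>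
     (\<forall>x\<in>carr A. \<forall>y\<in>carr A. f (x + y) = f x + f y \<and> f (prd A x y) = prd B (f x) (f y)) \<and>
     (\<forall>x\<in>carr A. (\<forall>q. f (scal A q x) = scal B q (f x)) \<and> f (dif A x) = dif B (f x)) \<and>
     f (unt A) = unt B"

definition dga_iso ::
  "('a::ab_group_add \<Rightarrow> 'b::ab_group_add) \<Rightarrow> 'a dg_algebra \<Rightarrow> 'b dg_algebra \<Rightarrow> bool" where
  "dga_iso f A B \<longleftrightarrow> dga_hom f A B \<and> bij_betw f (carr A) (carr B)"


subsection \<open>Cohomology\<close>

text \<open>Cohomology classes are cosets of the coboundaries; the operations on classes are defined
  through representatives. None of this uses graded commutativity.\<close>

definition cocycles :: "'a::ab_group_add dg_algebra \<Rightarrow> nat \<Rightarrow> 'a set" where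
  "cocycles A k = {x \<in> gr A k. dif A x = 0}"

definition cobounds :: "'a::ab_group_add dg_algebra \<Rightarrow> nat \<Rightarrow> 'a set" where
  "cobounds A k = (if k = 0 then {0} else dif A ` gr A (k - 1))"

definition cls :: "'a::ab_group_add dg_algebra \<Rightarrow> nat \<Rightarrow> 'a \<Rightarrow> 'a set" where
  "cls A k x = (\<lambda>b. x + b) ` cobounds A k"

definition coh :: "'a::ab_group_add dg_algebra \<Rightarrow> nat \<Rightarrow> 'a set set" where
  "coh A k = cls A k ` cocycles A k"

definition coh_add :: "'a::ab_group_add dg_algebra \<Rightarrow> nat \<Rightarrow> 'a set \<Rightarrow> 'a set \<Rightarrow> 'a set" where
  "coh_add A k \<alpha> \<beta> = (\<Union>x\<in>\<alpha>. \<Union>y\<in>\<beta>. cls A k (x + y))"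

definition coh_scal :: "'a::ab_group_add dg_algebra \<Rightarrow> nat \<Rightarrow> rat \<Rightarrow> 'a set \<Rightarrow> 'a set" where
  "coh_scal A k q \<alpha> = (\<Union>x\<in>\<alpha>. cls A k (scal A q x))"

definition coh_prd ::
  "'a::ab_group_add dg_algebra \<Rightarrow> nat \<Rightarrow> nat \<Rightarrow> 'a set \<Rightarrow> 'a set \<Rightarrow> 'a set" where
  "coh_prd A i j \<alpha> \<beta> = (\<Union>x\<in>\<alpha>. \<Union>y\<in>\<beta>. cls A (i + j) (prd A x y))"

definition coh_map ::
  "('a::ab_group_add \<Rightarrow> 'b::ab_group_add) \<Rightarrow> 'b dg_algebra \<Rightarrow> nat \<Rightarrow> 'a set \<Rightarrow> 'b set" where
  "coh_map f B k \<alpha> = (\<Union>x\<in>\<alpha>. cls B k (f x))"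

definition quasi_iso ::
  "('a::ab_group_add \<Rightarrow> 'b::ab_group_add) \<Rightarrow> 'a dg_algebra \<Rightarrow> 'b dg_algebra \<Rightarrow> bool" where
  "quasi_iso f A B \<longleftrightarrow> dga_hom f A B \<and> (\<forall>k. bij_betw (coh_map f B k) (coh A k) (coh B k))"


subsection \<open>Poincare dgas and inflexibility\<close>

definition simply_connected_dga :: "'a::ab_group_add dg_algebra \<Rightarrow> bool" where
  "simply_connected_dga A \<longleftrightarrow>
     dga A \<and> bij_betw (\<lambda>q. coh_scal A 0 q (cls A 0 (unt A))) UNIV (coh A 0) \<and> coh A 1 = {cls A 1 0}"

definition coh_dual :: "'a::ab_group_add dg_algebra \<Rightarrow> nat \<Rightarrow> ('a set \<Rightarrow> rat) set" where
  "coh_dual A k = {\<phi> \<in> extensional (coh A k).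
     (\<forall>\<alpha>\<in>coh A k. \<forall>\<beta>\<in>coh A k. \<phi> (coh_add A k \<alpha> \<beta>) = \<phi> \<alpha> + \<phi> \<beta>) \<and>
     (\<forall>\<alpha>\<in>coh A k. \<forall>q. \<phi> (coh_scal A k q \<alpha>) = q * \<phi> \<alpha>)}"

definition poincare_dga :: "nat \<Rightarrow> 'a::ab_group_add dg_algebra \<Rightarrow> 'a set \<Rightarrow> bool" where
  "poincare_dga n A c \<longleftrightarrow>
     simply_connected_dga A \<and> c \<in> coh A n \<and>
     (\<forall>j>n. coh A j = {cls A j 0}) \<and>
     bij_betw (\<lambda>q. coh_scal A n q c) UNIV (coh A n) \<and>
     (\<forall>j\<le>n. bij_betw
        (\<lambda>\<alpha>. \<lambda>\<beta>\<in>coh A (n - j). inv_into UNIV (\<lambda>q. coh_scal A n q c) (coh_prd A j (n - j) \<alpha> \<beta>))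
        (coh A j) (coh_dual A (n - j)))"

definition inflexible :: "nat \<Rightarrow> 'a::ab_group_add dg_algebra \<Rightarrow> 'a set \<Rightarrow> bool" where
  "inflexible n A c \<longleftrightarrow>
     \<not> (\<exists>f \<delta>. dga_hom f A A \<and> \<delta> \<notin> {-1, 0, 1} \<and> coh_map f A n c = coh_scal A n \<delta> c)"


subsection \<open>Minimal Sullivan algebras\<close>

text \<open>For a graded vector space \<open>V\<close> with homogeneous basis \<open>X\<close>, the free graded commutative algebra
  on \<open>V\<close> is the tensor algebra \<open>T V\<close> modulo the two-sided ideal generated by the graded commutators
  of elements of \<open>X\<close>. The words in \<open>X\<close> form a basis of \<open>T V\<close>, whose elements are therefore
  finitely supported rational functions on words.\<close>

definition word :: "'a dg_algebra \<Rightarrow> 'a list \<Rightarrow> 'a" where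
  "word A w = foldr (prd A) w (unt A)"

definition tensors :: "'a set \<Rightarrow> ('a list \<Rightarrow> rat) set" where
  "tensors X = {t. finite {w. t w \<noteq> 0} \<and> {w. t w \<noteq> 0} \<subseteq> lists X}"

definition tensor_eval :: "'a::ab_group_add dg_algebra \<Rightarrow> ('a list \<Rightarrow> rat) \<Rightarrow> 'a" where
  "tensor_eval A t = (\<Sum>w | t w \<noteq> 0. scal A (t w) (word A w))"

definition tensor_unit :: "'a list \<Rightarrow> 'a list \<Rightarrow> rat" where
  "tensor_unit w = (\<lambda>v. if v = w then 1 else 0)"

definition commutator_ideal :: "('a \<Rightarrow> nat) \<Rightarrow> 'a set \<Rightarrow> ('a list \<Rightarrow> rat) set" where
  "commutator_ideal dg X = module.span (\<lambda>q t w. q * t w)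
     {t. \<exists>u\<in>lists X. \<exists>v\<in>lists X. \<exists>x\<in>X. \<exists>y\<in>X.
        t = (\<lambda>w. tensor_unit (u @ [x, y] @ v) w
                 - (-1) ^ (dg x * dg y) * tensor_unit (u @ [y, x] @ v) w)}"

definition freely_generated :: "'a::ab_group_add dg_algebra \<Rightarrow> ('a \<Rightarrow> nat) \<Rightarrow> 'a set \<Rightarrow> bool" where
  "freely_generated A dg X \<longleftrightarrow>
     (\<forall>x\<in>X. x \<in> gr A (dg x)) \<and>
     tensor_eval A ` tensors X = carr A \<and>
     {t \<in> tensors X. tensor_eval A t = 0} = commutator_ideal dg X"

text \<open>\<open>F j\<close> is a basis of the \<open>j\<close>-th stage \<open>V(j)\<close> of the filtration of \<open>V\<close>
  (\<open>d V(0) = 0\<close> and \<open>d V(j + 1)\<close> lies in the subalgebra generated by \<open>V(j)\<close>). Minimality says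
  that \<open>d\<close> takes values in the decomposable elements.\<close>

definition minimal_sullivan :: "'a::ab_group_add dg_algebra \<Rightarrow> bool" where
  "minimal_sullivan A \<longleftrightarrow> dga A \<and>
     (\<exists>X dg F. freely_generated A dg X \<and> (\<forall>x\<in>X. 1 \<le> dg x) \<and>
        mono F \<and> (\<Union>j::nat. F j) = X \<and>
        (\<forall>x\<in>F 0. dif A x = 0) \<and>
        (\<forall>j. \<forall>x\<in>F (Suc j). dif A x \<in> module.span (scal A) (word A ` lists (F j))) \<and>
        (\<forall>x\<in>X. dif A x \<in> module.span (scal A) (word A ` {w \<in> lists X. 2 \<le> length w})))"


section \<open>Polynomial differential forms\<close>

text \<open>A polynomial form on the standard \<open>p\<close>-simplex with barycentric coordinates
  \<open>t\<^sub>0, \<dots>, t\<^sub>p\<close> is written in the independent coordinates \<open>t\<^sub>1, \<dots>, t\<^sub>p\<close>; \<open>\<omega> I\<close> is the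
  coefficient of \<open>dt\<^sub>I\<close>, the factors of \<open>dt\<^sub>I\<close> being in increasing order.\<close>

type_synonym poly_form = "nat set \<Rightarrow> (nat \<Rightarrow>\<^sub>0 nat) \<Rightarrow>\<^sub>0 rat"

definition mconst :: "rat \<Rightarrow> (nat \<Rightarrow>\<^sub>0 nat) \<Rightarrow>\<^sub>0 rat" where
  "mconst q = Poly_Mapping.single 0 q"

definition mvar :: "nat \<Rightarrow> (nat \<Rightarrow>\<^sub>0 nat) \<Rightarrow>\<^sub>0 rat" where
  "mvar i = Poly_Mapping.single (Poly_Mapping.single i 1) 1"

definition mpartial :: "nat \<Rightarrow> ((nat \<Rightarrow>\<^sub>0 nat) \<Rightarrow>\<^sub>0 rat) \<Rightarrow> (nat \<Rightarrow>\<^sub>0 nat) \<Rightarrow>\<^sub>0 rat" where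
  "mpartial i P = (\<Sum>m\<in>Poly_Mapping.keys P. Poly_Mapping.single (m - Poly_Mapping.single i 1)
     (of_nat (Poly_Mapping.lookup m i) * Poly_Mapping.lookup P m))"

definition msubst ::
  "(nat \<Rightarrow> (nat \<Rightarrow>\<^sub>0 nat) \<Rightarrow>\<^sub>0 rat) \<Rightarrow> ((nat \<Rightarrow>\<^sub>0 nat) \<Rightarrow>\<^sub>0 rat) \<Rightarrow> (nat \<Rightarrow>\<^sub>0 nat) \<Rightarrow>\<^sub>0 rat" where
  "msubst s P = (\<Sum>m\<in>Poly_Mapping.keys P. mconst (Poly_Mapping.lookup P m) *
     (\<Prod>i\<in>Poly_Mapping.keys m. s i ^ Poly_Mapping.lookup m i))"

definition poly_forms :: "nat \<Rightarrow> nat \<Rightarrow> poly_form set" where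
  "poly_forms p k = {\<omega>. \<forall>I. \<omega> I \<noteq> 0 \<longrightarrow> I \<subseteq> {1..p} \<and> card I = k \<and>
     (\<forall>m\<in>Poly_Mapping.keys (\<omega> I). Poly_Mapping.keys m \<subseteq> {1..p})}"

definition form_one :: poly_form where
  "form_one = (\<lambda>I. if I = {} then 1 else 0)"

definition wedge :: "poly_form \<Rightarrow> poly_form \<Rightarrow> poly_form" where
  "wedge \<omega> \<eta> = (\<lambda>K. \<Sum>I\<in>Pow K.
     (-1) ^ card {(i, j). i \<in> I \<and> j \<in> K - I \<and> j < i} * \<omega> I * \<eta> (K - I))"

definition form_d :: "poly_form \<Rightarrow> poly_form" where
  "form_d \<omega> = (\<lambda>K. \<Sum>i\<in>K. (-1) ^ card {j\<in>K. j < i} * mpartial i (\<omega> (K - {i})))"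

definition form_of_poly :: "((nat \<Rightarrow>\<^sub>0 nat) \<Rightarrow>\<^sub>0 rat) \<Rightarrow> poly_form" where
  "form_of_poly P = (\<lambda>I. if I = {} then P else 0)"

definition barycentric :: "nat \<Rightarrow> nat \<Rightarrow> (nat \<Rightarrow>\<^sub>0 nat) \<Rightarrow>\<^sub>0 rat" where
  "barycentric p i = (if i = 0 then 1 - (\<Sum>j=1..p. mvar j) else mvar i)"

text \<open>A map \<open>\<theta>\<close> from \<open>{0..p}\<close> to \<open>{0..q}\<close> induces an affine map of standard simplices, under which
  \<open>t\<^sub>i\<close> pulls back to the sum of the \<open>t\<^sub>j\<close> with \<open>\<theta> j = i\<close>.\<close>

definition affine_simplex_map :: "nat \<Rightarrow> (nat \<Rightarrow> nat) \<Rightarrow> (nat \<Rightarrow> real) \<Rightarrow> nat \<Rightarrow> real" where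
  "affine_simplex_map p \<theta> x = (\<lambda>i. \<Sum>j | j \<le> p \<and> \<theta> j = i. x j)"

definition form_pullback :: "nat \<Rightarrow> nat \<Rightarrow> (nat \<Rightarrow> nat) \<Rightarrow> poly_form \<Rightarrow> poly_form" where
  "form_pullback p q \<theta> \<omega> =
     (let s = (\<lambda>i. \<Sum>j | j \<le> p \<and> \<theta> j = i. barycentric p j)
      in \<Sum>I\<in>Pow {1..q}. wedge (form_of_poly (msubst s (\<omega> I)))
           (foldr (\<lambda>i. wedge (form_d (form_of_poly (s i)))) (sorted_list_of_set I) form_one))"

text \<open>Integration over the standard \<open>p\<close>-simplex, by the Dirichlet formula for the integral
  of the monomial \<open>t\<^sub>1\<^bsup>m\<^sub>1\<^esup> \<cdots> t\<^sub>p\<^bsup>m\<^sub>p\<^esup>\<close>.\<close>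

definition form_integral :: "nat \<Rightarrow> poly_form \<Rightarrow> rat" where
  "form_integral p \<omega> = (\<Sum>m\<in>Poly_Mapping.keys (\<omega> {1..p}). Poly_Mapping.lookup (\<omega> {1..p}) m *
     (\<Prod>i=1..p. fact (Poly_Mapping.lookup m i)) / fact (p + (\<Sum>i=1..p. Poly_Mapping.lookup m i)))"

text \<open>Sullivan's algebra of polynomial forms on a space: compatible families of polynomial
  forms on all singular simplices. Compatibility is required for all monotone \<open>\<theta>\<close>,
  i.e. for all composites of face and degeneracy maps.\<close>

definition A_PL :: "'m topology \<Rightarrow> (nat \<Rightarrow> ((nat \<Rightarrow> real) \<Rightarrow> 'm) \<Rightarrow> poly_form) dg_algebra" where
  "A_PL X = \<lparr>
     scal = (\<lambda>q \<omega> p \<sigma> I. mconst q * \<omega> p \<sigma> I),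
     gr = (\<lambda>k. {\<omega>. (\<forall>p \<sigma>. singular_simplex p X \<sigma> \<longrightarrow> \<omega> p \<sigma> \<in> poly_forms p k) \<and>
                 (\<forall>p \<sigma>. \<not> singular_simplex p X \<sigma> \<longrightarrow> \<omega> p \<sigma> = 0) \<and>
                 (\<forall>p q \<theta> \<sigma>. singular_simplex q X \<sigma> \<and> mono_on {..p} \<theta> \<and> \<theta> ` {..p} \<subseteq> {..q} \<longrightarrow>
                    \<omega> p (restrict (\<sigma> \<circ> affine_simplex_map p \<theta>) (standard_simplex p))
                      = form_pullback p q \<theta> (\<omega> q \<sigma>))}),
     prd = (\<lambda>\<omega> \<eta> p \<sigma>. wedge (\<omega> p \<sigma>) (\<eta> p \<sigma>)),
     unt = (\<lambda>p \<sigma>. if singular_simplex p X \<sigma> then form_one else 0),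
     dif = (\<lambda>\<omega> p \<sigma>. form_d (\<omega> p \<sigma>)) \<rparr>"


section \<open>Singular cohomology with rational coefficients\<close>

type_synonym 'm cochain = "nat \<Rightarrow> ((nat \<Rightarrow> real) \<Rightarrow> 'm) \<Rightarrow> rat"

definition evaluate :: "nat \<Rightarrow> 'm cochain \<Rightarrow> 'm chain \<Rightarrow> rat" where
  "evaluate p c z = (\<Sum>\<sigma>\<in>Poly_Mapping.keys z. of_int (Poly_Mapping.lookup z \<sigma>) * c p \<sigma>)"

definition front_face :: "nat \<Rightarrow> ((nat \<Rightarrow> real) \<Rightarrow> 'm) \<Rightarrow> (nat \<Rightarrow> real) \<Rightarrow> 'm" where
  "front_face p \<sigma> = restrict \<sigma> (standard_simplex p)"

definition back_face :: "nat \<Rightarrow> nat \<Rightarrow> ((nat \<Rightarrow> real) \<Rightarrow> 'm) \<Rightarrow> (nat \<Rightarrow> real) \<Rightarrow> 'm" where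
  "back_face p q \<sigma> = restrict (\<lambda>x. \<sigma> (\<lambda>i. if i < p then 0 else x (i - p))) (standard_simplex q)"

text \<open>The singular cochain algebra with the cup product; it is not graded commutative.\<close>

definition cochains :: "'m topology \<Rightarrow> 'm cochain dg_algebra" where
  "cochains X = \<lparr>
     scal = (\<lambda>q c p \<sigma>. q * c p \<sigma>),
     gr = (\<lambda>k. {c. \<forall>p \<sigma>. c p \<sigma> \<noteq> 0 \<longrightarrow> p = k \<and> singular_simplex p X \<sigma>}),
     prd = (\<lambda>a b r \<sigma>. if singular_simplex r X \<sigma>
              then \<Sum>p\<le>r. a p (front_face p \<sigma>) * b (r - p) (back_face p (r - p) \<sigma>) else 0),
     unt = (\<lambda>p \<sigma>. if p = 0 \<and> singular_simplex p X \<sigma> then 1 else 0),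
     dif = (\<lambda>c p \<sigma>. if 0 < p \<and> singular_simplex p X \<sigma>
              then evaluate (p - 1) c (chain_boundary p (frag_of \<sigma>)) else 0) \<rparr>"

definition cochain_pullback ::
  "'m topology \<Rightarrow> ('m \<Rightarrow> 'k) \<Rightarrow> 'k cochain \<Rightarrow> 'm cochain" where
  "cochain_pullback X g c =
     (\<lambda>p \<sigma>. if singular_simplex p X \<sigma> then c p (simplex_map p g \<sigma>) else 0)"

text \<open>The de Rham map from polynomial forms to cochains.\<close>

definition de_Rham ::
  "'m topology \<Rightarrow> (nat \<Rightarrow> ((nat \<Rightarrow> real) \<Rightarrow> 'm) \<Rightarrow> poly_form) \<Rightarrow> 'm cochain" where
  "de_Rham X \<omega> = (\<lambda>p \<sigma>. if singular_simplex p X \<sigma> then form_integral p (\<omega> p \<sigma>) else 0)"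

text \<open>The Kronecker pairing takes the value \<open>r\<close> on a cohomology class and an
  integral homology class.\<close>

definition kronecker_eq :: "nat \<Rightarrow> 'm cochain set \<Rightarrow> 'm chain set \<Rightarrow> rat \<Rightarrow> bool" where
  "kronecker_eq p \<alpha> u r \<longleftrightarrow> (\<forall>c\<in>\<alpha>. \<forall>z\<in>u. evaluate p c z = r)"


section \<open>Oriented closed simply connected smooth manifolds\<close>

text \<open>\<open>\<real>\<^sup>n\<close> is \<open>Euclidean_space n\<close>, the space of real sequences vanishing from index \<open>n\<close> on.\<close>

definition partial_deriv ::
  "nat \<Rightarrow> ((nat \<Rightarrow> real) \<Rightarrow> real) \<Rightarrow> (nat \<Rightarrow> real) \<Rightarrow> real" where
  "partial_deriv i f x = deriv (\<lambda>t. f (x(i := t))) (x i)"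

definition smooth_fun :: "nat \<Rightarrow> (nat \<Rightarrow> real) set \<Rightarrow> ((nat \<Rightarrow> real) \<Rightarrow> real) \<Rightarrow> bool" where
  "smooth_fun n U f \<longleftrightarrow> (\<forall>is\<in>lists {..<n}.
     continuous_map (subtopology (Euclidean_space n) U) euclideanreal (foldr partial_deriv is f) \<and>
     (\<forall>i<n. \<forall>x\<in>U. (\<lambda>t. foldr partial_deriv is f (x(i := t))) differentiable (at (x i))))"

record 'm oriented_manifold =
  mtop   :: "'m topology"
  atlas  :: "('m set \<times> ('m \<Rightarrow> nat \<Rightarrow> real)) set"
  orient :: "'m \<Rightarrow> 'm chain set"

definition smooth_atlas ::
  "nat \<Rightarrow> 'm topology \<Rightarrow> ('m set \<times> ('m \<Rightarrow> nat \<Rightarrow> real)) set \<Rightarrow> bool" where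
  "smooth_atlas n X \<A> \<longleftrightarrow>
     (\<Union>(U, \<phi>)\<in>\<A>. U) = topspace X \<and>
     (\<forall>(U, \<phi>)\<in>\<A>. openin X U \<and> openin (Euclidean_space n) (\<phi> ` U) \<and>
        homeomorphic_map (subtopology X U) (subtopology (Euclidean_space n) (\<phi> ` U)) \<phi>) \<and>
     (\<forall>(U, \<phi>)\<in>\<A>. \<forall>(V, \<psi>)\<in>\<A>. \<forall>i<n.
        smooth_fun n (\<phi> ` (U \<inter> V)) (\<lambda>y. \<psi> (inv_into U \<phi> y) i))"

definition generates :: "('g, 'z) monoid_scheme \<Rightarrow> 'g \<Rightarrow> bool" where
  "generates G u \<longleftrightarrow> u \<in> carrier G \<and> subgroup_generated G {u} = G"

text \<open>An orientation is a locally consistent choice of generators of the local homology groups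
  \<open>H\<^sub>n(X, X - x)\<close>.\<close>

definition orientation :: "nat \<Rightarrow> 'm topology \<Rightarrow> ('m \<Rightarrow> 'm chain set) \<Rightarrow> bool" where
  "orientation n X \<mu> \<longleftrightarrow>
     (\<forall>x\<in>topspace X.
        generates (relative_homology_group (int n) X (topspace X - {x})) (\<mu> x) \<and>
        (\<exists>U a. openin X U \<and> x \<in> U \<and> a \<in> carrier (relative_homology_group (int n) X (topspace X - U)) \<and>
           (\<forall>y\<in>U. hom_induced (int n) X (topspace X - U) X (topspace X - {y}) id a = \<mu> y)))"

definition fundamental_class ::
  "nat \<Rightarrow> 'm topology \<Rightarrow> ('m \<Rightarrow> 'm chain set) \<Rightarrow> 'm chain set \<Rightarrow> bool" where
  "fundamental_class n X \<mu> u \<longleftrightarrow> u \<in> carrier (homology_group (int n) X) \<and>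
     (\<forall>x\<in>topspace X. hom_induced (int n) X {} X (topspace X - {x}) id u = \<mu> x)"

text \<open>Nonempty, and any two loops are freely homotopic, as in the library's notion of simply
  connected sets; path connectedness is the case of constant loops.\<close>

definition simply_connected_space :: "'m topology \<Rightarrow> bool" where
  "simply_connected_space X \<longleftrightarrow> topspace X \<noteq> {} \<and>
     (\<forall>p q. pathin X p \<and> p 0 = p 1 \<and> pathin X q \<and> q 0 = q 1 \<longrightarrow>
        homotopic_with (\<lambda>h. h 0 = h 1) (top_of_set {0..1}) X p q)"

definition closed_sc_manifold :: "nat \<Rightarrow> 'm oriented_manifold \<Rightarrow> bool" where
  "closed_sc_manifold n M \<longleftrightarrow>
     Hausdorff_space (mtop M) \<and> second_countable (mtop M) \<and> compact_space (mtop M) \<and>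
     simply_connected_space (mtop M) \<and> smooth_atlas n (mtop M) (atlas M) \<and>
     orientation n (mtop M) (orient M)"


section \<open>Chern and Pontryagin classes with rational coefficients\<close>

text \<open>Lines in \<open>\<complex>\<^sup>N\<close> are represented by the orthogonal projections onto them.\<close>

definition unit_vectors :: "nat \<Rightarrow> (nat \<Rightarrow> complex) set" where
  "unit_vectors N = {v. (\<forall>i\<ge>N. v i = 0) \<and> (\<Sum>i<N. (cmod (v i))\<^sup>2) = 1}"

definition line_proj :: "(nat \<Rightarrow> complex) \<Rightarrow> nat \<times> nat \<Rightarrow> complex" where
  "line_proj v = (\<lambda>(i, j). v i * cnj (v j))"

text \<open>The complex projective space of lines in \<open>\<complex>\<^sup>N\<close>.\<close>

definition proj_space :: "nat \<Rightarrow> (nat \<times> nat \<Rightarrow> complex) topology" where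
  "proj_space N = top_of_set (line_proj ` unit_vectors N)"

text \<open>The first Chern class of the dual tautological line bundle on \<open>proj_space N\<close>, for \<open>N \<ge> 2\<close>, up
  to sign: the class taking the value \<open>1\<close> on a generator of the infinite cyclic second
  homology group. Changing its sign changes the sign of the odd Chern classes below
  only, which do not enter the Pontryagin classes.\<close>

definition hyperplane_class :: "nat \<Rightarrow> (nat \<times> nat \<Rightarrow> complex) cochain set \<Rightarrow> bool" where
  "hyperplane_class N h \<longleftrightarrow> h \<in> coh (cochains (proj_space N)) 2 \<and>
     (\<exists>u. generates (homology_group 2 (proj_space N)) u \<and> kronecker_eq 2 h u 1)"

text \<open>A complex vector bundle over \<open>X\<close> is given as a subbundle \<open>E\<close> of the trivial bundle with fibre
  \<open>\<complex>\<^sup>N\<close>.\<close>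

definition proj_bundle ::
  "'m topology \<Rightarrow> nat \<Rightarrow> ('m \<Rightarrow> (nat \<Rightarrow> complex) set) \<Rightarrow> ('m \<times> (nat \<times> nat \<Rightarrow> complex)) topology" where
  "proj_bundle X N E = subtopology (prod_topology X (proj_space N))
     {(x, line_proj v) |x v. x \<in> topspace X \<and> v \<in> E x \<inter> unit_vectors N}"

text \<open>Grothendieck's definition of the Chern classes \<open>c 0, \<dots>, c r\<close> of a bundle \<open>E\<close> of rank \<open>r\<close>: with \<open>\<xi>\<close>
  the first Chern class of the dual tautological line bundle on the projective bundle of
  \<open>E\<close>, the sum of the \<open>c i \<cdot> \<xi>\<^bsup>r - i\<^esup>\<close> vanishes and \<open>c 0 = 1\<close>.\<close>

definition chern_classes ::
  "'m topology \<Rightarrow> nat \<Rightarrow> nat \<Rightarrow> ('m \<Rightarrow> (nat \<Rightarrow> complex) set) \<Rightarrow> (nat \<Rightarrow> 'm cochain set) \<Rightarrow> bool" where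
  "chern_classes X N r E c \<longleftrightarrow>
     (\<forall>i. c i \<in> coh (cochains X) (2 * i)) \<and>
     c 0 = cls (cochains X) 0 (unt (cochains X)) \<and>
     (\<forall>i>r. c i = cls (cochains X) (2 * i) 0) \<and>
     (\<exists>h. hyperplane_class N h \<and>
        (\<forall>\<gamma> \<eta>. (\<forall>i\<le>r. \<gamma> i \<in> c i) \<and> \<eta> \<in> h \<longrightarrow>
           (let P = proj_bundle X N E; \<xi> = cochain_pullback P snd \<eta>
            in (\<Sum>i\<le>r. prd (cochains P) (cochain_pullback P fst (\<gamma> i))
                  ((prd (cochains P) \<xi> ^^ (r - i)) (unt (cochains P))))
               \<in> cobounds (cochains P) (2 * r))))"

definition coord_tangent ::
  "nat \<Rightarrow> ('m \<Rightarrow> nat \<Rightarrow> real) \<Rightarrow> 'm set \<times> ('m \<Rightarrow> nat \<Rightarrow> real) \<Rightarrow> 'm \<Rightarrow> nat \<Rightarrow> nat \<Rightarrow> real" where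
  "coord_tangent N F = (\<lambda>(U, \<phi>) x j i.
     if i < N then partial_deriv j (\<lambda>y. F (inv_into U \<phi> y) i) (\<phi> x) else 0)"

definition immersion ::
  "nat \<Rightarrow> 'm oriented_manifold \<Rightarrow> nat \<Rightarrow> ('m \<Rightarrow> nat \<Rightarrow> real) \<Rightarrow> bool" where
  "immersion n M N F \<longleftrightarrow>
     (\<forall>(U, \<phi>)\<in>atlas M. (\<forall>i<N. smooth_fun n (\<phi> ` U) (\<lambda>y. F (inv_into U \<phi> y) i)) \<and>
        (\<forall>x\<in>U. \<forall>a. (\<forall>i<N. (\<Sum>j<n. a j * coord_tangent N F (U, \<phi>) x j i) = 0) \<longrightarrow> (\<forall>j<n. a j = 0)))"

text \<open>The complexified tangent bundle, as a subbundle of the trivial bundle with fibre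
  \<open>\<complex>\<^sup>N\<close> by means of the differential of an immersion into \<open>\<real>\<^sup>N\<close>.\<close>

definition complex_tangent ::
  "nat \<Rightarrow> 'm oriented_manifold \<Rightarrow> nat \<Rightarrow> ('m \<Rightarrow> nat \<Rightarrow> real) \<Rightarrow> 'm \<Rightarrow> (nat \<Rightarrow> complex) set" where
  "complex_tangent n M N F x = {v. \<exists>(U, \<phi>)\<in>atlas M. x \<in> U \<and>
     (\<exists>w. v = (\<lambda>i. \<Sum>j<n. w j * complex_of_real (coord_tangent N F (U, \<phi>) x j i)))}"

text \<open>\<open>p k\<close> is the component of the total rational Pontryagin class in degree \<open>4k\<close>, that is
  \<open>(-1)\<^sup>k c\<^bsub>2k\<^esub>\<close> of the complexified tangent bundle. It does not depend on the
  immersion, which exists since \<open>M\<close> is compact.\<close>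

definition total_pontryagin_class ::
  "nat \<Rightarrow> 'm oriented_manifold \<Rightarrow> (nat \<Rightarrow> 'm cochain set) \<Rightarrow> bool" where
  "total_pontryagin_class n M p \<longleftrightarrow>
     (\<exists>N F c. 2 \<le> N \<and> immersion n M N F \<and>
        chern_classes (mtop M) N n (complex_tangent n M N F) c \<and>
        p = (\<lambda>k. coh_scal (cochains (mtop M)) (4 * k) ((-1) ^ k) (c (2 * k))))"

definition trivial_pontryagin :: "nat \<Rightarrow> 'm oriented_manifold \<Rightarrow> bool" where
  "trivial_pontryagin n M \<longleftrightarrow> total_pontryagin_class n M
     (\<lambda>k. cls (cochains (mtop M)) (4 * k) (if k = 0 then unt (cochains (mtop M)) else 0))"


section \<open>Minimal models of manifolds and the classes of realizing manifolds\<close>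

definition minimal_model ::
  "'a::ab_group_add dg_algebra \<Rightarrow>
   ('a \<Rightarrow> nat \<Rightarrow> ((nat \<Rightarrow> real) \<Rightarrow> 'm) \<Rightarrow> poly_form) \<Rightarrow> 'm topology \<Rightarrow> bool" where
  "minimal_model B m X \<longleftrightarrow> minimal_sullivan B \<and> quasi_iso m B (A_PL X)"

text \<open>\<open>b\<close> is the cohomology class of the minimal model \<open>m : B \<rightarrow> A_PL M\<close> that corresponds to the dual of
  the rational fundamental class.\<close>

definition dual_fundamental_class ::
  "nat \<Rightarrow> 'm oriented_manifold \<Rightarrow> 'a::ab_group_add dg_algebra \<Rightarrow>
   ('a \<Rightarrow> nat \<Rightarrow> ((nat \<Rightarrow> real) \<Rightarrow> 'm) \<Rightarrow> poly_form) \<Rightarrow> 'a set \<Rightarrow> bool" where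
  "dual_fundamental_class n M B m b \<longleftrightarrow> b \<in> coh B n \<and>
     (\<exists>u. fundamental_class n (mtop M) (orient M) u \<and>
        kronecker_eq n (coh_map (de_Rham (mtop M) \<circ> m) (cochains (mtop M)) n b) u 1)"

text \<open>The minimal model \<open>B\<close> is only defined up to isomorphism; since it is required to be
  isomorphic to \<open>A\<close>, it may be chosen on the type of \<open>A\<close>.\<close>

definition realizing_manifolds ::
  "nat \<Rightarrow> 'a::ab_group_add dg_algebra \<Rightarrow> 'a set \<Rightarrow> 'm oriented_manifold set" where
  "realizing_manifolds n A c =
     {M. closed_sc_manifold n M \<and> trivial_pontryagin n M \<and>
         (\<exists>(B :: 'a dg_algebra) m b f. minimal_model B m (mtop M) \<and>
            dual_fundamental_class n M B m b \<and> dga_iso f B A \<and> coh_map f A n b = c)}"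

end

theory Submission
  imports Defs
begin

text \<open>A homotopy equivalence \<open>g : M \<rightarrow> M'\<close> sends the integral fundamental class \<open>u\<close> to a multiple \<open>k u'\<close>: a
  class of top degree that vanishes at one point vanishes at all points by connectedness, and a class
  that vanishes at all points is zero by a Mayer-Vietoris argument over boxes and charts. The same
  holds for a homotopy inverse, and pairing with the dual class yields \<open>k = \<plusminus>1\<close>. The pullback of forms
  along \<open>g\<close>, precomposed with the minimal model of \<open>M'\<close>, lifts up to homotopy to a homomorphism \<open>\<phi>\<close> of
  minimal models; the lift is built generator by generator through a path object made of polynomial
  paths. By Stokes' theorem \<open>\<phi>\<close> multiplies the dual classes by \<open>k\<close> as well. Transported to \<open>A\<close> it becomes
  an endomorphism of degree \<open>k a / a'\<close>, which is not in \<open>{-1, 0, 1}\<close>.\<close>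

section \<open>Top-degree homology of closed manifolds and its detection at points\<close>

subsection \<open>Excision and Mayer-Vietoris for relative cycles\<close>

text \<open>The pullback of forms along \<open>g\<close> and the minimal model \<open>m\<close> of
  \<open>M\<close> both end in the forms on \<open>M\<close>, so \<open>m\<close> points the wrong
  way and has no strict inverse. It is therefore replaced by \<open>endpoint\<close>, defined on
  pairs of an element \<open>b\<close> and a path of forms that starts at \<open>m b\<close>; along
  this map primitives lift strictly, which is what an induction over generators needs. The algebra
  of paths, \<open>C[t, dt]\<close> for the forms \<open>C\<close>, is realised by functions on the
  rationals: the value at a point records a coefficient, its derivative and the coefficient of
  \<open>dt\<close>. All operations are then pointwise, and a polynomial is determined by its
  values.

  The degree of \<open>\<phi>\<close> is found by pairing. The space \<open>H^n(A)\<close> is a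
  line, so \<open>\<phi>\<close> multiplies the dual class by some rational number, and integration
  over the fundamental cycle of \<open>M\<close> identifies that number with \<open>k\<close>.

  In homology the detection of classes at points is proved in all degrees \<open>p \<ge> n\<close>
  together, since a Mayer-Vietoris step in degree \<open>p\<close> refers to degree
  \<open>p + 1\<close>.\<close>

lemma singular_relboundary_mono:
  assumes "singular_relboundary p X S z" "S \<subseteq> T"
  shows "singular_relboundary p X T z"
  using assms(1) singular_chain_mono[OF _ assms(2)] unfolding singular_relboundary by blast

lemma singular_relcycle_mono:
  assumes "singular_relcycle p X S z" "S \<subseteq> T"
  shows "singular_relcycle p X T z"
  using assms(1) singular_chain_mono[OF _ assms(2)] unfolding singular_relcycle by blast

lemma singular_chain_from_subtopology:
  "singular_chain p (subtopology X S) c \<Longrightarrow> singular_chain p X c"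
  by (simp add: singular_chain_subtopology)

lemma singular_chain_sub_sub:
  "singular_chain p (subtopology (subtopology X S) T) c \<Longrightarrow> singular_chain p (subtopology X T) c"
  by (simp add: singular_chain_subtopology)

lemma singular_relboundary_from_subtopology:
  assumes "singular_relboundary p (subtopology X W) S z" "S \<subseteq> T"
  shows "singular_relboundary p X T z"
proof -
  have "singular_relboundary p X S z"
    using assms(1) singular_chain_from_subtopology[of _ X W] singular_chain_sub_sub[of _ X W S]
    unfolding singular_relboundary by blast
  then show ?thesis using assms(2) singular_relboundary_mono by blast
qed

lemma singular_relcycle_from_subtopology:
  assumes "singular_relcycle p (subtopology X W) S z" "S \<subseteq> T"
  shows "singular_relcycle p X T z"
proof -
  have "singular_relcycle p X S z"
    using assms(1) singular_chain_from_subtopology[of _ X W] singular_chain_sub_sub[of _ X W S]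
    unfolding singular_relcycle by blast
  then show ?thesis using assms(2) singular_relcycle_mono by blast
qed

text \<open>For open \<open>U\<close> and \<open>V\<close> the set \<open>V - U\<close> is closed in
  \<open>U \<union> V\<close> and contained in the open set \<open>V\<close>, which is the
  hypothesis of the excision axiom; cutting it out of the pair (\<open>U \<union> V\<close>,
  \<open>V\<close>) leaves (\<open>U\<close>, \<open>U \<inter> V\<close>).\<close>

lemma excision_iso:
  assumes U: "openin X U" and V: "openin X V"
  shows "hom_induced p (subtopology X U) (U \<inter> V) (subtopology X (U \<union> V)) V id
     \<in> iso (relative_homology_group p (subtopology X U) (U \<inter> V))
           (relative_homology_group p (subtopology X (U \<union> V)) V)"
proof -
  let ?Y = "subtopology X (U \<union> V)"
  have subs: "U \<subseteq> topspace X" "V \<subseteq> topspace X"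
    using U V openin_subset by auto
  have top: "topspace ?Y = U \<union> V"
    using subs by auto
  have oU: "openin ?Y U" and oV: "openin ?Y V"
    using U V by (simp_all add: openin_open_subtopology openin_Un)
  have "closedin ?Y (V - U)"
  proof -
    have "V - U = topspace ?Y - U" using top by auto
    then show ?thesis using oU by (metis closedin_diff closedin_topspace)
  qed
  then have "?Y closure_of (V - U) \<subseteq> ?Y interior_of V"
    using oV by (simp add: closure_of_closedin interior_of_openin)
  from homology_excision_axiom[OF this, of "U \<union> V" p]
  have "hom_induced p (subtopology ?Y (U \<union> V - (V - U))) (V - (V - U)) (subtopology ?Y (U \<union> V)) V id
    \<in> iso (relative_homology_group p (subtopology ?Y (U \<union> V - (V - U))) (V - (V - U)))
          (relative_homology_group p (subtopology ?Y (U \<union> V)) V)"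
    by auto
  moreover have "U \<union> V - (V - U) = U" "V - (V - U) = U \<inter> V" by auto
  moreover have "subtopology ?Y U = subtopology X U" "subtopology ?Y (U \<union> V) = ?Y"
    by (simp_all add: subtopology_subtopology Int_absorb1)
  ultimately show ?thesis by simp
qed

text \<open>The injective half of \<open>excision_iso\<close>, unpacked from classes to chains
  because the Mayer-Vietoris step below corrects explicit chains.\<close>

lemma excision_relboundary:
  assumes U: "openin X U" and V: "openin X V"
    and u: "singular_relcycle p (subtopology X U) (U \<inter> V) u"
    and b: "singular_relboundary p (subtopology X (U \<union> V)) V u"
  shows "singular_relboundary p (subtopology X U) (U \<inter> V) u"
proof -
  let ?h = "hom_induced p (subtopology X U) (U \<inter> V) (subtopology X (U \<union> V)) V id"
  let ?G = "relative_homology_group p (subtopology X U) (U \<inter> V)"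
  have inj: "inj_on ?h (carrier ?G)"
    using excision_iso[OF U V, of p] by (auto simp: iso_def bij_betw_def)
  have cm: "continuous_map (subtopology X U) (subtopology X (U \<union> V)) id"
    by (simp add: continuous_map_in_subtopology)
  have hz: "?h (homologous_rel_set p (subtopology X U) (U \<inter> V) z)
      = homologous_rel_set p (subtopology X (U \<union> V)) V z"
    if "singular_relcycle p (subtopology X U) (U \<inter> V) z" for z
    using hom_induced_chain_map[OF cm _ that, of V] that
    by (auto simp: singular_relcycle chain_map_ident[of p "subtopology X U"])
  have "homologous_rel_set p (subtopology X (U \<union> V)) V u = homologous_rel_set p (subtopology X (U \<union> V)) V 0"
    unfolding homologous_rel_set_eq using b by (simp add: homologous_rel_def)
  then have "homologous_rel_set p (subtopology X U) (U \<inter> V) u = homologous_rel_set p (subtopology X U) (U \<inter> V) 0"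
    using inj hz[OF u] hz[of 0] u
    by (simp add: inj_on_def carrier_relative_homology_group)
  then show ?thesis
    unfolding homologous_rel_set_eq by (simp add: homologous_rel_def)
qed

text \<open>The surjective half of \<open>excision_iso\<close>: it moves a relative cycle into
  \<open>U\<close>, which \<open>chart_transfer\<close> needs before a chart can be applied to
  it.\<close>

lemma excision_relcycle:
  assumes U: "openin X U" and V: "openin X V"
    and z: "singular_relcycle p (subtopology X (U \<union> V)) V z"
  obtains u where "singular_relcycle p (subtopology X U) (U \<inter> V) u"
    and "singular_relboundary p (subtopology X (U \<union> V)) V (z - u)"
proof -
  let ?h = "hom_induced p (subtopology X U) (U \<inter> V) (subtopology X (U \<union> V)) V id"
  let ?G = "relative_homology_group p (subtopology X U) (U \<inter> V)"
  let ?H = "relative_homology_group p (subtopology X (U \<union> V)) V"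
  have surj: "?h ` carrier ?G = carrier ?H"
    using excision_iso[OF U V, of p] by (auto simp: iso_def bij_betw_def)
  have cm: "continuous_map (subtopology X U) (subtopology X (U \<union> V)) id"
    by (simp add: continuous_map_in_subtopology)
  have "homologous_rel_set p (subtopology X (U \<union> V)) V z \<in> carrier ?H"
    using z by (simp add: carrier_relative_homology_group)
  then obtain u where u: "singular_relcycle p (subtopology X U) (U \<inter> V) u"
    and eq: "homologous_rel_set p (subtopology X (U \<union> V)) V z
       = ?h (homologous_rel_set p (subtopology X U) (U \<inter> V) u)"
    by (subst (asm) surj[symmetric], subst (asm) (1) carrier_relative_homology_group, blast)
  have "?h (homologous_rel_set p (subtopology X U) (U \<inter> V) u)
      = homologous_rel_set p (subtopology X (U \<union> V)) V u"
    using hom_induced_chain_map[OF cm _ u, of V] u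
    by (auto simp: singular_relcycle chain_map_ident[of p "subtopology X U"])
  with eq have "homologous_rel p (subtopology X (U \<union> V)) V z u"
    by (metis homologous_rel_set_eq)
  with u that show thesis
    by (simp add: homologous_rel_def)
qed

text \<open>Exactness of the relative Mayer-Vietoris sequence, on chains. The chains
  \<open>c\<close> and \<open>c'\<close> that bound \<open>z\<close> relative to \<open>U\<close>
  and to \<open>V\<close> differ by a relative cycle of degree \<open>p + 1\<close> for
  \<open>U \<union> V\<close>. By \<open>van\<close> it bounds up to a chain \<open>w\<close> in
  \<open>U \<union> V\<close>, and the boundary of \<open>w\<close> is \<open>u - v\<close>. So the
  remainder \<open>u\<close> of \<open>z\<close> in \<open>U\<close> bounds relative to
  \<open>V\<close>, hence by excision relative to \<open>U \<inter> V\<close>.\<close>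

lemma relboundary_Int:
  assumes U: "openin X U" and V: "openin X V"
    and zU: "singular_relboundary p X U z" and zV: "singular_relboundary p X V z"
    and z: "singular_relcycle p X (U \<inter> V) z"
    and van: "\<And>c. singular_relcycle (Suc p) X (U \<union> V) c \<Longrightarrow> singular_relboundary (Suc p) X (U \<union> V) c"
  shows "singular_relboundary p X (U \<inter> V) z"
proof -
  obtain c u where c: "singular_chain (Suc p) X c" and u: "singular_chain p (subtopology X U) u"
    and zc: "chain_boundary (Suc p) c + u = z"
    using zU by (auto simp: singular_relboundary)
  obtain c' v where c': "singular_chain (Suc p) X c'" and v: "singular_chain p (subtopology X V) v"
    and zc': "chain_boundary (Suc p) c' + v = z"
    using zV by (auto simp: singular_relboundary)
  have bdiff: "chain_boundary (Suc p) (c' - c) = u - v"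
    using zc zc' by (simp add: chain_boundary_diff algebra_simps)
  have "singular_relcycle (Suc p) X (U \<union> V) (c' - c)"
    using c c' u v unfolding singular_relcycle
    by (auto simp: bdiff intro!: singular_chain_diff intro: singular_chain_mono)
  then obtain e w where e: "singular_chain (Suc (Suc p)) X e"
    and w: "singular_chain (Suc p) (subtopology X (U \<union> V)) w"
    and ew: "chain_boundary (Suc (Suc p)) e + w = c' - c"
    using van by (meson singular_relboundary)
  have "chain_boundary (Suc p) (chain_boundary (Suc (Suc p)) e) = 0"
    using chain_boundary_boundary_alt e by blast
  then have bw: "chain_boundary (Suc p) w = u - v"
    using bdiff unfolding ew[symmetric] by (simp add: chain_boundary_add)
  have subV: "V \<inter> (U \<union> V) = V" "(U \<union> V) \<inter> V = V" "U \<inter> (U \<inter> V) = U \<inter> V" by auto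
  have ub: "singular_relboundary p (subtopology X (U \<union> V)) V u"
    unfolding singular_relboundary subtopology_subtopology subV
    using w v bw by (intro exI[of _ w] exI[of _ v]) simp
  have bu: "chain_boundary p u = chain_boundary p z"
    using chain_boundary_boundary_alt[OF c] by (simp add: zc[symmetric] chain_boundary_add)
  have "singular_relcycle p (subtopology X U) (U \<inter> V) u"
    using u z unfolding singular_relcycle subtopology_subtopology subV
    by (simp add: bu)
  from excision_relboundary[OF U V this ub]
  obtain w' u' where w': "singular_chain (Suc p) (subtopology X U) w'"
    and u': "singular_chain p (subtopology X (U \<inter> V)) u'" and "chain_boundary (Suc p) w' + u' = u"
    unfolding singular_relboundary subtopology_subtopology subV by blast
  then have "chain_boundary (Suc p) (c + w') + u' = z"
    using zc by (metis (no_types, lifting) add.assoc chain_boundary_add)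
  moreover have "singular_chain (Suc p) X (c + w')"
    using c w' singular_chain_add singular_chain_from_subtopology by blast
  ultimately show ?thesis
    unfolding singular_relboundary using u' by blast
qed

subsection \<open>Classes detected at points\<close>

text \<open>The chain represents zero in the local homology \<open>H_p(X, X - K)\<close>. Indexing
  by \<open>K\<close> instead of its complement makes the restriction maps go from larger to smaller
  sets.\<close>

definition null_at :: "nat \<Rightarrow> 'a topology \<Rightarrow> 'a set \<Rightarrow> 'a chain \<Rightarrow> bool" where
  "null_at p X K z \<longleftrightarrow> singular_relboundary p X (topspace X - K) z"

definition cycle_at :: "nat \<Rightarrow> 'a topology \<Rightarrow> 'a set \<Rightarrow> 'a chain \<Rightarrow> bool" where
  "cycle_at p X K z \<longleftrightarrow> singular_relcycle p X (topspace X - K) z"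

text \<open>Two statements in one: injectivity of the map to the local homology at points in degree
  \<open>n\<close>, and, where local homology at points vanishes above \<open>n\<close>, vanishing
  of \<open>H_p(X, X - K)\<close> for \<open>p > n\<close>. The union step in degree
  \<open>p\<close> calls on the intersection in degree \<open>p + 1\<close>, so the two must be
  carried along together.\<close>

definition pointwise_detected :: "nat \<Rightarrow> 'a topology \<Rightarrow> 'a set \<Rightarrow> bool" where
  "pointwise_detected n X K \<longleftrightarrow>
     (\<forall>p\<ge>n. \<forall>z. cycle_at p X K z \<and> (\<forall>x\<in>K. null_at p X {x} z) \<longrightarrow> null_at p X K z)"

definition locally_bounded_dim :: "nat \<Rightarrow> 'a topology \<Rightarrow> bool" where
  "locally_bounded_dim n X \<longleftrightarrow>
     (\<forall>x\<in>topspace X. \<forall>p>n. \<forall>z. cycle_at p X {x} z \<longrightarrow> null_at p X {x} z)"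

lemma null_at_mono: "null_at p X K z \<Longrightarrow> L \<subseteq> K \<Longrightarrow> null_at p X L z"
  unfolding null_at_def by (erule singular_relboundary_mono) blast

lemma cycle_at_mono: "cycle_at p X K z \<Longrightarrow> L \<subseteq> K \<Longrightarrow> cycle_at p X L z"
  unfolding cycle_at_def by (erule singular_relcycle_mono) blast

text \<open>\<open>relboundary_Int\<close> is applied to the complements, which turns the union of
  \<open>K\<close> and \<open>L\<close> into an intersection of open sets. Its hypothesis in degree
  \<open>p + 1\<close> concerns \<open>K \<inter> L\<close>; there nullity at points is automatic
  because \<open>p + 1 > n\<close>.\<close>

lemma pointwise_detected_Un:
  assumes "locally_bounded_dim n X" and K: "closedin X K" and L: "closedin X L"
    and QK: "pointwise_detected n X K" and QL: "pointwise_detected n X L"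
    and QI: "pointwise_detected n X (K \<inter> L)"
  shows "pointwise_detected n X (K \<union> L)"
  unfolding pointwise_detected_def
proof (intro allI impI)
  fix p z assume p: "n \<le> p" and z: "cycle_at p X (K \<union> L) z \<and> (\<forall>x\<in>K \<union> L. null_at p X {x} z)"
  let ?U = "topspace X - K" and ?V = "topspace X - L"
  have int: "?U \<inter> ?V = topspace X - (K \<union> L)" and un: "?U \<union> ?V = topspace X - (K \<inter> L)" by auto
  have subs: "K \<subseteq> topspace X" using K closedin_subset by auto
  have "null_at p X K z"
    using QK p z cycle_at_mono unfolding pointwise_detected_def by blast
  moreover have "null_at p X L z"
    using QL p z cycle_at_mono unfolding pointwise_detected_def by blast
  moreover have "singular_relboundary (Suc p) X (?U \<union> ?V) c"
    if "singular_relcycle (Suc p) X (?U \<union> ?V) c" for c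
  proof -
    have c: "cycle_at (Suc p) X (K \<inter> L) c"
      using that by (simp add: cycle_at_def un)
    have "null_at (Suc p) X {x} c" if "x \<in> K \<inter> L" for x
      using c assms(1) subs p that cycle_at_mono[OF c, of "{x}"]
      unfolding locally_bounded_dim_def by auto
    then show ?thesis
      using QI p c unfolding pointwise_detected_def un null_at_def by auto
  qed
  ultimately show "null_at p X (K \<union> L) z"
    using relboundary_Int[of X ?U ?V p z] K L z
    unfolding null_at_def cycle_at_def int by auto
qed

text \<open>Strong induction on the number of sets. After splitting off \<open>B\<close>, the rest
  meets \<open>B\<close> in the union of the sets \<open>B \<inter> C\<close>; these are again in
  \<open>G\<close>, and there are fewer of them than sets in \<open>F\<close>.\<close>

lemma pointwise_detected_Union:
  assumes "locally_bounded_dim n X"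
    and G: "\<And>K. K \<in> G \<Longrightarrow> closedin X K \<and> pointwise_detected n X K"
    and Int: "\<And>K L. K \<in> G \<Longrightarrow> L \<in> G \<Longrightarrow> K \<inter> L \<in> G"
    and "finite F" "F \<subseteq> G"
  shows "pointwise_detected n X (\<Union>F)"
  using \<open>finite F\<close> \<open>F \<subseteq> G\<close>
proof (induction "card F" arbitrary: F rule: less_induct)
  case less
  show ?case
  proof (cases "F = {}")
    case True
    have "singular_relboundary p X (topspace X) z" if "singular_relcycle p X (topspace X) z" for p and z :: "'a chain"
      using that singular_chain_imp_relboundary[of p X "topspace X" z]
      by (simp add: singular_relcycle)
    then show ?thesis using True
      by (auto simp: pointwise_detected_def null_at_def cycle_at_def)
  next
    case False
    then obtain B where B: "B \<in> F" by auto
    let ?F' = "F - {B}"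
    have c: "card ?F' < card F"
      using B less.prems by (intro psubset_card_mono) auto
    have "card ((\<inter>) B ` ?F') < card F"
      using c card_image_le[of ?F' "(\<inter>) B"] less.prems by auto
    then have "pointwise_detected n X (\<Union>((\<inter>) B ` ?F'))"
      using less.prems B Int by (intro less.hyps) auto
    moreover have "\<Union>((\<inter>) B ` ?F') = B \<inter> \<Union>?F'" by auto
    moreover have "pointwise_detected n X (\<Union>?F')"
      using less.prems c by (intro less.hyps) auto
    moreover have "closedin X (\<Union>?F')"
      using less.prems G by (intro closedin_Union) auto
    ultimately have "pointwise_detected n X (B \<union> \<Union>?F')"
      using B G less.prems by (intro pointwise_detected_Un assms(1)) auto
    moreover have "B \<union> \<Union>?F' = \<Union>F" using B by auto
    ultimately show ?thesis by simp
  qed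
qed

lemma closedin_chain_support:
  assumes X: "Hausdorff_space X" and c: "singular_chain p X c"
  shows "closedin X (\<Union>f\<in>Poly_Mapping.keys c. f ` standard_simplex p)"
proof (rule closedin_Union)
  show "finite ((\<lambda>f. f ` standard_simplex p) ` Poly_Mapping.keys c)" by simp
  fix S assume "S \<in> (\<lambda>f. f ` standard_simplex p) ` Poly_Mapping.keys c"
  then obtain f where S: "S = f ` standard_simplex p" and "singular_simplex p X f"
    using c by (auto simp: singular_chain_def)
  then have "continuous_map (subtopology (powertop_real UNIV) (standard_simplex p)) X f"
    by (simp add: singular_simplex_def)
  moreover have "compactin (subtopology (powertop_real UNIV) (standard_simplex p)) (standard_simplex p)"
    using compactin_standard_simplex by (simp add: compactin_subtopology)
  ultimately have "compactin X S"
    unfolding S by (metis image_compactin)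
  then show "closedin X S"
    using X compactin_imp_closedin by blast
qed

lemma singular_chain_image:
  assumes c: "singular_chain p X c" and f: "f \<in> Poly_Mapping.keys c"
  shows "f ` standard_simplex p \<subseteq> topspace X"
proof -
  have "continuous_map (subtopology (powertop_real UNIV) (standard_simplex p)) X f"
    using assms by (auto simp: singular_chain_def singular_simplex_def)
  then show ?thesis
    by (metis continuous_map_image_subset_topspace topspace_standard_simplex)
qed

text \<open>The boundary of \<open>z\<close> consists of finitely many simplices with compact images
  that avoid \<open>K\<close>; off these images \<open>z\<close> is still a relative cycle.\<close>

lemma cycle_at_neighbourhood:
  assumes X: "Hausdorff_space X" and z: "cycle_at p X K z" and K: "K \<subseteq> topspace X"
  obtains N where "openin X N" "K \<subseteq> N" "\<And>L. L \<subseteq> N \<Longrightarrow> cycle_at p X L z"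
proof
  let ?b = "chain_boundary p z"
  let ?N = "topspace X - (\<Union>f\<in>Poly_Mapping.keys ?b. f ` standard_simplex (p - 1))"
  have zc: "singular_chain p X z" and b: "singular_chain (p-1) (subtopology X (topspace X - K)) ?b"
    using z by (auto simp: cycle_at_def singular_relcycle)
  then have bX: "singular_chain (p-1) X ?b" by (simp add: singular_chain_subtopology)
  show "openin X ?N"
    using closedin_chain_support[OF X bX] by blast
  show "K \<subseteq> ?N"
    using b K by (auto simp: singular_chain_subtopology)
  fix L assume L: "L \<subseteq> ?N"
  have "f ` standard_simplex (p-1) \<subseteq> topspace X" if "f \<in> Poly_Mapping.keys ?b" for f
    using that by (rule singular_chain_image[OF bX])
  then show "cycle_at p X L z"
    unfolding cycle_at_def singular_relcycle singular_chain_subtopology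
    using zc bX L by blast
qed

text \<open>The same support argument, applied to the part \<open>e\<close> of \<open>z\<close> that
  remains after subtracting a boundary. It makes the set of points at which \<open>z\<close> is null
  open.\<close>

lemma null_at_neighbourhood:
  assumes X: "Hausdorff_space X" and z: "null_at p X K z" and K: "K \<subseteq> topspace X"
  obtains N where "openin X N" "K \<subseteq> N" "null_at p X N z"
proof -
  obtain d e where d: "singular_chain (Suc p) X d"
    and e: "singular_chain p (subtopology X (topspace X - K)) e"
    and de: "chain_boundary (Suc p) d + e = z"
    using z by (auto simp: null_at_def singular_relboundary)
  let ?N = "topspace X - (\<Union>f\<in>Poly_Mapping.keys e. f ` standard_simplex p)"
  have eX: "singular_chain p X e" using e by (simp add: singular_chain_subtopology)
  have 1: "openin X ?N"
    using closedin_chain_support[OF X eX] by blast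
  have 2: "K \<subseteq> ?N"
    using e K by (auto simp: singular_chain_subtopology)
  have "f ` standard_simplex p \<subseteq> topspace X" if "f \<in> Poly_Mapping.keys e" for f
    using that by (rule singular_chain_image[OF eX])
  then have "singular_chain p (subtopology X (topspace X - ?N)) e"
    unfolding singular_chain_subtopology using eX by blast
  then have "null_at p X ?N z"
    unfolding null_at_def singular_relboundary using d de by blast
  with 1 2 that show thesis by blast
qed

text \<open>A deformation of \<open>X - L\<close> that preserves \<open>X - K\<close> and ends
  inside it makes the homology of the pair (\<open>X - L\<close>, \<open>X - K\<close>) vanish.
  Hence the restriction from local homology along \<open>K\<close> to local homology along
  \<open>L\<close> is injective.\<close>

lemma null_at_push:
  assumes hom: "homotopic_with (\<lambda>h. h \<in> (topspace X - K) \<rightarrow> (topspace X - K))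
      (subtopology X (topspace X - L)) (subtopology X (topspace X - L)) id r"
    and r: "r \<in> (topspace X - L) \<rightarrow> (topspace X - K)" and "L \<subseteq> K"
    and z: "cycle_at p X K z" "null_at p X L z"
  shows "null_at p X K z"
proof -
  let ?S = "topspace X - L" and ?T = "topspace X - K"
  have ST: "?S \<inter> ?T = ?T" using \<open>L \<subseteq> K\<close> by auto
  obtain c e where c: "singular_chain (Suc p) X c" and e: "singular_chain p (subtopology X ?S) e"
    and zc: "chain_boundary (Suc p) c + e = z"
    using z(2) by (auto simp: null_at_def singular_relboundary)
  have be: "chain_boundary p e = chain_boundary p z"
    using chain_boundary_boundary_alt[OF c] by (simp add: zc[symmetric] chain_boundary_add)
  have "singular_relcycle p (subtopology X ?S) ?T e"
    using e z(1) unfolding cycle_at_def singular_relcycle be subtopology_subtopology ST by blast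
  from homotopic_imp_homologous_rel_chain_maps[OF hom this]
  have "homologous_rel p (subtopology X ?S) ?T e (chain_map p r e)"
    using chain_map_ident[OF e] by simp
  then have b: "singular_relboundary p (subtopology X ?S) ?T (e - chain_map p r e)"
    by (simp add: homologous_rel_def)
  have "continuous_map (subtopology X ?S) (subtopology X ?S) r"
    using hom homotopic_with_imp_continuous_maps by blast
  then have "continuous_map (subtopology X ?S) (subtopology (subtopology X ?S) ?T) r"
    using r by (auto simp: continuous_map_in_subtopology)
  then have "singular_chain p (subtopology (subtopology X ?S) ?T) (chain_map p r e)"
    using singular_chain_chain_map e by blast
  then have "singular_relboundary p (subtopology X ?S) ?T (chain_map p r e)"
    by (rule singular_chain_imp_relboundary)
  from singular_relboundary_add[OF b this] have "singular_relboundary p X ?T e"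
    by (auto intro: singular_relboundary_from_subtopology)
  moreover have "singular_relboundary p X ?T (chain_boundary (Suc p) c)"
    using c unfolding singular_relboundary by (metis add.right_neutral singular_chain_0)
  ultimately show ?thesis
    using singular_relboundary_add zc unfolding null_at_def by blast
qed

subsection \<open>Boxes in Euclidean space\<close>

text \<open>Boxes may be degenerate or empty, so that the intersection of two boxes is always a box;
  \<open>pointwise_detected_Union\<close> asks for this.\<close>

definition box_set :: "nat \<Rightarrow> (nat \<Rightarrow> real) \<Rightarrow> (nat \<Rightarrow> real) \<Rightarrow> (nat \<Rightarrow> real) set" where
  "box_set n a b = {x \<in> topspace (Euclidean_space n). \<forall>i<n. a i \<le> x i \<and> x i \<le> b i}"

definition open_box :: "nat \<Rightarrow> (nat \<Rightarrow> real) \<Rightarrow> (nat \<Rightarrow> real) \<Rightarrow> (nat \<Rightarrow> real) set" where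
  "open_box n a b = {x \<in> topspace (Euclidean_space n). \<forall>i<n. a i < x i \<and> x i < b i}"

lemma open_box_subset: "open_box n a b \<subseteq> box_set n a b"
  by (auto simp: open_box_def box_set_def less_imp_le)

lemma box_set_Int: "box_set n a b \<inter> box_set n a' b' = box_set n (\<lambda>i. max (a i) (a' i)) (\<lambda>i. min (b i) (b' i))"
  by (auto simp: box_set_def)

lemma continuous_map_Euclidean_coord: "continuous_map (Euclidean_space n) euclideanreal (\<lambda>x. x i)"
  unfolding Euclidean_space_def
  by (intro continuous_map_from_subtopology continuous_map_product_projection) auto

lemma closedin_box_set: "closedin (Euclidean_space n) (box_set n a b)"
proof -
  have "box_set n a b = topspace (Euclidean_space n) \<inter>
      (\<Inter>i\<in>{..<n}. {x \<in> topspace (Euclidean_space n). x i \<in> {a i..b i}})"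
    by (auto simp: box_set_def)
  moreover have "closedin (Euclidean_space n) \<dots>"
  proof (cases "n = 0")
    case False
    have "closedin (Euclidean_space n) {x \<in> topspace (Euclidean_space n). x i \<in> {a i..b i}}" for i
      by (rule closedin_continuous_map_preimage[OF continuous_map_Euclidean_coord]) auto
    then show ?thesis using False
      by (intro closedin_Int closedin_topspace closedin_Inter) auto
  qed simp
  ultimately show ?thesis by metis
qed

lemma openin_open_box:
  "openin (Euclidean_space n) (open_box n a b)"
proof -
  have "open_box n a b = topspace (Euclidean_space n) \<inter>
      (\<Inter>i\<in>{..<n}. {x \<in> topspace (Euclidean_space n). x i \<in> {a i<..<b i}})"
    by (auto simp: open_box_def)
  moreover have "openin (Euclidean_space n) \<dots>"
  proof (cases "n = 0")
    case False
    have "openin (Euclidean_space n) {x \<in> topspace (Euclidean_space n). x i \<in> {a i<..<b i}}" for i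
      by (rule openin_continuous_map_preimage[OF continuous_map_Euclidean_coord]) auto
    then show ?thesis using False
      by (intro openin_Int openin_topspace openin_Inter) auto
  qed simp
  ultimately show ?thesis by metis
qed

text \<open>A basic open set of the product topology constrains each coordinate separately, and the
  coordinates from \<open>n\<close> on are zero for all points, so closed intervals around the first
  \<open>n\<close> coordinates suffice.\<close>

lemma box_neighbourhood:
  assumes N: "openin (Euclidean_space n) N" and x: "x \<in> N"
  obtains a b where "box_set n a b \<subseteq> N" "x \<in> open_box n a b"
proof -
  have xt: "x \<in> topspace (Euclidean_space n)" using N x openin_subset by blast
  obtain V where V: "openin (powertop_real UNIV) V" and NV: "N = V \<inter> {x. \<forall>i\<ge>n. x i = 0}"
    using N unfolding Euclidean_space_def openin_subtopology by auto
  obtain U where U: "\<And>i. open (U i)" and xU: "x \<in> Pi\<^sub>E UNIV U" and UV: "Pi\<^sub>E UNIV U \<subseteq> V"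
    using V x NV unfolding openin_product_topology_alt by (auto; metis)
  have "\<exists>e>0. cball (x i) e \<subseteq> U i" for i
    using U[of i] xU open_contains_cball by (metis PiE_mem UNIV_I)
  then obtain e where e: "\<And>i. e i > 0" "\<And>i. cball (x i) (e i) \<subseteq> U i" by metis
  let ?a = "\<lambda>i. x i - e i" and ?b = "\<lambda>i. x i + e i"
  have "y \<in> N" if y: "y \<in> box_set n ?a ?b" for y
  proof -
    have "y i \<in> U i" for i
    proof (cases "i < n")
      case True
      then have "y i \<in> cball (x i) (e i)" using y by (auto simp: box_set_def dist_real_def abs_if)
      then show ?thesis using e(2) by blast
    next
      case False
      then have "y i = x i" using y xt by (auto simp: box_set_def topspace_Euclidean_space)
      then show ?thesis using xU by auto
    qed
    then have "y \<in> V" using UV by auto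
    then show ?thesis using y NV by (auto simp: box_set_def topspace_Euclidean_space)
  qed
  moreover have "x \<in> open_box n ?a ?b"
    using e xt by (auto simp: open_box_def)
  ultimately show thesis using that by blast
qed

text \<open>The complement of a point \<open>y\<close> of a box is pushed radially, away from \<open>y\<close>, off the box.\<close>

lemma null_at_box:
  assumes y: "y \<in> box_set n a b"
    and z: "cycle_at p (Euclidean_space n) (box_set n a b) z" "null_at p (Euclidean_space n) {y} z"
  shows "null_at p (Euclidean_space n) (box_set n a b) z"
proof -
  let ?E = "topspace (Euclidean_space n)" and ?K = "box_set n a b"
  have E: "Euclidean_space n = top_of_set ?E"
    by (simp add: Euclidean_space_def euclidean_product_topology)
  have ES: "subtopology (Euclidean_space n) S = top_of_set S" if "S \<subseteq> ?E" for S
  proof -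
    have "subtopology (top_of_set ?E) S = top_of_set S"
      using that by (simp add: subtopology_subtopology Int_absorb1)
    then show ?thesis by (metis E)
  qed
  define N where "N = (\<lambda>x::nat \<Rightarrow> real. \<Sum>i<n. \<bar>x i - y i\<bar>)"
  \<comment> \<open>\<open>R\<close> exceeds the distance \<open>N\<close> from \<open>y\<close> of
    every point of the box, and \<open>h (u, x)\<close> lies at distance \<open>N x + u * R\<close>,
    so at time 1 every point has left the box. The summand 1 keeps \<open>R\<close> positive for
    degenerate boxes.\<close>
  define R where "R = (\<Sum>i<n. b i - a i) + 1"
  define h where "h = (\<lambda>(u, x) i. y i + (1 + u * R / N x) * (x i - y i))"
  have yE: "y \<in> ?E" using y by (simp add: box_set_def)
  have ab: "a i \<le> b i" if "i < n" for i using y that by (force simp: box_set_def)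
  then have "0 \<le> (\<Sum>i<n. b i - a i)" by (intro sum_nonneg) auto
  then have R: "R > 0" by (simp add: R_def)
  have N0: "N x \<ge> 0" for x by (simp add: N_def sum_nonneg)
  have Npos: "N x > 0" if "x \<in> ?E - {y}" for x
  proof -
    have "x \<noteq> y" using that by auto
    then obtain i where i: "x i \<noteq> y i" by (auto simp: fun_eq_iff)
    then have "i < n" using that yE by (auto simp: topspace_Euclidean_space)
    then have "\<bar>x i - y i\<bar> \<le> N x" unfolding N_def by (intro member_le_sum) auto
    with i show ?thesis by auto
  qed
  have hE: "h (u, x) \<in> ?E" if "x \<in> ?E" for u x
    using that yE by (auto simp: topspace_Euclidean_space h_def)
  have hN: "N (h (u, x)) = N x + u * R" if "x \<in> ?E - {y}" "u \<ge> 0" for u x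
  proof -
    have p: "0 \<le> 1 + u * R / N x" using that R N0 by simp
    have "N (h (u, x)) = (\<Sum>i<n. (1 + u * R / N x) * \<bar>x i - y i\<bar>)"
      unfolding N_def h_def using p by (simp add: abs_mult N_def)
    also have "\<dots> = (1 + u * R / N x) * N x"
      by (simp add: N_def sum_distrib_left)
    also have "\<dots> = N x + u * R" using Npos[OF that(1)] by (simp add: field_simps)
    finally show ?thesis .
  qed
  have hS: "h (u, x) \<in> ?E - {y}" if "x \<in> ?E - {y}" "0 \<le> u" for u x
  proof -
    have "N (h (u, x)) > 0" using hN[OF that] Npos[OF that(1)] R that(2) by (simp add: add_pos_nonneg)
    then have "h (u, x) \<noteq> y" by (auto simp: N_def)
    then show ?thesis using hE that by auto
  qed
  have hS': "h \<in> {0..1} \<times> (?E - {y}) \<rightarrow> ?E - {y}"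
  proof
    fix p assume "p \<in> {0..1::real} \<times> (?E - {y})"
    then show "h p \<in> ?E - {y}" using hS[of "snd p" "fst p"] by auto
  qed
  \<comment> \<open>A point outside the box stays outside: the box is convex and contains
    \<open>y\<close>, so if the image on the ray from \<open>y\<close> through \<open>x\<close> were
    inside, then \<open>x\<close>, which lies between, would be inside too. This is checked in each
    coordinate.\<close>
  have hK: "h (u, x) \<in> ?E - ?K" if x: "x \<in> ?E - ?K" and u: "0 \<le> u" for u x
  proof -
    have xy: "x \<in> ?E - {y}" using x y by auto
    have s: "1 + u * R / N x \<ge> 1" using R u N0 by simp
    have "x \<in> ?K" if hx: "h (u, x) \<in> ?K"
    proof -
      have "a i \<le> x i \<and> x i \<le> b i" if "i < n" for i
      proof -
        let ?s = "1 + u * R / N x"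
        have hb: "a i \<le> y i + ?s * (x i - y i)" "y i + ?s * (x i - y i) \<le> b i"
          using hx that by (auto simp: box_set_def h_def)
        have yb: "a i \<le> y i" "y i \<le> b i" using y that by (auto simp: box_set_def)
        show ?thesis
        proof (cases "x i \<ge> y i")
          case True
          have "x i - y i \<le> ?s * (x i - y i)" using mult_right_mono[OF s, of "x i - y i"] True by simp
          then show ?thesis using hb yb True by linarith
        next
          case False
          have "?s * (x i - y i) \<le> x i - y i"
            using mult_right_mono_neg[OF s, of "x i - y i"] False by simp
          then show ?thesis using hb yb False by linarith
        qed
      qed
      then show ?thesis using x by (auto simp: box_set_def)
    qed
    then show ?thesis using x hE by blast
  qed
  have h1: "h (1, x) \<in> ?E - ?K" if "x \<in> ?E - {y}" for x
  proof -
    have "N w \<le> (\<Sum>i<n. b i - a i)" if "w \<in> ?K" for w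
      unfolding N_def using that y by (intro sum_mono) (force simp: box_set_def abs_le_iff)
    moreover have "N (h (1, x)) > (\<Sum>i<n. b i - a i)"
      using hN[OF that, of 1] Npos[OF that] by (simp add: R_def)
    ultimately have "h (1, x) \<notin> ?K" by fastforce
    then show ?thesis using hE that by auto
  qed
  have "homotopic_with (\<lambda>h. h \<in> (?E - ?K) \<rightarrow> (?E - ?K))
      (subtopology (Euclidean_space n) (?E - {y})) (subtopology (Euclidean_space n) (?E - {y})) id (\<lambda>x. h (1, x))"
    unfolding homotopic_with_def
  proof (intro exI[of _ h] conjI allI ballI)
    have coord: "continuous_on A (\<lambda>p. snd p i)" for A :: "(real \<times> (nat \<Rightarrow> real)) set" and i :: nat
      by (rule continuous_on_compose2[OF continuous_on_product_coordinates[of i] continuous_on_snd])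
         (auto intro: continuous_on_id)
    have Npos': "N x \<noteq> 0" if "x \<in> ?E" "x \<noteq> y" for x using Npos[of x] that by auto
    have "continuous_on ({0..1} \<times> (?E - {y})) h"
    proof (rule continuous_on_coordinatewise_then_product)
      fix i
      have cN: "continuous_on ({0..1::real} \<times> (?E - {y})) (\<lambda>p. N (snd p))"
        unfolding N_def by (intro continuous_on_sum continuous_on_rabs continuous_on_diff continuous_on_const coord)
      have "continuous_on ({0..1} \<times> (?E - {y})) (\<lambda>p. y i + (1 + fst p * R / N (snd p)) * (snd p i - y i))"
        by (intro continuous_on_add continuous_on_mult continuous_on_divide continuous_on_const
            continuous_on_fst continuous_on_id continuous_on_diff coord cN) (use Npos' in auto)
      then show "continuous_on ({0..1} \<times> (?E - {y})) (\<lambda>x. h x i)"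
        by (rule continuous_on_eq) (auto simp: h_def)
    qed
    then show "continuous_map (prod_topology (top_of_set {0..1}) (subtopology (Euclidean_space n) (?E - {y})))
        (subtopology (Euclidean_space n) (?E - {y})) h"
      unfolding ES[OF Diff_subset] using hS' by (auto simp: continuous_map_in_subtopology image_subset_iff_funcset)
    show "h (0, x) = id x" for x by (auto simp: h_def)
    show "(\<lambda>x. h (t, x)) \<in> (?E - ?K) \<rightarrow> (?E - ?K)" if "t \<in> {0..1}" for t
      using hK that by auto
  qed auto
  then show ?thesis
    using h1 y z by (intro null_at_push[of "Euclidean_space n" ?K "{y}"]) auto
qed

text \<open>The local homology at \<open>x\<close> is that at the origin, and \<open>n\<close>
  suspension steps identify it with the homology of a one-point space in degree
  \<open>p - n > 0\<close>, which vanishes by the dimension axiom.\<close>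

lemma locally_bounded_dim_Euclidean: "locally_bounded_dim n (Euclidean_space n)"
  unfolding locally_bounded_dim_def
proof (intro ballI allI impI)
  fix x p z assume x: "x \<in> topspace (Euclidean_space n)" and p: "n < p"
    and z: "cycle_at p (Euclidean_space n) {x} z"
  let ?o = "\<lambda>i::nat. 0::real"
  have top0: "topspace (Euclidean_space 0) = {?o}" by (auto simp: topspace_Euclidean_space)
  have o: "?o \<in> topspace (Euclidean_space n)" by (simp add: topspace_Euclidean_space)
  have cl: "closedin (Euclidean_space n) {v}" if "v \<in> topspace (Euclidean_space n)" for v n
    using closedin_Hausdorff_singleton[OF Hausdorff_Euclidean_space that] .
  have "(subtopology (Euclidean_space n) {x}) homeomorphic_space (subtopology (Euclidean_space n) {?o})"
    unfolding homeomorphic_space_def homeomorphic_maps_def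
    using x o by (intro exI[of _ "\<lambda>v. ?o"] exI[of _ "\<lambda>v. x"])
      (auto simp: continuous_map_in_subtopology)
  from isomorphic_relative_homology_groups_Euclidean_complements[OF cl[OF x] cl[OF o] this, of "int p"]
  have 1: "relative_homology_group (int p) (Euclidean_space n) (topspace (Euclidean_space n) - {x})
     \<cong> relative_homology_group (int p) (Euclidean_space n) (topspace (Euclidean_space n) - {?o})" .
  have "relative_homology_group (int p - int n) (Euclidean_space 0) (topspace (Euclidean_space 0) - {?o})
      \<cong> relative_homology_group (int p) (Euclidean_space n) (topspace (Euclidean_space n) - {?o})"
    using relative_homology_group_Euclidean_complement_step[of 0 "{?o}" "int p - int n" n] cl[of ?o 0] top0
    by simp
  moreover have "trivial_group (relative_homology_group (int p - int n) (Euclidean_space 0) (topspace (Euclidean_space 0) - {?o}))"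
    using homology_dimension_axiom[OF top0, of "int p - int n"] p top0 by simp
  ultimately have "trivial_group (relative_homology_group (int p) (Euclidean_space n) (topspace (Euclidean_space n) - {?o}))"
    using isomorphic_group_triviality by (metis group_relative_homology_group)
  then have "trivial_group (relative_homology_group (int p) (Euclidean_space n) (topspace (Euclidean_space n) - {x}))"
    using 1 isomorphic_group_triviality by (metis group_relative_homology_group)
  then have triv: "homologous_rel_set p (Euclidean_space n) (topspace (Euclidean_space n) - {x}) `
      singular_relcycle_set p (Euclidean_space n) (topspace (Euclidean_space n) - {x})
     = {singular_relboundary_set p (Euclidean_space n) (topspace (Euclidean_space n) - {x})}"
    unfolding trivial_group_def carrier_relative_homology_group by simp
  have "homologous_rel_set p (Euclidean_space n) (topspace (Euclidean_space n) - {x}) z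
     = singular_relboundary_set p (Euclidean_space n) (topspace (Euclidean_space n) - {x})"
    by (rule singletonD, subst triv[symmetric], rule imageI) (use z in \<open>simp add: cycle_at_def\<close>)
  then show "null_at p (Euclidean_space n) {x} z"
    unfolding null_at_def homologous_rel_set_eq_relboundary .
qed

text \<open>Since \<open>z\<close> stays a relative cycle near \<open>K\<close>, finitely many boxes
  inside that neighbourhood, each around a point of \<open>K\<close>, cover \<open>K\<close>. On
  each box nullity at its point of \<open>K\<close> spreads by \<open>null_at_box\<close>, so
  \<open>z\<close> is null at all points of the union of the boxes, also those outside
  \<open>K\<close>, and the union lemma for boxes applies.\<close>

lemma pointwise_detected_compact_Euclidean:
  assumes K: "compactin (Euclidean_space n) K"
  shows "pointwise_detected n (Euclidean_space n) K"
  unfolding pointwise_detected_def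
proof (intro allI impI, elim conjE)
  fix p z assume p: "n \<le> p" and z: "cycle_at p (Euclidean_space n) K z"
    and nul: "\<forall>x\<in>K. null_at p (Euclidean_space n) {x} z"
  let ?E = "Euclidean_space n"
  have KE: "K \<subseteq> topspace ?E" using K compactin_subset_topspace by blast
  obtain N where N: "openin ?E N" "K \<subseteq> N" and NL: "\<And>L. L \<subseteq> N \<Longrightarrow> cycle_at p ?E L z"
    using cycle_at_neighbourhood[OF Hausdorff_Euclidean_space z KE] by metis
  have "\<exists>a b. box_set n a b \<subseteq> N \<and> x \<in> open_box n a b" if "x \<in> K" for x
  proof -
    have "x \<in> N" using N(2) that by blast
    then show ?thesis
      by (rule box_neighbourhood[OF N(1)]) (intro exI conjI)
  qed
  then obtain a b where ab: "\<And>x. x \<in> K \<Longrightarrow> box_set n (a x) (b x) \<subseteq> N"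
    "\<And>x. x \<in> K \<Longrightarrow> x \<in> open_box n (a x) (b x)" by metis
  let ?O = "\<lambda>x. open_box n (a x) (b x)"
  obtain F where F: "finite F" "F \<subseteq> K" "K \<subseteq> \<Union>(?O ` F)"
  proof -
    have "\<forall>U\<in>?O ` K. openin ?E U" using openin_open_box by blast
    moreover have "K \<subseteq> \<Union>(?O ` K)" using ab(2) by blast
    ultimately obtain \<F> where "finite \<F>" "\<F> \<subseteq> ?O ` K" "K \<subseteq> \<Union>\<F>"
      using K unfolding compactin_def by meson
    then show ?thesis using that finite_subset_image[of \<F> ?O K] by blast
  qed
  let ?B = "\<lambda>x. box_set n (a x) (b x)"
  have OB: "?O x \<subseteq> ?B x" for x by (rule open_box_subset)
  have box: "closedin ?E L \<and> pointwise_detected n ?E L" if L: "L \<in> range (\<lambda>(a, b). box_set n a b)" for L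
  proof -
    obtain a b where L: "L = box_set n a b" using L by auto
    \<comment> \<open>A nonempty box contains a point to push away from; over the empty box every
      chain is null.\<close>
    have "null_at q ?E L w" if "cycle_at q ?E L w" "\<forall>x\<in>L. null_at q ?E {x} w" for q w
    proof (cases "L = {}")
      case True
      have "singular_chain q (subtopology ?E (topspace ?E)) w"
        using that(1) by (simp add: cycle_at_def singular_relcycle)
      then show ?thesis using singular_chain_imp_relboundary True unfolding null_at_def by fastforce
    next
      case False
      then show ?thesis using that null_at_box L by blast
    qed
    then show ?thesis unfolding pointwise_detected_def using closedin_box_set L by auto
  qed
  have "pointwise_detected n ?E (\<Union>(?B ` F))"
  proof (rule pointwise_detected_Union[OF locally_bounded_dim_Euclidean box])
    fix K L assume "K \<in> range (\<lambda>(a, b). box_set n a b)" "L \<in> range (\<lambda>(a, b). box_set n a b)"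
    then obtain a b a' b' where "K = box_set n a b" "L = box_set n a' b'" by auto
    then show "K \<inter> L \<in> range (\<lambda>(a, b). box_set n a b)"
      by (simp add: box_set_Int) (metis (mono_tags, lifting) case_prod_conv rangeI)
  qed (use F in auto)
  moreover have "cycle_at p ?E (\<Union>(?B ` F)) z"
    using ab(1) F by (intro NL) blast
  moreover have "null_at p ?E {y} z" if y: "y \<in> \<Union>(?B ` F)" for y
  proof -
    obtain x where x: "x \<in> F" "y \<in> ?B x" using y by auto
    then have "x \<in> ?B x" using ab(2) F OB by blast
    moreover have "cycle_at p ?E (?B x) z" using ab(1) x F by (intro NL) blast
    ultimately have "null_at p ?E (?B x) z" using null_at_box nul x F by blast
    then show ?thesis using x null_at_mono by (metis empty_subsetI insert_subset)
  qed
  ultimately have "null_at p ?E (\<Union>(?B ` F)) z"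
    using p unfolding pointwise_detected_def by blast
  moreover have "K \<subseteq> \<Union>(?B ` F)" using F(3) OB by blast
  ultimately show "null_at p ?E K z" by (rule null_at_mono)
qed

subsection \<open>Charts\<close>

definition chart :: "nat \<Rightarrow> 'm topology \<Rightarrow> 'm set \<Rightarrow> ('m \<Rightarrow> nat \<Rightarrow> real) \<Rightarrow> bool" where
  "chart n X W \<phi> \<longleftrightarrow> openin X W \<and> openin (Euclidean_space n) (\<phi> ` W) \<and>
     homeomorphic_map (subtopology X W) (subtopology (Euclidean_space n) (\<phi> ` W)) \<phi>"

definition locally_Euclidean :: "nat \<Rightarrow> 'm topology \<Rightarrow> bool" where
  "locally_Euclidean n X \<longleftrightarrow> Hausdorff_space X \<and> (\<forall>x\<in>topspace X. \<exists>W \<phi>. chart n X W \<phi> \<and> x \<in> W)"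

lemma chart_inverse:
  assumes "chart n X W \<phi>"
  obtains \<psi> where "continuous_map (subtopology X W) (subtopology (Euclidean_space n) (\<phi> ` W)) \<phi>"
    "continuous_map (subtopology (Euclidean_space n) (\<phi> ` W)) (subtopology X W) \<psi>"
    "\<And>x. x \<in> W \<Longrightarrow> \<psi> (\<phi> x) = x" "inj_on \<phi> W"
proof -
  have W: "W \<subseteq> topspace X" using assms openin_subset unfolding chart_def by blast
  obtain \<psi> where "homeomorphic_maps (subtopology X W) (subtopology (Euclidean_space n) (\<phi> ` W)) \<phi> \<psi>"
    using assms homeomorphic_map_maps unfolding chart_def by blast
  then have \<psi>: "continuous_map (subtopology X W) (subtopology (Euclidean_space n) (\<phi> ` W)) \<phi>"
    "continuous_map (subtopology (Euclidean_space n) (\<phi> ` W)) (subtopology X W) \<psi>"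
    "\<And>x. x \<in> W \<Longrightarrow> \<psi> (\<phi> x) = x"
    using W by (auto simp: homeomorphic_maps_def)
  then have "inj_on \<phi> W" by (metis inj_onI)
  with \<psi> that show thesis by blast
qed

text \<open>Excision moves \<open>z\<close> to a cycle inside the chart domain, the chart carries it
  to Euclidean space where \<open>Euc\<close> decides, and the inverse chart brings the answer back.
  The set \<open>K'\<close> of points where nullity is known is kept apart from \<open>K\<close> to
  serve three uses: the empty set for the bound on local dimension, all of \<open>K\<close> for
  detection at points, and one point for spreading nullity over a box.\<close>

lemma chart_transfer:
  assumes ch: "chart n X W \<phi>" and X: "Hausdorff_space X"
    and K: "K \<subseteq> W" "closedin X K" "closedin (Euclidean_space n) (\<phi> ` K)" and K': "K' \<subseteq> K"
    and z: "cycle_at p X K z" "\<And>x. x \<in> K' \<Longrightarrow> null_at p X {x} z"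
    and Euc: "\<And>w. cycle_at p (Euclidean_space n) (\<phi> ` K) w \<Longrightarrow>
        (\<And>x. x \<in> K' \<Longrightarrow> null_at p (Euclidean_space n) {\<phi> x} w) \<Longrightarrow>
        null_at p (Euclidean_space n) (\<phi> ` K) w"
  shows "null_at p X K z"
proof -
  let ?E = "Euclidean_space n"
  have W: "openin X W" "openin ?E (\<phi> ` W)" using ch by (auto simp: chart_def)
  have WX: "W \<subseteq> topspace X" and WE: "\<phi> ` W \<subseteq> topspace ?E" using W openin_subset by blast+
  obtain \<psi> where \<phi>: "continuous_map (subtopology X W) (subtopology ?E (\<phi> ` W)) \<phi>"
    and \<psi>: "continuous_map (subtopology ?E (\<phi> ` W)) (subtopology X W) \<psi>"
    and \<psi>\<phi>: "\<And>x. x \<in> W \<Longrightarrow> \<psi> (\<phi> x) = x" and inj: "inj_on \<phi> W"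
    by (rule chart_inverse[OF ch]) blast
  let ?V = "topspace X - K"
  have V: "openin X ?V" using K(2) by blast
  have un: "W \<union> ?V = topspace X" using K(1) WX by auto
  have cz: "singular_relcycle p (subtopology X (W \<union> ?V)) ?V z"
    unfolding un subtopology_topspace using z(1) by (simp add: cycle_at_def)
  obtain u where u: "singular_relcycle p (subtopology X W) (W \<inter> ?V) u"
    and zu: "singular_relboundary p X ?V (z - u)"
    using excision_relcycle[OF W(1) V cz] unfolding un subtopology_topspace by blast
  have im: "\<phi> \<in> (W \<inter> ?V) \<rightarrow> \<phi> ` W \<inter> (topspace ?E - \<phi> ` K)"
    using inj K(1) WE by (auto simp: inj_on_def)
  define w where "w = chain_map p \<phi> u"
  have w: "singular_relcycle p (subtopology ?E (\<phi> ` W)) (\<phi> ` W \<inter> (topspace ?E - \<phi> ` K)) w"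
    unfolding w_def by (rule singular_relcycle_chain_map[OF u \<phi> im])
  have "null_at p ?E (\<phi> ` K) w"
  proof (rule Euc)
    show "cycle_at p ?E (\<phi> ` K) w"
      unfolding cycle_at_def by (rule singular_relcycle_from_subtopology[OF w]) blast
  next
    fix x assume x: "x \<in> K'"
    let ?V' = "topspace X - {x}"
    have xW: "x \<in> W" using x K' K(1) by blast
    have V': "openin X ?V'"
      using X xW WX by (metis closedin_Hausdorff_singleton openin_diff openin_topspace subsetD)
    have un': "W \<union> ?V' = topspace X" using xW WX by auto
    have "singular_relboundary p X ?V' (z - u)"
      using zu by (rule singular_relboundary_mono) (use x K' in blast)
    moreover have "singular_relboundary p X ?V' z"
      using z(2)[OF x] by (simp add: null_at_def)
    ultimately have "singular_relboundary p X ?V' (z - (z - u))"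
      using singular_relboundary_diff by blast
    then have bu: "singular_relboundary p (subtopology X (W \<union> ?V')) ?V' u"
      unfolding un' subtopology_topspace by simp
    have cu: "singular_relcycle p (subtopology X W) (W \<inter> ?V') u"
      using u by (rule singular_relcycle_mono) (use x K' in blast)
    have im': "\<phi> \<in> (W \<inter> ?V') \<rightarrow> topspace ?E - {\<phi> x}"
      using inj xW WE by (auto simp: inj_on_def)
    have "singular_relboundary p (subtopology ?E (\<phi> ` W)) (topspace ?E - {\<phi> x}) w"
      unfolding w_def
      by (rule singular_relboundary_chain_map[OF excision_relboundary[OF W(1) V' cu bu] \<phi> im'])
    then show "null_at p ?E {\<phi> x} w"
      unfolding null_at_def by (rule singular_relboundary_from_subtopology) blast
  qed
  moreover have "\<phi> ` W \<union> (topspace ?E - \<phi> ` K) = topspace ?E" using K(1) WE by auto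
  ultimately have bw: "singular_relboundary p (subtopology ?E (\<phi> ` W \<union> (topspace ?E - \<phi> ` K))) (topspace ?E - \<phi> ` K) w"
    by (simp add: null_at_def)
  have VE: "openin ?E (topspace ?E - \<phi> ` K)" using K(3) by blast
  have im2: "\<psi> \<in> (\<phi> ` W \<inter> (topspace ?E - \<phi> ` K)) \<rightarrow> ?V"
    using \<psi>\<phi> WX by auto
  have "singular_relboundary p (subtopology X W) ?V (chain_map p \<psi> w)"
    by (rule singular_relboundary_chain_map[OF excision_relboundary[OF W(2) VE w bw] \<psi> im2])
  moreover have "chain_map p \<psi> w = u"
  proof -
    have "chain_map p \<psi> w = chain_map p (\<psi> \<circ> \<phi>) u"
      by (simp add: w_def chain_map_compose)
    also have "\<dots> = u"
      by (rule chain_map_id_gen[of p "subtopology X W"]) (use u \<psi>\<phi> in \<open>auto simp: singular_relcycle\<close>)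
    finally show ?thesis .
  qed
  ultimately have "singular_relboundary p X ?V u"
    by (metis singular_relboundary_from_subtopology subset_refl)
  then show ?thesis
    unfolding null_at_def using singular_relboundary_add[OF zu] by fastforce
qed

lemma locally_bounded_dim_locally_Euclidean:
  assumes "locally_Euclidean n X"
  shows "locally_bounded_dim n X"
  unfolding locally_bounded_dim_def
proof (intro ballI allI impI)
  fix x p z assume x: "x \<in> topspace X" and p: "n < p" and z: "cycle_at p X {x} z"
  obtain W \<phi> where ch: "chart n X W \<phi>" and xW: "x \<in> W"
    using assms x unfolding locally_Euclidean_def by blast
  have X: "Hausdorff_space X" using assms unfolding locally_Euclidean_def by blast
  have fx: "\<phi> x \<in> topspace (Euclidean_space n)"
    using ch xW openin_subset unfolding chart_def by blast
  show "null_at p X {x} z"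
  proof (rule chart_transfer[OF ch X _ _ _ _ z, of "{}"])
    show "closedin X {x}" using X x by (rule closedin_Hausdorff_singleton)
    show "closedin (Euclidean_space n) (\<phi> ` {x})"
      using closedin_Hausdorff_singleton[OF Hausdorff_Euclidean_space fx] by simp
    show "null_at p (Euclidean_space n) (\<phi> ` {x}) w"
      if "cycle_at p (Euclidean_space n) (\<phi> ` {x}) w" for w
      using locally_bounded_dim_Euclidean[of n] fx p that unfolding locally_bounded_dim_def by simp
  qed (use xW in auto)
qed

lemma compactin_chart_image:
  assumes ch: "chart n X W \<phi>" and K: "compactin X K" "K \<subseteq> W"
  shows "compactin (Euclidean_space n) (\<phi> ` K)"
proof -
  obtain \<psi> where "continuous_map (subtopology X W) (subtopology (Euclidean_space n) (\<phi> ` W)) \<phi>"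
    by (rule chart_inverse[OF ch]) blast
  moreover have "compactin (subtopology X W) K" using K by (simp add: compactin_subtopology)
  ultimately have "compactin (subtopology (Euclidean_space n) (\<phi> ` W)) (\<phi> ` K)"
    using image_compactin by metis
  then show ?thesis by (simp add: compactin_subtopology)
qed

lemma pointwise_detected_compact_chart:
  assumes X: "Hausdorff_space X" and ch: "chart n X W \<phi>" and K: "compactin X K" "K \<subseteq> W"
  shows "pointwise_detected n X K"
  unfolding pointwise_detected_def
proof (intro allI impI, elim conjE)
  fix p z assume p: "n \<le> p" and z: "cycle_at p X K z" and nul: "\<forall>x\<in>K. null_at p X {x} z"
  have cK: "compactin (Euclidean_space n) (\<phi> ` K)" by (rule compactin_chart_image[OF ch K])
  show "null_at p X K z"
  proof (rule chart_transfer[OF ch X K(2) _ _ subset_refl z])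
    show "closedin X K" using X K(1) by (rule compactin_imp_closedin)
    show "closedin (Euclidean_space n) (\<phi> ` K)"
      using Hausdorff_Euclidean_space cK by (rule compactin_imp_closedin)
    show "null_at p X {x} z" if "x \<in> K" for x using nul that by blast
    show "null_at p (Euclidean_space n) (\<phi> ` K) w"
      if "cycle_at p (Euclidean_space n) (\<phi> ` K) w" "\<And>x. x \<in> K \<Longrightarrow> null_at p (Euclidean_space n) {\<phi> x} w" for w
      using pointwise_detected_compact_Euclidean[OF cK] p that unfolding pointwise_detected_def by simp
  qed
qed

lemma compactin_box_set: "compactin (Euclidean_space n) (box_set n a b)"
proof -
  \<comment> \<open>As a product over all coordinates, with \<open>{0}\<close> from index
    \<open>n\<close> on, the box is compact by Tychonoff's theorem.\<close>
  have "box_set n a b = (\<Pi>\<^sub>E i\<in>UNIV. if i < n then {a i..b i} else {0})"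
    by (auto simp: box_set_def topspace_Euclidean_space PiE_iff split: if_splits; metis leI)
  moreover have "compactin (powertop_real UNIV) (\<Pi>\<^sub>E i\<in>UNIV. if i < n then {a i..b i} else {0})"
    by (subst compactin_PiE) auto
  ultimately have "compactin (powertop_real UNIV) (box_set n a b)" by simp
  then show ?thesis
    unfolding Euclidean_space_def by (auto simp: compactin_subtopology box_set_def topspace_Euclidean_space)
qed

text \<open>\<open>B\<close> is the preimage of a closed box and \<open>U\<close> that of its open
  version. The box shape of \<open>B\<close> allows \<open>null_at_box\<close>, and \<open>U\<close>
  makes \<open>B\<close> a neighbourhood of \<open>x\<close>.\<close>

lemma chart_box:
  assumes X: "locally_Euclidean n X" and x: "x \<in> topspace X"
  obtains W \<phi> a b B U where "chart n X W \<phi>" "B \<subseteq> W" "compactin X B" "\<phi> ` B = box_set n a b"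
    "openin X U" "x \<in> U" "U \<subseteq> B"
proof -
  obtain W \<phi> where ch: "chart n X W \<phi>" and xW: "x \<in> W"
    using X x unfolding locally_Euclidean_def by blast
  have WX: "W \<subseteq> topspace X" using ch openin_subset unfolding chart_def by blast
  obtain \<psi> where \<phi>: "continuous_map (subtopology X W) (subtopology (Euclidean_space n) (\<phi> ` W)) \<phi>"
    and \<psi>: "continuous_map (subtopology (Euclidean_space n) (\<phi> ` W)) (subtopology X W) \<psi>"
    and \<psi>\<phi>: "\<And>x. x \<in> W \<Longrightarrow> \<psi> (\<phi> x) = x" and inj: "inj_on \<phi> W"
    by (rule chart_inverse[OF ch]) blast
  have oW: "openin (Euclidean_space n) (\<phi> ` W)" "openin X W" using ch by (auto simp: chart_def)
  obtain a b where ab: "box_set n a b \<subseteq> \<phi> ` W" "\<phi> x \<in> open_box n a b"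
    using box_neighbourhood[OF oW(1) imageI[OF xW]] .
  let ?B = "\<psi> ` box_set n a b" and ?U = "{v \<in> topspace (subtopology X W). \<phi> v \<in> open_box n a b}"
  have "compactin (subtopology (Euclidean_space n) (\<phi> ` W)) (box_set n a b)"
    using ab(1) compactin_box_set by (simp add: compactin_subtopology)
  then have "compactin (subtopology X W) ?B"
    using image_compactin \<psi> by metis
  then have B: "compactin X ?B" "?B \<subseteq> W" by (auto simp: compactin_subtopology)
  have \<phi>B: "\<phi> ` ?B = box_set n a b"
  proof -
    have "\<phi> (\<psi> y) = y" if "y \<in> box_set n a b" for y
      using ab(1) that \<psi>\<phi> by force
    then show ?thesis by (simp add: image_image)
  qed
  have "openin (subtopology X W) ?U"
  proof (rule openin_continuous_map_preimage[OF \<phi>])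
    have "open_box n a b \<subseteq> \<phi> ` W" using ab(1) open_box_subset by blast
    then show "openin (subtopology (Euclidean_space n) (\<phi> ` W)) (open_box n a b)"
      using openin_open_box oW(1) by (simp add: openin_open_subtopology)
  qed
  then have "openin X ?U" using oW(2) openin_trans_full by blast
  moreover have "x \<in> ?U" using xW WX ab by auto
  moreover have "?U \<subseteq> ?B"
  proof
    fix v assume v: "v \<in> ?U"
    then have "\<phi> v \<in> box_set n a b" using open_box_subset by blast
    then show "v \<in> ?B" using \<psi>\<phi>[of v] v by (metis (no_types, lifting) IntD2 imageI mem_Collect_eq topspace_subtopology)
  qed
  ultimately show thesis using that[OF ch B(2) B(1) \<phi>B] by blast
qed

text \<open>The union lemma needs a family closed under intersections. Boxes of different charts are
  not, but in a Hausdorff space the compact sets that lie in some chart domain are.\<close>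

lemma pointwise_detected_topspace:
  assumes X: "locally_Euclidean n X" and c: "compact_space X"
  shows "pointwise_detected n X (topspace X)"
proof -
  have H: "Hausdorff_space X" using X by (simp add: locally_Euclidean_def)
  define G where "G = {K. compactin X K \<and> (\<exists>W \<phi>. chart n X W \<phi> \<and> K \<subseteq> W)}"
  define P where "P = (\<lambda>x U. openin X U \<and> x \<in> U \<and> (\<exists>B\<in>G. U \<subseteq> B))"
  have "\<exists>U. P x U" if "x \<in> topspace X" for x
    using X that by (rule chart_box) (auto simp: P_def G_def)
  then obtain U where U: "\<And>x. x \<in> topspace X \<Longrightarrow> P x (U x)" by metis
  have "\<forall>V\<in>U ` topspace X. openin X V" using U by (auto simp: P_def)
  moreover have "topspace X \<subseteq> \<Union>(U ` topspace X)" using U by (auto simp: P_def)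
  ultimately obtain \<F> where \<F>: "finite \<F>" "\<F> \<subseteq> U ` topspace X" "topspace X \<subseteq> \<Union>\<F>"
    using c unfolding compact_space_def compactin_def by meson
  have "\<forall>V\<in>\<F>. \<exists>B\<in>G. V \<subseteq> B" using \<F>(2) U unfolding P_def by blast
  then obtain B where B: "\<And>V. V \<in> \<F> \<Longrightarrow> B V \<in> G \<and> V \<subseteq> B V" by metis
  have "pointwise_detected n X (\<Union>(B ` \<F>))"
  proof (rule pointwise_detected_Union[OF locally_bounded_dim_locally_Euclidean[OF X]])
    show "closedin X K \<and> pointwise_detected n X K" if "K \<in> G" for K
      using that pointwise_detected_compact_chart[OF H] compactin_imp_closedin[OF H] unfolding G_def by blast
    show "K \<inter> L \<in> G" if "K \<in> G" "L \<in> G" for K L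
    proof -
      have "compactin X (K \<inter> L)"
        using that compactin_imp_closedin[OF H] closed_Int_compactin unfolding G_def by (metis (mono_tags, lifting) mem_Collect_eq)
      then show ?thesis using that unfolding G_def by blast
    qed
  qed (use \<F> B in auto)
  moreover have "\<Union>(B ` \<F>) = topspace X"
  proof
    show "\<Union>(B ` \<F>) \<subseteq> topspace X" using B compactin_subset_topspace unfolding G_def by blast
    show "topspace X \<subseteq> \<Union>(B ` \<F>)" using \<F>(3) B by blast
  qed
  ultimately show ?thesis by simp
qed

text \<open>The set \<open>S\<close> of points at which \<open>z\<close> is null is open because
  nullity extends to neighbourhoods. It is closed because inside a chart box nullity at one point
  spreads to the whole box, so the box interior around a point outside \<open>S\<close> cannot meet
  \<open>S\<close>. Once \<open>S\<close> is everything, detection at points applies with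
  \<open>K\<close> the whole space, whose complement is empty.\<close>

lemma null_at_one_point_imp_boundary:
  assumes X: "locally_Euclidean n X" and c: "compact_space X" and con: "connected_space X"
    and z: "singular_relcycle n X {} z" and x0: "x0 \<in> topspace X" "null_at n X {x0} z"
  shows "singular_relboundary n X {} z"
proof -
  have H: "Hausdorff_space X" using X by (simp add: locally_Euclidean_def)
  have cyc: "cycle_at n X K z" for K
    unfolding cycle_at_def using z by (rule singular_relcycle_mono) blast
  define S where "S = {x \<in> topspace X. null_at n X {x} z}"
  have "\<exists>T. openin X T \<and> x \<in> T \<and> T \<subseteq> S" if x: "x \<in> S" for x
  proof -
    obtain N where N: "openin X N" "{x} \<subseteq> N" "null_at n X N z"
      by (rule null_at_neighbourhood[OF H, of n "{x}" z]) (use x in \<open>auto simp: S_def\<close>)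
    then have "N \<subseteq> S" using null_at_mono[OF N(3)] openin_subset[OF N(1)] by (auto simp: S_def)
    with N show ?thesis by blast
  qed
  then have oS: "openin X S" by (subst openin_subopen) blast
  have "\<exists>T. openin X T \<and> y \<in> T \<and> T \<subseteq> topspace X - S" if y: "y \<in> topspace X - S" for y
  proof -
    obtain W \<phi> a b B U where ch: "chart n X W \<phi>" and B: "B \<subseteq> W" "compactin X B" "\<phi> ` B = box_set n a b"
      and U: "openin X U" "y \<in> U" "U \<subseteq> B"
      by (rule chart_box[OF X DiffD1[OF y]]) blast
    have "x \<notin> S" if x: "x \<in> U" for x
    proof
      assume xS: "x \<in> S"
      have "null_at n X B z"
      proof (rule chart_transfer[OF ch H B(1) _ _ _ cyc, of "{x}"])
        show "closedin X B" using H B(2) by (rule compactin_imp_closedin)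
        show "closedin (Euclidean_space n) (\<phi> ` B)" unfolding B(3) by (rule closedin_box_set)
        show "{x} \<subseteq> B" using U x by blast
        show "null_at n X {v} z" if "v \<in> {x}" for v using xS that by (auto simp: S_def)
        show "null_at n (Euclidean_space n) (\<phi> ` B) w"
          if "cycle_at n (Euclidean_space n) (\<phi> ` B) w"
            "\<And>v. v \<in> {x} \<Longrightarrow> null_at n (Euclidean_space n) {\<phi> v} w" for w
          using null_at_box[of "\<phi> x" n a b n w] that U x unfolding B(3)[symmetric] by blast
      qed
      then have "null_at n X {y} z" by (rule null_at_mono) (use U in blast)
      then show False using y by (auto simp: S_def)
    qed
    then show ?thesis using U openin_subset[OF U(1)] by blast
  qed
  then have "openin X (topspace X - S)" by (subst openin_subopen) blast
  then have "closedin X S" by (simp add: closedin_def S_def)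
  then have S: "S = topspace X"
    using con oS x0 unfolding connected_space_clopen_in S_def by blast
  have "null_at n X (topspace X) z"
    using pointwise_detected_topspace[OF X c] cyc S unfolding pointwise_detected_def S_def by blast
  then show ?thesis by (simp add: null_at_def)
qed

subsection \<open>The fundamental class\<close>

text \<open>The group law yields the set of all sums of representatives. To see that this is a full
  class, any \<open>t\<close> homologous to \<open>a + b\<close> is split as
  \<open>(t - b) + b\<close>.\<close>

lemma mult_homologous_rel_set:
  "homologous_rel_set p X S a \<otimes>\<^bsub>relative_homology_group (int p) X S\<^esub> homologous_rel_set p X S b
     = homologous_rel_set p X S (a + b)"
proof -
  have "t \<in> (\<Union>r\<in>homologous_rel_set p X S a. \<Union>s\<in>homologous_rel_set p X S b. {r + s})"
    if "homologous_rel p X S (a + b) t" for t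
  proof -
    have "homologous_rel p X S (a + b - b) (t - b)"
      using that homologous_rel_diff homologous_rel_refl by blast
    then have "t - b \<in> homologous_rel_set p X S a" by simp
    moreover have "b \<in> homologous_rel_set p X S b" by simp
    moreover have "t = (t - b) + b" by simp
    ultimately show ?thesis by blast
  qed
  then show ?thesis
    unfolding mult_relative_homology_group using homologous_rel_add by fastforce
qed

lemma inv_homologous_rel_set:
  assumes "singular_relcycle p X S a"
  shows "inv\<^bsub>relative_homology_group (int p) X S\<^esub> homologous_rel_set p X S a = homologous_rel_set p X S (- a)"
proof (rule group.inv_equality)
  show "homologous_rel_set p X S (- a) \<otimes>\<^bsub>relative_homology_group (int p) X S\<^esub> homologous_rel_set p X S a
      = \<one>\<^bsub>relative_homology_group (int p) X S\<^esub>"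
    unfolding mult_homologous_rel_set by (simp add: homologous_rel_set_eq_relboundary)
qed (use assms in \<open>auto simp: carrier_relative_homology_group singular_relcycle_minus intro!: imageI\<close>)

lemma int_pow_homologous_rel_set:
  assumes "singular_relcycle p X S a"
  shows "homologous_rel_set p X S a [^]\<^bsub>relative_homology_group (int p) X S\<^esub> (k::int)
      = homologous_rel_set p X S (frag_cmul k a)"
proof -
  let ?G = "relative_homology_group (int p) X S"
  have nat: "homologous_rel_set p X S a [^]\<^bsub>?G\<^esub> m = homologous_rel_set p X S (frag_cmul (int m) a)" for m :: nat
  proof (induction m)
    case 0
    have "singular_relboundary_set p X S = homologous_rel_set p X S 0"
      by (metis homologous_rel_set_eq_relboundary singular_relboundary_0)
    then show ?case by simp
  next
    case (Suc m)
    have "frag_cmul (int m) a + a = frag_cmul (int (Suc m)) a"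
      by (simp add: frag_cmul_distrib algebra_simps)
    then show ?case using Suc by (simp add: mult_homologous_rel_set)
  qed
  show ?thesis
  proof (cases "k < 0")
    case True
    then have "homologous_rel_set p X S a [^]\<^bsub>?G\<^esub> k
        = inv\<^bsub>?G\<^esub> (homologous_rel_set p X S (frag_cmul (int (nat (- k))) a))"
      by (simp add: int_pow_def2 nat)
    also have "\<dots> = homologous_rel_set p X S (- frag_cmul (int (nat (- k))) a)"
      using assms by (intro inv_homologous_rel_set singular_relcycle_cmul)
    finally show ?thesis using True by simp
  next
    case False
    then show ?thesis by (simp add: int_pow_def2 nat)
  qed
qed

text \<open>A free homotopy between the constant loops at \<open>x\<close> and \<open>y\<close>
  traces a path from \<open>x\<close> to \<open>y\<close>.\<close>

lemma simply_connected_space_imp_connected: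
  assumes "simply_connected_space X"
  shows "connected_space X"
proof (rule path_connected_imp_connected_space, unfold path_connected_space_def, intro ballI)
  fix x y assume x: "x \<in> topspace X" and y: "y \<in> topspace X"
  have p: "pathin X (\<lambda>t. x)" "pathin X (\<lambda>t. y)" using x y by (simp_all add: pathin_def)
  have "\<forall>p q. pathin X p \<and> p 0 = p 1 \<and> pathin X q \<and> q 0 = q 1 \<longrightarrow>
      homotopic_with (\<lambda>h. h 0 = h 1) (top_of_set {0..1::real}) X p q"
    using assms unfolding simply_connected_space_def by (rule conjunct2)
  from this[THEN spec, THEN spec, of "\<lambda>t. x" "\<lambda>t. y"]
  have "homotopic_with (\<lambda>h. h 0 = h 1) (top_of_set {0..1::real}) X (\<lambda>t. x) (\<lambda>t. y)"
    using p by simp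
  then obtain h :: "real \<times> real \<Rightarrow> 'a" where h: "continuous_map (prod_topology (top_of_set {0..1}) (top_of_set {0..1})) X h"
    "\<And>s. h (0, s) = x" "\<And>s. h (1, s) = y"
    unfolding homotopic_with_def by blast
  have "continuous_map (top_of_set {0..1}) (prod_topology (top_of_set {0..1}) (top_of_set {0..1})) (\<lambda>t. (t, 0::real))"
    by (auto intro!: continuous_on_Pair continuous_on_id continuous_on_const)
  from continuous_map_compose[OF this h(1)]
  have "pathin X (\<lambda>t. h (t, 0))" by (simp add: pathin_def o_def)
  then show "\<exists>g. pathin X g \<and> g 0 = x \<and> g 1 = y"
    using h by (intro exI[of _ "\<lambda>t. h (t, 0)"]) auto
qed

lemma closed_sc_manifold_locally_Euclidean:
  assumes "closed_sc_manifold n M"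
  shows "locally_Euclidean n (mtop M)"
proof -
  have A: "Hausdorff_space (mtop M)" "smooth_atlas n (mtop M) (atlas M)"
    using assms by (auto simp: closed_sc_manifold_def)
  have "\<exists>W \<phi>. chart n (mtop M) W \<phi> \<and> x \<in> W" if "x \<in> topspace (mtop M)" for x
  proof -
    have "x \<in> (\<Union>(U, \<phi>)\<in>atlas M. U)"
      using conjunct1[OF A(2)[unfolded smooth_atlas_def]] that by simp
    then obtain U \<phi> where U: "(U, \<phi>) \<in> atlas M" "x \<in> U" by auto
    from bspec[OF conjunct1[OF conjunct2[OF A(2)[unfolded smooth_atlas_def]]] U(1)]
    have "chart n (mtop M) U \<phi>" by (simp add: chart_def)
    with U(2) show ?thesis by (intro exI conjI)
  qed
  then show ?thesis using A(1) by (simp add: locally_Euclidean_def)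
qed

text \<open>The multiple \<open>k\<close> is found at a single point \<open>x0\<close>, where the
  image of \<open>u\<close> generates the local homology group; the difference is then null at
  \<open>x0\<close> and therefore bounds.\<close>

lemma fundamental_class_generates:
  assumes M: "closed_sc_manifold n M" and u: "fundamental_class n (mtop M) (orient M) u" "z' \<in> u"
    and z: "singular_relcycle n (mtop M) {} z"
  obtains k where "singular_relboundary n (mtop M) {} (z - frag_cmul k z')"
    and "singular_relcycle n (mtop M) {} z'" and "u = homologous_rel_set n (mtop M) {} z'"
proof -
  let ?X = "mtop M"
  have u': "u \<in> carrier (homology_group (int n) ?X)" using u by (simp add: fundamental_class_def)
  then obtain z1 where z1: "u = homologous_rel_set n ?X {} z1" "singular_relcycle n ?X {} z1"
    by (auto simp: carrier_relative_homology_group)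
  then have z1z': "homologous_rel n ?X {} z1 z'" using u(2) by simp
  then have uz': "u = homologous_rel_set n ?X {} z'" using z1 by (metis homologous_rel_set_eq)
  have cz': "singular_relcycle n ?X {} z'"
    using z1z' z1(2) homologous_rel_singular_relcycle by blast
  have "topspace ?X \<noteq> {}"
    using M unfolding closed_sc_manifold_def simply_connected_space_def by (elim conjE)
  then obtain x0 where x0: "x0 \<in> topspace ?X" by blast
  let ?S = "topspace ?X - {x0}"
  let ?G = "relative_homology_group (int n) ?X ?S"
  have c: "singular_relcycle n ?X ?S z" "singular_relcycle n ?X ?S z'"
    using z cz' by (auto intro: singular_relcycle_mono)
  have "hom_induced (int n) ?X {} ?X ?S id u = homologous_rel_set n ?X ?S z'"
    unfolding uz' using hom_induced_chain_map[of ?X ?X id "{}" ?S n z'] cz'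
    by (auto simp: singular_relcycle chain_map_ident)
  then have mu: "orient M x0 = homologous_rel_set n ?X ?S z'"
    using u(1) x0 by (simp add: fundamental_class_def)
  have "generates ?G (orient M x0)"
    using M x0 by (simp add: closed_sc_manifold_def orientation_def)
  then have "carrier ?G = range (\<lambda>k::int. orient M x0 [^]\<^bsub>?G\<^esub> k)"
    unfolding generates_def
    by (metis group.carrier_subgroup_generated_by_singleton group_relative_homology_group)
  moreover have "homologous_rel_set n ?X ?S z \<in> carrier ?G"
    using c by (simp add: carrier_relative_homology_group)
  ultimately obtain k :: int where "homologous_rel_set n ?X ?S z = homologous_rel_set n ?X ?S (frag_cmul k z')"
    unfolding mu int_pow_homologous_rel_set[OF c(2)] by blast
  then have "null_at n ?X {x0} (z - frag_cmul k z')"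
    unfolding homologous_rel_set_eq null_at_def by (simp add: homologous_rel_def)
  then have "singular_relboundary n ?X {} (z - frag_cmul k z')"
    using M z cz' x0 closed_sc_manifold_locally_Euclidean[OF M]
    by (intro null_at_one_point_imp_boundary[of n ?X _ x0])
      (auto simp: closed_sc_manifold_def simply_connected_space_imp_connected
        intro: singular_relcycle_diff singular_relcycle_cmul)
  then show thesis using that cz' uz' by blast
qed

section \<open>Polynomial differential forms: products, differential and pullback\<close>

subsection \<open>Polynomials\<close>

type_synonym mpoly = "(nat \<Rightarrow>\<^sub>0 nat) \<Rightarrow>\<^sub>0 rat"

definition in_vars :: "nat set \<Rightarrow> mpoly \<Rightarrow> bool" where
  "in_vars V P \<longleftrightarrow> (\<forall>m\<in>Poly_Mapping.keys P. Poly_Mapping.keys m \<subseteq> V)"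

lemma sum_singles:
  fixes p :: "'a \<Rightarrow>\<^sub>0 'b::comm_monoid_add"
  shows "p = (\<Sum>m\<in>Poly_Mapping.keys p. Poly_Mapping.single m (Poly_Mapping.lookup p m))"
  by (rule poly_mapping_eqI) (auto simp: lookup_sum lookup_single when_def in_keys_iff)

text \<open>Only monomials that occur in \<open>p\<close> are visited, so bounds on the variables of
  \<open>p\<close> carry over to each of them.\<close>

lemma poly_add_induct:
  fixes p :: "'a \<Rightarrow>\<^sub>0 'b::comm_monoid_add"
  assumes "\<And>m c. m \<in> Poly_Mapping.keys p \<Longrightarrow> Q (Poly_Mapping.single m c)" "Q 0"
    and "\<And>p q. Q p \<Longrightarrow> Q q \<Longrightarrow> Q (p + q)"
  shows "Q p"
proof -
  have "Q (\<Sum>m\<in>F. Poly_Mapping.single m (Poly_Mapping.lookup p m))"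
    if "finite F" "F \<subseteq> Poly_Mapping.keys p" for F
    using that by (induction F) (auto intro: assms)
  from this[of "Poly_Mapping.keys p"] show ?thesis
    by (simp flip: sum_singles)
qed

lemma mconst_0 [simp]: "mconst 0 = 0" and mconst_1 [simp]: "mconst 1 = 1"
  by (simp_all add: mconst_def)

lemma mconst_add: "mconst (a + b) = mconst a + mconst b"
  and mconst_mult: "mconst (a * b) = mconst a * mconst b"
  and mconst_minus: "mconst (- a) = - mconst a"
  by (simp_all add: mconst_def single_add mult_single single_uminus)

lemma mconst_of_nat: "mconst (of_nat k) = of_nat k"
  by (simp add: mconst_def)

text \<open>Polynomials in the variables \<open>V\<close> form the algebra generated by the
  constants and these variables, so properties of derivations and substitutions need only be checked
  on generators.\<close>

lemma mpoly_induct [consumes 1, case_names const var add mult]: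
  assumes V: "in_vars V p"
    and const: "\<And>c. Q (mconst c)" and var: "\<And>i. i \<in> V \<Longrightarrow> Q (mvar i)"
    and add: "\<And>p q. Q p \<Longrightarrow> Q q \<Longrightarrow> Q (p + q)" and mult: "\<And>p q. Q p \<Longrightarrow> Q q \<Longrightarrow> Q (p * q)"
  shows "Q p"
proof -
  have one: "Q 1" using const[of 1] by simp
  have pow: "Q (Poly_Mapping.single (Poly_Mapping.single i v) 1)" if "i \<in> V" for i v
  proof (induction v)
    case (Suc v)
    have "Poly_Mapping.single (Poly_Mapping.single i (Suc v)) (1::rat)
        = mvar i * Poly_Mapping.single (Poly_Mapping.single i v) 1"
      by (simp add: mvar_def mult_single single_add[symmetric])
    then show ?case using Suc var[OF that] mult by simp
  qed (use one in simp)
  have mono: "Q (Poly_Mapping.single (\<Sum>i\<in>I. Poly_Mapping.single i (f i)) 1)"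
    if "finite I" "I \<subseteq> V" for I and f :: "nat \<Rightarrow> nat"
    using that
  proof (induction I)
    case (insert i I)
    have "Poly_Mapping.single (\<Sum>i\<in>insert i I. Poly_Mapping.single i (f i)) (1::rat)
      = Poly_Mapping.single (Poly_Mapping.single i (f i)) 1 * Poly_Mapping.single (\<Sum>i\<in>I. Poly_Mapping.single i (f i)) 1"
      using insert by (simp add: mult_single)
    then show ?case using insert pow mult by simp
  qed (use one in simp)
  show ?thesis
  proof (rule poly_add_induct)
    fix m c assume m: "m \<in> Poly_Mapping.keys p"
    have "Q (Poly_Mapping.single m 1)"
      using mono[of "Poly_Mapping.keys m" "Poly_Mapping.lookup m"] V m
      by (simp add: in_vars_def flip: sum_singles)
    moreover have "Poly_Mapping.single m c = mconst c * Poly_Mapping.single m 1"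
      by (simp add: mconst_def mult_single)
    ultimately show "Q (Poly_Mapping.single m c)" using const mult by simp
  next
    show "Q 0" using const[of 0] by simp
  qed (rule add)
qed

lemma mpoly_induct_UNIV:
  assumes "\<And>c. Q (mconst c)" "\<And>i. Q (mvar i)"
    and "\<And>p q. Q p \<Longrightarrow> Q q \<Longrightarrow> Q (p + q)" "\<And>p q. Q p \<Longrightarrow> Q q \<Longrightarrow> Q (p * q)"
  shows "Q p"
  by (rule mpoly_induct[of UNIV]) (use assms in \<open>auto simp: in_vars_def\<close>)

lemma in_vars_mono: "in_vars V p \<Longrightarrow> V \<subseteq> W \<Longrightarrow> in_vars W p"
  by (auto simp: in_vars_def)

lemma in_vars_0 [simp]: "in_vars V 0" and in_vars_mconst [simp]: "in_vars V (mconst c)"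
  and in_vars_mvar: "i \<in> V \<Longrightarrow> in_vars V (mvar i)"
  by (auto simp: in_vars_def mconst_def mvar_def)

lemma in_vars_1 [simp]: "in_vars V 1"
  using in_vars_mconst[of V 1] by simp

lemma in_vars_add: "in_vars V p \<Longrightarrow> in_vars V q \<Longrightarrow> in_vars V (p + q)"
  unfolding in_vars_def using keys_add[of p q] by blast

lemma in_vars_mult: "in_vars V p \<Longrightarrow> in_vars V q \<Longrightarrow> in_vars V (p * q)"
  unfolding in_vars_def
proof
  fix m assume V: "\<forall>m\<in>Poly_Mapping.keys p. Poly_Mapping.keys m \<subseteq> V" "\<forall>m\<in>Poly_Mapping.keys q. Poly_Mapping.keys m \<subseteq> V"
    and "m \<in> Poly_Mapping.keys (p * q)"
  then obtain a b where "a \<in> Poly_Mapping.keys p" "b \<in> Poly_Mapping.keys q" "m = a + b"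
    using keys_mult[of p q] by blast
  then show "Poly_Mapping.keys m \<subseteq> V"
    using V keys_add[of a b] by blast
qed

lemma in_vars_minus: "in_vars V (- p) \<longleftrightarrow> in_vars V p"
  by (simp add: in_vars_def in_keys_iff)

lemma in_vars_diff: "in_vars V p \<Longrightarrow> in_vars V q \<Longrightarrow> in_vars V (p - q)"
  using in_vars_add[of V p "- q"] by (simp add: in_vars_minus)

lemma in_vars_power: "in_vars V p \<Longrightarrow> in_vars V (p ^ k)"
  by (induction k) (auto intro: in_vars_mult)

lemma in_vars_sum: "(\<And>i. i \<in> I \<Longrightarrow> in_vars V (f i)) \<Longrightarrow> in_vars V (sum f I)"
  by (induction I rule: infinite_finite_induct) (auto intro: in_vars_add)

lemma in_vars_neg_one_power [simp]: "in_vars V ((-1) ^ k)"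
  by (intro in_vars_power) (simp add: in_vars_minus)

subsection \<open>Partial derivatives\<close>

lemma mpartial_single:
  "mpartial i (Poly_Mapping.single m c)
     = Poly_Mapping.single (m - Poly_Mapping.single i 1) (of_nat (Poly_Mapping.lookup m i) * c)"
  by (cases "c = 0") (simp_all add: mpartial_def)

lemma mpartial_0 [simp]: "mpartial i 0 = 0"
  by (simp add: mpartial_def)

lemma mpartial_add: "mpartial i (p + q) = mpartial i p + mpartial i q"
  unfolding mpartial_def
  by (rule setsum_keys_plus_distrib) (simp_all add: single_add[symmetric] distrib_left)

lemma mpartial_sum: "mpartial i (sum f I) = (\<Sum>j\<in>I. mpartial i (f j))"
  by (induction I rule: infinite_finite_induct) (simp_all add: mpartial_add)

lemma mpartial_minus: "mpartial i (- p) = - mpartial i p"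
  using mpartial_add[of i p "- p"] by (simp add: eq_neg_iff_add_eq_0 add.commute)

lemma mpartial_mconst [simp]: "mpartial i (mconst c) = 0"
  by (simp add: mconst_def mpartial_single)

lemma mpartial_1 [simp]: "mpartial i 1 = 0"
  using mpartial_mconst[of i 1] by simp

lemma mpartial_mvar: "mpartial i (mvar j) = (if i = j then 1 else 0)"
  by (auto simp: mvar_def mpartial_single lookup_single)

lemma mpartial_mult: "mpartial i (p * q) = mpartial i p * q + p * mpartial i q"
proof (induction p rule: poly_add_induct)
  case (1 m a)
  show ?case
  proof (induction q rule: poly_add_induct)
    case (1 n b)
    let ?e = "Poly_Mapping.single i (1::nat)"
    \<comment> \<open>Truncated subtraction of the exponent commutes with adding \<open>n\<close>
      only if the variable occurs in \<open>m\<close>; if it does not, the coefficient in the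
      derivative is zero, and \<open>*\<close> holds in both cases.\<close>
    have shift: "m + n - ?e = (m - ?e) + n" if "Poly_Mapping.lookup m i \<noteq> 0" for m n :: "nat \<Rightarrow>\<^sub>0 nat"
      using that by (intro poly_mapping_eqI) (auto simp: lookup_add lookup_minus lookup_single when_def)
    have *: "Poly_Mapping.single (m + n - ?e) (of_nat (Poly_Mapping.lookup m i) * c)
      = Poly_Mapping.single ((m - ?e) + n) (of_nat (Poly_Mapping.lookup m i) * (c::rat))" for m n c
      using shift[of m n] by (cases "Poly_Mapping.lookup m i = 0") auto
    have "mpartial i (Poly_Mapping.single m a * Poly_Mapping.single n b)
       = Poly_Mapping.single (m + n - ?e) (of_nat (Poly_Mapping.lookup m i) * (a * b))
         + Poly_Mapping.single (n + m - ?e) (of_nat (Poly_Mapping.lookup n i) * (a * b))"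
      by (simp add: mult_single mpartial_single lookup_add single_add[symmetric] algebra_simps)
    also have "\<dots> = mpartial i (Poly_Mapping.single m a) * Poly_Mapping.single n b
        + Poly_Mapping.single m a * mpartial i (Poly_Mapping.single n b)"
      unfolding * by (simp add: mult_single mpartial_single algebra_simps)
    finally show ?case .
  qed (simp_all add: mpartial_add algebra_simps)
qed (simp_all add: mpartial_add algebra_simps)

lemma mpartial_mconst_mult: "mpartial i (mconst c * p) = mconst c * mpartial i p"
  by (simp add: mpartial_mult)

lemma mpartial_neg_one_power_mult: "mpartial i ((-1) ^ k * p) = (-1) ^ k * mpartial i p"
  by (cases "even k") (simp_all add: mpartial_minus)

lemma mpartial_commute: "mpartial i (mpartial j p) = mpartial j (mpartial i p)"
  by (induction p rule: mpoly_induct_UNIV)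
     (simp_all add: mpartial_add mpartial_mult mpartial_mvar algebra_simps)

lemma mpartial_eq_0:
  assumes "in_vars V p" "i \<notin> V"
  shows "mpartial i p = 0"
proof -
  have "Poly_Mapping.lookup m i = 0" if "m \<in> Poly_Mapping.keys p" for m
    using assms that unfolding in_vars_def in_keys_iff by (metis in_keys_iff subsetD)
  then show ?thesis by (simp add: mpartial_def)
qed

lemma in_vars_mpartial:
  assumes "in_vars V p" shows "in_vars V (mpartial i p)"
proof -
  have "in_vars V p \<and> in_vars V (mpartial i p)"
    using assms
    by (induction p rule: mpoly_induct)
       (auto simp: mpartial_mvar mpartial_add mpartial_mult intro: in_vars_add in_vars_mult in_vars_mvar)
  then show ?thesis ..
qed

subsection \<open>Substitution\<close>

definition monomial_eval :: "(nat \<Rightarrow> mpoly) \<Rightarrow> (nat \<Rightarrow>\<^sub>0 nat) \<Rightarrow> mpoly" where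
  "monomial_eval s m = (\<Prod>i\<in>Poly_Mapping.keys m. s i ^ Poly_Mapping.lookup m i)"

lemma monomial_eval_add: "monomial_eval s (m + n) = monomial_eval s m * monomial_eval s n"
proof -
  let ?K = "Poly_Mapping.keys m \<union> Poly_Mapping.keys n"
  have ext: "monomial_eval s k = (\<Prod>i\<in>?K. s i ^ Poly_Mapping.lookup k i)" if "Poly_Mapping.keys k \<subseteq> ?K" for k
    unfolding monomial_eval_def using that
    by (intro prod.mono_neutral_left) (auto simp: in_keys_iff)
  show ?thesis
    using keys_add[of m n] by (simp add: ext lookup_add power_add prod.distrib)
qed

lemma msubst_alt: "msubst s P = (\<Sum>m\<in>Poly_Mapping.keys P. mconst (Poly_Mapping.lookup P m) * monomial_eval s m)"
  by (simp add: msubst_def monomial_eval_def)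

lemma msubst_single: "msubst s (Poly_Mapping.single m c) = mconst c * monomial_eval s m"
  by (cases "c = 0") (simp_all add: msubst_alt)

lemma msubst_0 [simp]: "msubst s 0 = 0"
  by (simp add: msubst_def)

lemma msubst_add: "msubst s (p + q) = msubst s p + msubst s q"
  unfolding msubst_alt
  by (rule setsum_keys_plus_distrib) (simp_all add: mconst_add distrib_right)

lemma msubst_mconst [simp]: "msubst s (mconst c) = mconst c"
  by (simp add: mconst_def msubst_single[of s 0, unfolded monomial_eval_def] mult_single)

lemma msubst_1 [simp]: "msubst s 1 = 1"
  using msubst_mconst[of s 1] by simp

lemma msubst_mvar [simp]: "msubst s (mvar i) = s i"
  by (simp add: mvar_def msubst_single monomial_eval_def)

lemma msubst_minus: "msubst s (- p) = - msubst s p"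
  using msubst_add[of s p "- p"] by (simp add: eq_neg_iff_add_eq_0 add.commute)

lemma msubst_sum: "msubst s (sum f I) = (\<Sum>j\<in>I. msubst s (f j))"
  by (induction I rule: infinite_finite_induct) (simp_all add: msubst_add)

lemma msubst_mult: "msubst s (p * q) = msubst s p * msubst s q"
proof (induction p rule: poly_add_induct)
  case (1 m a)
  show ?case
    by (induction q rule: poly_add_induct)
       (simp_all add: mult_single msubst_single monomial_eval_add mconst_mult msubst_add algebra_simps)
qed (simp_all add: msubst_add algebra_simps)

lemma msubst_neg_one_power_mult: "msubst s ((-1) ^ k * p) = (-1) ^ k * msubst s p"
  by (cases "even k") (simp_all add: msubst_minus)

lemma in_vars_msubst:
  assumes "in_vars V p" "\<And>i. i \<in> V \<Longrightarrow> in_vars W (s i)"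
  shows "in_vars W (msubst s p)"
  using assms(1)
  by (induction p rule: mpoly_induct)
     (use assms in \<open>auto simp: msubst_add msubst_mult intro: in_vars_add in_vars_mult\<close>)

text \<open>The chain rule. It is the reason why pullback of forms commutes with the
  differential.\<close>

lemma mpartial_msubst:
  assumes "in_vars V p" "finite V"
  shows "mpartial j (msubst s p) = (\<Sum>i\<in>V. msubst s (mpartial i p) * mpartial j (s i))"
  using assms(1)
proof (induction p rule: mpoly_induct)
  case (var k)
  have "(\<Sum>i\<in>V. msubst s (mpartial i (mvar k)) * mpartial j (s i))
     = (\<Sum>i\<in>V. if i = k then mpartial j (s i) else 0)"
    by (intro sum.cong) (auto simp: mpartial_mvar)
  then show ?case using var assms(2) by simp
qed (use assms in \<open>simp_all add: msubst_add msubst_mult mpartial_add mpartial_mult sum.distrib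
   sum_distrib_left sum_distrib_right algebra_simps\<close>)

subsection \<open>Wedge products\<close>

lemma sum_fun_apply: "(\<Sum>i\<in>I. f i) x = (\<Sum>i\<in>I. f i x)"
  by (induction I rule: infinite_finite_induct) simp_all

text \<open>The number of transpositions that sort \<open>dt_I dt_J\<close> into increasing order
  when \<open>I\<close> and \<open>J\<close> are disjoint; \<open>shuffle_sign\<close> is the
  resulting sign.\<close>

definition inversions :: "nat set \<Rightarrow> nat set \<Rightarrow> nat" where
  "inversions I J = card {(i, j). i \<in> I \<and> j \<in> J \<and> j < i}"

abbreviation shuffle_sign :: "nat set \<Rightarrow> nat set \<Rightarrow> mpoly" where
  "shuffle_sign I J \<equiv> (-1) ^ inversions I J"

lemma finite_inversions: "finite I \<Longrightarrow> finite J \<Longrightarrow> finite {(i, j). i \<in> I \<and> j \<in> J \<and> j < (i::nat)}"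
  by (rule finite_subset[of _ "I \<times> J"]) auto

lemma inversions_empty [simp]: "inversions {} J = 0" "inversions I {} = 0"
  by (simp_all add: inversions_def)

lemma inversions_Un_left:
  assumes "finite I" "finite J" "finite N" "I \<inter> J = {}"
  shows "inversions (I \<union> J) N = inversions I N + inversions J N"
proof -
  have "{(i, j). i \<in> I \<union> J \<and> j \<in> N \<and> j < i}
      = {(i, j). i \<in> I \<and> j \<in> N \<and> j < i} \<union> {(i, j). i \<in> J \<and> j \<in> N \<and> j < i}" by auto
  then show ?thesis
    unfolding inversions_def using assms
    by (simp add: finite_inversions) (intro card_Un_disjoint; auto simp: finite_inversions)
qed

lemma inversions_Un_right:
  assumes "finite I" "finite J" "finite N" "J \<inter> N = {}"
  shows "inversions I (J \<union> N) = inversions I J + inversions I N"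
proof -
  have "{(i, j). i \<in> I \<and> j \<in> J \<union> N \<and> j < i}
      = {(i, j). i \<in> I \<and> j \<in> J \<and> j < i} \<union> {(i, j). i \<in> I \<and> j \<in> N \<and> j < i}" by auto
  then show ?thesis
    unfolding inversions_def using assms
    by (simp add: finite_inversions) (intro card_Un_disjoint; auto simp: finite_inversions)
qed

text \<open>Each pair in \<open>I \<times> J\<close> is inverted in exactly one of the two orders.
  This produces the sign in \<open>wedge_commute\<close>.\<close>

lemma inversions_swap:
  assumes "finite I" "finite J" "I \<inter> J = {}"
  shows "inversions I J + inversions J I = card I * card J"
proof -
  let ?A = "{(i, j). i \<in> I \<and> j \<in> J \<and> j < i}" and ?B = "{(j, i). j \<in> J \<and> i \<in> I \<and> i < j}"
  have "I \<times> J = ?A \<union> prod.swap ` ?B" using assms(3) by (auto simp: image_iff)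
  then have "card I * card J = card (?A \<union> prod.swap ` ?B)"
    by (metis card_cartesian_product)
  also have "\<dots> = card ?A + card (prod.swap ` ?B)"
    using assms by (intro card_Un_disjoint) (auto simp: finite_inversions)
  also have "card (prod.swap ` ?B) = card ?B"
    by (rule card_image) (auto simp: inj_on_def)
  finally show ?thesis by (simp add: inversions_def)
qed

lemma inversions_singleton: "inversions {i} J = card {j \<in> J. j < i}"
proof -
  have "{(i', j). i' \<in> {i} \<and> j \<in> J \<and> j < i'} = Pair i ` {j \<in> J. j < i}" by auto
  then show ?thesis by (simp add: inversions_def card_image inj_on_def)
qed

lemma wedge_eq: "wedge \<omega> \<eta> K = (\<Sum>I\<in>Pow K. shuffle_sign I (K - I) * \<omega> I * \<eta> (K - I))"
  by (simp add: wedge_def inversions_def)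

lemma wedge_infinite: "infinite K \<Longrightarrow> wedge \<omega> \<eta> K = 0"
  by (simp add: wedge_eq)

lemma wedge_cong:
  assumes "\<And>I. I \<subseteq> K \<Longrightarrow> \<omega> I = \<omega>' I" "\<And>I. I \<subseteq> K \<Longrightarrow> \<eta> I = \<eta>' I"
  shows "wedge \<omega> \<eta> K = wedge \<omega>' \<eta>' K"
  unfolding wedge_eq using assms by (intro sum.cong) auto

definition cmul :: "mpoly \<Rightarrow> poly_form \<Rightarrow> poly_form" where
  "cmul c \<omega> = (\<lambda>I. c * \<omega> I)"

lemma cmul_simps [simp]: "cmul 0 \<omega> = 0" "cmul 1 \<omega> = \<omega>" "cmul c 0 = 0" "cmul a (cmul b \<omega>) = cmul (a * b) \<omega>"
  by (auto simp: cmul_def algebra_simps)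

lemma cmul_add: "cmul c (\<omega> + \<eta>) = cmul c \<omega> + cmul c \<eta>" "cmul (c + c') \<omega> = cmul c \<omega> + cmul c' \<omega>"
  by (auto simp: cmul_def algebra_simps)

lemma cmul_sum: "cmul c (\<Sum>i\<in>I. f i) = (\<Sum>i\<in>I. cmul c (f i))" "cmul (\<Sum>i\<in>I. g i) \<omega> = (\<Sum>i\<in>I. cmul (g i) \<omega>)"
  by (auto simp: cmul_def sum_fun_apply sum_distrib_left sum_distrib_right)

lemma wedge_add_left: "wedge (\<omega> + \<omega>') \<eta> = wedge \<omega> \<eta> + wedge \<omega>' \<eta>"
  and wedge_add_right: "wedge \<omega> (\<eta> + \<eta>') = wedge \<omega> \<eta> + wedge \<omega> \<eta>'"
  by (rule ext, simp add: wedge_eq sum.distrib[symmetric] algebra_simps)+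

lemma wedge_cmul_left: "wedge (cmul c \<omega>) \<eta> = cmul c (wedge \<omega> \<eta>)"
  and wedge_cmul_right: "wedge \<omega> (cmul c \<eta>) = cmul c (wedge \<omega> \<eta>)"
  by (rule ext, simp add: wedge_eq cmul_def sum_distrib_left algebra_simps)+

lemma wedge_0 [simp]: "wedge 0 \<eta> = 0" "wedge \<omega> 0 = 0"
  by (rule ext, simp add: wedge_eq)+

lemma wedge_sum_left: "wedge (\<Sum>i\<in>I. f i) \<eta> = (\<Sum>i\<in>I. wedge (f i) \<eta>)"
  and wedge_sum_right: "wedge \<omega> (\<Sum>i\<in>I. f i) = (\<Sum>i\<in>I. wedge \<omega> (f i))"
  by (induction I rule: infinite_finite_induct) (simp_all add: wedge_add_left wedge_add_right)

text \<open>Both sides run over the ordered partitions of \<open>K\<close> into three blocks; the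
  signs agree because inversions are additive in each argument.\<close>

lemma wedge_assoc: "wedge (wedge \<omega> \<eta>) \<zeta> = wedge \<omega> (wedge \<eta> \<zeta>)"
proof
  fix K
  show "wedge (wedge \<omega> \<eta>) \<zeta> K = wedge \<omega> (wedge \<eta> \<zeta>) K"
  proof (cases "finite K")
    case True
    have fin: "finite I" if "I \<subseteq> K" for I using True that finite_subset by blast
    have "wedge (wedge \<omega> \<eta>) \<zeta> K = (\<Sum>L\<in>Pow K. \<Sum>I\<in>Pow L.
        shuffle_sign L (K - L) * shuffle_sign I (L - I) * \<omega> I * \<eta> (L - I) * \<zeta> (K - L))"
      by (simp add: wedge_eq sum_distrib_left sum_distrib_right mult.assoc)
    also have "\<dots> = (\<Sum>(L, I)\<in>Sigma (Pow K) Pow.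
        shuffle_sign L (K - L) * shuffle_sign I (L - I) * \<omega> I * \<eta> (L - I) * \<zeta> (K - L))"
      using True fin by (subst sum.Sigma) auto
    also have "\<dots> = (\<Sum>(I, J)\<in>Sigma (Pow K) (\<lambda>I. Pow (K - I)).
        shuffle_sign I (K - I) * shuffle_sign J (K - I - J) * \<omega> I * \<eta> J * \<zeta> (K - I - J))"
    proof (rule sum.reindex_bij_witness[where i = "\<lambda>(I, J). (I \<union> J, I)" and j = "\<lambda>(L, I). (I, L - I)"], goal_cases)
      case (5 LI)
      obtain L I where LI: "LI = (L, I)" by force
      have sub: "I \<subseteq> L" "L \<subseteq> K" using 5 LI by auto
      have eqs: "K - I - (L - I) = K - L" "L = I \<union> (L - I)" "K - I = (L - I) \<union> (K - L)" using sub by auto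
      have fs: "finite I" "finite (L - I)" "finite (K - L)" using sub fin by auto
      have "inversions L (K - L) + inversions I (L - I) = inversions I (K - L) + inversions (L - I) (K - L) + inversions I (L - I)"
        using inversions_Un_left[of I "L - I" "K - L"] fs eqs(2) by auto
      also have "\<dots> = inversions I (K - I) + inversions (L - I) (K - L)"
      proof -
        have "(L - I) \<inter> (K - L) = {}" by auto
        from inversions_Un_right[OF fs this] show ?thesis by (simp only: eqs(3))
      qed
      finally have "shuffle_sign L (K - L) * shuffle_sign I (L - I)
          = shuffle_sign I (K - I) * shuffle_sign (L - I) (K - L)"
        by (simp flip: power_add)
      then show ?case by (simp add: LI eqs(1))
    qed auto
    also have "\<dots> = (\<Sum>I\<in>Pow K. \<Sum>J\<in>Pow (K - I).
        shuffle_sign I (K - I) * shuffle_sign J (K - I - J) * \<omega> I * \<eta> J * \<zeta> (K - I - J))"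
      using True fin by (subst sum.Sigma) auto
    also have "\<dots> = wedge \<omega> (wedge \<eta> \<zeta>) K"
      by (simp add: wedge_eq sum_distrib_left algebra_simps)
    finally show ?thesis .
  qed (simp add: wedge_infinite)
qed

definition deg_form :: "nat \<Rightarrow> poly_form \<Rightarrow> bool" where
  "deg_form k \<omega> \<longleftrightarrow> (\<forall>I. \<omega> I \<noteq> 0 \<longrightarrow> finite I \<and> card I = k)"

lemma neg_one_power_cancel:
  assumes "a + b = n"
  shows "(-1) ^ n * (-1) ^ b = ((-1) ^ a :: 'a::comm_ring_1)"
  unfolding assms[symmetric] power_add mult.assoc power_mult_distrib[symmetric] by simp

lemma wedge_commute:
  assumes "deg_form p \<omega>" "deg_form q \<eta>"
  shows "wedge \<omega> \<eta> = cmul ((-1) ^ (p * q)) (wedge \<eta> \<omega>)"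
proof
  fix K
  show "wedge \<omega> \<eta> K = cmul ((-1) ^ (p * q)) (wedge \<eta> \<omega>) K"
  proof (cases "finite K")
    case True
    have "wedge \<omega> \<eta> K = (\<Sum>I\<in>Pow K. shuffle_sign I (K - I) * \<omega> I * \<eta> (K - I))" by (rule wedge_eq)
    also have "\<dots> = (\<Sum>J\<in>Pow K. (-1) ^ (p * q) * (shuffle_sign J (K - J) * \<eta> J * \<omega> (K - J)))"
    proof (rule sum.reindex_bij_witness[where i = "\<lambda>J. K - J" and j = "\<lambda>J. K - J"], goal_cases)
      case (5 I)
      have dd: "K - (K - I) = I" using 5 by auto
      show ?case
      proof (cases "\<omega> I = 0 \<or> \<eta> (K - I) = 0")
        case False
        then have c: "card I = p" "card (K - I) = q" using assms by (auto simp: deg_form_def)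
        have "inversions I (K - I) + inversions (K - I) I = p * q"
          using inversions_swap[of I "K - I"] True 5 c finite_subset by fastforce
        then have sg: "(-1) ^ (p * q) * shuffle_sign (K - I) I = shuffle_sign I (K - I)"
          by (rule neg_one_power_cancel)
        have "(-1) ^ (p * q) * (shuffle_sign (K - I) I * \<eta> (K - I) * \<omega> I)
            = ((-1) ^ (p * q) * shuffle_sign (K - I) I) * \<omega> I * \<eta> (K - I)"
          by (simp only: ac_simps)
        then show ?thesis by (simp only: dd sg)
      qed (auto simp: dd)
    qed auto
    also have "\<dots> = cmul ((-1) ^ (p * q)) (wedge \<eta> \<omega>) K"
      by (simp add: cmul_def wedge_eq sum_distrib_left)
    finally show ?thesis .
  qed (simp add: wedge_infinite cmul_def)
qed

lemma deg_form_wedge: "deg_form p \<omega> \<Longrightarrow> deg_form q \<eta> \<Longrightarrow> deg_form (p + q) (wedge \<omega> \<eta>)"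
  unfolding deg_form_def
proof (intro allI impI)
  fix K assume d: "\<forall>I. \<omega> I \<noteq> 0 \<longrightarrow> finite I \<and> card I = p" "\<forall>I. \<eta> I \<noteq> 0 \<longrightarrow> finite I \<and> card I = q"
    and K: "wedge \<omega> \<eta> K \<noteq> 0"
  have fK: "finite K" using K wedge_infinite by blast
  obtain I where "I \<subseteq> K" "\<omega> I \<noteq> 0" "\<eta> (K - I) \<noteq> 0"
    using K unfolding wedge_eq by (metis (no_types, lifting) PowD mult_zero_left mult_zero_right sum.neutral)
  then show "finite K \<and> card K = p + q"
    using d fK by (metis card_Diff_subset card_mono finite_subset le_add_diff_inverse)
qed

text \<open>The hypothesis concerns infinite index sets: there a wedge product is zero by the
  convention for infinite sums, so multiplication by a function, and in particular by one, agrees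
  with \<open>cmul\<close> only on forms that vanish there too.\<close>

lemma wedge_form_of_poly:
  assumes "\<And>K. infinite K \<Longrightarrow> \<eta> K = 0"
  shows "wedge (form_of_poly c) \<eta> = cmul c \<eta>"
proof
  fix K
  show "wedge (form_of_poly c) \<eta> K = cmul c \<eta> K"
  proof (cases "finite K")
    case True
    have "wedge (form_of_poly c) \<eta> K = (\<Sum>I\<in>{{}}. shuffle_sign I (K - I) * form_of_poly c I * \<eta> (K - I))"
      unfolding wedge_eq using True by (intro sum.mono_neutral_right) (auto simp: form_of_poly_def)
    then show ?thesis by (simp add: form_of_poly_def cmul_def)
  qed (simp add: wedge_infinite cmul_def assms)
qed

lemma form_one_eq: "form_one = form_of_poly 1"
  by (simp add: form_one_def form_of_poly_def)

lemma wedge_one_left: "(\<And>K. infinite K \<Longrightarrow> \<eta> K = 0) \<Longrightarrow> wedge form_one \<eta> = \<eta>"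
  by (simp add: form_one_eq wedge_form_of_poly)

lemma deg_form_of_poly: "deg_form 0 (form_of_poly c)"
  by (simp add: deg_form_def form_of_poly_def)

lemma wedge_one_right:
  assumes "\<And>K. infinite K \<Longrightarrow> \<eta> K = 0"
  shows "wedge \<eta> form_one = \<eta>"
proof
  fix K
  show "wedge \<eta> form_one K = \<eta> K"
  proof (cases "finite K")
    case True
    have "wedge \<eta> form_one K = (\<Sum>I\<in>{K}. shuffle_sign I (K - I) * \<eta> I * form_one (K - I))"
      unfolding wedge_eq using True by (intro sum.mono_neutral_right) (auto simp: form_one_def)
    then show ?thesis by (simp add: form_one_def)
  qed (simp add: wedge_infinite assms)
qed

subsection \<open>The exterior derivative\<close>

definition dvar :: "nat \<Rightarrow> poly_form" where
  "dvar i = (\<lambda>I. if I = {i} then 1 else 0)"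

definition form_partial :: "nat \<Rightarrow> poly_form \<Rightarrow> poly_form" where
  "form_partial i \<omega> = (\<lambda>I. mpartial i (\<omega> I))"

lemma wedge_dvar:
  "wedge (dvar i) \<eta> K = (if finite K \<and> i \<in> K then (-1) ^ card {j\<in>K. j < i} * \<eta> (K - {i}) else 0)"
proof (cases "finite K")
  case True
  have "wedge (dvar i) \<eta> K = (\<Sum>I\<in>Pow K. if I = {i} then shuffle_sign I (K - I) * \<eta> (K - I) else 0)"
    unfolding wedge_eq by (intro sum.cong) (auto simp: dvar_def)
  also have "\<dots> = (if i \<in> K then shuffle_sign {i} (K - {i}) * \<eta> (K - {i}) else 0)"
    using True by simp
  also have "inversions {i} (K - {i}) = card {j\<in>K. j < i}"
    unfolding inversions_singleton by (intro arg_cong[of _ _ card]) auto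
  finally show ?thesis using True by simp
qed (simp add: wedge_infinite)

text \<open>This is \<open>d = \<Sum> dt_i \<partial>_i\<close>. No number of variables is fixed in
  advance, so it is stated at index sets inside a finite \<open>V\<close>; the indices outside
  \<open>K\<close> contribute nothing at \<open>K\<close>.\<close>

lemma form_d_local:
  assumes "finite V" "K \<subseteq> V"
  shows "form_d \<omega> K = (\<Sum>i\<in>V. wedge (dvar i) (form_partial i \<omega>)) K"
proof -
  have "finite K" using assms finite_subset by blast
  then have "(\<Sum>i\<in>V. wedge (dvar i) (form_partial i \<omega>)) K
      = (\<Sum>i\<in>V. if i \<in> K then (-1) ^ card {j\<in>K. j < i} * mpartial i (\<omega> (K - {i})) else 0)"
    unfolding sum_fun_apply by (intro sum.cong) (simp_all add: wedge_dvar form_partial_def)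
  also have "\<dots> = (\<Sum>i\<in>K. (-1) ^ card {j\<in>K. j < i} * mpartial i (\<omega> (K - {i})))"
    using assms by (simp add: sum.inter_restrict[symmetric] inf.absorb2)
  finally show ?thesis by (simp add: form_d_def)
qed

lemma form_d_infinite: "infinite K \<Longrightarrow> form_d \<omega> K = 0"
  by (simp add: form_d_def)

lemma mpartial_neg_one_power: "mpartial i ((-1) ^ k) = 0"
  using mpartial_neg_one_power_mult[of i k 1] by simp

lemma form_partial_wedge:
  "form_partial i (wedge \<omega> \<eta>) = wedge (form_partial i \<omega>) \<eta> + wedge \<omega> (form_partial i \<eta>)"
  by (rule ext) (simp add: form_partial_def wedge_eq mpartial_sum mpartial_mult mpartial_neg_one_power
     mult.assoc sum.distrib[symmetric] distrib_left)

lemma deg_dvar: "deg_form 1 (dvar i)"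
  by (simp add: deg_form_def dvar_def)

lemma form_d_add: "form_d (\<omega> + \<eta>) = form_d \<omega> + form_d \<eta>"
  by (rule ext) (simp add: form_d_def mpartial_add sum.distrib[symmetric] distrib_left)

lemma form_d_0 [simp]: "form_d 0 = 0"
  by (rule ext) (simp add: form_d_def)

lemma form_d_sum: "form_d (\<Sum>i\<in>I. f i) = (\<Sum>i\<in>I. form_d (f i))"
  by (induction I rule: infinite_finite_induct)
     (simp_all only: sum.infinite sum.empty sum.insert form_d_0 form_d_add not_False_eq_True)

lemma form_d_cmul_mconst: "form_d (cmul (mconst c) \<omega>) = cmul (mconst c) (form_d \<omega>)"
  by (rule ext) (simp add: form_d_def cmul_def mpartial_mconst_mult sum_distrib_left algebra_simps)

lemma wedge_dvar_swap: "wedge (dvar i) (wedge (dvar j) \<omega>) = cmul (-1) (wedge (dvar j) (wedge (dvar i) \<omega>))"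
  using wedge_commute[OF deg_dvar deg_dvar, of i j]
  by (simp add: wedge_assoc[symmetric] wedge_cmul_left)

lemma mpoly_eq_minus_self: "x = - x \<Longrightarrow> x = 0" for x :: mpoly
proof (rule poly_mapping_eqI)
  fix m assume "x = - x"
  then have "Poly_Mapping.lookup x m = - Poly_Mapping.lookup x m" by (metis lookup_uminus)
  then show "Poly_Mapping.lookup x m = Poly_Mapping.lookup 0 m" by simp
qed

text \<open>Partial derivatives commute and the \<open>dt_i\<close> anticommute, so the double sum
  equals its own negative.\<close>

lemma form_d_form_d: "form_d (form_d \<omega>) = 0"
proof
  fix K
  show "form_d (form_d \<omega>) K = 0 K"
  proof (cases "finite K")
    case True
    let ?S = "\<Sum>i\<in>K. \<Sum>j\<in>K. wedge (dvar i) (wedge (dvar j) (form_partial i (form_partial j \<omega>)))"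
    have loc: "form_partial i (form_d \<omega>) I = (\<Sum>j\<in>K. wedge (dvar j) (form_partial i (form_partial j \<omega>))) I"
      if "I \<subseteq> K" for i I
      unfolding form_partial_def[of i "form_d \<omega>"] form_d_local[OF True that] sum_fun_apply mpartial_sum
      by (intro sum.cong refl) (simp add: form_partial_def wedge_dvar mpartial_neg_one_power_mult)
    have "form_d (form_d \<omega>) K = (\<Sum>i\<in>K. wedge (dvar i) (form_partial i (form_d \<omega>))) K"
      by (rule form_d_local[OF True subset_refl])
    also have "\<dots> = ?S K"
      unfolding sum_fun_apply[of _ K K]
    proof (intro sum.cong refl)
      fix i
      have "wedge (dvar i) (form_partial i (form_d \<omega>)) K
          = wedge (dvar i) (\<Sum>j\<in>K. wedge (dvar j) (form_partial i (form_partial j \<omega>))) K"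
        by (rule wedge_cong) (simp_all only: loc)
      then show "wedge (dvar i) (form_partial i (form_d \<omega>)) K
          = (\<Sum>j\<in>K. wedge (dvar i) (wedge (dvar j) (form_partial i (form_partial j \<omega>))) K)"
        by (simp only: wedge_sum_right sum_fun_apply)
    qed
    finally have 1: "form_d (form_d \<omega>) K = ?S K" .
    have "form_partial i (form_partial j \<omega>) = form_partial j (form_partial i \<omega>)" for i j
      by (simp add: form_partial_def mpartial_commute)
    then have "?S = (\<Sum>i\<in>K. \<Sum>j\<in>K. cmul (-1) (wedge (dvar j) (wedge (dvar i) (form_partial j (form_partial i \<omega>)))))"
      by (subst wedge_dvar_swap) simp
    also have "\<dots> = cmul (-1) ?S"
      by (subst sum.swap) (simp add: cmul_sum)
    finally have "?S K = cmul (-1) ?S K" by (rule arg_cong)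
    then have "?S K = 0" by (intro mpoly_eq_minus_self) (simp add: cmul_def)
    with 1 show ?thesis by simp
  qed (simp add: form_d_infinite)
qed

text \<open>Each \<open>form_partial i\<close> is a derivation without signs; the sign arises from
  moving \<open>dt_i\<close> past a form of degree \<open>k\<close>.\<close>

lemma form_d_wedge:
  assumes "deg_form k \<omega>"
  shows "form_d (wedge \<omega> \<eta>) = wedge (form_d \<omega>) \<eta> + cmul ((-1) ^ k) (wedge \<omega> (form_d \<eta>))"
proof
  fix K
  show "form_d (wedge \<omega> \<eta>) K = (wedge (form_d \<omega>) \<eta> + cmul ((-1) ^ k) (wedge \<omega> (form_d \<eta>))) K"
  proof (cases "finite K")
    case True
    have sw: "wedge (dvar i) (wedge \<omega> \<zeta>) = cmul ((-1) ^ k) (wedge \<omega> (wedge (dvar i) \<zeta>))" for i \<zeta>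
      using wedge_commute[OF deg_dvar assms, of i] by (simp add: wedge_assoc[symmetric] wedge_cmul_left)
    have "form_d (wedge \<omega> \<eta>) K = (\<Sum>i\<in>K. wedge (dvar i) (form_partial i (wedge \<omega> \<eta>))) K"
      by (rule form_d_local[OF True subset_refl])
    also have "\<dots> = (\<Sum>i\<in>K. wedge (wedge (dvar i) (form_partial i \<omega>)) \<eta>
        + cmul ((-1) ^ k) (wedge \<omega> (wedge (dvar i) (form_partial i \<eta>)))) K"
      by (simp only: form_partial_wedge wedge_add_right sw wedge_assoc)
    also have "\<dots> = wedge (\<Sum>i\<in>K. wedge (dvar i) (form_partial i \<omega>)) \<eta> K
        + cmul ((-1) ^ k) (wedge \<omega> (\<Sum>i\<in>K. wedge (dvar i) (form_partial i \<eta>))) K"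
      by (simp add: sum.distrib wedge_sum_left wedge_sum_right cmul_sum)
    also have "wedge (\<Sum>i\<in>K. wedge (dvar i) (form_partial i \<omega>)) \<eta> K = wedge (form_d \<omega>) \<eta> K"
      by (rule wedge_cong) (simp_all add: form_d_local[OF True])
    also have "wedge \<omega> (\<Sum>i\<in>K. wedge (dvar i) (form_partial i \<eta>)) K = wedge \<omega> (form_d \<eta>) K"
      by (rule wedge_cong) (simp_all add: form_d_local[OF True])
    then have "cmul ((-1) ^ k) (wedge \<omega> (\<Sum>i\<in>K. wedge (dvar i) (form_partial i \<eta>))) K
        = cmul ((-1) ^ k) (wedge \<omega> (form_d \<eta>)) K" by (simp add: cmul_def)
    finally show ?thesis by simp
  qed (simp add: form_d_infinite wedge_infinite cmul_def)
qed

lemma deg_form_d: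
  assumes "deg_form k \<omega>" shows "deg_form (Suc k) (form_d \<omega>)"
  unfolding deg_form_def
proof (intro allI impI)
  fix K assume K: "form_d \<omega> K \<noteq> 0"
  then have fK: "finite K" using form_d_infinite by blast
  obtain i where i: "i \<in> K" "mpartial i (\<omega> (K - {i})) \<noteq> 0"
    using K unfolding form_d_def by (metis (no_types, lifting) mult_zero_right sum.neutral)
  then have "\<omega> (K - {i}) \<noteq> 0" by auto
  then have "card (K - {i}) = k" using assms by (simp add: deg_form_def)
  then show "finite K \<and> card K = Suc k" using fK i(1) by (metis card.remove)
qed

subsection \<open>Pullbacks\<close>

text \<open>The pullback of \<open>dt_I\<close> under the substitution \<open>s\<close>, that is the
  product of the \<open>ds_i\<close> in increasing order of \<open>i\<close>. For infinite
  \<open>I\<close> the sorted list is empty and the product is \<open>form_one\<close>.\<close>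

definition dforms :: "(nat \<Rightarrow> mpoly) \<Rightarrow> nat set \<Rightarrow> poly_form" where
  "dforms s I = foldr (\<lambda>i. wedge (form_d (form_of_poly (s i)))) (sorted_list_of_set I) form_one"

text \<open>The general form of \<open>form_pullback\<close>, for an arbitrary polynomial
  substitution; simplicial maps are the instance in \<open>form_pullback_eq_pull\<close>.\<close>

definition pull :: "(nat \<Rightarrow> mpoly) \<Rightarrow> nat set \<Rightarrow> poly_form \<Rightarrow> poly_form" where
  "pull s V \<omega> = (\<Sum>I\<in>Pow V. cmul (msubst s (\<omega> I)) (dforms s I))"

lemma dforms_empty [simp]: "dforms s {} = form_one"
  by (simp add: dforms_def)

lemma dforms_insert:
  assumes "finite A" "\<forall>a\<in>A. b < a"
  shows "dforms s (insert b A) = wedge (form_d (form_of_poly (s b))) (dforms s A)"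
proof -
  have "Min (insert b A) = b" using assms by (intro Min_eqI) (auto simp: less_imp_le)
  moreover have "insert b A - {b} = A" using assms(2) by auto
  ultimately have "sorted_list_of_set (insert b A) = b # sorted_list_of_set A"
    using sorted_list_of_set_nonempty[of "insert b A"] assms(1) by simp
  then show ?thesis by (simp add: dforms_def)
qed

lemma deg_form_one: "deg_form 0 form_one"
  by (simp add: form_one_eq deg_form_of_poly)

lemma deg_dform: "deg_form 1 (form_d (form_of_poly c))"
  using deg_form_d[OF deg_form_of_poly] by simp

lemma deg_form_infinite: "deg_form k \<omega> \<Longrightarrow> infinite K \<Longrightarrow> \<omega> K = 0"
  by (auto simp: deg_form_def)

lemma deg_dforms: "finite I \<Longrightarrow> deg_form (card I) (dforms s I)"
proof (induction I rule: finite_linorder_min_induct)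
  case empty
  then show ?case by (simp add: deg_form_one)
next
  case (insert b A)
  have "b \<notin> A" using insert by auto
  then show ?case
    using deg_form_wedge[OF deg_dform insert.IH] insert(1) by (simp add: dforms_insert[OF insert(1,2)])
qed

lemma dforms_infinite: "infinite K \<Longrightarrow> dforms s I K = 0"
proof (cases "finite I")
  case True
  then show "infinite K \<Longrightarrow> dforms s I K = 0" using deg_form_infinite[OF deg_dforms] by blast
next
  case False
  then show "infinite K \<Longrightarrow> dforms s I K = 0"
    by (auto simp: dforms_def form_one_def)
qed

lemma form_eq_minus_self: "\<omega> = cmul (-1) \<omega> \<Longrightarrow> \<omega> = 0"
proof
  fix K assume "\<omega> = cmul (-1) \<omega>"
  then have "\<omega> K = cmul (-1) \<omega> K" by (rule fun_cong)
  then have "\<omega> K = 0" by (intro mpoly_eq_minus_self) (simp add: cmul_def)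
  then show "\<omega> K = 0 K" by simp
qed

lemma wedge_dform_swap:
  "wedge (form_d (form_of_poly a)) (wedge (form_d (form_of_poly b)) \<omega>)
     = cmul (-1) (wedge (form_d (form_of_poly b)) (wedge (form_d (form_of_poly a)) \<omega>))"
  using wedge_commute[OF deg_dform deg_dform, of a b]
  by (simp add: wedge_assoc[symmetric] wedge_cmul_left)

lemma wedge_dform_self: "wedge (form_d (form_of_poly a)) (wedge (form_d (form_of_poly a)) \<omega>) = 0"
  by (rule form_eq_minus_self[OF wedge_dform_swap])

text \<open>A single differential is moved past the smaller indices to its place in the sorted
  product, with one sign for each; a repeated differential gives zero because one-forms
  anticommute.\<close>

lemma wedge_dform_dforms:
  assumes "finite J"
  shows "wedge (form_d (form_of_poly (s i))) (dforms s J)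
     = (if i \<in> J then 0 else cmul ((-1) ^ card {j\<in>J. j < i}) (dforms s (insert i J)))"
  using assms
proof (induction J rule: finite_linorder_min_induct)
  case empty
  have "dforms s {i} = wedge (form_d (form_of_poly (s i))) (dforms s {})"
    by (rule dforms_insert) auto
  then show ?case by simp
next
  case (insert m J)
  let ?D = "\<lambda>i. form_d (form_of_poly (s i))"
  have fin: "finite J" and mJ: "\<forall>a\<in>J. m < a" and mnot: "m \<notin> J" using insert by auto
  note dm = dforms_insert[OF fin mJ]
  consider "i < m" | "i = m" | "m < i" by linarith
  then show ?case
  proof cases
    case 1
    have "\<forall>a\<in>insert m J. i < a" using 1 mJ by auto
    then have "dforms s (insert i (insert m J)) = wedge (?D i) (dforms s (insert m J))"
      using fin by (intro dforms_insert) auto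
    moreover have "i \<notin> insert m J" "{j \<in> insert m J. j < i} = {}" using \<open>\<forall>a\<in>insert m J. i < a\<close> by auto
    ultimately show ?thesis by (simp only: card.empty power_0 cmul_simps if_False)
  next
    case 2
    then show ?thesis by (simp add: dm wedge_dform_self)
  next
    case 3
    have sw: "wedge (?D i) (dforms s (insert m J)) = cmul (-1) (wedge (?D m) (wedge (?D i) (dforms s J)))"
      unfolding dm by (rule wedge_dform_swap)
    show ?thesis
    proof (cases "i \<in> J")
      case True
      then have "wedge (?D i) (dforms s J) = 0" using insert.IH by (simp only: if_True)
      with sw have "wedge (?D i) (dforms s (insert m J)) = 0" by (simp only: wedge_0 cmul_simps)
      then show ?thesis using True by (simp only: insert_iff simp_thms if_True)
    next
      case False
      have "\<forall>a\<in>insert i J. m < a" using mJ 3 by auto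
      then have d: "dforms s (insert m (insert i J)) = wedge (?D m) (dforms s (insert i J))"
        using fin by (intro dforms_insert) auto
      have "{j \<in> insert m J. j < i} = insert m {j \<in> J. j < i}" using 3 by auto
      then have c: "card {j \<in> insert m J. j < i} = Suc (card {j \<in> J. j < i})"
        using fin mnot by simp
      have "wedge (?D i) (dforms s J) = cmul ((-1) ^ card {j \<in> J. j < i}) (dforms s (insert i J))"
        using insert.IH False by (simp only: if_False)
      then have "wedge (?D i) (dforms s (insert m J))
          = cmul ((-1) ^ Suc (card {j \<in> J. j < i})) (dforms s (insert m (insert i J)))"
        using sw d by (simp add: wedge_cmul_right)
      moreover have "i \<notin> insert m J" using False 3 by auto
      ultimately show ?thesis by (simp only: c if_False insert_commute[of m i])
    qed
  qed
qed

lemma wedge_dforms: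
  assumes "finite I" "finite J"
  shows "wedge (dforms s I) (dforms s J)
     = (if I \<inter> J = {} then cmul (shuffle_sign I J) (dforms s (I \<union> J)) else 0)"
  using assms(1)
proof (induction I rule: finite_linorder_min_induct)
  case empty
  then show ?case by (simp add: wedge_one_left dforms_infinite)
next
  case (insert m I)
  let ?D = "\<lambda>i. form_d (form_of_poly (s i))"
  have mI: "m \<notin> I" using insert by auto
  have 1: "wedge (dforms s (insert m I)) (dforms s J) = wedge (?D m) (wedge (dforms s I) (dforms s J))"
    by (simp add: dforms_insert[OF insert(1,2)] wedge_assoc)
  show ?case
  proof (cases "I \<inter> J = {}")
    case True
    have "{j \<in> I \<union> J. j < m} = {j \<in> J. j < m}" using insert(2) by auto
    then have 2: "wedge (?D m) (dforms s (I \<union> J))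
        = (if m \<in> J then 0 else cmul (shuffle_sign {m} J) (dforms s (insert m (I \<union> J))))"
      using wedge_dform_dforms[of "I \<union> J" s m] insert(1) assms(2) mI by (simp add: inversions_singleton)
    have "inversions (insert m I) J = inversions {m} J + inversions I J"
      using inversions_Un_left[of "{m}" I J] insert(1) assms(2) mI by simp
    then show ?thesis
      using 1 2 insert.IH True by (simp add: wedge_cmul_right power_add mult.commute)
  next
    case False
    then have "wedge (dforms s I) (dforms s J) = 0" using insert.IH by (simp only: if_False)
    with 1 have "wedge (dforms s (insert m I)) (dforms s J) = 0" by (simp only: wedge_0)
    moreover have "insert m I \<inter> J \<noteq> {}" using False by auto
    ultimately show ?thesis by (simp only: if_False)
  qed
qed

text \<open>Both sides become sums over pairs of index sets. On the left only disjoint pairs occur;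
  on the right the overlapping ones vanish because some \<open>ds_i\<close> appears twice.\<close>

lemma pull_wedge:
  assumes V: "finite V"
  shows "pull s V (wedge \<omega> \<eta>) = wedge (pull s V \<omega>) (pull s V \<eta>)"
proof -
  have fin: "finite I" if "I \<subseteq> V" for I using V that finite_subset by blast
  let ?t = "\<lambda>I J. cmul (shuffle_sign I J * (msubst s (\<omega> I) * msubst s (\<eta> J))) (dforms s (I \<union> J))"
  have "pull s V (wedge \<omega> \<eta>) = (\<Sum>K\<in>Pow V. \<Sum>I\<in>Pow K. ?t I (K - I))"
    unfolding pull_def
  proof (intro sum.cong refl)
    fix K assume "K \<in> Pow V"
    have "msubst s (wedge \<omega> \<eta> K) = (\<Sum>I\<in>Pow K. shuffle_sign I (K - I) * (msubst s (\<omega> I) * msubst s (\<eta> (K - I))))"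
      by (simp only: wedge_eq msubst_sum mult.assoc msubst_neg_one_power_mult) (simp only: msubst_mult)
    moreover have "I \<union> (K - I) = K" if "I \<in> Pow K" for I using that by auto
    ultimately show "cmul (msubst s (wedge \<omega> \<eta> K)) (dforms s K) = (\<Sum>I\<in>Pow K. ?t I (K - I))"
      by (simp add: cmul_sum)
  qed
  also have "\<dots> = (\<Sum>(K, I)\<in>Sigma (Pow V) Pow. ?t I (K - I))"
    using V fin by (subst sum.Sigma) auto
  also have "\<dots> = (\<Sum>(I, J)\<in>{(I, J). I \<subseteq> V \<and> J \<subseteq> V \<and> I \<inter> J = {}}. ?t I J)"
    by (rule sum.reindex_bij_witness[where i = "\<lambda>(I, J). (I \<union> J, I)" and j = "\<lambda>(K, I). (I, K - I)"]) auto
  also have "{(I, J). I \<subseteq> V \<and> J \<subseteq> V \<and> I \<inter> J = {}} = {p \<in> Pow V \<times> Pow V. fst p \<inter> snd p = {}}"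
    by auto
  also have "(\<Sum>(I, J)\<in>\<dots>. ?t I J) = (\<Sum>p\<in>Pow V \<times> Pow V. if fst p \<inter> snd p = {} then (case p of (I, J) \<Rightarrow> ?t I J) else 0)"
    by (rule sum.inter_filter) (use V in simp)
  also have "\<dots> = (\<Sum>I\<in>Pow V. \<Sum>J\<in>Pow V. if I \<inter> J = {} then ?t I J else 0)"
    unfolding sum.cartesian_product by (rule sum.cong) (simp_all only: case_prod_beta)
  also have "\<dots> = (\<Sum>I\<in>Pow V. \<Sum>J\<in>Pow V. cmul (msubst s (\<omega> I)) (cmul (msubst s (\<eta> J)) (wedge (dforms s I) (dforms s J))))"
    using fin by (intro sum.cong refl) (auto simp: wedge_dforms algebra_simps)
  also have "\<dots> = wedge (pull s V \<omega>) (pull s V \<eta>)"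
    by (simp only: pull_def wedge_sum_left wedge_sum_right wedge_cmul_left wedge_cmul_right cmul_sum)
       (subst sum.swap, simp add: mult.commute)
  finally show ?thesis .
qed

lemma form_d_form_of_poly: "form_d (form_of_poly c) = (\<Sum>j\<in>W. cmul (mpartial j c) (dvar j))"
  if "finite W" "in_vars W c" for W
proof
  fix K
  have "form_d (form_of_poly c) K = (\<Sum>i\<in>K. if K = {i} then mpartial i c else 0)"
    unfolding form_d_def
  proof (intro sum.cong refl)
    fix i assume i: "i \<in> K"
    show "(-1) ^ card {j \<in> K. j < i} * mpartial i (form_of_poly c (K - {i})) = (if K = {i} then mpartial i c else 0)"
    proof (cases "K = {i}")
      case True
      have e: "{j \<in> K. j < i} = {}" using True by auto
      show ?thesis unfolding e using True by (simp add: form_of_poly_def)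
    next
      case False
      then have "K - {i} \<noteq> {}" using i by blast
      then show ?thesis using False by (simp add: form_of_poly_def)
    qed
  qed
  also have "\<dots> = (\<Sum>j\<in>W. if K = {j} then mpartial j c else 0)"
  proof (cases "\<exists>i. K = {i}")
    case True
    then obtain i where "K = {i}" by blast
    have "(\<Sum>j\<in>W. if {i} = {j} then mpartial j c else 0) = (\<Sum>j\<in>W. if j = i then mpartial j c else 0)"
      by (intro sum.cong) auto
    also have "\<dots> = mpartial i c"
      using that mpartial_eq_0[OF that(2), of i] by simp
    finally show ?thesis using \<open>K = {i}\<close> by simp
  next
    case False
    then show ?thesis by (auto intro!: sum.neutral)
  qed
  finally show "form_d (form_of_poly c) K = (\<Sum>j\<in>W. cmul (mpartial j c) (dvar j)) K"
    by (simp add: sum_fun_apply cmul_def dvar_def if_distrib cong: if_cong)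
qed

lemma finite_in_vars: obtains W where "finite W" "in_vars W c"
proof
  show "finite (\<Union>m\<in>Poly_Mapping.keys c. Poly_Mapping.keys m)" by simp
qed (auto simp: in_vars_def)

lemma form_d_msubst:
  assumes V: "finite V" and P: "in_vars V P"
  shows "form_d (form_of_poly (msubst s P)) = (\<Sum>i\<in>V. cmul (msubst s (mpartial i P)) (form_d (form_of_poly (s i))))"
proof -
  have "\<forall>i. \<exists>W. finite W \<and> in_vars W (s i)" using finite_in_vars by metis
  then obtain W where W: "\<And>i. finite (W i)" "\<And>i. in_vars (W i) (s i)" by metis
  let ?W = "\<Union>i\<in>V. W i"
  have fW: "finite ?W" using V W by auto
  have sW: "in_vars ?W (s i)" if "i \<in> V" for i using W(2) in_vars_mono that by blast
  have "form_d (form_of_poly (msubst s P)) = (\<Sum>j\<in>?W. cmul (mpartial j (msubst s P)) (dvar j))"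
    by (rule form_d_form_of_poly[OF fW]) (rule in_vars_msubst[OF P sW])
  also have "\<dots> = (\<Sum>j\<in>?W. \<Sum>i\<in>V. cmul (msubst s (mpartial i P) * mpartial j (s i)) (dvar j))"
    by (simp add: mpartial_msubst[OF P V] cmul_sum)
  also have "\<dots> = (\<Sum>i\<in>V. cmul (msubst s (mpartial i P)) (\<Sum>j\<in>?W. cmul (mpartial j (s i)) (dvar j)))"
    by (subst sum.swap) (simp add: cmul_sum)
  also have "\<dots> = (\<Sum>i\<in>V. cmul (msubst s (mpartial i P)) (form_d (form_of_poly (s i))))"
    by (intro sum.cong refl) (simp add: form_d_form_of_poly[OF fW sW])
  finally show ?thesis .
qed

lemma form_d_one [simp]: "form_d form_one = 0"
  using form_d_form_of_poly[of "{}" 1] by (simp add: form_one_eq)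

lemma form_d_dforms: "finite I \<Longrightarrow> form_d (dforms s I) = 0"
proof (induction I rule: finite_linorder_min_induct)
  case (insert b A)
  then show ?case
    by (simp only: dforms_insert[OF insert(1,2)] form_d_wedge[OF deg_dform] form_d_form_d
        wedge_0 cmul_simps add_0_left)
qed simp

lemma form_d_cmul:
  assumes "\<And>K. infinite K \<Longrightarrow> \<eta> K = 0"
  shows "form_d (cmul c \<eta>) = wedge (form_d (form_of_poly c)) \<eta> + cmul c (form_d \<eta>)"
  using form_d_wedge[OF deg_form_of_poly, of c \<eta>]
  by (simp add: wedge_form_of_poly[OF assms] wedge_form_of_poly[OF form_d_infinite])

text \<open>Each product of the \<open>ds_i\<close> is closed, so only the coefficients are
  differentiated. The chain rule produces terms indexed by \<open>I\<close> and a new index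
  \<open>i\<close>, which correspond to the terms of \<open>form_d\<close> at
  \<open>insert i I\<close>.\<close>

lemma pull_form_d:
  assumes V: "finite V" and \<omega>: "\<And>I. in_vars V (\<omega> I)"
  shows "pull s V (form_d \<omega>) = form_d (pull s V \<omega>)"
proof -
  have fin: "finite I" if "I \<subseteq> V" for I using V that finite_subset by blast
  let ?t = "\<lambda>i I. cmul ((-1) ^ card {j\<in>I. j < i} * msubst s (mpartial i (\<omega> I))) (dforms s (insert i I))"
  have "pull s V (form_d \<omega>) = (\<Sum>K\<in>Pow V. \<Sum>i\<in>K. ?t i (K - {i}))"
    unfolding pull_def
  proof (intro sum.cong refl)
    fix K assume "K \<in> Pow V"
    have "{j \<in> K - {i}. j < i} = {j \<in> K. j < i}" for i by auto
    moreover have "insert i (K - {i}) = K" if "i \<in> K" for i using that by auto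
    ultimately show "cmul (msubst s (form_d \<omega> K)) (dforms s K) = (\<Sum>i\<in>K. ?t i (K - {i}))"
      by (simp add: form_d_def msubst_sum cmul_sum msubst_neg_one_power_mult)
  qed
  also have "\<dots> = (\<Sum>(K, i)\<in>Sigma (Pow V) (\<lambda>K. K). ?t i (K - {i}))"
    using V fin by (subst sum.Sigma) auto
  also have "\<dots> = (\<Sum>(I, i)\<in>Sigma (Pow V) (\<lambda>I. V - I). ?t i I)"
    by (rule sum.reindex_bij_witness[where i = "\<lambda>(I, i). (insert i I, i)" and j = "\<lambda>(K, i). (K - {i}, i)"])
       (auto simp: insert_absorb)
  also have "\<dots> = (\<Sum>I\<in>Pow V. \<Sum>i\<in>V - I. ?t i I)"
    using V fin by (subst sum.Sigma) auto
  also have "\<dots> = (\<Sum>I\<in>Pow V. form_d (cmul (msubst s (\<omega> I)) (dforms s I)))"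
  proof (intro sum.cong refl)
    fix I assume I: "I \<in> Pow V"
    have "form_d (cmul (msubst s (\<omega> I)) (dforms s I))
        = (\<Sum>i\<in>V. cmul (msubst s (mpartial i (\<omega> I))) (wedge (form_d (form_of_poly (s i))) (dforms s I)))"
      using I fin by (subst form_d_cmul[OF dforms_infinite])
        (simp_all only: form_d_dforms form_d_msubst[OF V \<omega>] wedge_sum_left wedge_cmul_left
           cmul_simps add_0_right Pow_iff not_False_eq_True)
    also have "\<dots> = (\<Sum>i\<in>V. if i \<in> I then 0 else ?t i I)"
      using I fin by (intro sum.cong refl) (auto simp: wedge_dform_dforms algebra_simps)
    also have "\<dots> = (\<Sum>i\<in>V - I. ?t i I)"
      using V by (intro sum.mono_neutral_cong_right) auto
    finally show "(\<Sum>i\<in>V - I. ?t i I) = form_d (cmul (msubst s (\<omega> I)) (dforms s I))" ..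
  qed
  also have "\<dots> = form_d (pull s V \<omega>)"
    unfolding pull_def by (rule form_d_sum[symmetric])
  finally show ?thesis .
qed

lemma pull_add: "pull s V (\<omega> + \<eta>) = pull s V \<omega> + pull s V \<eta>"
  by (simp add: pull_def msubst_add cmul_add sum.distrib)

lemma pull_cmul_mconst: "pull s V (cmul (mconst c) \<omega>) = cmul (mconst c) (pull s V \<omega>)"
  by (simp add: pull_def cmul_sum cmul_def[of "mconst c" \<omega>] msubst_mult)

lemma pull_0: "pull s V 0 = 0"
  by (simp add: pull_def)

lemma pull_one: "finite V \<Longrightarrow> pull s V form_one = form_one"
proof -
  assume V: "finite V"
  have "pull s V form_one = (\<Sum>I\<in>Pow V. if I = {} then form_one else 0)"
    unfolding pull_def by (intro sum.cong) (auto simp: form_one_def)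
  then show ?thesis using V by simp
qed

lemma form_pullback_eq_pull:
  "form_pullback p q \<theta> = pull (\<lambda>i. \<Sum>j | j \<le> p \<and> \<theta> j = i. barycentric p j) {1..q}"
  by (rule ext) (simp add: form_pullback_def pull_def dforms_def[symmetric] wedge_form_of_poly dforms_infinite Let_def)

subsection \<open>The algebra of polynomial forms on a space\<close>

lemma poly_forms_iff:
  "\<omega> \<in> poly_forms p k \<longleftrightarrow> (\<forall>I. \<omega> I \<noteq> 0 \<longrightarrow> I \<subseteq> {1..p} \<and> card I = k \<and> in_vars {1..p} (\<omega> I))"
  by (simp add: poly_forms_def in_vars_def)

lemma poly_forms_deg: "\<omega> \<in> poly_forms p k \<Longrightarrow> deg_form k \<omega>"
  unfolding poly_forms_iff deg_form_def
proof (intro allI impI)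
  fix I assume "\<forall>I. \<omega> I \<noteq> 0 \<longrightarrow> I \<subseteq> {1..p} \<and> card I = k \<and> in_vars {1..p} (\<omega> I)" "\<omega> I \<noteq> 0"
  then show "finite I \<and> card I = k" using finite_subset[of I "{1..p}"] by simp
qed

lemma poly_forms_in_vars: "\<omega> \<in> poly_forms p k \<Longrightarrow> in_vars {1..p} (\<omega> I)"
  by (cases "\<omega> I = 0") (auto simp: poly_forms_iff)

lemma poly_forms_0: "0 \<in> poly_forms p k"
  by (simp add: poly_forms_iff)

lemma poly_forms_add: "\<omega> \<in> poly_forms p k \<Longrightarrow> \<eta> \<in> poly_forms p k \<Longrightarrow> \<omega> + \<eta> \<in> poly_forms p k"
  unfolding poly_forms_iff
proof (intro allI impI)
  fix I
  assume \<omega>: "\<forall>I. \<omega> I \<noteq> 0 \<longrightarrow> I \<subseteq> {1..p} \<and> card I = k \<and> in_vars {1..p} (\<omega> I)"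
    and \<eta>: "\<forall>I. \<eta> I \<noteq> 0 \<longrightarrow> I \<subseteq> {1..p} \<and> card I = k \<and> in_vars {1..p} (\<eta> I)"
    and "(\<omega> + \<eta>) I \<noteq> 0"
  then have "\<omega> I \<noteq> 0 \<or> \<eta> I \<noteq> 0" by auto
  moreover have "in_vars {1..p} (\<omega> I)" "in_vars {1..p} (\<eta> I)"
    using \<omega> \<eta> by (cases "\<omega> I = 0", simp_all) (cases "\<eta> I = 0", simp_all)
  ultimately show "I \<subseteq> {1..p} \<and> card I = k \<and> in_vars {1..p} ((\<omega> + \<eta>) I)"
    using \<omega> \<eta> by (auto intro: in_vars_add)
qed

lemma poly_forms_cmul: "\<omega> \<in> poly_forms p k \<Longrightarrow> cmul (mconst c) \<omega> \<in> poly_forms p k"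
  by (auto simp: poly_forms_iff cmul_def intro!: in_vars_mult)

lemma poly_forms_one: "form_one \<in> poly_forms p 0"
  by (simp add: poly_forms_iff form_one_def)

lemma poly_forms_wedge:
  assumes "\<omega> \<in> poly_forms p i" "\<eta> \<in> poly_forms p j"
  shows "wedge \<omega> \<eta> \<in> poly_forms p (i + j)"
  unfolding poly_forms_iff
proof (intro allI impI conjI)
  fix K assume K: "wedge \<omega> \<eta> K \<noteq> 0"
  show "card K = i + j"
    using K deg_form_wedge[OF assms[THEN poly_forms_deg]] by (simp add: deg_form_def)
  obtain I where "I \<subseteq> K" "\<omega> I \<noteq> 0" "\<eta> (K - I) \<noteq> 0"
    using K unfolding wedge_eq by (metis (no_types, lifting) PowD mult_zero_left mult_zero_right sum.neutral)
  then have "I \<subseteq> {1..p}" "K - I \<subseteq> {1..p}" using assms by (simp_all add: poly_forms_iff)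
  then show "K \<subseteq> {1..p}" by blast
  show "in_vars {1..p} (wedge \<omega> \<eta> K)"
    unfolding wedge_eq
    by (intro in_vars_sum in_vars_mult in_vars_neg_one_power
        poly_forms_in_vars[OF assms(1)] poly_forms_in_vars[OF assms(2)])
qed

lemma poly_forms_form_d:
  assumes "\<omega> \<in> poly_forms p k"
  shows "form_d \<omega> \<in> poly_forms p (Suc k)"
  unfolding poly_forms_iff
proof (intro allI impI conjI)
  fix K assume K: "form_d \<omega> K \<noteq> 0"
  show "card K = Suc k"
    using K deg_form_d[OF poly_forms_deg[OF assms]] by (simp add: deg_form_def)
  obtain i where i: "i \<in> K" "mpartial i (\<omega> (K - {i})) \<noteq> 0"
    using K unfolding form_d_def by (metis (no_types, lifting) mult_zero_right sum.neutral)
  then have "\<omega> (K - {i}) \<noteq> 0" by auto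
  then have "K - {i} \<subseteq> {1..p}" using assms by (simp add: poly_forms_iff)
  moreover have "i \<in> {1..p}" using i(2) mpartial_eq_0[OF poly_forms_in_vars[OF assms]] by blast
  ultimately show "K \<subseteq> {1..p}" by blast
  show "in_vars {1..p} (form_d \<omega> K)"
    unfolding form_d_def
    by (intro in_vars_sum in_vars_mult in_vars_neg_one_power in_vars_mpartial poly_forms_in_vars[OF assms])
qed

lemma form_pullback_wedge: "form_pullback p q \<theta> (wedge \<omega> \<eta>) = wedge (form_pullback p q \<theta> \<omega>) (form_pullback p q \<theta> \<eta>)"
  unfolding form_pullback_eq_pull by (rule pull_wedge) simp

lemma form_pullback_form_d: "\<omega> \<in> poly_forms q k \<Longrightarrow> form_pullback p q \<theta> (form_d \<omega>) = form_d (form_pullback p q \<theta> \<omega>)"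
  unfolding form_pullback_eq_pull by (rule pull_form_d[OF finite_atLeastAtMost poly_forms_in_vars])

lemma A_PL_sel:
  "scal (A_PL X) = (\<lambda>q \<omega> p \<sigma>. cmul (mconst q) (\<omega> p \<sigma>))"
  "prd (A_PL X) = (\<lambda>\<omega> \<eta> p \<sigma>. wedge (\<omega> p \<sigma>) (\<eta> p \<sigma>))"
  "unt (A_PL X) = (\<lambda>p \<sigma>. if singular_simplex p X \<sigma> then form_one else 0)"
  "dif (A_PL X) = (\<lambda>\<omega> p \<sigma>. form_d (\<omega> p \<sigma>))"
  by (simp_all add: A_PL_def cmul_def)

lemma gr_A_PL_iff:
  "\<omega> \<in> gr (A_PL X) k \<longleftrightarrow>
     (\<forall>p \<sigma>. singular_simplex p X \<sigma> \<longrightarrow> \<omega> p \<sigma> \<in> poly_forms p k) \<and>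
     (\<forall>p \<sigma>. \<not> singular_simplex p X \<sigma> \<longrightarrow> \<omega> p \<sigma> = 0) \<and>
     (\<forall>p q \<theta> \<sigma>. singular_simplex q X \<sigma> \<and> mono_on {..p} \<theta> \<and> \<theta> ` {..p} \<subseteq> {..q} \<longrightarrow>
        \<omega> p (restrict (\<sigma> \<circ> affine_simplex_map p \<theta>) (standard_simplex p)) = form_pullback p q \<theta> (\<omega> q \<sigma>))"
  by (simp add: A_PL_def)

lemma vector_space_A_PL: "Vector_Spaces.vector_space (scal (A_PL X))"
  unfolding A_PL_sel
  by unfold_locales (intro ext; simp add: cmul_add cmul_def mconst_add mconst_mult algebra_simps)+

lemma affine_simplex_map_in_standard_simplex:
  assumes "x \<in> standard_simplex p" "\<theta> ` {..p} \<subseteq> {..q}"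
  shows "affine_simplex_map p \<theta> x \<in> standard_simplex q"
proof -
  have x: "\<And>i. 0 \<le> x i" "(\<Sum>i\<le>p. x i) = 1" using assms(1) by (auto simp: standard_simplex_def)
  have s: "(\<Sum>i\<le>q. affine_simplex_map p \<theta> x i) = 1"
  proof -
    have "(\<Sum>i\<le>q. affine_simplex_map p \<theta> x i) = (\<Sum>i\<in>{..q}. \<Sum>j\<in>{j\<in>{..p}. \<theta> j = i}. x j)"
      by (simp add: affine_simplex_map_def)
    also have "\<dots> = (\<Sum>j\<in>{..p}. x j)"
      by (rule sum.group) (use assms(2) in auto)
    finally show ?thesis using x(2) by simp
  qed
  have nn: "0 \<le> affine_simplex_map p \<theta> x i" for i
    unfolding affine_simplex_map_def by (intro sum_nonneg) (use x(1) in auto)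
  have z: "affine_simplex_map p \<theta> x i = 0" if "q < i" for i
  proof -
    have "{j. j \<le> p \<and> \<theta> j = i} = {}" using that assms(2) by fastforce
    then show ?thesis unfolding affine_simplex_map_def by (metis sum.empty)
  qed
  have "affine_simplex_map p \<theta> x i \<le> 1" for i
  proof (cases "i \<le> q")
    case True
    then have "affine_simplex_map p \<theta> x i \<le> (\<Sum>i\<le>q. affine_simplex_map p \<theta> x i)"
      by (intro member_le_sum) (use nn in auto)
    then show ?thesis using s by simp
  qed (use z in simp)
  then show ?thesis using nn z s by (simp add: standard_simplex_def)
qed

lemma singular_simplex_affine:
  assumes "singular_simplex q X \<sigma>" "\<theta> ` {..p} \<subseteq> {..q}"
  shows "singular_simplex p X (restrict (\<sigma> \<circ> affine_simplex_map p \<theta>) (standard_simplex p))"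
proof -
  have "continuous_map (powertop_real UNIV) euclideanreal (\<lambda>x. affine_simplex_map p \<theta> x i)" for i
    unfolding affine_simplex_map_def
    by (intro continuous_map_sum continuous_map_product_projection) auto
  then have "continuous_map (subtopology (powertop_real UNIV) (standard_simplex p))
      (subtopology (powertop_real UNIV) (standard_simplex q)) (affine_simplex_map p \<theta>)"
    using affine_simplex_map_in_standard_simplex[OF _ assms(2)]
    by (auto simp: continuous_map_in_subtopology continuous_map_componentwise_UNIV
        intro: continuous_map_from_subtopology)
  from continuous_map_compose[OF this] have "continuous_map (subtopology (powertop_real UNIV) (standard_simplex p)) X (\<sigma> \<circ> affine_simplex_map p \<theta>)"
    using assms(1) unfolding singular_simplex_def by blast
  then show ?thesis
    by (simp add: singular_simplex_def)
qed

text \<open>This provides what the unit laws require: wedge products vanish on infinite index sets,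
  and the unit is zero off the singular simplices, so elements of the algebra must vanish in both
  places.\<close>

lemma carr_A_PL_infinite:
  assumes "\<omega> \<in> carr (A_PL X)"
  shows "(infinite K \<longrightarrow> \<omega> p \<sigma> K = 0) \<and> (\<not> singular_simplex p X \<sigma> \<longrightarrow> \<omega> p \<sigma> = 0)"
proof -
  interpret vector_space "scal (A_PL X)" by (rule vector_space_A_PL)
  let ?S = "{\<omega>. (infinite K \<longrightarrow> \<omega> p \<sigma> K = 0) \<and> (\<not> singular_simplex p X \<sigma> \<longrightarrow> \<omega> p \<sigma> = 0)}"
  have "subspace ?S"
    unfolding subspace_def by (auto simp: A_PL_sel cmul_def zero_fun_def)
  moreover have "(\<Union>k. gr (A_PL X) k) \<subseteq> ?S"
  proof
    fix \<omega> assume "\<omega> \<in> (\<Union>k. gr (A_PL X) k)"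
    then obtain k where k: "\<omega> \<in> gr (A_PL X) k" by blast
    show "\<omega> \<in> ?S"
    proof (cases "singular_simplex p X \<sigma>")
      case True
      then have "\<omega> p \<sigma> \<in> poly_forms p k" using k by (simp add: gr_A_PL_iff)
      then show ?thesis using deg_form_infinite[OF poly_forms_deg] True by simp
    next
      case False
      then have "\<omega> p \<sigma> = 0" using k by (simp add: gr_A_PL_iff)
      then show ?thesis by simp
    qed
  qed
  ultimately have "span (\<Union>k. gr (A_PL X) k) \<subseteq> ?S" by (intro span_minimal)
  then show ?thesis using assms unfolding carr_def by blast
qed

lemma dga_A_PL: "dga (A_PL X)"
proof (rule dga.intro)
  show "Vector_Spaces.vector_space (scal (A_PL X))" by (rule vector_space_A_PL)
  interpret vector_space "scal (A_PL X)" by (rule vector_space_A_PL)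
  have pb: "form_pullback p q \<theta> 0 = 0" for p q \<theta>
    by (simp only: form_pullback_eq_pull pull_0)
  show "subspace (gr (A_PL X) k)" for k
  proof (rule subspaceI)
    show "0 \<in> gr (A_PL X) k"
      by (simp add: gr_A_PL_iff poly_forms_0 pb)
    show "x + y \<in> gr (A_PL X) k" if "x \<in> gr (A_PL X) k" "y \<in> gr (A_PL X) k" for x y
      using that by (auto simp: gr_A_PL_iff poly_forms_add form_pullback_eq_pull pull_add)
    show "scal (A_PL X) c x \<in> gr (A_PL X) k" if "x \<in> gr (A_PL X) k" for c x
      using that by (auto simp: gr_A_PL_iff A_PL_sel poly_forms_cmul form_pullback_eq_pull pull_cmul_mconst)
  qed
  show "a k = 0" if K: "finite K" "\<forall>k\<in>K. a k \<in> gr (A_PL X) k" "(\<Sum>k\<in>K. a k) = 0" "k \<in> K" for K k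
    and a :: "nat \<Rightarrow> nat \<Rightarrow> ((nat \<Rightarrow> real) \<Rightarrow> 'a) \<Rightarrow> poly_form"
  proof (intro ext)
    fix p \<sigma> I
    \<comment> \<open>The degree can be read off the index set: at \<open>I\<close> only the summand
      of degree \<open>card I\<close> can be nonzero, hence no cancellation between degrees is
      possible.\<close>
    have z: "a j p \<sigma> I = 0" if "j \<in> K" "j \<noteq> card I" for j
    proof (cases "singular_simplex p X \<sigma>")
      case True
      then have "a j p \<sigma> \<in> poly_forms p j" using K(2) that by (simp add: gr_A_PL_iff)
      then show ?thesis using that unfolding poly_forms_iff by blast
    next
      case False
      then have "a j p \<sigma> = 0" using K(2) that by (simp add: gr_A_PL_iff)
      then show ?thesis by simp
    qed
    show "a k p \<sigma> I = 0 p \<sigma> I"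
    proof (cases "k = card I")
      case True
      have "(\<Sum>j\<in>K. a j p \<sigma> I) = 0"
        using arg_cong[OF K(3), of "\<lambda>f. f p \<sigma> I"] by (simp add: sum_fun_apply)
      moreover have "(\<Sum>j\<in>K. a j p \<sigma> I) = a k p \<sigma> I"
        using K(1,4) z True by (subst sum.remove[OF K(1,4)]) (simp add: sum.neutral)
      ultimately show ?thesis by simp
    qed (use z K in simp)
  qed
  have inf: "infinite K \<Longrightarrow> \<omega> p \<sigma> K = 0" "\<not> singular_simplex p X \<sigma> \<Longrightarrow> \<omega> p \<sigma> = 0"
    if "\<omega> \<in> carr (A_PL X)" for \<omega> K p \<sigma>
    using carr_A_PL_infinite[OF that] by blast+
  have deg: "deg_form k (\<omega> p \<sigma>)" if "\<omega> \<in> gr (A_PL X) k" for \<omega> k p \<sigma>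
  proof (cases "singular_simplex p X \<sigma>")
    case True
    then have "\<omega> p \<sigma> \<in> poly_forms p k" using that by (simp add: gr_A_PL_iff)
    then show ?thesis by (rule poly_forms_deg)
  next
    case False
    then have "\<omega> p \<sigma> = 0" using that by (simp add: gr_A_PL_iff)
    then show ?thesis by (simp add: deg_form_def)
  qed
  show "unt (A_PL X) \<in> gr (A_PL X) 0"
    using singular_simplex_affine[of _ X]
    by (auto simp: gr_A_PL_iff A_PL_sel poly_forms_one form_pullback_eq_pull pull_one)
  show "prd (A_PL X) x y \<in> gr (A_PL X) (i + j)" if "x \<in> gr (A_PL X) i" "y \<in> gr (A_PL X) j" for x y i j
    using that by (auto simp: gr_A_PL_iff A_PL_sel poly_forms_wedge form_pullback_wedge)
  show "prd (A_PL X) (prd (A_PL X) x y) z = prd (A_PL X) x (prd (A_PL X) y z)" for x y z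
    by (simp only: A_PL_sel wedge_assoc)
  show "prd (A_PL X) (unt (A_PL X)) x = x" if "x \<in> carr (A_PL X)" for x
  proof (intro ext)
    fix p \<sigma> K
    show "prd (A_PL X) (unt (A_PL X)) x p \<sigma> K = x p \<sigma> K"
      using inf[OF that] by (cases "singular_simplex p X \<sigma>") (simp_all add: A_PL_sel wedge_one_left)
  qed
  show "prd (A_PL X) x (unt (A_PL X)) = x" if "x \<in> carr (A_PL X)" for x
  proof (intro ext)
    fix p \<sigma> K
    show "prd (A_PL X) x (unt (A_PL X)) p \<sigma> K = x p \<sigma> K"
      using inf[OF that] by (cases "singular_simplex p X \<sigma>") (simp_all add: A_PL_sel wedge_one_right)
  qed
  show "prd (A_PL X) (x + y) z = prd (A_PL X) x z + prd (A_PL X) y z"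
    "prd (A_PL X) x (y + z) = prd (A_PL X) x y + prd (A_PL X) x z" for x y z
    by (intro ext, simp add: A_PL_sel wedge_add_left wedge_add_right)+
  show "prd (A_PL X) (scal (A_PL X) q x) y = scal (A_PL X) q (prd (A_PL X) x y)"
    "prd (A_PL X) x (scal (A_PL X) q y) = scal (A_PL X) q (prd (A_PL X) x y)" for x y q
    by (simp_all only: A_PL_sel wedge_cmul_left wedge_cmul_right)
  have sgn: "mconst ((-1) ^ k) = (-1) ^ k" for k
    by (cases "even k") (simp_all add: mconst_minus)
  show "prd (A_PL X) x y = scal (A_PL X) ((-1) ^ (i * j)) (prd (A_PL X) y x)"
    if "x \<in> gr (A_PL X) i" "y \<in> gr (A_PL X) j" for x y i j
    using wedge_commute[OF deg[OF that(1)] deg[OF that(2)]] by (simp add: A_PL_sel sgn)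
  show "dif (A_PL X) x \<in> gr (A_PL X) (Suc k)" if "x \<in> gr (A_PL X) k" for x k
    using that by (auto simp: gr_A_PL_iff A_PL_sel poly_forms_form_d intro!: form_pullback_form_d[symmetric, of _ _ k])
  show "dif (A_PL X) (x + y) = dif (A_PL X) x + dif (A_PL X) y" for x y
    by (intro ext, simp add: A_PL_sel form_d_add)
  show "dif (A_PL X) (scal (A_PL X) q x) = scal (A_PL X) q (dif (A_PL X) x)" for x q
    by (simp only: A_PL_sel form_d_cmul_mconst)
  show "dif (A_PL X) (dif (A_PL X) x) = 0" for x
    by (intro ext, simp add: A_PL_sel form_d_form_d)
  show "dif (A_PL X) (prd (A_PL X) x y) = prd (A_PL X) (dif (A_PL X) x) y
      + scal (A_PL X) ((-1) ^ i) (prd (A_PL X) x (dif (A_PL X) y))"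
    if "x \<in> gr (A_PL X) i" "y \<in> gr (A_PL X) j" for x y i j
    by (intro ext, simp add: A_PL_sel form_d_wedge[OF deg[OF that(1)]] sgn)
qed

section \<open>Integration of forms, Stokes' theorem and the pairing with chains\<close>

subsection \<open>Integration of polynomials over the simplex\<close>

definition Jint :: "nat \<Rightarrow> mpoly \<Rightarrow> rat" where
  "Jint p P = (\<Sum>m\<in>Poly_Mapping.keys P. Poly_Mapping.lookup P m *
     (\<Prod>i=1..p. fact (Poly_Mapping.lookup m i)) / fact (p + (\<Sum>i=1..p. Poly_Mapping.lookup m i)))"

lemma form_integral_eq: "form_integral p \<omega> = Jint p (\<omega> {1..p})"
  by (simp add: form_integral_def Jint_def)

lemma Jint_0 [simp]: "Jint p 0 = 0"
  by (simp add: Jint_def)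

lemma Jint_add: "Jint p (P + Q) = Jint p P + Jint p Q"
  unfolding Jint_def by (rule setsum_keys_plus_distrib) (simp_all add: algebra_simps add_divide_distrib)

lemma Jint_single: "Jint p (Poly_Mapping.single m c) = c *
    (\<Prod>i=1..p. fact (Poly_Mapping.lookup m i)) / fact (p + (\<Sum>i=1..p. Poly_Mapping.lookup m i))"
  by (cases "c = 0") (simp_all add: Jint_def)

lemma Jint_mconst_mult: "Jint p (mconst c * P) = c * Jint p P"
proof (induction P rule: poly_add_induct)
  case (1 m b)
  have "mconst c * Poly_Mapping.single m b = Poly_Mapping.single m (c * b)"
    by (simp add: mconst_def mult_single)
  then show ?case by (simp add: Jint_single)
qed (simp_all add: Jint_add algebra_simps)

lemma Jint_minus: "Jint p (- P) = - Jint p P"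
  using Jint_mconst_mult[of p "-1" P] by (simp add: mconst_minus)

lemma Jint_diff: "Jint p (P - Q) = Jint p P - Jint p Q"
  using Jint_add[of p P "- Q"] by (simp add: Jint_minus)

lemma Jint_sum: "Jint p (\<Sum>i\<in>I. f i) = (\<Sum>i\<in>I. Jint p (f i))"
  by (induction I rule: infinite_finite_induct) (simp_all add: Jint_add)

lemma Jint_neg_one_power_mult: "Jint p ((-1) ^ k * P) = (-1) ^ k * Jint p P"
  by (cases "even k") (simp_all add: Jint_minus)

text \<open>Exponents are given by a plain function because it is easier to update and to compose
  with \<open>coface\<close> than a finitely supported map.\<close>

definition mon :: "nat set \<Rightarrow> (nat \<Rightarrow> nat) \<Rightarrow> mpoly" where
  "mon I e = (\<Prod>k\<in>I. mvar k ^ e k)"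

lemma mvar_power: "mvar k ^ v = Poly_Mapping.single (Poly_Mapping.single k v) 1"
proof (induction v)
  case (Suc v)
  then show ?case by (simp add: mvar_def mult_single single_add[symmetric])
qed simp

lemma mon_eq_single: "finite I \<Longrightarrow> mon I e = Poly_Mapping.single (\<Sum>k\<in>I. Poly_Mapping.single k (e k)) 1"
proof (induction I rule: finite_induct)
  case (insert k I)
  then show ?case by (simp add: mon_def mvar_power mult_single)
qed (simp add: mon_def)

lemma single_eq_mon:
  assumes "finite I" "Poly_Mapping.keys m \<subseteq> I"
  shows "Poly_Mapping.single m c = mconst c * mon I (Poly_Mapping.lookup m)"
proof -
  have "m = (\<Sum>k\<in>I. Poly_Mapping.single k (Poly_Mapping.lookup m k))"
    by (subst (1) sum_singles, rule sum.mono_neutral_left) (use assms in \<open>auto simp: in_keys_iff\<close>)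
  then have "mon I (Poly_Mapping.lookup m) = Poly_Mapping.single m 1"
    using mon_eq_single[OF assms(1), of "Poly_Mapping.lookup m"] by simp
  then show ?thesis by (simp add: mconst_def mult_single)
qed

lemma Jint_mon: "Jint N (mon {1..N} e) = (\<Prod>i=1..N. fact (e i)) / fact (N + (\<Sum>i=1..N. e i))"
proof -
  have "Poly_Mapping.lookup (\<Sum>k\<in>{1..N}. Poly_Mapping.single k (e k)) i = e i" if "i \<in> {1..N}" for i
    using that by (simp add: lookup_sum lookup_single when_def)
  then have p: "(\<Prod>i=1..N. fact (Poly_Mapping.lookup (\<Sum>k\<in>{1..N}. Poly_Mapping.single k (e k)) i) :: rat) = (\<Prod>i=1..N. fact (e i))"
    and s: "(\<Sum>i=1..N. Poly_Mapping.lookup (\<Sum>k\<in>{1..N}. Poly_Mapping.single k (e k)) i) = (\<Sum>i=1..N. e i)"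
    by (intro prod.cong sum.cong; simp)+
  show ?thesis unfolding mon_eq_single[OF finite_atLeastAtMost] Jint_single p s by simp
qed

lemma mvar_mult_mon:
  assumes "finite I" "j \<in> I"
  shows "mvar j * mon I e = mon I (e(j := Suc (e j)))"
proof -
  have "mon I e = mvar j ^ e j * (\<Prod>k\<in>I - {j}. mvar k ^ e k)"
    unfolding mon_def using assms by (simp add: prod.remove)
  moreover have "mon I (e(j := Suc (e j))) = mvar j ^ Suc (e j) * (\<Prod>k\<in>I - {j}. mvar k ^ e k)"
    unfolding mon_def using assms by (subst prod.remove[of I j]) (auto intro!: arg_cong2[of _ _ _ _ "(*)"] prod.cong)
  ultimately show ?thesis by simp
qed

text \<open>The symmetric Dirichlet formula, with the barycentric coordinate \<open>t_0\<close>
  raised to the power \<open>k\<close>. Expanding one factor \<open>1 - \<Sum> t_j\<close> raises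
  one exponent at a time. With \<open>E\<close> the sum of the exponents, the numbers
  \<open>e j + 1\<close> add up to \<open>E + N\<close>, and the difference of
  \<open>N + k + 1 + E\<close> and \<open>E + N\<close> is the factor \<open>k + 1\<close> of the
  new factorial.\<close>

lemma Jint_Dirichlet:
  "Jint N ((1 - (\<Sum>j=1..N. mvar j)) ^ k * mon {1..N} e)
     = fact k * (\<Prod>i=1..N. fact (e i)) / fact (N + k + (\<Sum>i=1..N. e i))"
proof (induction k arbitrary: e)
  case 0
  then show ?case using Jint_mon[of N e] by simp
next
  case (Suc k)
  let ?S = "\<Sum>j=1..N. mvar j" and ?E = "\<Sum>i=1..N. e i" and ?P = "\<Prod>i=1..N. fact (e i) :: rat"
  have F: "fact (N + Suc k + ?E) = of_nat (N + Suc k + ?E) * (fact (N + k + ?E) :: rat)"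
    using fact_Suc[of "N + k + ?E", where 'a = rat] by simp
  have term_j: "Jint N ((1 - ?S) ^ k * (mvar j * mon {1..N} e))
      = fact k * (of_nat (Suc (e j)) * ?P) / fact (N + Suc k + ?E)" if j: "j \<in> {1..N}" for j
  proof -
    let ?e = "e(j := Suc (e j))"
    have "(\<Sum>i=1..N. ?e i) = Suc ?E"
    proof -
      have "(\<Sum>i=1..N. ?e i) = ?e j + sum ?e ({1..N} - {j})" "?E = e j + sum e ({1..N} - {j})"
        using j by (intro sum.remove; simp)+
      moreover have "sum ?e ({1..N} - {j}) = sum e ({1..N} - {j})" by (intro sum.cong) auto
      ultimately show ?thesis by simp
    qed
    moreover have "(\<Prod>i=1..N. fact (?e i)) = of_nat (Suc (e j)) * ?P"
    proof -
      have "(\<Prod>i=1..N. fact (?e i) :: rat) = fact (?e j) * (\<Prod>i\<in>{1..N} - {j}. fact (?e i))"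
        "?P = fact (e j) * (\<Prod>i\<in>{1..N} - {j}. fact (e i))"
        using j by (intro prod.remove; simp)+
      moreover have "(\<Prod>i\<in>{1..N} - {j}. fact (?e i) :: rat) = (\<Prod>i\<in>{1..N} - {j}. fact (e i))"
        by (intro prod.cong) auto
      ultimately show ?thesis by simp
    qed
    ultimately show ?thesis
      unfolding mvar_mult_mon[OF finite_atLeastAtMost j] Suc.IH by simp
  qed
  have gen: "(\<Sum>j\<in>I. c * (x j * p) / F) = (\<Sum>j\<in>I. x j) * (c * p / F)"
    for I :: "nat set" and x and c p F :: rat
    unfolding sum_distrib_right by (intro sum.cong refl) (simp add: mult.commute mult.left_commute)
  have d: "of_nat (N + Suc k + ?E) - of_nat (?E + N) = (of_nat (Suc k) :: rat)" by simp
  have "(1 - ?S) ^ Suc k * mon {1..N} e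
      = (1 - ?S) ^ k * mon {1..N} e - (\<Sum>j=1..N. (1 - ?S) ^ k * (mvar j * mon {1..N} e))"
    by (simp add: algebra_simps sum_distrib_left sum_distrib_right)
  then have "Jint N ((1 - ?S) ^ Suc k * mon {1..N} e)
      = fact k * ?P / fact (N + k + ?E) - (\<Sum>j=1..N. fact k * (of_nat (Suc (e j)) * ?P) / fact (N + Suc k + ?E))"
    using sum.cong[OF refl term_j, of "{1..N}"] by (simp only: Jint_diff Jint_sum Suc.IH)
  also have "(\<Sum>j=1..N. fact k * (of_nat (Suc (e j)) * ?P) / fact (N + Suc k + ?E))
      = (\<Sum>j=1..N. of_nat (Suc (e j))) * (fact k * ?P / fact (N + Suc k + ?E))"
    by (rule gen)
  also have "(\<Sum>j=1..N. of_nat (Suc (e j))) = (of_nat (?E + N) :: rat)"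
    by (simp add: sum.distrib)
  also have "fact k * ?P / fact (N + k + ?E) = of_nat (N + Suc k + ?E) * (fact k * ?P / fact (N + Suc k + ?E))"
  proof -
    have "of_nat (N + Suc k + ?E) \<noteq> (0::rat)" by (simp only: of_nat_eq_0_iff)
    then have "a / b = c * (a / (c * b))" if "c = of_nat (N + Suc k + ?E)" for a b c :: rat
      using that by simp
    then show ?thesis unfolding F by blast
  qed
  also have "of_nat (N + Suc k + ?E) * (fact k * ?P / fact (N + Suc k + ?E))
       - of_nat (?E + N) * (fact k * ?P / fact (N + Suc k + ?E))
      = fact (Suc k) * ?P / fact (N + Suc k + ?E)"
    unfolding left_diff_distrib[symmetric] d fact_Suc by (simp only: mult.assoc times_divide_eq_right)
  finally show ?case .
qed

subsection \<open>Faces of the simplex\<close>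

text \<open>The increasing map that skips the value \<open>j\<close>.\<close>

definition coface :: "nat \<Rightarrow> nat \<Rightarrow> nat" where
  "coface j l = (if l < j then l else Suc l)"

text \<open>The restriction of coordinates to the face opposite vertex \<open>j\<close>, in the form
  in which \<open>form_pullback\<close> uses it.\<close>

definition coface_subst :: "nat \<Rightarrow> nat \<Rightarrow> nat \<Rightarrow> mpoly" where
  "coface_subst n j = (\<lambda>i. \<Sum>l | l \<le> n \<and> coface j l = i. barycentric n l)"

lemma coface_inj: "coface j l = coface j l' \<longleftrightarrow> l = l'"
  by (auto simp: coface_def split: if_splits)

lemma coface_neq: "coface j l \<noteq> j"
  by (auto simp: coface_def)

lemma coface_less: "l < l' \<Longrightarrow> coface j l < coface j l'"
  by (auto simp: coface_def)

lemma coface_subst_coface: "l \<le> n \<Longrightarrow> coface_subst n j (coface j l) = barycentric n l"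
proof -
  assume "l \<le> n"
  then have "{l'. l' \<le> n \<and> coface j l' = coface j l} = {l}" by (auto simp: coface_inj)
  then show ?thesis by (simp add: coface_subst_def)
qed

lemma coface_subst_omitted: "coface_subst n j j = 0"
  by (simp add: coface_subst_def coface_neq)

lemma barycentric_pos: "0 < l \<Longrightarrow> barycentric n l = mvar l"
  by (simp add: barycentric_def)

lemma coface_image:
  assumes "1 \<le> j" "j \<le> Suc n"
  shows "{1..Suc n} - {j} = coface j ` {1..n}"
proof (intro equalityI subsetI)
  fix i assume i: "i \<in> {1..Suc n} - {j}"
  show "i \<in> coface j ` {1..n}"
  proof (cases "i < j")
    case True
    then have "i = coface j i" "i \<in> {1..n}" using i assms by (auto simp: coface_def)
    then show ?thesis by blast
  next
    case False
    then have "i = coface j (i - 1)" "i - 1 \<in> {1..n}" using i assms by (auto simp: coface_def)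
    then show ?thesis by blast
  qed
qed (use assms in \<open>auto simp: coface_def split: if_splits\<close>)

lemma coface_split:
  assumes "1 \<le> j" "j \<le> Suc n"
  shows "(\<Prod>i=1..Suc n. f i) = f j * (\<Prod>l=1..n. f (coface j l) :: 'a::comm_monoid_mult)"
    and "(\<Sum>i=1..Suc n. g i) = g j + (\<Sum>l=1..n. g (coface j l) :: 'b::comm_monoid_add)"
proof -
  have inj: "inj_on (coface j) {1..n}" by (auto simp: inj_on_def coface_inj)
  have "(\<Prod>i=1..Suc n. f i) = f j * prod f ({1..Suc n} - {j})"
    using assms by (intro prod.remove) auto
  then show "(\<Prod>i=1..Suc n. f i) = f j * (\<Prod>l=1..n. f (coface j l))"
    unfolding coface_image[OF assms] prod.reindex[OF inj] by simp
  have "(\<Sum>i=1..Suc n. g i) = g j + sum g ({1..Suc n} - {j})"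
    using assms by (intro sum.remove) auto
  then show "(\<Sum>i=1..Suc n. g i) = g j + (\<Sum>l=1..n. g (coface j l))"
    unfolding coface_image[OF assms] sum.reindex[OF inj] by simp
qed

lemma msubst_power: "msubst s (p ^ k) = msubst s p ^ k"
  by (induction k) (simp_all add: msubst_mult)

lemma msubst_prod: "msubst s (\<Prod>i\<in>I. f i) = (\<Prod>i\<in>I. msubst s (f i))"
  by (induction I rule: infinite_finite_induct) (simp_all add: msubst_mult)

lemma msubst_coface_mon:
  assumes "1 \<le> j" "j \<le> Suc n"
  shows "msubst (coface_subst n j) (mon {1..Suc n} e) = 0 ^ e j * mon {1..n} (\<lambda>l. e (coface j l))"
proof -
  have "msubst (coface_subst n j) (mon {1..Suc n} e)
      = coface_subst n j j ^ e j * (\<Prod>l=1..n. coface_subst n j (coface j l) ^ e (coface j l))"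
    unfolding mon_def msubst_prod msubst_power msubst_mvar by (rule coface_split(1)[OF assms])
  also have "(\<Prod>l=1..n. coface_subst n j (coface j l) ^ e (coface j l)) = mon {1..n} (\<lambda>l. e (coface j l))"
    unfolding mon_def by (intro prod.cong refl) (simp add: coface_subst_coface barycentric_pos)
  finally show ?thesis by (simp add: coface_subst_omitted)
qed

lemma coface_0_1: "l \<in> {1..n} \<Longrightarrow> coface 0 l = coface 1 l"
  by (auto simp: coface_def)

text \<open>On face 0 the coordinate \<open>t_1\<close> becomes the coordinate \<open>t_0\<close> of
  the face, which is not a free variable, while the others only change their index. This is why the
  Dirichlet formula with a power of \<open>t_0\<close> is needed.\<close>

lemma msubst_coface_0_mon:
  "msubst (coface_subst n 0) (mon {1..Suc n} e)
     = (1 - (\<Sum>j=1..n. mvar j)) ^ e 1 * mon {1..n} (\<lambda>l. e (coface 1 l))"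
proof -
  have "msubst (coface_subst n 0) (mon {1..Suc n} e)
      = coface_subst n 0 1 ^ e 1 * (\<Prod>l=1..n. coface_subst n 0 (coface 1 l) ^ e (coface 1 l))"
    unfolding mon_def msubst_prod msubst_power msubst_mvar by (rule coface_split(1)) auto
  also have "(\<Prod>l=1..n. coface_subst n 0 (coface 1 l) ^ e (coface 1 l)) = mon {1..n} (\<lambda>l. e (coface 1 l))"
    unfolding mon_def
  proof (intro prod.cong refl)
    fix l assume l: "l \<in> {1..n}"
    have "coface_subst n 0 (coface 1 l) = mvar l"
      using coface_subst_coface[of l n 0] l by (simp add: coface_0_1[OF l] barycentric_pos)
    then show "coface_subst n 0 (coface 1 l) ^ e (coface 1 l) = mvar l ^ e (coface 1 l)" by simp
  qed
  also have "coface_subst n 0 1 = 1 - (\<Sum>j=1..n. mvar j)"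
    using coface_subst_coface[of 0 n 0] by (simp add: coface_def barycentric_def)
  finally show ?thesis .
qed

lemma mpartial_mon:
  assumes "finite I" "i \<in> I"
  shows "mpartial i (mon I e) = mconst (of_nat (e i)) * mon I (e(i := e i - 1))"
proof -
  let ?R = "\<Prod>k\<in>I - {i}. mvar k ^ e k"
  have pw: "mpartial i (mvar i ^ v) = mconst (of_nat v) * mvar i ^ (v - 1)" for v
    unfolding mconst_of_nat
  proof (induction v)
    case (Suc v)
    then show ?case
      by (cases v) (simp_all add: mpartial_mult mpartial_mvar algebra_simps)
  qed simp
  have "in_vars (I - {i}) ?R"
  proof -
    have "in_vars (I - {i}) (\<Prod>k\<in>J. mvar k ^ e k)" if "J \<subseteq> I - {i}" for J
      using that by (induction J rule: infinite_finite_induct) (auto intro: in_vars_mult in_vars_power in_vars_mvar)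
    then show ?thesis by blast
  qed
  then have R0: "mpartial i ?R = 0" by (rule mpartial_eq_0) simp
  have "mon I e = mvar i ^ e i * ?R"
    unfolding mon_def using assms by (simp add: prod.remove)
  moreover have "mon I (e(i := e i - 1)) = mvar i ^ (e i - 1) * ?R"
    unfolding mon_def using assms by (subst prod.remove[of I i]) (auto intro!: arg_cong2[of _ _ _ _ "(*)"] prod.cong)
  ultimately show ?thesis by (simp add: mpartial_mult pw R0)
qed

text \<open>The fundamental theorem of calculus in the direction of \<open>t_i\<close>: a line in
  this direction enters the simplex where \<open>t_i = 0\<close> and leaves it where
  \<open>t_0 = 0\<close>. It is verified on monomials with the Dirichlet formula.\<close>

lemma Jint_mpartial:
  assumes P: "in_vars {1..Suc n} P" and i: "i \<in> {1..Suc n}"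
  shows "Jint (Suc n) (mpartial i P)
     = Jint n (msubst (coface_subst n 0) P) - Jint n (msubst (coface_subst n i) P)"
proof (induction P rule: poly_add_induct)
  case (1 m c)
  let ?e = "Poly_Mapping.lookup m" and ?N = "{1..Suc n}"
  have i': "1 \<le> i" "i \<le> Suc n" using i by auto
  have m: "Poly_Mapping.single m c = mconst c * mon ?N ?e"
    using P 1 by (intro single_eq_mon) (auto simp: in_vars_def)
  \<comment> \<open>\<open>A\<close> is the integral of the monomial over face 0. If the exponent of
    \<open>t_i\<close> is zero, face \<open>i\<close> contributes \<open>A\<close> too and the
    derivative vanishes; otherwise face \<open>i\<close> contributes nothing and the derivative
    integrates to \<open>A\<close>.\<close>
  define A where "A = (\<Prod>k=1..Suc n. fact (?e k) :: rat) / fact (n + (\<Sum>k=1..Suc n. ?e k))"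
  have zero: "Jint n (msubst (coface_subst n 0) (mon ?N ?e)) = A"
    unfolding msubst_coface_0_mon Jint_Dirichlet A_def
    using coface_split(1)[of 1 n "\<lambda>k. fact (?e k) :: rat"] coface_split(2)[of 1 n ?e]
    by (simp add: algebra_simps)
  have ith: "Jint n (msubst (coface_subst n i) (mon ?N ?e)) = (if ?e i = 0 then A else 0)"
    unfolding msubst_coface_mon[OF i'] A_def
    using coface_split(1)[OF i', of "\<lambda>k. fact (?e k) :: rat"] coface_split(2)[OF i', of ?e]
    by (auto simp: Jint_mon Jint_mon[unfolded One_nat_def] power_0_left)
  have part: "Jint (Suc n) (mpartial i (mon ?N ?e)) = (if ?e i = 0 then 0 else A)"
  proof (cases "?e i")
    case 0
    then show ?thesis using i by (simp add: mpartial_mon)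
  next
    case (Suc v)
    let ?e' = "?e(i := v)"
    have c1: "(\<Prod>k=1..Suc n. fact (?e k) :: rat) = fact (Suc v) * (\<Prod>l=1..n. fact (?e (coface i l)))"
      using coface_split(1)[OF i', of "\<lambda>k. fact (?e k) :: rat"] Suc by simp
    have c2: "(\<Prod>k=1..Suc n. fact (?e' k) :: rat) = fact v * (\<Prod>l=1..n. fact (?e (coface i l)))"
      using coface_split(1)[OF i', of "\<lambda>k. fact (?e' k) :: rat"] by (simp add: coface_neq)
    have s1: "(\<Sum>k=1..Suc n. ?e k) = Suc v + (\<Sum>l=1..n. ?e (coface i l))"
      using coface_split(2)[OF i', of ?e] Suc by simp
    have s2: "(\<Sum>k=1..Suc n. ?e' k) = v + (\<Sum>l=1..n. ?e (coface i l))"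
      using coface_split(2)[OF i', of ?e'] by (simp add: coface_neq)
    have "Jint (Suc n) (mpartial i (mon ?N ?e)) = of_nat (Suc v) * Jint (Suc n) (mon ?N ?e')"
      unfolding mpartial_mon[OF finite_atLeastAtMost i] Jint_mconst_mult Suc by simp
    also have "\<dots> = A"
      unfolding Jint_mon A_def c1 c2 s1 s2 by simp
    finally show ?thesis using Suc by simp
  qed
  show ?case
    unfolding m mpartial_mconst_mult msubst_mult msubst_mconst Jint_mconst_mult zero ith part
    by simp
qed (simp_all add: mpartial_add msubst_add Jint_add)

lemma dforms_cong: "finite I \<Longrightarrow> (\<And>i. i \<in> I \<Longrightarrow> s i = t i) \<Longrightarrow> dforms s I = dforms t I"
proof (induction I rule: finite_linorder_min_induct)
  case (insert b A)
  then show ?case by (simp add: dforms_insert[OF insert(1,2)])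
qed simp

lemma dforms_coface: "finite I \<Longrightarrow> dforms s (coface j ` I) = dforms (\<lambda>l. s (coface j l)) I"
proof (induction I rule: finite_linorder_min_induct)
  case (insert b A)
  have "\<forall>a\<in>coface j ` A. coface j b < a" using insert(2) coface_less by auto
  then show ?case
    using insert(1,3) by (simp add: dforms_insert[OF insert(1,2)] dforms_insert)
qed simp

lemma form_d_mvar: "form_d (form_of_poly (mvar i)) = dvar i"
  using form_d_form_of_poly[of "{i}" "mvar i"] by (simp add: in_vars_mvar mpartial_mvar)

lemma dforms_mvar: "finite I \<Longrightarrow> dforms mvar I = (\<lambda>K. if K = I then 1 else 0)"
proof (induction I rule: finite_linorder_min_induct)
  case empty
  then show ?case by (simp add: form_one_def)
next
  case (insert b A)
  have bA: "b \<notin> A" using insert(2) by auto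
  show ?case
  proof
    fix K
    have e: "{j \<in> insert b A. j < b} = {}" using insert(2) by auto
    have "wedge (dvar b) (dforms mvar A) K = (if K = insert b A then 1 else 0)"
    proof (cases "K = insert b A")
      case True
      show ?thesis unfolding True wedge_dvar e insert.IH using insert(1) bA by simp
    next
      case False
      then have "b \<notin> K \<or> K - {b} \<noteq> A" by auto
      then show ?thesis unfolding wedge_dvar insert.IH using False by auto
    qed
    then show "dforms mvar (insert b A) K = (if K = insert b A then 1 else 0)"
      by (simp add: dforms_insert[OF insert(1,2)] form_d_mvar)
  qed
qed

text \<open>Moving the vanishing factor to the front costs the sign \<open>?c\<close>, whose square
  is one.\<close>

lemma dforms_zero_factor:
  assumes "finite I" "i \<in> I" "s i = 0"
  shows "dforms s I = 0"
proof -
  let ?c = "(-1) ^ card {j \<in> I - {i}. j < i} :: mpoly"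
  have "form_of_poly 0 = 0" by (rule ext) (simp add: form_of_poly_def)
  then have "wedge (form_d (form_of_poly (s i))) (dforms s (I - {i})) = 0"
    using assms(3) by (simp only: form_d_0 wedge_0)
  then have "cmul ?c (dforms s I) = 0"
    using assms wedge_dform_dforms[of "I - {i}" s i] by (simp add: insert_absorb)
  then have "cmul (?c * ?c) (dforms s I) = 0" by (metis cmul_simps(3,4))
  moreover have "?c * ?c = 1" by (simp add: power_mult_distrib[symmetric])
  ultimately show ?thesis by (metis cmul_simps(2))
qed

text \<open>On face \<open>j\<close> the coordinate \<open>t_j\<close> is zero, so every product
  containing its differential vanishes; only the product that omits it survives, and it becomes the
  standard volume form.\<close>

lemma dforms_face_pos:
  assumes "1 \<le> j" "j \<le> Suc n" "i \<in> {1..Suc n}"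
  shows "dforms (coface_subst n j) ({1..Suc n} - {i}) {1..n} = (if i = j then 1 else 0)"
proof (cases "i = j")
  case True
  have "dforms (coface_subst n j) ({1..Suc n} - {j}) = dforms (\<lambda>l. coface_subst n j (coface j l)) {1..n}"
    unfolding coface_image[OF assms(1,2)] by (rule dforms_coface) simp
  also have "\<dots> = dforms mvar {1..n}"
    by (rule dforms_cong) (auto simp: coface_subst_coface barycentric_pos)
  finally show ?thesis using True by (simp add: dforms_mvar)
next
  case False
  then have "dforms (coface_subst n j) ({1..Suc n} - {i}) = 0"
    using assms by (intro dforms_zero_factor[of _ j]) (auto simp: coface_subst_omitted)
  then show ?thesis using False by (simp only: if_False zero_fun_apply)
qed

text \<open>On face 0 the differential of \<open>t_1\<close> becomes minus the sum of all
  \<open>dt_j\<close>. Only the summand with \<open>j = i - 1\<close> complements the remaining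
  factors, and sorting it in contributes \<open>(-1) ^ (i - 2)\<close>. For \<open>i = 1\<close>
  that factor is omitted from the start.\<close>

lemma dforms_face_0:
  assumes i: "i \<in> {1..Suc n}"
  shows "dforms (coface_subst n 0) ({1..Suc n} - {i}) {1..n} = (-1) ^ (i - 1)"
proof (cases "i = 1")
  case True
  have "coface 1 ` {1..n} = coface 0 ` {1..n}" by (intro image_cong refl) (auto simp: coface_def)
  then have "dforms (coface_subst n 0) ({1..Suc n} - {1}) = dforms (\<lambda>l. coface_subst n 0 (coface 0 l)) {1..n}"
    using coface_image[of 1 n] dforms_coface[of "{1..n}" "coface_subst n 0" 0] by simp
  also have "\<dots> = dforms mvar {1..n}"
    by (rule dforms_cong) (auto simp: coface_subst_coface barycentric_pos)
  finally show ?thesis using True by (simp add: dforms_mvar)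
next
  case False
  \<comment> \<open>The indices of the remaining factors after the shift by one that face 0 causes;
    the missing index is \<open>i - 1\<close>.\<close>
  define R where "R = {1..n} - {i - 1}"
  have im: "{1..Suc n} - {i} = insert 1 (coface 0 ` R)"
  proof (intro equalityI subsetI)
    fix x assume x: "x \<in> {1..Suc n} - {i}"
    show "x \<in> insert 1 (coface 0 ` R)"
    proof (cases "x = 1")
      case False
      then have "x = coface 0 (x - 1)" "x - 1 \<in> R" using x i by (auto simp: coface_def R_def)
      then show ?thesis by blast
    qed simp
  qed (use i False in \<open>auto simp: coface_def R_def\<close>)
  have less: "\<forall>a\<in>coface 0 ` R. 1 < a" by (auto simp: coface_def R_def)
  have fR: "finite R" by (simp add: R_def)
  have c1: "coface_subst n 0 1 = 1 - (\<Sum>j=1..n. mvar j)"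
    using coface_subst_coface[of 0 n 0] by (simp add: coface_def barycentric_def)
  have iv: "in_vars {1..n} (1 - (\<Sum>j=1..n. mvar j))"
    by (intro in_vars_diff in_vars_1 in_vars_sum in_vars_mvar)
  have mp: "mpartial j (1 - (\<Sum>j=1..n. mvar j)) = -1" if "j \<in> {1..n}" for j
    using that mpartial_add[of j 1 "- (\<Sum>j=1..n. mvar j)"]
    by (simp add: mpartial_minus mpartial_sum mpartial_mvar)
  have D1: "form_d (form_of_poly (coface_subst n 0 1)) = (\<Sum>j\<in>{1..n}. cmul (-1) (dvar j))"
    unfolding c1 form_d_form_of_poly[OF finite_atLeastAtMost iv]
    by (intro sum.cong refl) (simp only: mp)
  have "dforms (coface_subst n 0) (coface 0 ` R) = dforms (\<lambda>l. coface_subst n 0 (coface 0 l)) R"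
    using fR by (rule dforms_coface)
  also have "\<dots> = dforms mvar R"
    using fR by (rule dforms_cong) (auto simp: coface_subst_coface barycentric_pos R_def)
  also have "\<dots> = (\<lambda>K. if K = R then 1 else 0)"
    using fR by (rule dforms_mvar)
  finally have dR: "dforms (coface_subst n 0) (coface 0 ` R) = (\<lambda>K. if K = R then 1 else 0)" .
  have "dforms (coface_subst n 0) ({1..Suc n} - {i}) {1..n}
      = (\<Sum>j\<in>{1..n}. - wedge (dvar j) (\<lambda>K. if K = R then 1 else 0) {1..n})"
    unfolding im dforms_insert[OF finite_imageI[OF fR] less] D1 dR wedge_sum_left wedge_cmul_left sum_fun_apply
    by (simp add: cmul_def)
  also have "\<dots> = (\<Sum>j\<in>{1..n}. if j = i - 1 then - ((-1) ^ card {k \<in> {1..n}. k < j}) else 0)"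
  proof (intro sum.cong refl)
    fix j assume j: "j \<in> {1..n}"
    have "i - 1 \<in> {1..n}" using i False by auto
    then have "{1..n} - {j} = R \<longleftrightarrow> j = i - 1" using j unfolding R_def by blast
    then show "- wedge (dvar j) (\<lambda>K. if K = R then 1 else 0) {1..n}
        = (if j = i - 1 then - ((-1) ^ card {k \<in> {1..n}. k < j}) else 0)"
      using j by (simp add: wedge_dvar)
  qed
  also have "\<dots> = - ((-1) ^ card {k \<in> {1..n}. k < i - 1})"
    using i False by (subst sum.delta) auto
  also have "{k \<in> {1..n}. k < i - 1} = {1..<i - 1}" using i by auto
  also have "- ((-1) ^ card {1..<i - 1}) = ((-1) ^ (i - 1) :: mpoly)"
  proof -
    have "i - 1 = Suc (i - 2)" using i False by auto
    then have "card {1..<i - 1} = i - 2" "(-1) ^ (i - 1) = - ((-1) ^ (i - 2) :: mpoly)" by simp_all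
    then show ?thesis by simp
  qed
  finally show ?thesis .
qed

text \<open>The subsets of \<open>{1..Suc n}\<close> with \<open>n\<close> elements are the
  complements of single points.\<close>

lemma pull_top:
  assumes \<omega>: "\<And>I. \<omega> I \<noteq> 0 \<Longrightarrow> card I = n"
  shows "pull s {1..Suc n} \<omega> {1..n}
     = (\<Sum>i=1..Suc n. msubst s (\<omega> ({1..Suc n} - {i})) * dforms s ({1..Suc n} - {i}) {1..n})"
proof -
  let ?N = "{1..Suc n}"
  let ?g = "\<lambda>I. msubst s (\<omega> I) * dforms s I {1..n}"
  have inj: "inj_on (\<lambda>i. ?N - {i}) ?N" by (auto simp: inj_on_def)
  have "pull s ?N \<omega> {1..n} = (\<Sum>I\<in>Pow ?N. ?g I)"
    by (simp add: pull_def sum_fun_apply cmul_def)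
  also have "\<dots> = (\<Sum>I\<in>(\<lambda>i. ?N - {i}) ` ?N. ?g I)"
  proof (rule sum.mono_neutral_right)
    show "\<forall>I\<in>Pow ?N - (\<lambda>i. ?N - {i}) ` ?N. ?g I = 0"
    proof
      fix I assume I: "I \<in> Pow ?N - (\<lambda>i. ?N - {i}) ` ?N"
      have "\<omega> I = 0"
      proof (rule ccontr)
        assume "\<omega> I \<noteq> 0"
        then have "card (?N - I) = 1"
          using \<omega>[of I] I by (subst card_Diff_subset) (auto intro: finite_subset)
        then obtain i where "?N - I = {i}" by (auto simp: card_1_singleton_iff)
        then have "i \<in> ?N" "I = ?N - {i}" using I by auto
        then show False using I by blast
      qed
      then show "?g I = 0" by simp
    qed
  qed auto
  also have "\<dots> = (\<Sum>i\<in>?N. ?g (?N - {i}))"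
    by (simp only: sum.reindex[OF inj] o_def)
  finally show ?thesis .
qed

text \<open>Each coefficient of the form contributes, by \<open>Jint_mpartial\<close>, a term on
  face 0 and one on the face of its own missing index. Face 0 thus collects contributions of all
  coefficients, with the signs of \<open>dforms_face_0\<close>, whereas face \<open>j > 0\<close>
  sees a single one.\<close>

lemma form_integral_Stokes:
  assumes \<omega>: "\<omega> \<in> poly_forms (Suc n) n"
  shows "form_integral (Suc n) (form_d \<omega>)
     = (\<Sum>j\<le>Suc n. (-1) ^ j * form_integral n (form_pullback n (Suc n) (coface j) \<omega>))"
proof -
  let ?N = "{1..Suc n}"
  let ?W = "\<lambda>i. \<omega> (?N - {i})"
  have iv: "in_vars ?N (?W i)" for i
    using \<omega> by (cases "?W i = 0") (auto simp: poly_forms_def in_vars_def)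
  have card: "card I = n" if "\<omega> I \<noteq> 0" for I using \<omega> that by (auto simp: poly_forms_def)
  have pb: "form_pullback n (Suc n) (coface j) \<omega> = pull (coface_subst n j) ?N \<omega>" for j
    unfolding form_pullback_eq_pull coface_subst_def ..
  have pt: "pull s ?N \<omega> {1..n} = (\<Sum>i=1..Suc n. msubst s (?W i) * dforms s (?N - {i}) {1..n})" for s
    by (rule pull_top) (rule card)
  have c: "card {k \<in> ?N. k < i} = i - 1" if "i \<in> ?N" for i
  proof -
    have "{k \<in> ?N. k < i} = {1..<i}" using that by auto
    then show ?thesis by simp
  qed
  have lhs: "form_integral (Suc n) (form_d \<omega>) = (\<Sum>i\<in>?N. (-1) ^ (i - 1) *
      (Jint n (msubst (coface_subst n 0) (?W i)) - Jint n (msubst (coface_subst n i) (?W i))))"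
    unfolding form_integral_eq form_d_def Jint_sum
    by (intro sum.cong refl) (simp only: c Jint_neg_one_power_mult Jint_mpartial[OF iv])
  have zero: "form_integral n (form_pullback n (Suc n) (coface 0) \<omega>)
      = (\<Sum>i\<in>?N. (-1) ^ (i - 1) * Jint n (msubst (coface_subst n 0) (?W i)))"
    unfolding form_integral_eq pb pt Jint_sum
    by (intro sum.cong refl) (simp only: dforms_face_0 mult.commute[of _ "(-1) ^ _"] Jint_neg_one_power_mult)
  have pos: "form_integral n (form_pullback n (Suc n) (coface j) \<omega>) = Jint n (msubst (coface_subst n j) (?W j))"
    if j: "j \<in> ?N" for j
  proof -
    have "form_integral n (form_pullback n (Suc n) (coface j) \<omega>)
        = (\<Sum>i\<in>?N. if i = j then Jint n (msubst (coface_subst n j) (?W j)) else 0)"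
      unfolding form_integral_eq pb pt Jint_sum
      using j by (intro sum.cong refl) (simp add: dforms_face_pos[unfolded One_nat_def])
    then show ?thesis using j by simp
  qed
  have "{..Suc n} = insert 0 ?N" by auto
  then have "(\<Sum>j\<le>Suc n. (-1) ^ j * form_integral n (form_pullback n (Suc n) (coface j) \<omega>))
     = form_integral n (form_pullback n (Suc n) (coface 0) \<omega>)
       + (\<Sum>j\<in>?N. (-1) ^ j * form_integral n (form_pullback n (Suc n) (coface j) \<omega>))"
    by simp
  also have "(\<Sum>j\<in>?N. (-1) ^ j * form_integral n (form_pullback n (Suc n) (coface j) \<omega>))
     = (\<Sum>i\<in>?N. - ((-1) ^ (i - 1) * Jint n (msubst (coface_subst n i) (?W i))))"
  proof (intro sum.cong refl)
    fix i assume i: "i \<in> ?N"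
    then have "(-1) ^ i = - ((-1) ^ (i - 1) :: rat)" by (cases i) auto
    then show "(-1) ^ i * form_integral n (form_pullback n (Suc n) (coface i) \<omega>)
        = - ((-1) ^ (i - 1) * Jint n (msubst (coface_subst n i) (?W i)))"
      using pos[OF i] by simp
  qed
  finally show ?thesis
    unfolding lhs zero by (simp add: right_diff_distrib sum_subtractf sum_negf)
qed

subsection \<open>Pullback and integration of polynomial forms\<close>

text \<open>The value zero off the singular simplices is imposed by
  \<open>gr (A_PL X)\<close>.\<close>

definition apl_pullback ::
  "'m topology \<Rightarrow> ('m \<Rightarrow> 'k) \<Rightarrow> (nat \<Rightarrow> ((nat \<Rightarrow> real) \<Rightarrow> 'k) \<Rightarrow> poly_form) \<Rightarrow> nat \<Rightarrow> ((nat \<Rightarrow> real) \<Rightarrow> 'm) \<Rightarrow> poly_form" where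
  "apl_pullback X g \<omega> = (\<lambda>p \<sigma>. if singular_simplex p X \<sigma> then \<omega> p (simplex_map p g \<sigma>) else 0)"

lemma simplex_map_affine:
  assumes "\<theta> ` {..p} \<subseteq> {..q}"
  shows "simplex_map p g (restrict (\<sigma> \<circ> affine_simplex_map p \<theta>) (standard_simplex p))
     = restrict (simplex_map q g \<sigma> \<circ> affine_simplex_map p \<theta>) (standard_simplex p)"
  using affine_simplex_map_in_standard_simplex[OF _ assms]
  by (auto simp: simplex_map_def restrict_def fun_eq_iff)

lemma dga_hom_apl_pullback:
  assumes g: "continuous_map X Y g"
  shows "dga_hom (apl_pullback X g) (A_PL Y) (A_PL X)"
proof -
  have s: "singular_simplex p Y (simplex_map p g \<sigma>)" if "singular_simplex p X \<sigma>" for p \<sigma>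
    using that g by (rule singular_simplex_simplex_map)
  have gr: "apl_pullback X g \<omega> \<in> gr (A_PL X) k" if \<omega>: "\<omega> \<in> gr (A_PL Y) k" for \<omega> k
    unfolding gr_A_PL_iff
  proof (intro conjI allI impI)
    fix p q :: nat and \<theta> \<sigma> assume a: "singular_simplex q X \<sigma> \<and> mono_on {..p} \<theta> \<and> \<theta> ` {..p} \<subseteq> {..q}"
    then have r: "singular_simplex p X (restrict (\<sigma> \<circ> affine_simplex_map p \<theta>) (standard_simplex p))"
      using singular_simplex_affine by blast
    have "\<omega> p (restrict (simplex_map q g \<sigma> \<circ> affine_simplex_map p \<theta>) (standard_simplex p))
        = form_pullback p q \<theta> (\<omega> q (simplex_map q g \<sigma>))"
      using \<omega> a s[of q \<sigma>] unfolding gr_A_PL_iff by blast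
    then show "apl_pullback X g \<omega> p (restrict (\<sigma> \<circ> affine_simplex_map p \<theta>) (standard_simplex p))
        = form_pullback p q \<theta> (apl_pullback X g \<omega> q \<sigma>)"
      using a r simplex_map_affine[of \<theta> p q g \<sigma>] by (simp add: apl_pullback_def)
  next
    fix p \<sigma> assume "singular_simplex p X \<sigma>"
    then show "apl_pullback X g \<omega> p \<sigma> \<in> poly_forms p k"
      using \<omega> s by (simp add: apl_pullback_def gr_A_PL_iff)
  qed (simp add: apl_pullback_def)
  show ?thesis
    unfolding dga_hom_def
  proof (intro conjI allI ballI)
    show "apl_pullback X g ` gr (A_PL Y) k \<subseteq> gr (A_PL X) k" for k using gr by blast
    fix x y q
    show "apl_pullback X g (x + y) = apl_pullback X g x + apl_pullback X g y"
      by (intro ext) (simp add: apl_pullback_def)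
    show "apl_pullback X g (prd (A_PL Y) x y) = prd (A_PL X) (apl_pullback X g x) (apl_pullback X g y)"
      by (intro ext) (simp add: apl_pullback_def A_PL_sel)
    show "apl_pullback X g (scal (A_PL Y) q x) = scal (A_PL X) q (apl_pullback X g x)"
      by (intro ext) (simp add: apl_pullback_def A_PL_sel)
    show "apl_pullback X g (dif (A_PL Y) x) = dif (A_PL X) (apl_pullback X g x)"
      by (intro ext) (simp add: apl_pullback_def A_PL_sel)
  next
    show "apl_pullback X g (unt (A_PL Y)) = unt (A_PL X)"
      by (intro ext) (simp add: apl_pullback_def A_PL_sel s)
  qed
qed

lemma evaluate_add: "evaluate p c (a + b) = evaluate p c a + evaluate p c b"
  unfolding evaluate_def by (rule setsum_keys_plus_distrib) (simp_all add: algebra_simps)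

lemma evaluate_0 [simp]: "evaluate p c 0 = 0"
  by (simp add: evaluate_def)

lemma evaluate_minus: "evaluate p c (- a) = - evaluate p c a"
  using evaluate_add[of p c a "- a"] by simp

lemma evaluate_diff: "evaluate p c (a - b) = evaluate p c a - evaluate p c b"
  using evaluate_add[of p c a "- b"] by (simp add: evaluate_minus)

lemma evaluate_sum: "evaluate p c (\<Sum>i\<in>I. f i) = (\<Sum>i\<in>I. evaluate p c (f i))"
  by (induction I rule: infinite_finite_induct) (simp_all add: evaluate_add)

lemma evaluate_frag_of [simp]: "evaluate p c (frag_of \<sigma>) = c p \<sigma>"
  by (simp add: evaluate_def)

lemma evaluate_cmul: "evaluate p c (frag_cmul k z) = of_int k * evaluate p c z"
proof -
  have "evaluate p c (frag_cmul k z) = (\<Sum>\<sigma>\<in>Poly_Mapping.keys z. of_int (Poly_Mapping.lookup (frag_cmul k z) \<sigma>) * c p \<sigma>)"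
    unfolding evaluate_def by (rule sum.mono_neutral_left) (auto simp: in_keys_iff)
  then show ?thesis by (simp add: evaluate_def sum_distrib_left algebra_simps)
qed

lemma de_Rham_pullback:
  assumes "continuous_map X Y g" "singular_chain n X z"
  shows "evaluate n (de_Rham X (apl_pullback X g \<omega>)) z = evaluate n (de_Rham Y \<omega>) (chain_map n g z)"
  using assms(2) unfolding singular_chain_def
proof (induction z rule: frag_induction)
  case (one \<sigma>)
  then show ?case
    using singular_simplex_simplex_map[OF _ assms(1)] by (simp add: de_Rham_def apl_pullback_def)
qed (simp_all add: evaluate_diff chain_map_diff)

text \<open>This identifies the faces in the singular boundary with the affine maps in the
  compatibility condition of \<open>A_PL\<close>, so that the value of a form on a face is a
  pullback along \<open>coface\<close>.\<close>

lemma singular_face_eq_affine: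
  assumes "k \<le> Suc n"
  shows "singular_face (Suc n) k \<sigma> = restrict (\<sigma> \<circ> affine_simplex_map n (coface k)) (standard_simplex n)"
proof -
  have "simplical_face k x = affine_simplex_map n (coface k) x" if x: "x \<in> standard_simplex n" for x
  proof
    fix i
    consider "i < k" | "i = k" | "k < i" by linarith
    then show "simplical_face k x i = affine_simplex_map n (coface k) x i"
    proof cases
      case 1
      then have "{j. j \<le> n \<and> coface k j = i} = {i}" using assms by (auto simp: coface_def split: if_splits)
      then show ?thesis using 1 by (simp add: simplical_face_def affine_simplex_map_def)
    next
      case 2
      then have e: "{j. j \<le> n \<and> coface k j = i} = {}" by (auto simp: coface_neq)
      have "affine_simplex_map n (coface k) x i = 0"
        unfolding affine_simplex_map_def e by simp
      then show ?thesis using 2 by (simp add: simplical_face_def)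
    next
      case 3
      show ?thesis
      proof (cases "i - 1 \<le> n")
        case True
        then have "{j. j \<le> n \<and> coface k j = i} = {i - 1}" using 3 by (auto simp: coface_def split: if_splits)
        then show ?thesis using 3 by (simp add: simplical_face_def affine_simplex_map_def)
      next
        case False
        then have e: "{j. j \<le> n \<and> coface k j = i} = {}" using 3 by (auto simp: coface_def split: if_splits)
        have "affine_simplex_map n (coface k) x i = 0"
          unfolding affine_simplex_map_def e by simp
        moreover have "x (i - 1) = 0" using x False by (simp add: standard_simplex_def)
        ultimately show ?thesis using 3 by (simp add: simplical_face_def)
      qed
    qed
  qed
  then show ?thesis by (simp add: singular_face_def) (rule restrict_ext, simp)
qed

text \<open>Compatibility of the family of forms expresses its values on the faces of a simplex as
  pullbacks of a single form, and Stokes' theorem on that simplex applies.\<close>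

lemma de_Rham_Stokes:
  assumes \<omega>: "\<omega> \<in> gr (A_PL X) n" and c: "singular_chain (Suc n) X c"
  shows "evaluate (Suc n) (de_Rham X (dif (A_PL X) \<omega>)) c
     = evaluate n (de_Rham X \<omega>) (chain_boundary (Suc n) c)"
  using c unfolding singular_chain_def
proof (induction c rule: frag_induction)
  case (one \<sigma>)
  then have \<sigma>: "singular_simplex (Suc n) X \<sigma>" by simp
  have face: "de_Rham X \<omega> n (singular_face (Suc n) k \<sigma>)
      = form_integral n (form_pullback n (Suc n) (coface k) (\<omega> (Suc n) \<sigma>))" if k: "k \<le> Suc n" for k
  proof -
    have mono: "mono_on {..n} (coface k)" "coface k ` {..n} \<subseteq> {..Suc n}"
      by (auto simp: mono_on_def coface_def)
    then have "\<omega> n (singular_face (Suc n) k \<sigma>) = form_pullback n (Suc n) (coface k) (\<omega> (Suc n) \<sigma>)"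
      using \<omega> \<sigma> unfolding gr_A_PL_iff singular_face_eq_affine[OF k] by blast
    moreover have "singular_simplex n X (singular_face (Suc n) k \<sigma>)"
      unfolding singular_face_eq_affine[OF k] using \<sigma> mono(2) by (rule singular_simplex_affine)
    ultimately show ?thesis by (simp add: de_Rham_def)
  qed
  have "evaluate (Suc n) (de_Rham X (dif (A_PL X) \<omega>)) (frag_of \<sigma>) = form_integral (Suc n) (form_d (\<omega> (Suc n) \<sigma>))"
    using \<sigma> by (simp add: de_Rham_def A_PL_sel)
  also have "\<dots> = (\<Sum>k\<le>Suc n. (-1) ^ k * form_integral n (form_pullback n (Suc n) (coface k) (\<omega> (Suc n) \<sigma>)))"
    using \<omega> \<sigma> by (intro form_integral_Stokes) (simp add: gr_A_PL_iff)
  also have "\<dots> = (\<Sum>k\<le>Suc n. evaluate n (de_Rham X \<omega>) (frag_cmul ((-1) ^ k) (frag_of (singular_face (Suc n) k \<sigma>))))"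
    by (intro sum.cong refl) (simp add: evaluate_cmul face)
  also have "\<dots> = evaluate n (de_Rham X \<omega>) (chain_boundary (Suc n) (frag_of \<sigma>))"
    by (simp only: chain_boundary_of evaluate_sum[symmetric] nat.distinct if_False)
  finally show ?case .
qed (simp_all add: evaluate_diff chain_boundary_diff)

text \<open>Together with \<open>de_Rham_cobounds\<close> this makes integration a pairing of
  cohomology classes of \<open>A_PL\<close> with homology classes.\<close>

lemma de_Rham_boundary:
  assumes "\<omega> \<in> gr (A_PL X) n" "dif (A_PL X) \<omega> = 0" "singular_relboundary n X {} z"
  shows "evaluate n (de_Rham X \<omega>) z = 0"
proof -
  obtain c where c: "singular_chain (Suc n) X c" "chain_boundary (Suc n) c = z"
    using assms(3) by (auto simp: singular_boundary)
  have "de_Rham X 0 = 0" by (intro ext) (simp add: de_Rham_def form_integral_def)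
  then have "evaluate (Suc n) (de_Rham X (dif (A_PL X) \<omega>)) c = 0"
    unfolding assms(2) by (simp add: evaluate_def)
  then show ?thesis using de_Rham_Stokes[OF assms(1) c(1)] c(2) by simp
qed

lemma de_Rham_cobounds:
  assumes "\<omega> \<in> cobounds (A_PL X) n" "singular_relcycle n X {} z"
  shows "evaluate n (de_Rham X \<omega>) z = 0"
proof (cases n)
  case 0
  then have "\<omega> = 0" using assms(1) by (simp add: cobounds_def)
  then have "de_Rham X \<omega> = 0" by (intro ext) (simp add: de_Rham_def form_integral_def)
  then show ?thesis by (simp add: evaluate_def)
next
  case (Suc k)
  then obtain \<eta> where "\<eta> \<in> gr (A_PL X) k" "\<omega> = dif (A_PL X) \<eta>"
    using assms(1) by (auto simp: cobounds_def)
  then show ?thesis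
    using de_Rham_Stokes[of \<eta> X k z] assms(2) Suc by (simp add: singular_cycle)
qed

section \<open>Homomorphisms out of free graded commutative algebras\<close>

subsection \<open>Differential graded algebras\<close>

text \<open>The restriction to the plain record type, on which cohomology and \<open>dga_hom\<close>
  are defined.\<close>

locale plain_dga = dga A for A :: "'a::ab_group_add dg_algebra"
begin

sublocale V: vector_space "scal A" by (rule vector_space)

lemma gr_carr: "x \<in> gr A k \<Longrightarrow> x \<in> carr A"
  unfolding carr_def by (rule V.span_base) blast

lemma subspace_carr: "V.subspace (carr A)"
  unfolding carr_def by (rule V.subspace_span)

lemma carr_closed:
  "0 \<in> carr A" "x \<in> carr A \<Longrightarrow> y \<in> carr A \<Longrightarrow> x + y \<in> carr A" "x \<in> carr A \<Longrightarrow> scal A q x \<in> carr A"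
  "x \<in> carr A \<Longrightarrow> - x \<in> carr A" "x \<in> carr A \<Longrightarrow> y \<in> carr A \<Longrightarrow> x - y \<in> carr A"
  using V.subspace_0[OF subspace_carr] V.subspace_add[OF subspace_carr] V.subspace_scale[OF subspace_carr]
    V.subspace_neg[OF subspace_carr] V.subspace_diff[OF subspace_carr] by blast+

lemma gr_closed:
  "0 \<in> gr A k" "x \<in> gr A k \<Longrightarrow> y \<in> gr A k \<Longrightarrow> x + y \<in> gr A k" "x \<in> gr A k \<Longrightarrow> scal A q x \<in> gr A k"
  "x \<in> gr A k \<Longrightarrow> - x \<in> gr A k" "x \<in> gr A k \<Longrightarrow> y \<in> gr A k \<Longrightarrow> x - y \<in> gr A k"
  by (fact V.subspace_0[OF subspace] V.subspace_add[OF subspace] V.subspace_scale[OF subspace]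
    V.subspace_neg[OF subspace] V.subspace_diff[OF subspace])+

lemma carr_induct [consumes 1, case_names zero add]:
  assumes "x \<in> carr A" "P 0"
    and "\<And>k x y. x \<in> gr A k \<Longrightarrow> y \<in> carr A \<Longrightarrow> P y \<Longrightarrow> P (x + y)"
  shows "P x"
proof -
  have "x \<in> V.span (\<Union>k. gr A k)" using assms(1) by (simp add: carr_def)
  then have "x \<in> carr A \<and> P x"
  proof (induction rule: V.span_induct_alt)
    case base
    then show ?case using assms(2) carr_closed by simp
  next
    case (step c x y)
    then obtain k where "x \<in> gr A k" by blast
    then have sc: "scal A c x \<in> gr A k" by (rule gr_closed)
    have y: "y \<in> carr A" "P y" using step.IH by auto
    show ?case by (intro conjI carr_closed(2) gr_carr[OF sc] y assms(3)[OF sc y])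
  qed
  then show ?thesis ..
qed

lemma prd_0: "x \<in> carr A \<Longrightarrow> prd A 0 x = 0" "x \<in> carr A \<Longrightarrow> prd A x 0 = 0"
  using prd_add(1)[of 0 0 x] prd_add(2)[of x 0 0] carr_closed(1) by auto

lemma dif_0: "dif A 0 = 0"
  using dif_add[of 0 0] carr_closed(1) by simp

lemma carr_dif: "x \<in> carr A \<Longrightarrow> dif A x \<in> carr A"
proof (induction x rule: carr_induct)
  case (add k x y)
  have "dif A (x + y) = dif A x + dif A y" by (rule dif_add[OF gr_carr[OF add(1)] add(2)])
  then show ?case using carr_closed(2)[OF gr_carr[OF dif_gr[OF add(1)]] add(3)] by simp
qed (simp add: dif_0 carr_closed)

lemma carr_prd: "x \<in> carr A \<Longrightarrow> y \<in> carr A \<Longrightarrow> prd A x y \<in> carr A"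
proof (induction x rule: carr_induct)
  case (add k x x')
  have x: "x \<in> carr A" using add gr_carr by blast
  have "prd A x y \<in> carr A" using add(4)
  proof (induction y rule: carr_induct)
    case (add l y y')
    then have "prd A x y \<in> carr A" using prd_gr \<open>x \<in> gr A k\<close> gr_carr by blast
    then show ?case using add x prd_add(2)[of x y y'] gr_carr carr_closed by simp
  qed (simp add: prd_0 x carr_closed)
  then show ?case using add x prd_add(1) carr_closed by simp
qed (simp add: prd_0 carr_closed)

lemma carr_unt: "unt A \<in> carr A"
  using unt_gr gr_carr by blast

lemma dif_unt: "dif A (unt A) = 0"
proof -
  have "dif A (unt A) = dif A (unt A) + dif A (unt A)"
    using leibniz[OF unt_gr unt_gr] carr_unt carr_dif[OF carr_unt] by (simp add: prd_unt)
  then show ?thesis by simp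
qed

lemma carr_minus_simps:
  "x \<in> carr A \<Longrightarrow> y \<in> carr A \<Longrightarrow> dif A (x - y) = dif A x - dif A y"
  "x \<in> carr A \<Longrightarrow> dif A (- x) = - dif A x"
proof -
  show m: "dif A (- x) = - dif A x" if "x \<in> carr A" for x
    using dif_add[of x "- x"] that carr_closed dif_0 by (simp add: eq_neg_iff_add_eq_0 add.commute)
  show "x \<in> carr A \<Longrightarrow> y \<in> carr A \<Longrightarrow> dif A (x - y) = dif A x - dif A y"
    using dif_add[of x "- y"] carr_closed m by simp
qed

lemma carr_sum: "(\<And>i. i \<in> I \<Longrightarrow> f i \<in> carr A) \<Longrightarrow> sum f I \<in> carr A"
  by (rule V.subspace_sum[OF subspace_carr])

lemma gr_sum: "(\<And>i. i \<in> I \<Longrightarrow> f i \<in> gr A k) \<Longrightarrow> sum f I \<in> gr A k"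
  by (rule V.subspace_sum[OF subspace])

lemma dif_sum: "(\<And>i. i \<in> I \<Longrightarrow> f i \<in> carr A) \<Longrightarrow> dif A (sum f I) = (\<Sum>i\<in>I. dif A (f i))"
  by (induction I rule: infinite_finite_induct) (simp_all add: dif_0 dif_add carr_sum)

lemma carr_word: "set w \<subseteq> carr A \<Longrightarrow> word A w \<in> carr A"
  by (induction w) (simp_all add: word_def carr_unt carr_prd)

lemma word_Cons: "word A (x # w) = prd A x (word A w)"
  by (simp add: word_def)

lemma word_Nil: "word A [] = unt A"
  by (simp add: word_def)

lemma word_append: "set u \<subseteq> carr A \<Longrightarrow> set w \<subseteq> carr A \<Longrightarrow> word A (u @ w) = prd A (word A u) (word A w)"
proof (induction u)
  case Nil
  then show ?case by (simp add: word_Nil prd_unt carr_word)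
next
  case (Cons x u)
  then show ?case by (simp add: word_Cons prd_assoc carr_word)
qed

lemma word_swap:
  assumes "set u \<subseteq> carr A" "set w \<subseteq> carr A" "x \<in> gr A i" "y \<in> gr A j"
  shows "word A (u @ [x, y] @ w) = scal A ((-1) ^ (i * j)) (word A (u @ [y, x] @ w))"
proof -
  have xy: "x \<in> carr A" "y \<in> carr A" using assms gr_carr by blast+
  have W: "word A w \<in> carr A" using assms carr_word by blast
  have "word A ([x, y] @ w) = prd A (prd A x y) (word A w)"
    using xy W by (simp add: word_Cons prd_assoc)
  also have "\<dots> = prd A (scal A ((-1) ^ (i * j)) (prd A y x)) (word A w)"
    using graded_comm[OF assms(3,4)] by simp
  also have "\<dots> = scal A ((-1) ^ (i * j)) (prd A (prd A y x) (word A w))"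
    using xy W carr_prd by (intro prd_scal) auto
  also have "prd A (prd A y x) (word A w) = word A ([y, x] @ w)"
    using xy W by (simp add: word_Cons prd_assoc)
  finally have *: "word A ([x, y] @ w) = scal A ((-1) ^ (i * j)) (word A ([y, x] @ w))" .
  have "word A (u @ [x, y] @ w) = prd A (word A u) (word A ([x, y] @ w))"
    using assms xy by (intro word_append) auto
  also have "\<dots> = scal A ((-1) ^ (i * j)) (prd A (word A u) (word A ([y, x] @ w)))"
    unfolding * using assms xy by (intro prd_scal carr_word) auto
  also have "prd A (word A u) (word A ([y, x] @ w)) = word A (u @ [y, x] @ w)"
    using assms xy by (intro word_append[symmetric]) auto
  finally show ?thesis .
qed

lemma gr_word:
  assumes "\<And>x. x \<in> set w \<Longrightarrow> x \<in> gr A (d x)"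
  shows "word A w \<in> gr A (sum_list (map d w))"
  using assms
proof (induction w)
  case (Cons x w)
  then show ?case using prd_gr[of x "d x" "word A w"] by (simp add: word_Cons)
qed (simp add: word_Nil unt_gr)

end

lemma dga_homD:
  assumes "dga_hom f A B"
  shows "x \<in> gr A k \<Longrightarrow> f x \<in> gr B k"
    and "x \<in> carr A \<Longrightarrow> y \<in> carr A \<Longrightarrow> f (x + y) = f x + f y"
    and "x \<in> carr A \<Longrightarrow> y \<in> carr A \<Longrightarrow> f (prd A x y) = prd B (f x) (f y)"
    and "x \<in> carr A \<Longrightarrow> f (scal A q x) = scal B q (f x)"
    and "x \<in> carr A \<Longrightarrow> f (dif A x) = dif B (f x)"
    and "f (unt A) = unt B"
  using assms unfolding dga_hom_def by blast+

lemma dga_hom_0: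
  assumes "dga A" "dga_hom f A B"
  shows "f 0 = 0"
  using dga_homD(2)[OF assms(2), of 0 0] plain_dga.carr_closed(1)[OF plain_dga.intro[OF assms(1)]] by simp

lemma dga_hom_minus:
  assumes "dga A" "dga_hom f A B"
  shows "x \<in> carr A \<Longrightarrow> f (- x) = - f x" "x \<in> carr A \<Longrightarrow> y \<in> carr A \<Longrightarrow> f (x - y) = f x - f y"
proof -
  interpret A: plain_dga A by (rule plain_dga.intro[OF assms(1)])
  show m: "f (- x) = - f x" if "x \<in> carr A" for x
    using dga_homD(2)[OF assms(2), of x "- x"] that A.carr_closed dga_hom_0[OF assms]
    by (simp add: eq_neg_iff_add_eq_0 add.commute)
  show "x \<in> carr A \<Longrightarrow> y \<in> carr A \<Longrightarrow> f (x - y) = f x - f y"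
    using dga_homD(2)[OF assms(2), of x "- y"] m A.carr_closed by simp
qed

lemma dga_hom_carr:
  assumes "dga A" "dga B" "dga_hom f A B" "x \<in> carr A"
  shows "f x \<in> carr B"
proof -
  interpret A: plain_dga A by (rule plain_dga.intro[OF assms(1)])
  interpret B: plain_dga B by (rule plain_dga.intro[OF assms(2)])
  show ?thesis using assms(4)
  proof (induction x rule: A.carr_induct)
    case zero
    then show ?case using dga_hom_0[OF assms(1,3)] B.carr_closed by simp
  next
    case (add k x y)
    have "f (x + y) = f x + f y" by (rule dga_homD(2)[OF assms(3) A.gr_carr[OF add(1)] add(2)])
    then show ?case
      using B.carr_closed(2)[OF B.gr_carr[OF dga_homD(1)[OF assms(3) add(1)]] add(3)] by simp
  qed
qed

lemma dga_hom_comp: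
  assumes "dga A" "dga B" "dga_hom f A B" "dga_hom g B C"
  shows "dga_hom (g \<circ> f) A C"
  unfolding dga_hom_def o_def
  using dga_homD[OF assms(3)] dga_homD[OF assms(4)] dga_hom_carr[OF assms(1-3)]
  by (auto simp: image_subset_iff)

subsection \<open>Homomorphisms out of a free algebra\<close>

interpretation T: vector_space "\<lambda>(q::rat) (t::'a list \<Rightarrow> rat) w. q * t w"
  by unfold_locales (auto simp: fun_eq_iff algebra_simps)

text \<open>The map out of the tensor algebra that sends each letter \<open>x\<close> to
  \<open>v x\<close>. It is meant for finitely supported \<open>t\<close>, where it is
  linear.\<close>

definition teval :: "'p::ab_group_add dg_algebra \<Rightarrow> ('a \<Rightarrow> 'p) \<Rightarrow> ('a list \<Rightarrow> rat) \<Rightarrow> 'p" where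
  "teval P v t = (\<Sum>w | t w \<noteq> 0. scal P (t w) (word P (map v w)))"

lemma tensor_eval_eq_teval: "tensor_eval A t = teval A id t"
  by (simp add: tensor_eval_def teval_def)

context plain_dga
begin

lemma teval_superset:
  assumes "finite W" "{w. t w \<noteq> 0} \<subseteq> W"
  shows "teval A v t = (\<Sum>w\<in>W. scal A (t w) (word A (map v w)))"
  unfolding teval_def using assms by (intro sum.mono_neutral_left) auto

lemma teval_add:
  assumes "finite {w. t w \<noteq> 0}" "finite {w. t' w \<noteq> 0}"
  shows "teval A v (t + t') = teval A v t + teval A v t'"
proof -
  let ?W = "{w. t w \<noteq> 0} \<union> {w. t' w \<noteq> 0}"
  have W: "finite ?W" using assms by simp
  have "teval A v (t + t') = (\<Sum>w\<in>?W. scal A ((t + t') w) (word A (map v w)))"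
    "teval A v t = (\<Sum>w\<in>?W. scal A (t w) (word A (map v w)))"
    "teval A v t' = (\<Sum>w\<in>?W. scal A (t' w) (word A (map v w)))"
    by (rule teval_superset[OF W]; auto)+
  then show ?thesis by (simp add: sum.distrib V.scale_left_distrib)
qed

lemma teval_scale:
  assumes "finite {w. t w \<noteq> 0}"
  shows "teval A v (\<lambda>w. q * t w) = scal A q (teval A v t)"
proof -
  have "teval A v (\<lambda>w. q * t w) = (\<Sum>w\<in>{w. t w \<noteq> 0}. scal A (q * t w) (word A (map v w)))"
    by (rule teval_superset[OF assms]) auto
  then show ?thesis by (simp add: teval_def V.scale_sum_right)
qed

lemma teval_unit: "teval A v (tensor_unit u) = word A (map v u)"
proof -
  have "teval A v (tensor_unit u) = (\<Sum>w\<in>{u}. scal A (tensor_unit u w) (word A (map v w)))"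
    by (rule teval_superset) (auto simp: tensor_unit_def)
  then show ?thesis by (simp add: tensor_unit_def)
qed

lemma tensors_subspace:
  fixes X :: "'x set"
  shows "T.subspace (tensors X)"
proof (rule T.subspaceI)
  show "0 \<in> tensors X" by (simp add: tensors_def)
  show "x + y \<in> tensors X" if "x \<in> tensors X" "y \<in> tensors X" for x y :: "'x list \<Rightarrow> rat"
  proof -
    have "{w. (x + y) w \<noteq> 0} \<subseteq> {w. x w \<noteq> 0} \<union> {w. y w \<noteq> 0}" by auto
    then show ?thesis using that finite_subset[of "{w. (x + y) w \<noteq> 0}"] unfolding tensors_def by blast
  qed
  show "(\<lambda>w. c * x w) \<in> tensors X" if "x \<in> tensors X" for c and x :: "'x list \<Rightarrow> rat"
  proof -
    have "{w. c * x w \<noteq> 0} \<subseteq> {w. x w \<noteq> 0}" by auto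
    then show ?thesis using that finite_subset[of "{w. c * x w \<noteq> 0}"] unfolding tensors_def by blast
  qed
qed

lemma tensor_unit_tensors: "w \<in> lists X \<Longrightarrow> tensor_unit w \<in> tensors X"
  by (auto simp: tensors_def tensor_unit_def)

lemma tensors_finite: "t \<in> tensors X \<Longrightarrow> finite {w. t w \<noteq> 0}"
  by (simp add: tensors_def)

text \<open>Graded commutativity of the target kills the generators of the ideal, so evaluation
  factors through the free graded commutative algebra.\<close>

lemma teval_commutator_ideal:
  assumes v: "\<And>x. x \<in> X \<Longrightarrow> v x \<in> gr A (dg x)" and t: "t \<in> commutator_ideal dg X"
  shows "t \<in> tensors X \<and> teval A v t = 0"
proof -
  let ?S = "{t \<in> tensors X. teval A v t = 0}"
  have "T.subspace ?S"
  proof (rule T.subspaceI)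
    show "0 \<in> ?S" using T.subspace_0[OF tensors_subspace] by (simp add: teval_def)
    show "x + y \<in> ?S" if "x \<in> ?S" "y \<in> ?S" for x y
    proof -
      have x: "x \<in> tensors X" "teval A v x = 0" and y: "y \<in> tensors X" "teval A v y = 0" using that by auto
      show ?thesis
        using T.subspace_add[OF tensors_subspace x(1) y(1)]
          teval_add[OF tensors_finite[OF x(1)] tensors_finite[OF y(1)], of v] x(2) y(2) by (simp only: mem_Collect_eq add_0 simp_thms)
    qed
    show "(\<lambda>w. c * x w) \<in> ?S" if "x \<in> ?S" for c x
    proof -
      have x: "x \<in> tensors X" "teval A v x = 0" using that by auto
      show ?thesis
        using T.subspace_scale[OF tensors_subspace x(1), of c] teval_scale[OF tensors_finite[OF x(1)], of v c] x(2)
        by simp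
    qed
  qed
  moreover have "{t. \<exists>u\<in>lists X. \<exists>w\<in>lists X. \<exists>x\<in>X. \<exists>y\<in>X.
      t = (\<lambda>z. tensor_unit (u @ [x, y] @ w) z - (-1) ^ (dg x * dg y) * tensor_unit (u @ [y, x] @ w) z)} \<subseteq> ?S"
  proof (rule subsetI, unfold mem_Collect_eq, elim bexE)
    fix t u w x y assume uw: "u \<in> lists X" "w \<in> lists X" and xy: "x \<in> X" "y \<in> X"
      and t: "t = (\<lambda>z. tensor_unit (u @ [x, y] @ w) z - (-1) ^ (dg x * dg y) * tensor_unit (u @ [y, x] @ w) z)"
    let ?a = "tensor_unit (u @ [x, y] @ w)" and ?b = "tensor_unit (u @ [y, x] @ w)"
    let ?c = "- ((-1) ^ (dg x * dg y)) :: rat"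
    have eq: "(\<lambda>z. ?a z - (-1) ^ (dg x * dg y) * ?b z) = ?a + (\<lambda>z. ?c * ?b z)"
      by (simp add: fun_eq_iff)
    have ab: "?a \<in> tensors X" "?b \<in> tensors X"
      using uw xy by (auto intro!: tensor_unit_tensors)
    have cb: "(\<lambda>z. ?c * ?b z) \<in> tensors X" using T.subspace_scale[OF tensors_subspace ab(2)] .
    have 1: "(\<lambda>z. ?a z - (-1) ^ (dg x * dg y) * ?b z) \<in> tensors X"
      unfolding eq using T.subspace_add[OF tensors_subspace ab(1) cb] .
    have "word A (map v u @ [v x, v y] @ map v w) = scal A ((-1) ^ (dg x * dg y)) (word A (map v u @ [v y, v x] @ map v w))"
    proof (rule word_swap)
      have "v x \<in> carr A" if "x \<in> X" for x using gr_carr[OF v[OF that]] .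
      then show "set (map v u) \<subseteq> carr A" "set (map v w) \<subseteq> carr A" using uw by auto
    qed (use xy v in auto)
    then have 2: "teval A v (\<lambda>z. ?a z - (-1) ^ (dg x * dg y) * ?b z) = 0"
      unfolding eq
      using teval_add[OF tensors_finite[OF ab(1)] tensors_finite[OF cb], of v]
        teval_scale[OF tensors_finite[OF ab(2)], of v ?c]
      by (simp add: teval_unit)
    show "t \<in> tensors X \<and> teval A v t = 0"
      unfolding t by (rule conjI[OF 1 2])
  qed
  ultimately have "commutator_ideal dg X \<subseteq> ?S"
    unfolding commutator_ideal_def by (intro T.span_minimal)
  then show ?thesis using t by blast
qed

end

locale free_dga = plain_dga A for A :: "'a::ab_group_add dg_algebra" +
  fixes dg :: "'a \<Rightarrow> nat" and X :: "'a set"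
  assumes free: "freely_generated A dg X"
begin

lemma gen_gr: "x \<in> X \<Longrightarrow> x \<in> gr A (dg x)"
  using free by (simp add: freely_generated_def)

lemma carr_eq: "carr A = tensor_eval A ` tensors X"
  using free by (simp add: freely_generated_def)

lemma kernel_eq: "{t \<in> tensors X. tensor_eval A t = 0} = commutator_ideal dg X"
  using free by (simp add: freely_generated_def)

lemma set_lists_carr: "w \<in> lists X \<Longrightarrow> set w \<subseteq> carr A"
  using gen_gr gr_carr by auto

lemma carr_eq_span: "carr A = V.span (word A ` lists X)"
proof
  show "carr A \<subseteq> V.span (word A ` lists X)"
  proof
    fix b assume "b \<in> carr A"
    then obtain t where t: "t \<in> tensors X" "b = tensor_eval A t" using carr_eq by blast
    show "b \<in> V.span (word A ` lists X)"
      unfolding t(2) tensor_eval_def using t(1)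
      by (intro V.span_sum V.span_scale V.span_base) (auto simp: tensors_def)
  qed
  show "V.span (word A ` lists X) \<subseteq> carr A"
    by (rule V.span_minimal[OF _ subspace_carr]) (use set_lists_carr carr_word in blast)
qed

lemma carr_word_induct [consumes 1, case_names zero add]:
  assumes "b \<in> V.span (word A ` lists G)" "P 0"
    and "\<And>q w y. w \<in> lists G \<Longrightarrow> y \<in> V.span (word A ` lists G) \<Longrightarrow> P y \<Longrightarrow> P (scal A q (word A w) + y)"
  shows "P b"
proof -
  have "b \<in> V.span (word A ` lists G) \<and> P b"
    using assms(1)
  proof (induction rule: V.span_induct_alt)
    case base
    then show ?case using assms(2) V.span_zero by blast
  next
    case (step c x y)
    then obtain w where w: "w \<in> lists G" "x = word A w" by blast
    have y: "y \<in> V.span (word A ` lists G)" "P y" using step.IH by auto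
    have "scal A c x + y \<in> V.span (word A ` lists G)"
      using w by (intro V.span_add V.span_scale V.span_base y) auto
    moreover have "P (scal A c x + y)" unfolding w(2) by (rule assms(3)[OF w(1) y])
    ultimately show ?case ..
  qed
  then show ?thesis ..
qed

lemma span_words_carr: "G \<subseteq> X \<Longrightarrow> V.span (word A ` lists G) \<subseteq> carr A"
  unfolding carr_eq_span by (intro V.span_mono image_mono lists_mono)

text \<open>A tensor representing \<open>b\<close> may contain words of wrong degrees. Its parts
  \<open>tk j\<close> of the various degrees evaluate into different degrees of \<open>A\<close>, so
  by directness the part of degree \<open>k\<close> already represents \<open>b\<close>.\<close>

lemma homogeneous_tensor:
  assumes "b \<in> gr A k"
  obtains t where "t \<in> tensors X" "b = tensor_eval A t" "\<And>w. t w \<noteq> 0 \<Longrightarrow> sum_list (map dg w) = k"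
proof -
  obtain t where t: "t \<in> tensors X" "b = tensor_eval A t"
    using gr_carr[OF assms] carr_eq by blast
  define tk where "tk = (\<lambda>j w. if sum_list (map dg w) = j then t w else 0)"
  let ?S = "{w. t w \<noteq> 0}"
  have fin: "finite ?S" using t(1) by (rule tensors_finite)
  \<comment> \<open>\<open>k\<close> is inserted so that the argument also covers the case that no
    word has degree \<open>k\<close>, where it yields \<open>b = 0\<close>.\<close>
  define K where "K = insert k ((\<lambda>w. sum_list (map dg w)) ` ?S)"
  have fK: "finite K" using fin by (simp add: K_def)
  have tk: "tk j \<in> tensors X" for j
  proof -
    have "{w. tk j w \<noteq> 0} \<subseteq> ?S" by (auto simp: tk_def)
    then show ?thesis using t(1) finite_subset[OF _ fin] unfolding tensors_def by blast
  qed
  have tke: "tensor_eval A (tk j) = (\<Sum>w\<in>?S. if sum_list (map dg w) = j then scal A (t w) (word A w) else 0)" for j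
    unfolding tensor_eval_eq_teval
    by (subst teval_superset[OF fin]) (auto simp: tk_def intro!: sum.cong)
  have grk: "tensor_eval A (tk j) \<in> gr A j" for j
    unfolding tke
  proof (rule gr_sum)
    fix w assume w: "w \<in> ?S"
    then have "w \<in> lists X" using t(1) by (auto simp: tensors_def)
    then have "word A w \<in> gr A (sum_list (map dg w))" by (intro gr_word gen_gr) auto
    then show "(if sum_list (map dg w) = j then scal A (t w) (word A w) else 0) \<in> gr A j"
      using gr_closed by auto
  qed
  have "(\<Sum>j\<in>K. tensor_eval A (tk j)) = (\<Sum>w\<in>?S. \<Sum>j\<in>K. if sum_list (map dg w) = j then scal A (t w) (word A w) else 0)"
    unfolding tke by (rule sum.swap)
  also have "\<dots> = (\<Sum>w\<in>?S. scal A (t w) (word A w))"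
    using fK by (intro sum.cong refl) (simp add: K_def)
  also have "\<dots> = b" by (simp add: t(2) tensor_eval_def)
  finally have total: "(\<Sum>j\<in>K. tensor_eval A (tk j)) = b" .
  \<comment> \<open>The homogeneous parts with \<open>b\<close> subtracted in degree
    \<open>k\<close>; they sum to zero.\<close>
  let ?a = "\<lambda>j. if j = k then tensor_eval A (tk k) - b else tensor_eval A (tk j)"
  have "?a k = 0"
  proof (rule direct[where a = ?a and K = K and k = k])
    show "finite K" by (rule fK)
    show "k \<in> K" by (simp add: K_def)
    show "\<forall>j\<in>K. ?a j \<in> gr A j"
      using grk gr_closed(5)[OF grk assms] by simp
    have "(\<Sum>j\<in>K. ?a j) = (\<Sum>j\<in>K. tensor_eval A (tk j) - (if j = k then b else 0))"
      by (intro sum.cong) auto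
    also have "\<dots> = 0"
    proof -
      have "(\<Sum>j\<in>K. if j = k then b else 0) = b" using fK by (simp add: K_def)
      then show ?thesis by (simp only: sum_subtractf total diff_self)
    qed
    finally show "(\<Sum>j\<in>K. ?a j) = 0" .
  qed
  then have "b = tensor_eval A (tk k)" by simp
  moreover have "sum_list (map dg w) = k" if "tk k w \<noteq> 0" for w
    using that by (auto simp: tk_def split: if_splits)
  ultimately show thesis using that tk by blast
qed

end

locale free_dga_ext = free_dga A dg X + P: plain_dga P
  for A :: "'a::ab_group_add dg_algebra" and dg X and P :: "'p::ab_group_add dg_algebra"
begin

text \<open>A tensor representing \<open>b\<close> is chosen arbitrarily;
  \<open>ext_tensor_eval\<close> shows that the choice does not matter for \<open>v\<close> that
  respects degrees.\<close>

definition ext :: "('a \<Rightarrow> 'p) \<Rightarrow> 'a \<Rightarrow> 'p" where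
  "ext v b = teval P v (SOME t. t \<in> tensors X \<and> tensor_eval A t = b)"

definition admissible :: "('a \<Rightarrow> 'p) \<Rightarrow> bool" where
  "admissible v \<longleftrightarrow> (\<forall>x\<in>X. v x \<in> gr P (dg x))"

text \<open>Two tensors with the same value differ by an element of the commutator ideal, on which
  every evaluation that respects degrees vanishes.\<close>

lemma ext_tensor_eval:
  assumes v: "admissible v" and t: "t \<in> tensors X"
  shows "ext v (tensor_eval A t) = teval P v t"
proof -
  let ?s = "SOME s. s \<in> tensors X \<and> tensor_eval A s = tensor_eval A t"
  have s: "?s \<in> tensors X \<and> tensor_eval A ?s = tensor_eval A t"
    by (rule someI[of _ t]) (use t in blast)
  let ?m = "\<lambda>w. - 1 * t w"
  have m: "?m \<in> tensors X" by (rule T.subspace_scale[OF tensors_subspace t])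
  have d: "?s + ?m \<in> tensors X" using s m T.subspace_add[OF tensors_subspace] by blast
  have "tensor_eval A (?s + ?m) = 0"
    unfolding tensor_eval_eq_teval
    using s teval_add[OF tensors_finite tensors_finite, of ?s X ?m X id] m teval_scale[OF tensors_finite[OF t], of id "-1"]
    by (simp add: tensor_eval_eq_teval)
  then have c: "?s + ?m \<in> commutator_ideal dg X" using d kernel_eq by blast
  have "\<And>x. x \<in> X \<Longrightarrow> v x \<in> gr P (dg x)" using v by (simp add: admissible_def)
  from P.teval_commutator_ideal[OF this c] have "teval P v (?s + ?m) = 0" by (rule conjunct2)
  then have "teval P v ?s = teval P v t"
    using s P.teval_add[OF tensors_finite tensors_finite, of ?s X ?m X v] m P.teval_scale[OF tensors_finite[OF t], of v "-1"]
    by simp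
  then show ?thesis by (simp add: ext_def)
qed

lemma ext_add:
  assumes v: "admissible v" and "b \<in> carr A" "c \<in> carr A"
  shows "ext v (b + c) = ext v b + ext v c"
proof -
  obtain t s where t: "t \<in> tensors X" "b = tensor_eval A t" and s: "s \<in> tensors X" "c = tensor_eval A s"
    using assms carr_eq by blast
  have "b + c = tensor_eval A (t + s)"
    unfolding t s tensor_eval_eq_teval using t s by (simp add: teval_add tensors_finite)
  moreover have "t + s \<in> tensors X" using T.subspace_add[OF tensors_subspace t(1) s(1)] .
  ultimately show ?thesis
    using t s v by (simp add: ext_tensor_eval P.teval_add tensors_finite)
qed

lemma ext_scal:
  assumes v: "admissible v" and "b \<in> carr A"
  shows "ext v (scal A q b) = scal P q (ext v b)"
proof -
  obtain t where t: "t \<in> tensors X" "b = tensor_eval A t" using assms carr_eq by blast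
  have "scal A q b = tensor_eval A (\<lambda>w. q * t w)"
    unfolding t tensor_eval_eq_teval using t by (simp add: teval_scale tensors_finite)
  moreover have "(\<lambda>w. q * t w) \<in> tensors X" using T.subspace_scale[OF tensors_subspace t(1)] .
  ultimately show ?thesis
    using t v by (simp add: ext_tensor_eval P.teval_scale tensors_finite)
qed

lemma ext_word:
  assumes "admissible v" "w \<in> lists X"
  shows "ext v (word A w) = word P (map v w)"
proof -
  have "word A w = tensor_eval A (tensor_unit w)"
    unfolding tensor_eval_eq_teval by (simp add: teval_unit)
  then show ?thesis using assms by (simp add: ext_tensor_eval tensor_unit_tensors P.teval_unit)
qed

lemma ext_0: "admissible v \<Longrightarrow> ext v 0 = 0"
  using ext_add[of v 0 0] carr_closed(1) by simp

lemma admissible_set: "admissible v \<Longrightarrow> w \<in> lists X \<Longrightarrow> set (map v w) \<subseteq> carr P"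
  using P.gr_carr unfolding admissible_def by (auto simp: in_lists_conv_set) 

lemma ext_carr:
  assumes v: "admissible v" and b: "b \<in> carr A"
  shows "ext v b \<in> carr P"
  using b unfolding carr_eq_span
proof (induction b rule: carr_word_induct)
  case zero
  then show ?case using v ext_0 P.carr_closed(1) by simp
next
  case (add q w y)
  have w: "word A w \<in> carr A" using add(1) set_lists_carr carr_word by blast
  have y: "y \<in> carr A" using add(2) by (simp add: carr_eq_span)
  have "ext v (scal A q (word A w) + y) = scal P q (word P (map v w)) + ext v y"
    using v w y add(1) by (simp add: ext_add ext_scal ext_word carr_closed(3))
  moreover have "word P (map v w) \<in> carr P"
    by (rule P.carr_word[OF admissible_set[OF v add(1)]])
  ultimately show ?case using P.carr_closed(2)[OF P.carr_closed(3) add(3)] by simp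
qed

lemma ext_prd:
  assumes v: "admissible v" and b: "b \<in> carr A" and c: "c \<in> carr A"
  shows "ext v (prd A b c) = prd P (ext v b) (ext v c)"
proof -
  have word_c: "ext v (prd A (word A u) c) = prd P (ext v (word A u)) (ext v c)" if u: "u \<in> lists X" for u
    using c unfolding carr_eq_span
  proof (induction c rule: carr_word_induct)
    case zero
    then show ?case using v u ext_0 prd_0 P.prd_0 ext_carr carr_word[OF set_lists_carr[OF u]] by simp
  next
    case (add q w y)
    have U: "word A u \<in> carr A" and w: "word A w \<in> carr A" using u add(1) set_lists_carr carr_word by blast+
    have y: "y \<in> carr A" using add(2) by (simp add: carr_eq_span)
    have uw: "u @ w \<in> lists X" using u add(1) by simp
    have qw: "scal A q (word A w) \<in> carr A" using w by (rule carr_closed(3))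
    have "prd A (word A u) (scal A q (word A w) + y) = scal A q (word A (u @ w)) + prd A (word A u) y"
      using U w y qw u add(1) by (simp add: prd_add prd_scal word_append set_lists_carr)
    then have "ext v (prd A (word A u) (scal A q (word A w) + y))
        = scal P q (word P (map v (u @ w))) + prd P (ext v (word A u)) (ext v y)"
      using v U y uw carr_prd carr_word[OF set_lists_carr[OF uw]] add(3)
      by (simp add: ext_add ext_scal ext_word carr_closed(3) del: map_append)
    also have "word P (map v (u @ w)) = prd P (ext v (word A u)) (ext v (word A w))"
      using P.word_append[OF admissible_set[OF v u] admissible_set[OF v add(1)]] u add(1) v
      by (simp add: ext_word)
    also have "scal P q (prd P (ext v (word A u)) (ext v (word A w))) + prd P (ext v (word A u)) (ext v y)
        = prd P (ext v (word A u)) (ext v (scal A q (word A w) + y))"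
      using v U w y qw by (simp add: ext_add ext_scal P.prd_add P.prd_scal ext_carr P.carr_closed(3))
    finally show ?case .
  qed
  show ?thesis
    using b unfolding carr_eq_span
  proof (induction b rule: carr_word_induct)
    case zero
    then show ?case using v c ext_0 prd_0 P.prd_0 ext_carr by simp
  next
    case (add q w y)
    have w: "word A w \<in> carr A" using add(1) set_lists_carr carr_word by blast
    have y: "y \<in> carr A" using add(2) by (simp add: carr_eq_span)
    have qw: "scal A q (word A w) \<in> carr A" using w by (rule carr_closed(3))
    have "prd A (scal A q (word A w) + y) c = scal A q (prd A (word A w) c) + prd A y c"
      using w y qw c by (simp add: prd_add prd_scal)
    then have "ext v (prd A (scal A q (word A w) + y) c)
        = scal P q (prd P (ext v (word A w)) (ext v c)) + prd P (ext v y) (ext v c)"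
      using v w y c carr_prd word_c[OF add(1)] add(3) by (simp add: ext_add ext_scal carr_closed(3))
    also have "\<dots> = prd P (ext v (scal A q (word A w) + y)) (ext v c)"
      using v w y qw c by (simp add: ext_add ext_scal P.prd_add P.prd_scal ext_carr P.carr_closed(3))
    finally show ?case .
  qed
qed

lemma ext_unt: "admissible v \<Longrightarrow> ext v (unt A) = unt P"
  using ext_word[of v "[]"] by (simp add: word_Nil P.word_Nil)

lemma ext_gen:
  assumes v: "admissible v" and x: "x \<in> X"
  shows "ext v x = v x"
proof -
  have "x \<in> carr A" using gr_carr[OF gen_gr[OF x]] .
  moreover have "v x \<in> gr P (dg x)" using v x by (simp add: admissible_def)
  then have "v x \<in> carr P" by (rule P.gr_carr)
  ultimately show ?thesis
    using ext_word[OF v, of "[x]"] x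
    by (simp add: word_Cons word_Nil P.word_Cons P.word_Nil prd_unt P.prd_unt)
qed

lemma ext_gr:
  assumes v: "admissible v" and b: "b \<in> gr A k"
  shows "ext v b \<in> gr P k"
proof -
  obtain t where t: "t \<in> tensors X" "b = tensor_eval A t" "\<And>w. t w \<noteq> 0 \<Longrightarrow> sum_list (map dg w) = k"
    using homogeneous_tensor[OF b] by blast
  have "word P (map v w) \<in> gr P k" if w: "t w \<noteq> 0" for w
  proof -
    have "w \<in> lists X" using t(1) w by (auto simp: tensors_def)
    then have "sum_list (map dg w) = k \<Longrightarrow> word P (map v w) \<in> gr P k" for k
    proof (induction w arbitrary: k)
      case (Cons x w)
      then have "prd P (v x) (word P (map v w)) \<in> gr P (dg x + sum_list (map dg w))"
        using v unfolding admissible_def by (intro P.prd_gr) auto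
      then show ?case using Cons by (simp add: P.word_Cons)
    qed (use P.unt_gr in \<open>simp add: P.word_Nil\<close>)
    then show ?thesis using t(3)[OF w] by blast
  qed
  then have "teval P v t \<in> gr P k"
    unfolding teval_def by (intro P.gr_sum P.gr_closed(3)) auto
  then show ?thesis using ext_tensor_eval[OF v t(1)] t(2) by simp
qed

text \<open>Values on later generators do not affect the subalgebra generated by the earlier ones.
  This is what allows an assignment to be changed stage by stage.\<close>

lemma ext_cong:
  assumes "admissible v" "admissible v'" "G \<subseteq> X" "\<And>x. x \<in> G \<Longrightarrow> v x = v' x"
    and "b \<in> V.span (word A ` lists G)"
  shows "ext v b = ext v' b"
  using assms(5)
proof (induction b rule: carr_word_induct)
  case zero
  then show ?case using assms by (simp add: ext_0)
next
  case (add q w y)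
  have wX: "w \<in> lists X" using add(1) assms(3) by auto
  have w: "word A w \<in> carr A" using wX set_lists_carr carr_word by blast
  have y: "y \<in> carr A" using add(2) span_words_carr[OF assms(3)] by blast
  have "map v w = map v' w" using add(1) assms(4) by auto
  then have "word P (map v w) = word P (map v' w)" by (rule arg_cong)
  then show ?case
    using assms(1,2) w y wX add(3) carr_closed(3)[OF w] by (simp add: ext_add ext_scal ext_word)
qed

end

subsection \<open>Lifting homomorphisms out of minimal Sullivan algebras\<close>

text \<open>The assumption \<open>lift\<close> is the characteristic property of surjective
  quasi-isomorphisms: over a primitive \<open>c\<close> of \<open>p y\<close> lies a primitive of
  the cocycle \<open>y\<close>.\<close>

locale lift_problem = free_dga_ext A dg X P + C: plain_dga C
  for A :: "'a::ab_group_add dg_algebra" and dg X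
    and P :: "'p::ab_group_add dg_algebra" and C :: "'c::ab_group_add dg_algebra" +
  fixes p :: "'p \<Rightarrow> 'c" and \<psi> :: "'a \<Rightarrow> 'c"
  assumes p: "dga_hom p P C" and \<psi>: "dga_hom \<psi> A C"
    and lift: "y \<in> gr P (Suc k) \<Longrightarrow> dif P y = 0 \<Longrightarrow> c \<in> gr C k \<Longrightarrow> p y = dif C c \<Longrightarrow>
      \<exists>z\<in>gr P k. dif P z = y \<and> p z = c"
begin

text \<open>The assignment is defined on all generators, but compatibility is demanded only on those
  treated so far; elsewhere only the degree is right, which is enough for \<open>ext\<close> to be
  defined and multiplicative.\<close>

definition good :: "('a \<Rightarrow> 'p) \<Rightarrow> 'a set \<Rightarrow> bool" where
  "good v G \<longleftrightarrow> admissible v \<and> (\<forall>x\<in>G. dif P (v x) = ext v (dif A x) \<and> p (v x) = \<psi> x)"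

lemma good_word:
  assumes g: "good v G" and G: "G \<subseteq> X" and w: "w \<in> lists G"
  shows "dif P (word P (map v w)) = ext v (dif A (word A w)) \<and> p (word P (map v w)) = \<psi> (word A w)"
  using w
proof (induction w)
  case Nil
  have v: "admissible v" using g by (simp add: good_def)
  show ?case using v dga_homD(6)[OF p] dga_homD(6)[OF \<psi>] by (simp add: word_Nil P.word_Nil ext_0 dif_unt P.dif_unt)
next
  case (Cons x w)
  have v: "admissible v" using g by (simp add: good_def)
  have x: "x \<in> G" "x \<in> X" and w: "w \<in> lists X" using Cons G by auto
  have xg: "x \<in> gr A (dg x)" and vg: "v x \<in> gr P (dg x)" using x v gen_gr by (auto simp: admissible_def)
  have xc: "x \<in> carr A" and vc: "v x \<in> carr P" using gr_carr[OF xg] P.gr_carr[OF vg] .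
  have W: "word A w \<in> carr A" using carr_word[OF set_lists_carr[OF w]] .
  have PW: "word P (map v w) \<in> carr P" using P.carr_word[OF admissible_set[OF v w]] .
  have wg: "word A w \<in> gr A (sum_list (map dg w))" using w gen_gr by (intro gr_word) auto
  have pwg: "word P (map v w) \<in> gr P (sum_list (map dg w))"
    using ext_gr[OF v wg] ext_word[OF v w] by simp
  have IH: "dif P (word P (map v w)) = ext v (dif A (word A w))" "p (word P (map v w)) = \<psi> (word A w)"
    using Cons.IH by blast+
  have gx: "dif P (v x) = ext v (dif A x)" "p (v x) = \<psi> x" using g x by (auto simp: good_def)
  have dxc: "dif A x \<in> carr A" and dWc: "dif A (word A w) \<in> carr A" using carr_dif xc W by blast+
  have "dif P (word P (map v (x # w))) = prd P (dif P (v x)) (word P (map v w))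
      + scal P ((-1) ^ dg x) (prd P (v x) (dif P (word P (map v w))))"
    using P.leibniz[OF vg pwg] by (simp add: P.word_Cons)
  also have "\<dots> = ext v (prd A (dif A x) (word A w) + scal A ((-1) ^ dg x) (prd A x (dif A (word A w))))"
    unfolding gx IH using v xc W dxc dWc x w
    by (simp add: ext_add ext_scal ext_prd ext_word ext_gen carr_prd carr_closed(3))
  also have "\<dots> = ext v (dif A (word A (x # w)))"
    using leibniz[OF xg wg] by (simp add: word_Cons)
  finally have "dif P (word P (map v (x # w))) = ext v (dif A (word A (x # w)))" .
  moreover have "p (word P (map v (x # w))) = \<psi> (word A (x # w))"
    using dga_homD(3)[OF p vc PW] dga_homD(3)[OF \<psi> xc W] gx IH by (simp add: word_Cons P.word_Cons)
  ultimately show ?case by simp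
qed

lemma good_span:
  assumes g: "good v G" and G: "G \<subseteq> X" and b: "b \<in> V.span (word A ` lists G)"
  shows "dif P (ext v b) = ext v (dif A b) \<and> p (ext v b) = \<psi> b"
  using b
proof (induction b rule: carr_word_induct)
  case zero
  have "admissible v" using g by (simp add: good_def)
  then show ?case
    using dga_hom_0[OF P.dga_axioms p] dga_hom_0[OF dga_axioms \<psi>] by (simp add: ext_0 dif_0 P.dif_0)
next
  case (add q w y)
  have v: "admissible v" using g by (simp add: good_def)
  have wX: "w \<in> lists X" using add(1) G by auto
  have w: "word A w \<in> carr A" using carr_word[OF set_lists_carr[OF wX]] .
  have y: "y \<in> carr A" using add(2) span_words_carr[OF G] by blast
  have pw: "word P (map v w) \<in> carr P" using P.carr_word[OF admissible_set[OF v wX]] .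
  have ey: "ext v y \<in> carr P" using ext_carr[OF v y] .
  have e: "ext v (scal A q (word A w) + y) = scal P q (word P (map v w)) + ext v y"
    using v w y wX by (simp add: ext_add ext_scal ext_word carr_closed(3))
  have d: "dif A (scal A q (word A w) + y) = scal A q (dif A (word A w)) + dif A y"
    using w y by (simp add: dif_add dif_scal carr_closed(3))
  note gw = good_word[OF g G add(1)]
  have "dif P (ext v (scal A q (word A w) + y)) = ext v (dif A (scal A q (word A w) + y))"
    unfolding e d using v w y pw ey gw add(3) carr_dif
    by (simp add: P.dif_add P.dif_scal P.carr_closed(3) ext_add ext_scal carr_closed(3))
  moreover have "p (ext v (scal A q (word A w) + y)) = \<psi> (scal A q (word A w) + y)"
    unfolding e
    using dga_homD(2)[OF p P.carr_closed(3)[OF pw] ey] dga_homD(4)[OF p pw]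
      dga_homD(2)[OF \<psi> carr_closed(3)[OF w] y] dga_homD(4)[OF \<psi> w] gw add(3) by simp
  ultimately show ?case by simp
qed

text \<open>For a new generator \<open>x\<close> the element \<open>ext v (dif A x)\<close> is
  already determined. It is a cocycle whose image under \<open>p\<close> has the primitive
  \<open>\<psi> x\<close>, and \<open>lift\<close> supplies the value at \<open>x\<close>.\<close>

lemma good_extend:
  assumes g: "good v G" and GH: "G \<subseteq> H" "H \<subseteq> X"
    and H: "\<And>x. x \<in> G \<Longrightarrow> dif A x \<in> V.span (word A ` lists G)"
      "\<And>x. x \<in> H \<Longrightarrow> dif A x \<in> V.span (word A ` lists G)"
  shows "\<exists>v'. good v' H \<and> (\<forall>x\<in>G. v' x = v x)"
proof -
  have v: "admissible v" using g by (simp add: good_def)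
  have GX: "G \<subseteq> X" using GH by blast
  have "\<exists>z\<in>gr P (dg x). dif P z = ext v (dif A x) \<and> p z = \<psi> x" if x: "x \<in> H" for x
  proof (rule lift)
    have xg: "x \<in> gr A (dg x)" using x GH gen_gr by blast
    have xc: "x \<in> carr A" using gr_carr[OF xg] .
    show "ext v (dif A x) \<in> gr P (Suc (dg x))" using ext_gr[OF v dif_gr[OF xg]] .
    show "dif P (ext v (dif A x)) = 0"
      using good_span[OF g GX H(2)[OF x]] dif_dif[OF xc] v by (simp add: ext_0)
    show "\<psi> x \<in> gr C (dg x)" using dga_homD(1)[OF \<psi> xg] .
    show "p (ext v (dif A x)) = dif C (\<psi> x)"
      using good_span[OF g GX H(2)[OF x]] dga_homD(5)[OF \<psi> xc] by simp
  qed
  then obtain z where z: "\<And>x. x \<in> H \<Longrightarrow> z x \<in> gr P (dg x) \<and> dif P (z x) = ext v (dif A x) \<and> p (z x) = \<psi> x"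
    by metis
  define v' where "v' = (\<lambda>x. if x \<in> G then v x else if x \<in> H then z x else v x)"
  have v': "admissible v'" using v z by (auto simp: admissible_def v'_def)
  have eq: "ext v' (dif A x) = ext v (dif A x)" if "x \<in> H" for x
    by (rule ext_cong[OF v' v GX _ H(2)[OF that]]) (simp add: v'_def)
  have "dif P (v' x) = ext v' (dif A x) \<and> p (v' x) = \<psi> x" if x: "x \<in> H" for x
    using g z[OF x] eq[OF x] by (cases "x \<in> G") (auto simp: good_def v'_def x)
  then have "good v' H" using v' by (simp add: good_def)
  then show ?thesis by (auto simp: v'_def)
qed

theorem lift_exists:
  assumes F: "mono F" "(\<Union>j::nat. F j) = X" "\<forall>x\<in>F 0. dif A x = 0"
    "\<forall>j. \<forall>x\<in>F (Suc j). dif A x \<in> V.span (word A ` lists (F j))"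
  shows "\<exists>f. dga_hom f A P \<and> (\<forall>b\<in>carr A. p (f b) = \<psi> b)"
proof -
  \<comment> \<open>The filtration shifted by one, with the empty stage in front. The closed
    generators in \<open>F 0\<close> are then added by an ordinary extension step, since zero lies
    in the span of the words in no letters.\<close>
  define H where "H = (\<lambda>j. case j of 0 \<Rightarrow> {} | Suc i \<Rightarrow> F i)"
  have HX: "H j \<subseteq> X" for j using F(2) by (auto simp: H_def split: nat.splits)
  have Hmono: "H j \<subseteq> H (Suc j)" for j
    using monoD[OF F(1)] by (auto simp: H_def split: nat.splits)
  have Hd: "dif A x \<in> V.span (word A ` lists (H j))" if "x \<in> H (Suc j)" for x j
    using F(3,4) that V.span_zero by (auto simp: H_def split: nat.splits)
  have Hd': "dif A x \<in> V.span (word A ` lists (H j))" if "x \<in> H j" for x j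
  proof -
    have "x \<in> H (Suc j)" using Hmono that by blast
    then show ?thesis by (rule Hd)
  qed
  have "\<exists>v. \<forall>j. good (v j) (H j) \<and> (\<forall>x\<in>H j. v (Suc j) x = v j x)"
  proof (rule dependent_nat_choice)
    have "admissible (\<lambda>x. 0)" using P.gr_closed(1) by (simp add: admissible_def)
    then show "\<exists>v. good v (H 0)" by (intro exI[of _ "\<lambda>x. 0"]) (simp add: good_def H_def)
    show "\<exists>v'. good v' (H (Suc j)) \<and> (\<forall>x\<in>H j. v' x = v x)" if "good v (H j)" for v j
      using good_extend[OF that Hmono HX Hd' Hd] .
  qed
  then obtain v where v: "\<And>j. good (v j) (H j)" "\<And>j x. x \<in> H j \<Longrightarrow> v (Suc j) x = v j x" by blast
  have stable: "v (j + i) x = v j x" if "x \<in> H j" for i j x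
  proof (induction i)
    case (Suc i)
    have "H j \<subseteq> H (j + i)" using lift_Suc_mono_le[of H j "j + i"] Hmono by simp
    then show ?case using v(2)[of x "j + i"] that Suc by auto
  qed simp
  \<comment> \<open>Successive assignments agree on the earlier stages, so they are glued by using
    the first stage at which a generator appears.\<close>
  define lv where "lv = (\<lambda>x. LEAST j. x \<in> H j)"
  define u where "u = (\<lambda>x. v (lv x) x)"
  have u: "u x = v j x" if "x \<in> H j" for x j
  proof -
    have "x \<in> H (lv x)" "lv x \<le> j" unfolding lv_def using that by (rule LeastI, rule Least_le)
    then show ?thesis using stable[of x "lv x" "j - lv x"] by (simp add: u_def)
  qed
  have XH: "\<exists>j. x \<in> H j" if x: "x \<in> X" for x
  proof -
    obtain i where "x \<in> F i" using F(2) x by blast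
    then have "x \<in> H (Suc i)" by (simp add: H_def)
    then show ?thesis ..
  qed
  have adm_v: "admissible (v j)" for j using v(1) by (simp add: good_def)
  have adm: "admissible u"
    unfolding admissible_def
  proof
    fix x assume x: "x \<in> X"
    then obtain j where "x \<in> H j" using XH by blast
    then show "u x \<in> gr P (dg x)" using adm_v[of j] x u by (simp add: admissible_def)
  qed
  have "good u X"
    unfolding good_def
  proof (intro conjI ballI adm)
    fix x assume x: "x \<in> X"
    obtain j where j: "x \<in> H j" using XH[OF x] by blast
    have e: "ext u (dif A x) = ext (v j) (dif A x)"
      by (rule ext_cong[OF adm adm_v HX _ Hd'[OF j]]) (rule u)
    show "dif P (u x) = ext u (dif A x)" "p (u x) = \<psi> x"
      using v(1)[of j] j unfolding e u[OF j] by (auto simp: good_def)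
  qed
  then have G: "dif P (ext u b) = ext u (dif A b) \<and> p (ext u b) = \<psi> b" if "b \<in> carr A" for b
    using good_span[of u X b] that by (simp add: carr_eq_span)
  have "dga_hom (ext u) A P"
    unfolding dga_hom_def using G adm
    by (auto simp: ext_add ext_prd ext_scal ext_unt intro: ext_gr)
  then show ?thesis using G by blast
qed

end

context plain_dga
begin

lemma prd_minus:
  assumes "x \<in> carr A" "y \<in> carr A"
  shows "prd A (- x) y = - prd A x y" "prd A x (- y) = - prd A x y"
  using prd_scal(1)[OF assms, of "-1"] prd_scal(2)[OF assms, of "-1"] by (simp_all add: V.scale_minus_left)

lemma scal_neg_one_power:
  "scal A ((-1) ^ k) x = (if even k then x else - x)"
  by (simp add: V.scale_minus_left)

end

section \<open>Constructions of dgas leading to paths\<close>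

subsection \<open>Subalgebras, products and powers\<close>

text \<open>Only the graded pieces are replaced; the carrier shrinks with them because
  \<open>carr\<close> is their span.\<close>

definition sub_dga :: "'a dg_algebra \<Rightarrow> (nat \<Rightarrow> 'a set) \<Rightarrow> 'a dg_algebra" where
  "sub_dga D G = D\<lparr>gr := G\<rparr>"

lemma sub_dga_sel [simp]:
  "scal (sub_dga D G) = scal D" "gr (sub_dga D G) = G" "prd (sub_dga D G) = prd D"
  "unt (sub_dga D G) = unt D" "dif (sub_dga D G) = dif D"
  by (simp_all add: sub_dga_def)

lemma dga_sub:
  assumes D: "dga D" and sub: "\<And>k. G k \<subseteq> gr D k"
    and sp: "\<And>k. module.subspace (scal D) (G k)"
    and u: "unt D \<in> G 0"
    and p: "\<And>x y i j. x \<in> G i \<Longrightarrow> y \<in> G j \<Longrightarrow> prd D x y \<in> G (i + j)"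
    and d: "\<And>x k. x \<in> G k \<Longrightarrow> dif D x \<in> G (Suc k)"
  shows "dga (sub_dga D G)"
proof -
  interpret D: plain_dga D by (rule plain_dga.intro[OF D])
  have c: "carr (sub_dga D G) \<subseteq> carr D"
    unfolding carr_def using sub by (simp, intro D.V.span_mono) blast
  have g: "x \<in> gr D k" if "x \<in> G k" for x k using sub that by blast
  have cD: "x \<in> carr D" if "x \<in> carr (sub_dga D G)" for x using c that by blast
  show ?thesis
    apply (rule dga.intro; (unfold sub_dga_sel)?)
    subgoal by (rule D.vector_space)
    subgoal by (rule sp)
    subgoal for K a k by (rule D.direct[of K a k]) (auto intro: g)
    subgoal by (rule u)
    subgoal by (rule p)
    subgoal by (rule D.prd_assoc; rule cD)
    subgoal by (rule D.prd_unt; rule cD)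
    subgoal by (rule D.prd_unt; rule cD)
    subgoal by (rule D.prd_add; rule cD)
    subgoal by (rule D.prd_add; rule cD)
    subgoal by (rule D.prd_scal; rule cD)
    subgoal by (rule D.prd_scal; rule cD)
    subgoal by (rule D.graded_comm; rule g)
    subgoal by (rule d)
    subgoal by (rule D.dif_add; rule cD)
    subgoal by (rule D.dif_scal; rule cD)
    subgoal by (rule D.dif_dif; rule cD)
    subgoal by (rule D.leibniz; rule g)
    done
qed

definition prod_dga :: "'a dg_algebra \<Rightarrow> 'b dg_algebra \<Rightarrow> ('a \<times> 'b) dg_algebra" where
  "prod_dga A B = \<lparr>scal = (\<lambda>q x. (scal A q (fst x), scal B q (snd x))), gr = (\<lambda>k. gr A k \<times> gr B k),
     prd = (\<lambda>x y. (prd A (fst x) (fst y), prd B (snd x) (snd y))), unt = (unt A, unt B),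
     dif = (\<lambda>x. (dif A (fst x), dif B (snd x)))\<rparr>"

lemma prod_dga_sel [simp]:
  "scal (prod_dga A B) = (\<lambda>q x. (scal A q (fst x), scal B q (snd x)))"
  "gr (prod_dga A B) = (\<lambda>k. gr A k \<times> gr B k)"
  "prd (prod_dga A B) = (\<lambda>x y. (prd A (fst x) (fst y), prd B (snd x) (snd y)))"
  "unt (prod_dga A B) = (unt A, unt B)" "dif (prod_dga A B) = (\<lambda>x. (dif A (fst x), dif B (snd x)))"
  by (simp_all add: prod_dga_def)

lemma dga_prod:
  assumes "dga A" "dga B"
  shows "dga (prod_dga A B)"
proof -
  interpret A: plain_dga A by (rule plain_dga.intro[OF assms(1)])
  interpret B: plain_dga B by (rule plain_dga.intro[OF assms(2)])
  interpret V: vector_space "scal (prod_dga A B)"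
    by unfold_locales (auto simp: A.V.scale_right_distrib B.V.scale_right_distrib
      A.V.scale_left_distrib B.V.scale_left_distrib)
  have "V.subspace (carr A \<times> carr B)"
    unfolding V.subspace_def by (auto simp: zero_prod_def A.carr_closed B.carr_closed)
  moreover have "(\<Union>k. gr (prod_dga A B) k) \<subseteq> carr A \<times> carr B"
    using A.gr_carr B.gr_carr by auto
  ultimately have c: "carr (prod_dga A B) \<subseteq> carr A \<times> carr B"
    unfolding carr_def[of "prod_dga A B"] by (intro V.span_minimal)
  have c1: "fst x \<in> carr A" and c2: "snd x \<in> carr B" if "x \<in> carr (prod_dga A B)" for x
    using c that by auto
  have g1: "fst x \<in> gr A k" and g2: "snd x \<in> gr B k" if "x \<in> gr (prod_dga A B) k" for x k
    using that by auto
  show ?thesis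
  proof (rule dga.intro)
    show "Vector_Spaces.vector_space (scal (prod_dga A B))" by (rule V.vector_space_axioms)
    show "V.subspace (gr (prod_dga A B) k)" for k
      unfolding V.subspace_def by (auto simp: zero_prod_def A.gr_closed B.gr_closed)
    show "a k = 0" if K: "finite K" "\<forall>k\<in>K. a k \<in> gr (prod_dga A B) k" "(\<Sum>k\<in>K. a k) = 0" "k \<in> K" for K k a
    proof -
      have "(\<Sum>k\<in>K. fst (a k)) = 0" "(\<Sum>k\<in>K. snd (a k)) = 0"
        using arg_cong[OF K(3), of fst] arg_cong[OF K(3), of snd] by (simp_all add: fst_sum snd_sum)
      moreover have "\<forall>k\<in>K. fst (a k) \<in> gr A k" "\<forall>k\<in>K. snd (a k) \<in> gr B k" using K(2) by (auto simp: mem_Times_iff)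
      ultimately have "fst (a k) = 0" "snd (a k) = 0"
        using A.direct[OF K(1) _ _ K(4), of "\<lambda>k. fst (a k)"] B.direct[OF K(1) _ _ K(4), of "\<lambda>k. snd (a k)"] by auto
      then show ?thesis by (simp add: prod_eq_iff)
    qed
    show "prd (prod_dga A B) x y \<in> gr (prod_dga A B) (i + j)"
      if "x \<in> gr (prod_dga A B) i" "y \<in> gr (prod_dga A B) j" for x y i j
      using A.prd_gr[OF g1[OF that(1)] g1[OF that(2)]] B.prd_gr[OF g2[OF that(1)] g2[OF that(2)]] by simp
    show "prd (prod_dga A B) x y = scal (prod_dga A B) ((-1) ^ (i * j)) (prd (prod_dga A B) y x)"
      if "x \<in> gr (prod_dga A B) i" "y \<in> gr (prod_dga A B) j" for x y i j
      using A.graded_comm[OF g1[OF that(1)] g1[OF that(2)]] B.graded_comm[OF g2[OF that(1)] g2[OF that(2)]]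
      by (simp only: prod_dga_sel fst_conv snd_conv)
    show "dif (prod_dga A B) (prd (prod_dga A B) x y) = prd (prod_dga A B) (dif (prod_dga A B) x) y
        + scal (prod_dga A B) ((-1) ^ i) (prd (prod_dga A B) x (dif (prod_dga A B) y))"
      if "x \<in> gr (prod_dga A B) i" "y \<in> gr (prod_dga A B) j" for x y i j
      using A.leibniz[OF g1[OF that(1)] g1[OF that(2)]] B.leibniz[OF g2[OF that(1)] g2[OF that(2)]]
      by (simp only: prod_dga_sel fst_conv snd_conv add_Pair)
    show "dif (prod_dga A B) x \<in> gr (prod_dga A B) (Suc k)" if "x \<in> gr (prod_dga A B) k" for x k
      using A.dif_gr[OF g1[OF that]] B.dif_gr[OF g2[OF that]] by simp
  qed (simp_all add: prod_eq_iff c1 c2 A.unt_gr B.unt_gr A.prd_assoc B.prd_assoc A.prd_unt B.prd_unt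
      A.prd_add B.prd_add A.prd_scal B.prd_scal A.dif_add B.dif_add A.dif_scal B.dif_scal
      A.dif_dif B.dif_dif)
qed

definition fun_dga :: "'a dg_algebra \<Rightarrow> ('i \<Rightarrow> 'a) dg_algebra" where
  "fun_dga A = \<lparr>scal = (\<lambda>q f i. scal A q (f i)), gr = (\<lambda>k. {f. \<forall>i. f i \<in> gr A k}),
     prd = (\<lambda>f g i. prd A (f i) (g i)), unt = (\<lambda>i. unt A), dif = (\<lambda>f i. dif A (f i))\<rparr>"

lemma fun_dga_sel [simp]:
  "scal (fun_dga A) = (\<lambda>q f i. scal A q (f i))" "gr (fun_dga A) = (\<lambda>k. {f. \<forall>i. f i \<in> gr A k})"
  "prd (fun_dga A) = (\<lambda>f g i. prd A (f i) (g i))" "unt (fun_dga A) = (\<lambda>i. unt A)"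
  "dif (fun_dga A) = (\<lambda>f i. dif A (f i))"
  by (simp_all add: fun_dga_def)

lemma dga_fun:
  assumes "dga A"
  shows "dga (fun_dga A :: ('i \<Rightarrow> 'a::ab_group_add) dg_algebra)"
proof -
  let ?F = "fun_dga A :: ('i \<Rightarrow> 'a) dg_algebra"
  interpret A: plain_dga A by (rule plain_dga.intro[OF assms])
  interpret V: vector_space "scal ?F"
    by unfold_locales (auto simp: fun_eq_iff A.V.scale_right_distrib A.V.scale_left_distrib)
  have "V.subspace {f. \<forall>i. f i \<in> carr A}"
    unfolding V.subspace_def by (auto simp: A.carr_closed)
  moreover have "(\<Union>k. gr ?F k) \<subseteq> {f. \<forall>i. f i \<in> carr A}"
    using A.gr_carr by auto
  ultimately have "carr ?F \<subseteq> {f. \<forall>i. f i \<in> carr A}"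
    unfolding carr_def[of ?F] by (intro V.span_minimal)
  then have c: "f i \<in> carr A" if "f \<in> carr ?F" for f i
    using that by auto
  have g: "f i \<in> gr A k" if "f \<in> gr ?F k" for f i k
    using that by auto
  show ?thesis
  proof (rule dga.intro)
    show "Vector_Spaces.vector_space (scal ?F)" by (rule V.vector_space_axioms)
    show "V.subspace (gr ?F k)" for k
      unfolding V.subspace_def by (auto simp: A.gr_closed)
    show "a k = 0" if K: "finite K" "\<forall>k\<in>K. a k \<in> gr ?F k" "(\<Sum>k\<in>K. a k) = 0" "k \<in> K" for K k a
    proof
      fix i
      have "(\<Sum>k\<in>K. a k i) = 0"
        using fun_cong[OF K(3), of i] by (simp add: sum_fun_apply)
      moreover have "\<forall>k\<in>K. a k i \<in> gr A k" using K(2) by auto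
      ultimately have "a k i = 0"
        using A.direct[OF K(1) _ _ K(4), of "\<lambda>k. a k i"] by auto
      then show "a k i = 0 i" by simp
    qed
    show "prd ?F x y = scal ?F ((-1) ^ (i * j)) (prd ?F y x)" if "x \<in> gr ?F i" "y \<in> gr ?F j" for x y i j
      using that A.graded_comm by (auto simp: fun_eq_iff)
    show "dif ?F (prd ?F x y) = prd ?F (dif ?F x) y + scal ?F ((-1) ^ i) (prd ?F x (dif ?F y))"
      if "x \<in> gr ?F i" "y \<in> gr ?F j" for x y i j
      using that by (intro ext) (simp add: A.leibniz[of _ i _ j])
  qed (auto simp: fun_eq_iff c A.unt_gr A.prd_gr A.prd_assoc A.prd_unt
      A.prd_add A.prd_scal A.dif_gr A.dif_add A.dif_scal A.dif_dif)
qed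

subsection \<open>Polynomial paths\<close>

text \<open>\<open>\<tau>\<close> is the grading involution; it has to be linear on the whole ambient space, so that it can occur
  in the product of triples below.\<close>

locale signed_dga = plain_dga A for A :: "'a::ab_group_add dg_algebra" +
  fixes \<tau> :: "'a \<Rightarrow> 'a"
  assumes tau_add: "\<tau> (x + y) = \<tau> x + \<tau> y"
    and tau_scal: "\<tau> (scal A q x) = scal A q (\<tau> x)"
    and tau_gr: "x \<in> gr A k \<Longrightarrow> \<tau> x = scal A ((-1) ^ k) x"
begin

lemma tau_0 [simp]: "\<tau> 0 = 0"
  using tau_add[of 0 0] by simp

lemma tau_carr: "x \<in> carr A \<Longrightarrow> \<tau> x \<in> carr A"
proof (induction x rule: carr_induct)
  case (add k x y)
  have "\<tau> x \<in> carr A" using tau_gr[OF add(1)] carr_closed(3)[OF gr_carr[OF add(1)]] by simp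
  then show ?case using carr_closed(2)[OF _ add(3)] by (simp add: tau_add)
qed (simp add: carr_closed(1))

lemma tau_in_gr: "x \<in> gr A k \<Longrightarrow> \<tau> x \<in> gr A k"
  by (simp add: tau_gr gr_closed(3))

lemma tau_prd:
  assumes "x \<in> carr A" "y \<in> carr A"
  shows "\<tau> (prd A x y) = prd A (\<tau> x) (\<tau> y)"
  using assms(1)
proof (induction x rule: carr_induct)
  case (add k x x')
  have x: "x \<in> carr A" using gr_carr[OF add(1)] .
  have "\<tau> (prd A x y) = prd A (\<tau> x) (\<tau> y)"
    using assms(2)
  proof (induction y rule: carr_induct)
    case (add l y y')
    have y: "y \<in> carr A" using gr_carr[OF add(1)] .
    have "\<tau> (prd A x y) = prd A (\<tau> x) (\<tau> y)"
      unfolding tau_gr[OF add(1)] tau_gr[OF \<open>x \<in> gr A k\<close>] tau_gr[OF prd_gr[OF \<open>x \<in> gr A k\<close> add(1)]] scal_neg_one_power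
      using x y carr_closed(4) by (auto simp: prd_minus)
    then show ?case using add x y tau_carr by (simp add: tau_add prd_add)
  qed (simp add: x prd_0 tau_carr)
  then show ?case using add x assms(2) tau_carr by (simp add: tau_add prd_add)
qed (simp add: prd_0 assms tau_carr)

text \<open>The coefficients of \<open>dt\<close> in total degree \<open>k\<close>, which have
  degree \<open>k - 1\<close>. Degree zero is treated separately because \<open>0 - 1\<close> is
  \<open>0\<close> on naturals.\<close>

definition grm :: "nat \<Rightarrow> 'a set" where
  "grm k = (if k = 0 then {0} else gr A (k - 1))"

lemma grm_closed:
  "0 \<in> grm k" "x \<in> grm k \<Longrightarrow> y \<in> grm k \<Longrightarrow> x + y \<in> grm k" "x \<in> grm k \<Longrightarrow> scal A q x \<in> grm k"
  "x \<in> grm k \<Longrightarrow> - x \<in> grm k" "x \<in> grm k \<Longrightarrow> y \<in> grm k \<Longrightarrow> x - y \<in> grm k"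
  by (auto simp: grm_def gr_closed)

lemma grm_carr: "x \<in> grm k \<Longrightarrow> x \<in> carr A"
  by (auto simp: grm_def carr_closed(1) gr_carr split: if_splits)

lemma grm_dif: "x \<in> grm k \<Longrightarrow> dif A x \<in> gr A k"
  using dif_gr[of x "k - 1"] by (auto simp: grm_def dif_0 gr_closed(1) split: if_splits)

lemma grm_prd:
  "x \<in> gr A i \<Longrightarrow> y \<in> grm j \<Longrightarrow> prd A x y \<in> grm (i + j)"
  "y \<in> grm j \<Longrightarrow> x \<in> gr A i \<Longrightarrow> prd A y x \<in> grm (j + i)"
  using prd_gr[of x i y "j - 1"] prd_gr[of y "j - 1" x i] gr_carr[of x i]
  by (auto simp: grm_def prd_0 gr_closed(1) split: if_splits)

text \<open>A triple \<open>(c, c', e)\<close> stands for the value at some point of a path \<open>c + dt e\<close>, together with the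
  value \<open>c'\<close> of the derivative of \<open>c\<close>.\<close>

definition triple_dga :: "('a \<times> 'a \<times> 'a) dg_algebra" where
  "triple_dga = \<lparr>scal = (\<lambda>q (x, x', e). (scal A q x, scal A q x', scal A q e)),
     gr = (\<lambda>k. gr A k \<times> gr A k \<times> grm k),
     prd = (\<lambda>(x, x', e) (y, y', f). (prd A x y, prd A x' y + prd A x y', prd A e y + prd A (\<tau> x) f)),
     unt = (unt A, 0, 0),
     dif = (\<lambda>(x, x', e). (dif A x, dif A x', x' - dif A e))\<rparr>"

lemma triple_sel [simp]:
  "scal triple_dga q (x, x', e) = (scal A q x, scal A q x', scal A q e)"
  "gr triple_dga k = gr A k \<times> gr A k \<times> grm k"
  "prd triple_dga (x, x', e) (y, y', f) = (prd A x y, prd A x' y + prd A x y', prd A e y + prd A (\<tau> x) f)"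
  "unt triple_dga = (unt A, 0, 0)"
  "dif triple_dga (x, x', e) = (dif A x, dif A x', x' - dif A e)"
  by (simp_all add: triple_dga_def)

text \<open>The coefficient of \<open>dt\<close> in the graded commutativity of paths. As
  \<open>dt\<close> has degree one, \<open>x dt f\<close> equals \<open>dt (\<tau> x) f\<close>,
  which explains the term with \<open>\<tau>\<close>; moreover \<open>e\<close> and \<open>f\<close>
  have degree one less than \<open>x\<close> and \<open>y\<close>.\<close>

lemma triple_graded_comm:
  assumes "x \<in> gr A i" "e \<in> grm i" "y \<in> gr A j" "f \<in> grm j"
  shows "prd A e y + prd A (\<tau> x) f = scal A ((-1) ^ (i * j)) (prd A f x + prd A (\<tau> y) e)"
proof -
  have ca: "x \<in> carr A" "y \<in> carr A" "e \<in> carr A" "f \<in> carr A"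
    using assms gr_carr grm_carr by blast+
  have e: "prd A e y = scal A ((-1) ^ (i * j)) (prd A (\<tau> y) e)"
  proof (cases i)
    case 0
    then have "e = 0" using assms by (simp add: grm_def)
    then show ?thesis using ca tau_carr by (simp add: prd_0)
  next
    case (Suc i')
    then have "e \<in> gr A i'" using assms by (simp add: grm_def)
    from graded_comm[OF this assms(3)] show ?thesis
      unfolding tau_gr[OF assms(3)] scal_neg_one_power using ca Suc by (auto simp: prd_minus)
  qed
  have f: "prd A (\<tau> x) f = scal A ((-1) ^ (i * j)) (prd A f x)"
  proof (cases j)
    case 0
    then have "f = 0" using assms by (simp add: grm_def)
    then show ?thesis using ca tau_carr by (simp add: prd_0)
  next
    case (Suc j')
    then have "f \<in> gr A j'" using assms by (simp add: grm_def)
    from graded_comm[OF assms(1) this] show ?thesis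
      unfolding tau_gr[OF assms(1)] scal_neg_one_power using ca Suc by (auto simp: prd_minus)
  qed
  show ?thesis unfolding e f by (simp add: V.scale_right_distrib add.commute)
qed

text \<open>The coefficient of \<open>dt\<close> in the Leibniz rule for paths: the derivative in
  \<open>t\<close> obeys the product rule, and \<open>d (dt e)\<close> is \<open>- dt (d e)\<close>.
  The case distinction on parity turns \<open>\<tau>\<close> into explicit signs.\<close>

lemma triple_leibniz:
  assumes "x \<in> gr A i" "x' \<in> gr A i" "e \<in> grm i" "y \<in> gr A j" "y' \<in> gr A j" "f \<in> grm j"
  shows "(prd A x' y + prd A x y') - dif A (prd A e y + prd A (\<tau> x) f)
    = (prd A (x' - dif A e) y + prd A (\<tau> (dif A x)) f)
      + scal A ((-1) ^ i) (prd A e (dif A y) + prd A (\<tau> x) (y' - dif A f))"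
proof -
  have ca: "x \<in> carr A" "y \<in> carr A" "e \<in> carr A" "f \<in> carr A" "x' \<in> carr A" "y' \<in> carr A"
    using assms gr_carr grm_carr by blast+
  note cs = ca carr_dif carr_prd carr_closed tau_carr
  have ey: "dif A (prd A e y) = prd A (dif A e) y - scal A ((-1) ^ i) (prd A e (dif A y))"
  proof (cases i)
    case 0
    then have "e = 0" using assms by (simp add: grm_def)
    then show ?thesis using cs by (simp add: prd_0 dif_0)
  next
    case (Suc i')
    then have "e \<in> gr A i'" using assms by (simp add: grm_def)
    from leibniz[OF this assms(4)] show ?thesis
      unfolding scal_neg_one_power using Suc by auto
  qed
  have xf: "dif A (prd A x f) = prd A (dif A x) f + scal A ((-1) ^ i) (prd A x (dif A f))"
  proof (cases j)
    case 0
    then have "f = 0" using assms by (simp add: grm_def)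
    then show ?thesis using cs by (simp add: prd_0 dif_0)
  next
    case (Suc j')
    then have "f \<in> gr A j'" using assms by (simp add: grm_def)
    from leibniz[OF assms(1) this] show ?thesis .
  qed
  have sub: "prd A (u - v) w = prd A u w - prd A v w" "prd A w (u - v) = prd A w u - prd A w v"
    if "u \<in> carr A" "v \<in> carr A" "w \<in> carr A" for u v w
    using prd_add(1)[of u "- v" w] prd_add(2)[of w u "- v"] that carr_closed(4) by (simp_all add: prd_minus)
  show ?thesis
  proof (cases "even i")
    case True
    then have t: "\<tau> x = x" "\<tau> (dif A x) = - dif A x"
      using tau_gr[OF assms(1)] tau_gr[OF dif_gr[OF assms(1)]] by (simp_all add: scal_neg_one_power)
    show ?thesis
      unfolding t using True cs ey xf by (simp add: dif_add sub prd_minus scal_neg_one_power)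
  next
    case False
    then have t: "\<tau> x = - x" "\<tau> (dif A x) = dif A x"
      using tau_gr[OF assms(1)] tau_gr[OF dif_gr[OF assms(1)]] by (simp_all add: scal_neg_one_power)
    show ?thesis
      unfolding t using False cs ey xf
      by (simp add: dif_add sub prd_minus scal_neg_one_power carr_minus_simps)
  qed
qed

lemma dga_triple: "dga triple_dga"
proof -
  interpret W: vector_space "scal triple_dga"
    by unfold_locales (auto simp: V.scale_right_distrib V.scale_left_distrib)
  have "W.subspace (carr A \<times> carr A \<times> carr A)"
    unfolding W.subspace_def by (auto simp: zero_prod_def carr_closed)
  moreover have "(\<Union>k. gr triple_dga k) \<subseteq> carr A \<times> carr A \<times> carr A"
    using gr_carr grm_carr by auto
  ultimately have "carr triple_dga \<subseteq> carr A \<times> carr A \<times> carr A"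
    unfolding carr_def[of triple_dga] by (intro W.span_minimal)
  then have c: "t \<in> carr triple_dga \<Longrightarrow> t \<in> carr A \<times> carr A \<times> carr A" for t by blast
  note cs = carr_dif carr_prd carr_closed tau_carr
  show ?thesis
  proof (rule dga.intro)
    show "Vector_Spaces.vector_space (scal triple_dga)" by (rule W.vector_space_axioms)
    show "W.subspace (gr triple_dga k)" for k
      unfolding W.subspace_def by (auto simp: zero_prod_def gr_closed grm_closed)
    show "a k = 0" if K: "finite K" "\<forall>k\<in>K. a k \<in> gr triple_dga k" "(\<Sum>k\<in>K. a k) = 0" "k \<in> K" for K k a
    proof -
      have m: "fst (a k) \<in> gr A k" "fst (snd (a k)) \<in> gr A k" "snd (snd (a k)) \<in> grm k" if "k \<in> K" for k
        using K(2) that by (auto simp: mem_Times_iff)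
      have s: "(\<Sum>k\<in>K. fst (a k)) = 0" "(\<Sum>k\<in>K. fst (snd (a k))) = 0" "(\<Sum>k\<in>K. snd (snd (a k))) = 0"
        using arg_cong[OF K(3), of fst] arg_cong[OF K(3), of "\<lambda>t. fst (snd t)"]
          arg_cong[OF K(3), of "\<lambda>t. snd (snd t)"] by (simp_all add: fst_sum snd_sum)
      have 1: "fst (a k) = 0" using direct[OF K(1) _ s(1) K(4)] m by blast
      have 2: "fst (snd (a k)) = 0" using direct[OF K(1) _ s(2) K(4)] m by blast
      have 3: "snd (snd (a k)) = 0"
      proof (cases k)
        case 0
        then show ?thesis using m(3)[OF K(4)] by (simp add: grm_def)
      next
        case (Suc l)
        \<comment> \<open>The third components lie one degree lower, so directness is applied after
          reindexing by \<open>Suc\<close>; index 0 may be dropped because its third component is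
          zero.\<close>
        let ?L = "{l. Suc l \<in> K}"
        have fL: "finite ?L" by (rule finite_subset[of _ "(\<lambda>k. k - 1) ` K"]) (use K(1) in \<open>auto intro!: image_eqI[of _ _ "Suc _"]\<close>)
        have inj: "inj_on Suc ?L" by simp
        have "(\<Sum>l\<in>?L. snd (snd (a (Suc l)))) = (\<Sum>k\<in>Suc ` ?L. snd (snd (a k)))"
          by (simp add: sum.reindex[OF inj])
        also have "\<dots> = (\<Sum>k\<in>K. snd (snd (a k)))"
        proof (rule sum.mono_neutral_left[OF K(1)])
          show "\<forall>i\<in>K - Suc ` ?L. snd (snd (a i)) = 0"
          proof
            fix i assume i: "i \<in> K - Suc ` ?L"
            then have "i = 0" by (cases i) auto
            then show "snd (snd (a i)) = 0" using m(3)[of i] i by (simp add: grm_def)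
          qed
        qed auto
        finally have "(\<Sum>l\<in>?L. snd (snd (a (Suc l)))) = 0" using s(3) by simp
        moreover have "\<forall>l\<in>?L. snd (snd (a (Suc l))) \<in> gr A l"
          using m(3) by (force simp: grm_def)
        ultimately show ?thesis
          using direct[OF fL, of "\<lambda>l. snd (snd (a (Suc l)))" l] K(4) Suc by simp
      qed
      show ?thesis using 1 2 3 by (simp add: prod_eq_iff)
    qed
    show "unt triple_dga \<in> gr triple_dga 0" by (simp add: unt_gr gr_closed grm_closed)
    show "prd triple_dga s t \<in> gr triple_dga (i + j)" if "s \<in> gr triple_dga i" "t \<in> gr triple_dga j" for s t i j
      using that by (auto simp: prd_gr gr_closed grm_closed grm_prd tau_in_gr)
    show "prd triple_dga (prd triple_dga s t) r = prd triple_dga s (prd triple_dga t r)"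
      if "s \<in> carr triple_dga" "t \<in> carr triple_dga" "r \<in> carr triple_dga" for s t r
      using c[OF that(1)] c[OF that(2)] c[OF that(3)]
      by (auto simp: cs prd_assoc prd_add tau_prd add.assoc)
    show "prd triple_dga (unt triple_dga) s = s" "prd triple_dga s (unt triple_dga) = s" if "s \<in> carr triple_dga" for s
      using c[OF that] tau_gr[OF unt_gr] by (auto simp: cs prd_unt prd_0 carr_unt)
    show "prd triple_dga (s + t) r = prd triple_dga s r + prd triple_dga t r"
      if "s \<in> carr triple_dga" "t \<in> carr triple_dga" "r \<in> carr triple_dga" for s t r
      using c[OF that(1)] c[OF that(2)] c[OF that(3)] by (auto simp: cs prd_add tau_add)
    show "prd triple_dga s (t + r) = prd triple_dga s t + prd triple_dga s r"
      if "s \<in> carr triple_dga" "t \<in> carr triple_dga" "r \<in> carr triple_dga" for s t r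
      using c[OF that(1)] c[OF that(2)] c[OF that(3)] by (auto simp: cs prd_add tau_add)
    show "prd triple_dga (scal triple_dga q s) t = scal triple_dga q (prd triple_dga s t)"
      "prd triple_dga s (scal triple_dga q t) = scal triple_dga q (prd triple_dga s t)"
      if "s \<in> carr triple_dga" "t \<in> carr triple_dga" for s t q
      using c[OF that(1)] c[OF that(2)] by (auto simp: cs prd_scal tau_scal V.scale_right_distrib)
    show "prd triple_dga s t = scal triple_dga ((-1) ^ (i * j)) (prd triple_dga t s)"
      if st: "s \<in> gr triple_dga i" "t \<in> gr triple_dga j" for s t i j
    proof -
      obtain x x' e y y' f where s: "s = (x, x', e)" and t: "t = (y, y', f)" by (metis surj_pair)
      have m: "x \<in> gr A i" "x' \<in> gr A i" "e \<in> grm i" "y \<in> gr A j" "y' \<in> gr A j" "f \<in> grm j"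
        using st by (auto simp: s t)
      show ?thesis
        unfolding s t triple_sel triple_graded_comm[OF m(1,3,4,6)] graded_comm[OF m(1,4)]
          graded_comm[OF m(2,4)] graded_comm[OF m(1,5)]
        by (simp add: V.scale_right_distrib add.commute)
    qed
    show "dif triple_dga s \<in> gr triple_dga (Suc k)" if "s \<in> gr triple_dga k" for s k
      using that grm_dif gr_closed(5) by (auto simp: dif_gr grm_def)
    show "dif triple_dga (s + t) = dif triple_dga s + dif triple_dga t"
      if "s \<in> carr triple_dga" "t \<in> carr triple_dga" for s t
      using c[OF that(1)] c[OF that(2)] by (auto simp: dif_add)
    show "dif triple_dga (scal triple_dga q s) = scal triple_dga q (dif triple_dga s)"
      if "s \<in> carr triple_dga" for s q
      using c[OF that(1)] by (auto simp: dif_scal V.scale_right_diff_distrib)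
    show "dif triple_dga (dif triple_dga s) = 0" if "s \<in> carr triple_dga" for s
      using c[OF that] by (auto simp: dif_dif zero_prod_def carr_minus_simps cs)
    show "dif triple_dga (prd triple_dga s t) = prd triple_dga (dif triple_dga s) t
        + scal triple_dga ((-1) ^ i) (prd triple_dga s (dif triple_dga t))"
      if st: "s \<in> gr triple_dga i" "t \<in> gr triple_dga j" for s t i j
    proof -
      obtain x x' e y y' f where s: "s = (x, x', e)" and t: "t = (y, y', f)" by (metis surj_pair)
      have m: "x \<in> gr A i" "x' \<in> gr A i" "e \<in> grm i" "y \<in> gr A j" "y' \<in> gr A j" "f \<in> grm j"
        using st by (auto simp: s t)
      have "dif A (prd A x' y + prd A x y') = (prd A (dif A x') y + prd A (dif A x) y')
          + scal A ((-1) ^ i) (prd A x' (dif A y) + prd A x (dif A y'))"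
        using m gr_carr by (simp add: dif_add carr_prd leibniz[of _ i _ j] V.scale_right_distrib)
      then show ?thesis
        unfolding s t using triple_leibniz[OF m] leibniz[OF m(1,4)] by simp
    qed
  qed
qed

end

subsection \<open>Cohomology classes and their representatives\<close>

context plain_dga
begin

lemma cobounds_gr: "x \<in> cobounds A k \<Longrightarrow> x \<in> gr A k"
  using dif_gr[of _ "k - 1"] by (auto simp: cobounds_def gr_closed(1) split: if_splits)

lemma cobounds_dif: "x \<in> gr A k \<Longrightarrow> dif A x \<in> cobounds A (Suc k)"
  by (simp add: cobounds_def)

lemma cobounds_cocycles: "x \<in> cobounds A k \<Longrightarrow> x \<in> cocycles A k"
  using cobounds_gr[of x k] by (auto simp: cocycles_def cobounds_def dif_0 dif_dif gr_carr split: if_splits)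

lemma cobounds_closed:
  "0 \<in> cobounds A k" "x \<in> cobounds A k \<Longrightarrow> y \<in> cobounds A k \<Longrightarrow> x + y \<in> cobounds A k"
  "x \<in> cobounds A k \<Longrightarrow> scal A q x \<in> cobounds A k"
  "x \<in> cobounds A k \<Longrightarrow> - x \<in> cobounds A k"
proof -
  show "0 \<in> cobounds A k"
    unfolding cobounds_def using image_eqI[of 0 "dif A" 0 "gr A (k - 1)"] dif_0 gr_closed(1) by auto
  show "x + y \<in> cobounds A k" if xy: "x \<in> cobounds A k" "y \<in> cobounds A k" for x y
  proof (cases "k = 0")
    case False
    then obtain u v where "u \<in> gr A (k - 1)" "x = dif A u" "v \<in> gr A (k - 1)" "y = dif A v"
      using xy by (auto simp: cobounds_def)
    then show ?thesis
      using False image_eqI[of "x + y" "dif A" "u + v" "gr A (k - 1)"] gr_closed(2)[of u "k - 1" v]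
      by (simp add: cobounds_def dif_add gr_carr)
  qed (use xy in \<open>simp add: cobounds_def\<close>)
  show sc: "scal A q x \<in> cobounds A k" if x: "x \<in> cobounds A k" for x q
  proof (cases "k = 0")
    case False
    then obtain u where "u \<in> gr A (k - 1)" "x = dif A u"
      using x by (auto simp: cobounds_def)
    then show ?thesis
      using False image_eqI[of "scal A q x" "dif A" "scal A q u" "gr A (k - 1)"] gr_closed(3)[of u "k - 1" q]
      by (simp add: cobounds_def dif_scal gr_carr)
  qed (use x in \<open>simp add: cobounds_def\<close>)
  show "- x \<in> cobounds A k" if x: "x \<in> cobounds A k" for x
    using sc[OF x, of "-1"] by (simp add: V.scale_minus_left)
qed

lemma cobounds_diff: "x \<in> cobounds A k \<Longrightarrow> y \<in> cobounds A k \<Longrightarrow> x - y \<in> cobounds A k"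
  using cobounds_closed(2)[of x k "- y"] cobounds_closed(4) by simp

lemma mem_cls: "y \<in> cls A k x \<longleftrightarrow> y - x \<in> cobounds A k"
  unfolding cls_def by (auto intro!: image_eqI[of _ _ "y - x"])

lemma cls_self: "x \<in> cls A k x"
  by (simp add: mem_cls cobounds_closed(1))

lemma cls_eq_iff: "cls A k x = cls A k y \<longleftrightarrow> x - y \<in> cobounds A k"
proof
  assume "cls A k x = cls A k y"
  then show "x - y \<in> cobounds A k" using cls_self[of x k] mem_cls by auto
next
  assume xy: "x - y \<in> cobounds A k"
  show "cls A k x = cls A k y"
  proof (rule Set.set_eqI)
    fix z
    have "z - x = (z - y) - (x - y)" "z - y = (z - x) + (x - y)" by simp_all
    then show "z \<in> cls A k x \<longleftrightarrow> z \<in> cls A k y"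
      unfolding mem_cls using cobounds_closed(2)[OF _ xy] cobounds_diff[OF _ xy] by metis
  qed
qed

lemma coh_scal_cls: "coh_scal A k q (cls A k x) = cls A k (scal A q x)"
proof -
  have "cls A k (scal A q y) = cls A k (scal A q x)" if "y \<in> cls A k x" for y
    using cobounds_closed(3)[of "y - x" k q] that by (simp add: cls_eq_iff mem_cls V.scale_right_diff_distrib)
  note h = this
  show ?thesis unfolding coh_scal_def by (rule UN_constant_eq[OF cls_self]) (intro ballI h)
qed

lemma coh_cls: "\<alpha> \<in> coh A k \<Longrightarrow> x \<in> \<alpha> \<Longrightarrow> \<alpha> = cls A k x \<and> x \<in> cocycles A k"
proof -
  assume "\<alpha> \<in> coh A k" "x \<in> \<alpha>"
  then obtain y where y: "y \<in> cocycles A k" "\<alpha> = cls A k y" unfolding coh_def by blast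
  have xy: "x - y \<in> cobounds A k" using \<open>x \<in> \<alpha>\<close> y(2) by (simp add: mem_cls)
  have y': "y \<in> gr A k" "dif A y = 0" using y(1) by (auto simp: cocycles_def)
  have xy': "x - y \<in> gr A k" "dif A (x - y) = 0" using cobounds_cocycles[OF xy] by (auto simp: cocycles_def)
  have "x \<in> cocycles A k"
    using gr_closed(2)[OF y'(1) xy'(1)] dif_add[OF gr_carr[OF y'(1)] gr_carr[OF xy'(1)]] y' xy'
    by (simp add: cocycles_def)
  then show "\<alpha> = cls A k x \<and> x \<in> cocycles A k"
    using xy y(2) cls_eq_iff[of k x y] by simp
qed

end

context
  fixes A :: "'a::ab_group_add dg_algebra" and B :: "'b::ab_group_add dg_algebra" and f
  assumes A: "dga A" and B: "dga B" and f: "dga_hom f A B"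
begin

interpretation A: plain_dga A by (rule plain_dga.intro[OF A])
interpretation B: plain_dga B by (rule plain_dga.intro[OF B])

lemma dga_hom_cocycles: "x \<in> cocycles A k \<Longrightarrow> f x \<in> cocycles B k"
  using dga_homD(1,5)[OF f] dga_hom_0[OF A f] A.gr_carr by (auto simp: cocycles_def) metis

lemma dga_hom_cobounds: "x \<in> cobounds A k \<Longrightarrow> f x \<in> cobounds B k"
  using dga_homD(1,5)[OF f] dga_hom_0[OF A f] A.gr_carr
  by (auto simp: cobounds_def split: if_splits)

lemma coh_map_cls:
  assumes "x \<in> gr A k"
  shows "coh_map f B k (cls A k x) = cls B k (f x)"
proof -
  have "cls B k (f y) = cls B k (f x)" if "y \<in> cls A k x" for y
  proof -
    have yx: "y - x \<in> cobounds A k" using that by (simp add: A.mem_cls)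
    have c: "x \<in> carr A" "y - x \<in> carr A" using assms A.cobounds_gr[OF yx] A.gr_carr by blast+
    have "f y = f x + f (y - x)" using dga_homD(2)[OF f c] by simp
    then show ?thesis using dga_hom_cobounds[OF yx] by (simp add: B.cls_eq_iff)
  qed
  note h = this
  show ?thesis unfolding coh_map_def by (rule UN_constant_eq[OF A.cls_self]) (intro ballI h)
qed

end

lemma quasi_iso_inj:
  assumes "dga A" "dga B" "quasi_iso f A B" "x \<in> cocycles A k" "f x \<in> cobounds B k"
  shows "x \<in> cobounds A k"
proof -
  interpret A: plain_dga A by (rule plain_dga.intro[OF assms(1)])
  interpret B: plain_dga B by (rule plain_dga.intro[OF assms(2)])
  have f: "dga_hom f A B" and inj: "inj_on (coh_map f B k) (coh A k)"
    using assms(3) by (auto simp: quasi_iso_def bij_betw_def)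
  have x: "x \<in> gr A k" using assms(4) by (simp add: cocycles_def)
  have z: "0 \<in> cocycles A k" using A.cobounds_cocycles[OF A.cobounds_closed(1)] .
  have "coh_map f B k (cls A k x) = coh_map f B k (cls A k 0)"
    unfolding coh_map_cls[OF assms(1,2) f x] coh_map_cls[OF assms(1,2) f A.gr_closed(1)]
    using assms(5) by (simp add: B.cls_eq_iff dga_hom_0[OF assms(1) f])
  then have "cls A k x = cls A k 0"
    by (rule inj_onD[OF inj]) (use assms(4) z in \<open>auto simp: coh_def\<close>)
  then show ?thesis by (simp add: A.cls_eq_iff)
qed

lemma quasi_iso_surj:
  assumes "dga A" "dga B" "quasi_iso f A B" "y \<in> cocycles B k"
  obtains x where "x \<in> cocycles A k" "y - f x \<in> cobounds B k"
proof -
  interpret A: plain_dga A by (rule plain_dga.intro[OF assms(1)])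
  interpret B: plain_dga B by (rule plain_dga.intro[OF assms(2)])
  have f: "dga_hom f A B" and surj: "coh_map f B k ` coh A k = coh B k"
    using assms(3) by (auto simp: quasi_iso_def bij_betw_def)
  have "cls B k y \<in> coh B k" using assms(4) by (simp add: coh_def)
  then have "cls B k y \<in> coh_map f B k ` coh A k" unfolding surj .
  then obtain x where x: "x \<in> cocycles A k" "cls B k y = coh_map f B k (cls A k x)"
    unfolding coh_def by blast
  then have "x \<in> gr A k" by (simp add: cocycles_def)
  with x show ?thesis using that[of x] by (simp add: coh_map_cls[OF assms(1,2) f] B.cls_eq_iff)
qed

section \<open>The algebra of polynomial paths\<close>

context signed_dga
begin

text \<open>Subtracting \<open>2 ^ N\<close> times the value at \<open>q\<close> from the value at
  \<open>2 * q\<close> removes the leading term and multiplies the other coefficients by the nonzero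
  numbers \<open>2 ^ i - 2 ^ N\<close>.\<close>

lemma polynomial_eq_0:
  assumes "\<And>q. (\<Sum>i<N. scal A (q ^ i) (c i)) = 0" "i < N"
  shows "c i = 0"
  using assms
proof (induction N arbitrary: c i)
  case 0
  then show ?case by simp
next
  case (Suc N)
  have c: "c j = 0" if j: "j < N" for j
  proof -
    have "(\<Sum>i<N. scal A (q ^ i) (scal A (2 ^ i - 2 ^ N) (c i))) = 0" for q
    proof -
      have "(\<Sum>i<N. scal A (q ^ i) (scal A (2 ^ i - 2 ^ N) (c i)))
          = (\<Sum>i<Suc N. scal A (q ^ i) (scal A (2 ^ i - 2 ^ N) (c i)))" by simp
      also have "\<dots> = (\<Sum>i<Suc N. scal A ((2 * q) ^ i) (c i)) - scal A (2 ^ N) (\<Sum>i<Suc N. scal A (q ^ i) (c i))"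
        unfolding V.scale_sum_right sum_subtractf[symmetric]
      proof (intro sum.cong refl)
        fix i
        have "q ^ i * (2 ^ i - 2 ^ N) = (2 * q) ^ i - 2 ^ N * q ^ i"
          by (simp only: power_mult_distrib right_diff_distrib mult.commute)
        then show "scal A (q ^ i) (scal A (2 ^ i - 2 ^ N) (c i))
            = scal A ((2 * q) ^ i) (c i) - scal A (2 ^ N) (scal A (q ^ i) (c i))"
          by (simp only: V.scale_scale V.scale_left_diff_distrib[symmetric])
      qed
      also have "\<dots> = 0" unfolding Suc.prems(1) by simp
      finally show ?thesis .
    qed
    from Suc.IH[OF this j] have "scal A (2 ^ j - 2 ^ N) (c j) = 0" .
    moreover have "(2::rat) ^ j - 2 ^ N \<noteq> 0" using j by simp
    ultimately show ?thesis by (simp only: V.scale_eq_0_iff) simp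
  qed
  have "scal A (1 ^ N) (c N) = 0" using Suc.prems(1)[of 1] c by simp
  then show ?case using c Suc.prems(2) by (cases "i = N") auto
qed

text \<open>A large ambient dga of arbitrary functions with pointwise operations, in which the
  polynomial paths are a subalgebra.\<close>

definition paths :: "(rat \<Rightarrow> 'a \<times> 'a \<times> 'a) dg_algebra" where
  "paths = fun_dga triple_dga"

sublocale F: plain_dga paths
  unfolding paths_def by (rule plain_dga.intro[OF dga_fun[OF dga_triple]])

text \<open>The path \<open>t^i x\<close> together with its derivative. For \<open>i = 0\<close> the
  factor \<open>of_nat i\<close> is zero, so the truncated exponent is harmless.\<close>

definition cmono :: "nat \<Rightarrow> 'a \<Rightarrow> rat \<Rightarrow> 'a \<times> 'a \<times> 'a" where
  "cmono i x = (\<lambda>q. (scal A (q ^ i) x, scal A (of_nat i * q ^ (i - 1)) x, 0))"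

text \<open>The path \<open>dt t^i x\<close>.\<close>

definition emono :: "nat \<Rightarrow> 'a \<Rightarrow> rat \<Rightarrow> 'a \<times> 'a \<times> 'a" where
  "emono i x = (\<lambda>q. (0, 0, scal A (q ^ i) x))"

lemma cmono_add: "cmono i (x + y) = cmono i x + cmono i y"
  and emono_add: "emono i (x + y) = emono i x + emono i y"
  by (auto simp: cmono_def emono_def fun_eq_iff V.scale_right_distrib)

lemma cmono_0: "cmono i 0 = 0" and emono_0: "emono i 0 = 0"
  by (auto simp: cmono_def emono_def fun_eq_iff zero_prod_def)

lemma mono_scal:
  "scal paths r (cmono i x) = cmono i (scal A r x)" "scal paths r (emono i x) = emono i (scal A r x)"
  by (auto simp: paths_def cmono_def emono_def fun_eq_iff mult_ac)

lemma mono_gr: "x \<in> gr A k \<Longrightarrow> cmono i x \<in> gr paths k" "x \<in> grm k \<Longrightarrow> emono i x \<in> gr paths k"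
  by (auto simp: paths_def cmono_def emono_def gr_closed grm_closed)

lemma mono_dif:
  assumes "x \<in> carr A"
  shows "dif paths (cmono i x) = cmono i (dif A x) + emono (i - 1) (scal A (of_nat i) x)"
    and "dif paths (emono i x) = emono i (- dif A x)"
  using assms by (auto simp: paths_def cmono_def emono_def fun_eq_iff dif_scal dif_0 mult.commute)

lemma mono_prd:
  assumes "x \<in> carr A" "y \<in> carr A"
  shows "prd paths (cmono i x) (cmono j y) = cmono (i + j) (prd A x y)"
    and "prd paths (cmono i x) (emono j y) = emono (i + j) (prd A (\<tau> x) y)"
    and "prd paths (emono i x) (cmono j y) = emono (i + j) (prd A x y)"
    and "prd paths (emono i x) (emono j y) = 0"
proof -
  note s = assms carr_closed tau_carr
  have e: "of_nat i * q ^ (i - 1) * q ^ j + q ^ i * (of_nat j * q ^ (j - 1)) = of_nat (i + j) * q ^ (i + j - 1)"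
    for q :: rat
    by (cases i; cases j) (simp_all add: algebra_simps power_add)
  show "prd paths (cmono i x) (cmono j y) = cmono (i + j) (prd A x y)"
  proof
    fix q
    have "prd A (scal A (of_nat i * q ^ (i - 1)) x) (scal A (q ^ j) y)
        + prd A (scal A (q ^ i) x) (scal A (of_nat j * q ^ (j - 1)) y)
        = scal A (of_nat (i + j) * q ^ (i + j - 1)) (prd A x y)"
      unfolding e[symmetric] V.scale_left_distrib using s by (simp add: prd_scal mult_ac)
    then show "prd paths (cmono i x) (cmono j y) q = cmono (i + j) (prd A x y) q"
      using s by (simp add: paths_def cmono_def prd_scal prd_0 power_add)
  qed
  show "prd paths (cmono i x) (emono j y) = emono (i + j) (prd A (\<tau> x) y)"
    "prd paths (emono i x) (cmono j y) = emono (i + j) (prd A x y)"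
    "prd paths (emono i x) (emono j y) = 0"
    using s by (auto simp: paths_def cmono_def emono_def fun_eq_iff prd_scal prd_0 tau_scal power_add zero_prod_def mult.commute)
qed

text \<open>The part of degree \<open>k\<close> of the algebra of polynomial paths
  \<open>A[t, dt]\<close>.\<close>

definition Poly :: "nat \<Rightarrow> (rat \<Rightarrow> 'a \<times> 'a \<times> 'a) set" where
  "Poly k = F.V.span ({cmono i x |i x. x \<in> gr A k} \<union> {emono i x |i x. x \<in> grm k})"

lemma Poly_subspace: "F.V.subspace (Poly k)"
  unfolding Poly_def by (rule F.V.subspace_span)

lemma Poly_closed:
  "0 \<in> Poly k" "x \<in> Poly k \<Longrightarrow> y \<in> Poly k \<Longrightarrow> x + y \<in> Poly k" "x \<in> Poly k \<Longrightarrow> y \<in> Poly k \<Longrightarrow> x - y \<in> Poly k"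
  by (fact F.V.subspace_0[OF Poly_subspace] F.V.subspace_add[OF Poly_subspace] F.V.subspace_diff[OF Poly_subspace])+

lemma Poly_sum: "(\<And>i. i \<in> I \<Longrightarrow> f i \<in> Poly k) \<Longrightarrow> sum f I \<in> Poly k"
  by (rule F.V.subspace_sum[OF Poly_subspace])

lemma mono_Poly: "x \<in> gr A k \<Longrightarrow> cmono i x \<in> Poly k" "y \<in> grm k \<Longrightarrow> emono i y \<in> Poly k"
  unfolding Poly_def by (rule F.V.span_base; auto)+

lemma Poly_induct [consumes 1, case_names zero cmono emono]:
  assumes "\<gamma> \<in> Poly k" and zero: "P 0"
    and c: "\<And>i x \<delta>. x \<in> gr A k \<Longrightarrow> \<delta> \<in> Poly k \<Longrightarrow> P \<delta> \<Longrightarrow> P (cmono i x + \<delta>)"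
    and e: "\<And>i x \<delta>. x \<in> grm k \<Longrightarrow> \<delta> \<in> Poly k \<Longrightarrow> P \<delta> \<Longrightarrow> P (emono i x + \<delta>)"
  shows "P \<gamma>"
proof -
  have "\<gamma> \<in> Poly k \<and> P \<gamma>"
    using assms(1) unfolding Poly_def
  proof (induction rule: F.V.span_induct_alt)
    case base
    show ?case by (intro conjI zero F.V.span_zero)
  next
    case (step q \<eta> \<delta>)
    then have \<delta>: "\<delta> \<in> Poly k" "P \<delta>" by (auto simp: Poly_def)
    from step(1) consider i x where "x \<in> gr A k" "\<eta> = cmono i x" | i x where "x \<in> grm k" "\<eta> = emono i x"
      by blast
    then show ?case
    proof cases
      case 1
      have "scal A q x \<in> gr A k" using 1 by (simp add: gr_closed(3))
      then show ?thesis
        unfolding Poly_def[symmetric] 1 mono_scal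
        by (intro conjI Poly_closed(2)[OF mono_Poly(1) \<delta>(1)] c[OF _ \<delta>])
    next
      case 2
      have "scal A q x \<in> grm k" using 2 by (simp add: grm_closed(3))
      then show ?thesis
        unfolding Poly_def[symmetric] 2 mono_scal
        by (intro conjI Poly_closed(2)[OF mono_Poly(2) \<delta>(1)] e[OF _ \<delta>])
    qed
  qed
  then show ?thesis ..
qed

lemma Poly_gr: "\<gamma> \<in> Poly k \<Longrightarrow> \<gamma> \<in> gr paths k"
  by (induction \<gamma> rule: Poly_induct)
    (simp_all only: F.gr_closed mono_gr)

lemma Poly_dif: "\<gamma> \<in> Poly k \<Longrightarrow> dif paths \<gamma> \<in> Poly (Suc k)"
proof (induction \<gamma> rule: Poly_induct)
  case zero
  then show ?case by (simp only: F.dif_0 Poly_closed(1))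
next
  case (cmono i x \<delta>)
  have x: "scal A (of_nat i) x \<in> grm (Suc k)" using gr_closed(3)[OF cmono(1)] by (simp add: grm_def)
  have "dif paths (cmono i x) \<in> Poly (Suc k)"
    unfolding mono_dif(1)[OF gr_carr[OF cmono(1)]]
    by (intro Poly_closed mono_Poly dif_gr cmono x)
  then show ?case
    unfolding F.dif_add[OF F.gr_carr[OF mono_gr(1)[OF cmono(1)]] F.gr_carr[OF Poly_gr[OF cmono(2)]]]
    by (rule Poly_closed(2)[OF _ cmono(3)])
next
  case (emono i x \<delta>)
  have x: "- dif A x \<in> grm (Suc k)" using gr_closed(4)[OF grm_dif[OF emono(1)]] by (simp add: grm_def)
  have "dif paths (emono i x) \<in> Poly (Suc k)"
    unfolding mono_dif(2)[OF grm_carr[OF emono(1)]] by (intro mono_Poly x)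
  then show ?case
    unfolding F.dif_add[OF F.gr_carr[OF mono_gr(2)[OF emono(1)]] F.gr_carr[OF Poly_gr[OF emono(2)]]]
    by (rule Poly_closed(2)[OF _ emono(3)])
qed

lemma Poly_prd_mono:
  assumes "\<gamma> \<in> Poly k"
  shows "y \<in> gr A l \<Longrightarrow> prd paths \<gamma> (cmono j y) \<in> Poly (k + l)"
    and "y \<in> grm l \<Longrightarrow> prd paths \<gamma> (emono j y) \<in> Poly (k + l)"
proof -
  show "prd paths \<gamma> (cmono j y) \<in> Poly (k + l)" if y: "y \<in> gr A l"
    using assms
  proof (induction \<gamma> rule: Poly_induct)
    case zero
    then show ?case by (simp only: F.prd_0[OF F.gr_carr[OF mono_gr(1)[OF y]]] Poly_closed(1))
  next
    case (cmono i x \<delta>)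
    have "prd paths (cmono i x) (cmono j y) \<in> Poly (k + l)"
      unfolding mono_prd[OF gr_carr[OF cmono(1)] gr_carr[OF y]] by (intro mono_Poly prd_gr cmono y)
    then show ?case
      unfolding F.prd_add(1)[OF F.gr_carr[OF mono_gr(1)[OF cmono(1)]] F.gr_carr[OF Poly_gr[OF cmono(2)]] F.gr_carr[OF mono_gr(1)[OF y]]]
      by (rule Poly_closed(2)[OF _ cmono(3)])
  next
    case (emono i x \<delta>)
    have "prd paths (emono i x) (cmono j y) \<in> Poly (k + l)"
      unfolding mono_prd[OF grm_carr[OF emono(1)] gr_carr[OF y]] by (intro mono_Poly grm_prd emono y)
    then show ?case
      unfolding F.prd_add(1)[OF F.gr_carr[OF mono_gr(2)[OF emono(1)]] F.gr_carr[OF Poly_gr[OF emono(2)]] F.gr_carr[OF mono_gr(1)[OF y]]]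
      by (rule Poly_closed(2)[OF _ emono(3)])
  qed
  show "prd paths \<gamma> (emono j y) \<in> Poly (k + l)" if y: "y \<in> grm l"
    using assms
  proof (induction \<gamma> rule: Poly_induct)
    case zero
    then show ?case by (simp only: F.prd_0[OF F.gr_carr[OF mono_gr(2)[OF y]]] Poly_closed(1))
  next
    case (cmono i x \<delta>)
    have "prd paths (cmono i x) (emono j y) \<in> Poly (k + l)"
      unfolding mono_prd[OF gr_carr[OF cmono(1)] grm_carr[OF y]] by (intro mono_Poly grm_prd tau_in_gr cmono y)
    then show ?case
      unfolding F.prd_add(1)[OF F.gr_carr[OF mono_gr(1)[OF cmono(1)]] F.gr_carr[OF Poly_gr[OF cmono(2)]] F.gr_carr[OF mono_gr(2)[OF y]]]
      by (rule Poly_closed(2)[OF _ cmono(3)])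
  next
    case (emono i x \<delta>)
    have "prd paths (emono i x) (emono j y) \<in> Poly (k + l)"
      unfolding mono_prd[OF grm_carr[OF emono(1)] grm_carr[OF y]] by (rule Poly_closed)
    then show ?case
      unfolding F.prd_add(1)[OF F.gr_carr[OF mono_gr(2)[OF emono(1)]] F.gr_carr[OF Poly_gr[OF emono(2)]] F.gr_carr[OF mono_gr(2)[OF y]]]
      by (rule Poly_closed(2)[OF _ emono(3)])
  qed
qed

lemma Poly_prd:
  assumes \<gamma>: "\<gamma> \<in> Poly k" and "\<delta> \<in> Poly l"
  shows "prd paths \<gamma> \<delta> \<in> Poly (k + l)"
  using assms(2)
proof (induction \<delta> rule: Poly_induct)
  case zero
  then show ?case by (simp only: F.prd_0[OF F.gr_carr[OF Poly_gr[OF \<gamma>]]] Poly_closed(1))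
next
  case (cmono i x \<delta>)
  show ?case
    unfolding F.prd_add(2)[OF F.gr_carr[OF Poly_gr[OF \<gamma>]] F.gr_carr[OF mono_gr(1)[OF cmono(1)]] F.gr_carr[OF Poly_gr[OF cmono(2)]]]
    by (rule Poly_closed(2)[OF Poly_prd_mono(1)[OF \<gamma> cmono(1)] cmono(3)])
next
  case (emono i x \<delta>)
  show ?case
    unfolding F.prd_add(2)[OF F.gr_carr[OF Poly_gr[OF \<gamma>]] F.gr_carr[OF mono_gr(2)[OF emono(1)]] F.gr_carr[OF Poly_gr[OF emono(2)]]]
    by (rule Poly_closed(2)[OF Poly_prd_mono(2)[OF \<gamma> emono(1)] emono(3)])
qed

lemma Poly_unt: "unt paths \<in> Poly 0"
proof -
  have "unt paths = cmono 0 (unt A)" by (simp add: paths_def cmono_def fun_eq_iff)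
  then show ?thesis using mono_Poly(1)[OF unt_gr] by simp
qed

text \<open>The coefficients are defined for all \<open>i\<close> and padded by zeros, so that two
  normal forms can be added over a common bound; the zero at \<open>N\<close> also serves the index
  shift in \<open>path_integral\<close>.\<close>

lemma Poly_normal_form:
  assumes "\<gamma> \<in> Poly k"
  obtains N c e where "\<And>i. c i \<in> gr A k" "\<And>i. e i \<in> grm k" "\<And>i. i \<ge> N \<Longrightarrow> c i = 0 \<and> e i = 0"
    "\<gamma> = (\<Sum>i<N. cmono i (c i) + emono i (e i))"
proof -
  define nf where "nf \<gamma> N c e \<longleftrightarrow> (\<forall>i. c i \<in> gr A k) \<and> (\<forall>i. e i \<in> grm k) \<and> (\<forall>i\<ge>N. c i = 0 \<and> e i = 0) \<and>
    \<gamma> = (\<Sum>i<N. cmono i (c i) + emono i (e i))" for \<gamma> N c e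
  have ext: "nf \<gamma> M c e" if "nf \<gamma> N c e" "N \<le> M" for \<gamma> N M c e
  proof -
    have "(\<Sum>i<N. cmono i (c i) + emono i (e i)) = (\<Sum>i<M. cmono i (c i) + emono i (e i))"
      using that by (intro sum.mono_neutral_left) (auto simp: nf_def cmono_0 emono_0 simp flip: zero_fun_def)
    then show ?thesis using that by (auto simp: nf_def)
  qed
  have add: "nf (\<gamma> + \<gamma>') N (\<lambda>i. c i + c' i) (\<lambda>i. e i + e' i)" if "nf \<gamma> N c e" "nf \<gamma>' N c' e'" for \<gamma> \<gamma>' N c c' e e'
    using that gr_closed(2) grm_closed(2)
    by (auto simp: nf_def cmono_add emono_add sum.distrib add_ac)
  have single: "nf (cmono i x) (Suc i) (\<lambda>j. if j = i then x else 0) (\<lambda>_. 0)" if "x \<in> gr A k" for i x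
    using that by (auto simp: nf_def gr_closed grm_closed if_distrib[of "cmono _"] cmono_0 emono_0 cong: if_cong)
  have single': "nf (emono i x) (Suc i) (\<lambda>_. 0) (\<lambda>j. if j = i then x else 0)" if "x \<in> grm k" for i x
    using that by (auto simp: nf_def gr_closed grm_closed if_distrib[of "emono _"] cmono_0 emono_0 cong: if_cong)
  have "\<exists>N c e. nf \<gamma> N c e"
    using assms
  proof (induction \<gamma> rule: Poly_induct)
    case zero
    have "nf 0 0 (\<lambda>_. 0) (\<lambda>_. 0)" by (simp add: nf_def gr_closed grm_closed)
    then show ?case by blast
  next
    case (cmono i x \<delta>)
    then obtain N c e where "nf \<delta> N c e" by blast
    note add[OF ext[OF single[OF cmono(1)] max.cobounded1] ext[OF this max.cobounded2]]
    then show ?case by (intro exI)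
  next
    case (emono i x \<delta>)
    then obtain N c e where "nf \<delta> N c e" by blast
    note add[OF ext[OF single'[OF emono(1)] max.cobounded1] ext[OF this max.cobounded2]]
    then show ?case by (intro exI)
  qed
  then obtain N c e where "nf \<gamma> N c e" by blast
  then show ?thesis using that[of c e N] by (simp add: nf_def)
qed

end

subsection \<open>The path object\<close>

context signed_dga
begin

lemma fst_triple:
  "fst (dif triple_dga t) = dif A (fst t)" "fst (prd triple_dga s t) = prd A (fst s) (fst t)"
  "fst (scal triple_dga q t) = scal A q (fst t)"
  by (cases s; cases t; simp)+

lemma fst_paths:
  "fst (dif paths \<gamma> q) = dif A (fst (\<gamma> q))" "fst (prd paths \<gamma> \<delta> q) = prd A (fst (\<gamma> q)) (fst (\<delta> q))"
  "fst (scal paths r \<gamma> q) = scal A r (fst (\<gamma> q))" "fst (unt paths q) = unt A"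
  by (simp_all only: paths_def fun_dga_sel fst_triple triple_sel fst_conv)

lemma fst_mono: "fst (cmono i x q) = scal A (q ^ i) x" "fst (emono i x q) = 0"
  by (simp_all add: cmono_def emono_def)

lemma fst_Poly: "\<gamma> \<in> Poly k \<Longrightarrow> fst (\<gamma> q) \<in> gr A k"
  using Poly_gr[of \<gamma> k] by (auto simp: paths_def mem_Times_iff)

text \<open>\<open>h\<close> is the integral of \<open>\<gamma>\<close> from \<open>0\<close> to \<open>t\<close>.\<close>

lemma path_integral:
  assumes \<gamma>: "\<gamma> \<in> Poly k" "dif paths \<gamma> = 0"
  obtains h where "h \<in> (if k = 0 then {0} else Poly (k - 1))"
    "dif paths h = \<gamma> - cmono 0 (fst (\<gamma> 0))" "fst (h 0) = 0"
proof -
  obtain N c e where c: "\<And>i. c i \<in> gr A k" and e: "\<And>i. e i \<in> grm k"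
    and N: "\<And>i. i \<ge> N \<Longrightarrow> c i = 0 \<and> e i = 0"
    and nf: "\<gamma> = (\<Sum>i<N. cmono i (c i) + emono i (e i))"
    by (rule Poly_normal_form[OF \<gamma>(1)], rule that, assumption+)
  have cN: "c N = 0" using N by simp
  note ca = gr_carr[OF c] grm_carr[OF e]
  have v: "fst (snd (\<gamma> q)) = (\<Sum>i<N. scal A (of_nat i * q ^ (i - 1)) (c i))"
    "snd (snd (\<gamma> q)) = (\<Sum>i<N. scal A (q ^ i) (e i))" for q
    unfolding nf sum_fun_apply snd_sum fst_sum plus_fun_apply by (simp_all add: cmono_def emono_def)
  have shift: "(\<Sum>i<N. f i) = f 0 + (\<Sum>i<N. f (Suc i))" if "f N = 0" for f :: "nat \<Rightarrow> 'b::ab_group_add"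
  proof -
    have "(\<Sum>i<N. f i) = (\<Sum>i<Suc N. f i)" using that by simp
    also have "\<dots> = f 0 + (\<Sum>i<N. f (Suc i))" by (rule sum.lessThan_Suc_shift)
    finally show ?thesis .
  qed
  \<comment> \<open>Closedness of \<open>\<gamma>\<close> in the \<open>dt\<close> component says
    that the derivative of its first component is the differential of its third. As the values at
    all rationals agree, so do the coefficients.\<close>
  have de: "scal A (of_nat (Suc i)) (c (Suc i)) - dif A (e i) = 0" if "i < N" for i
  proof (rule polynomial_eq_0[OF _ that])
    fix q
    have "0 = snd (snd (dif paths \<gamma> q))" unfolding \<gamma>(2) by (simp add: zero_prod_def)
    also have "\<dots> = fst (snd (\<gamma> q)) - dif A (snd (snd (\<gamma> q)))"
      by (cases "\<gamma> q") (simp add: paths_def)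
    also have "fst (snd (\<gamma> q)) = (\<Sum>i<N. scal A (q ^ i) (scal A (of_nat (Suc i)) (c (Suc i))))"
    proof -
      have "(\<Sum>i<N. scal A (of_nat i * q ^ (i - 1)) (c i))
          = scal A (of_nat 0 * q ^ (0 - 1)) (c 0) + (\<Sum>i<N. scal A (of_nat (Suc i) * q ^ (Suc i - 1)) (c (Suc i)))"
        by (rule shift) (simp add: cN)
      then show ?thesis unfolding v by (simp add: mult.commute)
    qed
    also have "dif A (snd (snd (\<gamma> q))) = (\<Sum>i<N. scal A (q ^ i) (dif A (e i)))"
      unfolding v using ca carr_closed(3) by (subst dif_sum) (simp_all add: dif_scal)
    finally show "(\<Sum>i<N. scal A (q ^ i) (scal A (of_nat (Suc i)) (c (Suc i)) - dif A (e i))) = 0"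
      by (simp add: sum_subtractf V.scale_right_diff_distrib)
  qed
  \<comment> \<open>Integration of \<open>dt t^i e_i\<close> from 0 to \<open>t\<close>, term by
    term. There is no constant of integration, hence \<open>h\<close> vanishes at 0. In degree zero
    there is no \<open>dt\<close> part and \<open>h\<close> is zero.\<close>
  define h where "h = (\<Sum>i<N. cmono (Suc i) (scal A (1 / of_nat (Suc i)) (e i)))"
  have hc: "scal A (1 / of_nat (Suc i)) (e i) \<in> carr A" for i by (rule carr_closed(3)[OF ca(2)])
  have h_mem: "h \<in> (if k = 0 then {0} else Poly (k - 1))"
  proof (cases "k = 0")
    case True
    then have "e i = 0" for i using e[of i] by (simp add: grm_def)
    then show ?thesis using True by (simp add: h_def cmono_0 del: of_nat_Suc flip: zero_fun_def)
  next
    case False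
    then have "e i \<in> gr A (k - 1)" for i using e[of i] by (simp add: grm_def)
    then have "h \<in> Poly (k - 1)" unfolding h_def by (intro Poly_sum mono_Poly gr_closed(3))
    then show ?thesis using False by simp
  qed
  have cm: "cmono (Suc i) (scal A (1 / of_nat (Suc i)) (e i)) \<in> carr paths" for i
  proof (cases "k = 0")
    case True
    then have "e i = 0" using e[of i] by (simp add: grm_def)
    then show ?thesis using F.carr_closed(1) by (simp only: V.scale_zero_right cmono_0)
  next
    case False
    then have "e i \<in> gr A (k - 1)" using e[of i] by (simp add: grm_def)
    then show ?thesis by (intro F.gr_carr[OF mono_gr(1)] gr_closed(3))
  qed
  have "dif paths h = (\<Sum>i<N. dif paths (cmono (Suc i) (scal A (1 / of_nat (Suc i)) (e i))))"
    unfolding h_def by (rule F.dif_sum[OF cm])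
  also have "\<dots> = (\<Sum>i<N. cmono (Suc i) (c (Suc i)) + emono i (e i))"
  proof (intro sum.cong refl)
    fix i assume "i \<in> {..<N}"
    then have d: "dif A (e i) = scal A (of_nat (Suc i)) (c (Suc i))" using de[of i] by simp
    have 1: "scal A (1 / of_nat (Suc i)) (dif A (e i)) = c (Suc i)"
      unfolding d V.scale_scale by (simp del: of_nat_Suc)
    have 2: "scal A (of_nat (Suc i)) (scal A (1 / of_nat (Suc i)) (e i)) = e i"
      unfolding V.scale_scale by (simp del: of_nat_Suc)
    show "dif paths (cmono (Suc i) (scal A (1 / of_nat (Suc i)) (e i))) = cmono (Suc i) (c (Suc i)) + emono i (e i)"
      unfolding mono_dif(1)[OF hc] dif_scal[OF ca(2)] 1 2 diff_Suc_1 ..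
  qed
  also have "\<dots> = \<gamma> - cmono 0 (c 0)"
  proof -
    have "(\<Sum>i<N. cmono i (c i)) = cmono 0 (c 0) + (\<Sum>i<N. cmono (Suc i) (c (Suc i)))"
      by (rule shift) (simp only: cN cmono_0)
    then show ?thesis unfolding nf sum.distrib by (simp only: add.assoc add_diff_cancel_left')
  qed
  finally have dh: "dif paths h = \<gamma> - cmono 0 (c 0)" .
  have h0: "fst (h 0) = 0"
    unfolding h_def sum_fun_apply fst_sum fst_mono by simp
  have "fst (\<gamma> 0) = c 0"
    using fst_paths(1)[of h 0] unfolding dh h0 dif_0 by (simp add: fst_mono)
  then show ?thesis using that[OF h_mem _ h0] dh by simp
qed

text \<open>The integral \<open>h\<close> of the closed path has differential
  \<open>\<gamma>\<close> minus its constant initial value; evaluation at 1 exhibits the difference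
  of the ends as the differential of \<open>h 1\<close>.\<close>

lemma closed_path_ends:
  assumes \<gamma>: "\<gamma> \<in> Poly k" "dif paths \<gamma> = 0"
  shows "fst (\<gamma> 1) - fst (\<gamma> 0) \<in> cobounds A k"
proof -
  from path_integral[OF \<gamma>] obtain h where h: "h \<in> (if k = 0 then {0} else Poly (k - 1))"
    "dif paths h = \<gamma> - cmono 0 (fst (\<gamma> 0))" "fst (h 0) = 0" .
  have e: "fst (\<gamma> 1) - fst (\<gamma> 0) = dif A (fst (h 1))"
    using fst_paths(1)[of h 1] unfolding h(2) by (simp add: fst_mono)
  show ?thesis
  proof (cases "k = 0")
    case True
    then show ?thesis using h(1) cobounds_closed(1) unfolding e by (simp add: dif_0)
  next
    case False
    then have "fst (h 1) \<in> gr A (k - 1)" using h(1) fst_Poly by simp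
    then show ?thesis unfolding e using cobounds_dif[of "fst (h 1)" "k - 1"] False by simp
  qed
qed

text \<open>For \<open>w = dif A u\<close> the path is \<open>d (t u) = t w + dt u\<close>.\<close>

lemma exact_path:
  assumes "w \<in> cobounds A k"
  obtains \<kappa> where "\<kappa> \<in> Poly k" "dif paths \<kappa> = 0" "fst (\<kappa> 0) = 0" "fst (\<kappa> 1) = w"
proof (cases "k = 0")
  case True
  then have "w = 0" using assms by (simp add: cobounds_def)
  then show ?thesis using that[of 0] Poly_closed(1) F.dif_0 by simp
next
  case False
  then obtain u where u: "u \<in> gr A (k - 1)" "w = dif A u" using assms by (auto simp: cobounds_def)
  have P: "cmono 1 u \<in> Poly (k - 1)" by (rule mono_Poly(1)[OF u(1)])
  show ?thesis
  proof (rule that)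
    show "dif paths (cmono 1 u) \<in> Poly k" using Poly_dif[OF P] False by simp
    show "dif paths (dif paths (cmono 1 u)) = 0" by (rule F.dif_dif[OF F.gr_carr[OF Poly_gr[OF P]]])
    show "fst (dif paths (cmono 1 u) 0) = 0" "fst (dif paths (cmono 1 u) 1) = w"
      unfolding fst_paths fst_mono by (simp_all add: dif_0 u(2))
  qed
qed

end

locale path_object = signed_dga C \<tau> + B: plain_dga B
  for C :: "'c::ab_group_add dg_algebra" and \<tau> and B :: "'b::ab_group_add dg_algebra" +
  fixes m :: "'b \<Rightarrow> 'c"
  assumes quasi: "quasi_iso m B C"
begin

lemma m: "dga_hom m B C"
  using quasi by (simp add: quasi_iso_def)

lemma dgas: "dga B" "dga C"
  by (fact B.dga_axioms dga_axioms)+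

text \<open>The mapping path construction for \<open>m\<close>: it factors \<open>m\<close>, up to
  homotopy of paths, through the evaluation at the free end, along which lifting is strict.\<close>

definition path_gr :: "nat \<Rightarrow> ('b \<times> (rat \<Rightarrow> 'c \<times> 'c \<times> 'c)) set" where
  "path_gr k = {(b, \<gamma>). b \<in> gr B k \<and> \<gamma> \<in> Poly k \<and> fst (\<gamma> 0) = m b}"

definition path_alg :: "('b \<times> (rat \<Rightarrow> 'c \<times> 'c \<times> 'c)) dg_algebra" where
  "path_alg = sub_dga (prod_dga B paths) path_gr"

lemma dga_path_alg: "dga path_alg"
  unfolding path_alg_def
proof (rule dga_sub)
  show D: "dga (prod_dga B paths)" by (rule dga_prod[OF dgas(1) F.dga_axioms])
  interpret D: plain_dga "prod_dga B paths" by (rule plain_dga.intro[OF D])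
  show "path_gr k \<subseteq> gr (prod_dga B paths) k" for k
    using Poly_gr by (auto simp: path_gr_def)
  show "D.V.subspace (path_gr k)" for k
    unfolding D.V.subspace_def
  proof (intro conjI ballI allI)
    show "0 \<in> path_gr k"
      using B.gr_closed(1) Poly_closed(1) dga_hom_0[OF dgas(1) m] by (simp add: path_gr_def zero_prod_def)
    show "x + y \<in> path_gr k" if "x \<in> path_gr k" "y \<in> path_gr k" for x y
      using that B.gr_closed(2) Poly_closed(2) dga_homD(2)[OF m] B.gr_carr by (auto simp: path_gr_def)
    show "scal (prod_dga B paths) q x \<in> path_gr k" if "x \<in> path_gr k" for q x
      using that B.gr_closed(3) F.V.subspace_scale[OF Poly_subspace] dga_homD(4)[OF m] B.gr_carr
      by (auto simp: path_gr_def fst_paths)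
  qed
  show "unt (prod_dga B paths) \<in> path_gr 0"
    using B.unt_gr Poly_unt dga_homD(6)[OF m] by (simp add: path_gr_def fst_paths)
  show "prd (prod_dga B paths) x y \<in> path_gr (i + j)" if "x \<in> path_gr i" "y \<in> path_gr j" for x y i j
    using that B.prd_gr Poly_prd dga_homD(3)[OF m] B.gr_carr by (auto simp: path_gr_def fst_paths)
  show "dif (prod_dga B paths) x \<in> path_gr (Suc k)" if "x \<in> path_gr k" for x k
    using that B.dif_gr Poly_dif dga_homD(5)[OF m] B.gr_carr by (auto simp: path_gr_def fst_paths)
qed

sublocale P: plain_dga path_alg
  by (rule plain_dga.intro[OF dga_path_alg])

definition endpoint :: "'b \<times> (rat \<Rightarrow> 'c \<times> 'c \<times> 'c) \<Rightarrow> 'c" where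
  "endpoint y = fst (snd y 1)"

lemma dga_hom_endpoint: "dga_hom endpoint path_alg C"
  unfolding dga_hom_def path_alg_def endpoint_def
  using fst_Poly by (auto simp: path_gr_def fst_paths)

lemma dga_hom_fst: "dga_hom fst path_alg B"
  unfolding dga_hom_def path_alg_def by (auto simp: path_gr_def)

text \<open>Integrating the path shows that \<open>m b\<close> is exact, so \<open>b\<close> has a
  primitive \<open>b1\<close>, since \<open>m\<close> is injective on cohomology. This primitive
  need not fit the prescribed end \<open>c\<close>; the defect is a cocycle, which by surjectivity
  on cohomology equals \<open>m b2\<close> up to an exact term, and an exact path absorbs that
  term.\<close>

lemma path_lift:
  assumes y: "y \<in> gr path_alg (Suc k)" "dif path_alg y = 0" and c: "c \<in> gr C k" "endpoint y = dif C c"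
  shows "\<exists>z\<in>gr path_alg k. dif path_alg z = y \<and> endpoint z = c"
proof -
  obtain b \<gamma> where y_eq: "y = (b, \<gamma>)" by (cases y)
  have b: "b \<in> gr B (Suc k)" "dif B b = 0" and \<gamma>: "\<gamma> \<in> Poly (Suc k)" "dif paths \<gamma> = 0" "fst (\<gamma> 0) = m b"
    and c1: "fst (\<gamma> 1) = dif C c"
    using y c(2) by (auto simp: y_eq path_alg_def path_gr_def endpoint_def zero_prod_def)
  from path_integral[OF \<gamma>(1,2)] obtain h where "h \<in> (if Suc k = 0 then {0} else Poly (Suc k - 1))"
    "dif paths h = \<gamma> - cmono 0 (fst (\<gamma> 0))" and h0: "fst (h 0) = 0" .
  then have h: "h \<in> Poly k" "dif paths h = \<gamma> - cmono 0 (m b)" "fst (h 0) = 0"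
    unfolding \<gamma>(3) using h0 by simp_all
  have h1: "fst (h 1) \<in> gr C k" by (rule fst_Poly[OF h(1)])
  have dh1: "dif C (fst (h 1)) = dif C c - m b"
    using fst_paths(1)[of h 1] unfolding h(2) by (simp add: fst_mono c1)
  have ch: "c - fst (h 1) \<in> gr C k" by (rule gr_closed(5)[OF c(1) h1])
  have mb: "m b = dif C (c - fst (h 1))"
    using carr_minus_simps(1)[OF gr_carr[OF c(1)] gr_carr[OF h1]] dh1 by simp
  have "b \<in> cobounds B (Suc k)"
    by (rule quasi_iso_inj[OF dgas quasi]) (use b cobounds_dif[OF ch] mb in \<open>auto simp: cocycles_def\<close>)
  then obtain b1 where b1: "b1 \<in> gr B k" "b = dif B b1" by (auto simp: cobounds_def)
  have mb1: "m b1 \<in> gr C k" "dif C (m b1) = m b"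
    using dga_homD(1)[OF m b1(1)] dga_homD(5)[OF m B.gr_carr[OF b1(1)]] b1(2) by simp_all
  have "m b1 - (c - fst (h 1)) \<in> cocycles C k"
    using gr_closed(5)[OF mb1(1) ch] carr_minus_simps(1)[OF gr_carr[OF mb1(1)] gr_carr[OF ch]] mb mb1(2)
    by (simp add: cocycles_def)
  from quasi_iso_surj[OF dgas quasi this] obtain b2 where b2: "b2 \<in> cocycles B k"
    and w: "m b1 - (c - fst (h 1)) - m b2 \<in> cobounds C k" .
  from exact_path[OF w] obtain \<kappa> where \<kappa>: "\<kappa> \<in> Poly k" "dif paths \<kappa> = 0" "fst (\<kappa> 0) = 0"
    "fst (\<kappa> 1) = m b1 - (c - fst (h 1)) - m b2" .
  have b2': "b2 \<in> gr B k" "dif B b2 = 0" using b2 by (auto simp: cocycles_def)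
  let ?b = "b1 - b2"
  have b3: "?b \<in> gr B k" by (rule B.gr_closed(5)[OF b1(1) b2'(1)])
  have mb3: "m ?b = m b1 - m b2"
    by (rule dga_hom_minus(2)[OF dgas(1) m B.gr_carr[OF b1(1)] B.gr_carr[OF b2'(1)]])
  have db3: "dif B ?b = b"
    using B.carr_minus_simps(1)[OF B.gr_carr[OF b1(1)] B.gr_carr[OF b2'(1)]] b1 b2' by simp
  have mc: "m ?b \<in> gr C k" by (rule dga_homD(1)[OF m b3])
  have dmc: "dif C (m ?b) = m b" using dga_homD(5)[OF m B.gr_carr[OF b3]] db3 by simp
  \<comment> \<open>\<open>h\<close> plus the constant path at \<open>m ?b\<close> has the right
    differential and starts at \<open>m ?b\<close>; the closed path \<open>\<kappa>\<close>, which
    vanishes at 0, moves the other end to \<open>c\<close>.\<close>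
  let ?\<delta> = "h + cmono 0 (m ?b) - \<kappa>"
  have hm: "h + cmono 0 (m ?b) \<in> Poly k" by (rule Poly_closed(2)[OF h(1) mono_Poly(1)[OF mc]])
  have \<delta>: "?\<delta> \<in> Poly k" by (rule Poly_closed(3)[OF hm \<kappa>(1)])
  note pc = F.gr_carr[OF Poly_gr]
  have "dif paths ?\<delta> = dif paths h + dif paths (cmono 0 (m ?b)) - dif paths \<kappa>"
    unfolding F.carr_minus_simps(1)[OF pc[OF hm] pc[OF \<kappa>(1)]]
      F.dif_add[OF pc[OF h(1)] pc[OF mono_Poly(1)[OF mc]]] ..
  also have "dif paths (cmono 0 (m ?b)) = cmono 0 (m b)"
    unfolding mono_dif(1)[OF gr_carr[OF mc]] dmc of_nat_0 V.scale_zero_left emono_0 by (rule add_0_right)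
  also have "dif paths h + cmono 0 (m b) - dif paths \<kappa> = \<gamma>"
    unfolding h(2) \<kappa>(2) diff_0_right by (rule diff_add_cancel)
  finally have d\<delta>: "dif paths ?\<delta> = \<gamma>" .
  have "fst (?\<delta> 0) = m ?b" "fst (?\<delta> 1) = c"
    by (simp_all add: h(3) \<kappa>(3,4) fst_mono mb3)
  then have "(?b, ?\<delta>) \<in> gr path_alg k" "endpoint (?b, ?\<delta>) = c"
    using b3 \<delta> by (simp_all only: path_alg_def sub_dga_sel path_gr_def endpoint_def mem_Collect_eq case_prod_conv snd_conv simp_thms)
  moreover have "dif path_alg (?b, ?\<delta>) = y"
    unfolding y_eq path_alg_def sub_dga_sel prod_dga_sel fst_conv snd_conv db3 d\<delta> ..
  ultimately show ?thesis by blast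
qed

text \<open>A strict lift through the path object is a lift of \<open>\<psi>\<close> through the quasi-isomorphism \<open>m\<close> up to
  homotopy.\<close>

theorem homotopy_lift:
  fixes S :: "'s::ab_group_add dg_algebra"
  assumes S: "minimal_sullivan S" and \<psi>: "dga_hom \<psi> S C"
  shows "\<exists>\<phi>. dga_hom \<phi> S B \<and> (\<forall>k. \<forall>x\<in>cocycles S k. \<psi> x - m (\<phi> x) \<in> cobounds C k)"
proof -
  have dS: "dga S" using S by (simp add: minimal_sullivan_def)
  obtain X dg G where X: "freely_generated S dg X" "mono G" "(\<Union>j::nat. G j) = X" "\<forall>x\<in>G 0. dif S x = 0"
    "\<forall>j. \<forall>x\<in>G (Suc j). dif S x \<in> module.span (scal S) (word S ` lists (G j))"
    using S unfolding minimal_sullivan_def by auto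
  interpret S: plain_dga S by (rule plain_dga.intro[OF dS])
  interpret L: lift_problem S dg X path_alg C endpoint \<psi>
    by unfold_locales (fact X(1) dga_hom_endpoint \<psi> path_lift)+
  obtain f where f: "dga_hom f S path_alg" "\<forall>b\<in>carr S. endpoint (f b) = \<psi> b"
    using L.lift_exists[OF X(2-5)] by blast
  have "\<psi> x - m (fst (f x)) \<in> cobounds C k" if x: "x \<in> cocycles S k" for x k
  proof -
    have xg: "x \<in> gr S k" using x by (simp add: cocycles_def)
    obtain b \<gamma> where fx: "f x = (b, \<gamma>)" by (cases "f x")
    have "f x \<in> cocycles path_alg k" by (rule dga_hom_cocycles[OF dS dga_path_alg f(1) x])
    then have "\<gamma> \<in> Poly k" "dif paths \<gamma> = 0" "fst (\<gamma> 0) = m b"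
      by (auto simp: fx cocycles_def path_alg_def path_gr_def zero_prod_def)
    moreover have "fst (\<gamma> 1) = \<psi> x"
      using f(2) S.gr_carr[OF xg] by (auto simp: fx endpoint_def dest!: bspec[of _ _ x])
    ultimately show ?thesis using closed_path_ends[of \<gamma> k] by (simp add: fx)
  qed
  moreover have "dga_hom (fst \<circ> f) S B" by (rule dga_hom_comp[OF dS dga_path_alg f(1) dga_hom_fst])
  ultimately show ?thesis by (intro exI[of _ "fst \<circ> f"]) simp
qed

end

section \<open>Degrees of maps and the comparison with inflexibility\<close>

subsection \<open>Signs and pairings for polynomial forms\<close>

text \<open>The sign is read off the index set \<open>I\<close> and not off the degree of a
  homogeneous element, so the involution is linear on the whole ambient space.\<close>

lemma signed_dga_A_PL: "signed_dga (A_PL X) (\<lambda>\<omega> p \<sigma> I. (-1) ^ card I * \<omega> p \<sigma> I)"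
proof (intro signed_dga.intro plain_dga.intro dga_A_PL signed_dga_axioms.intro)
  let ?\<tau> = "\<lambda>\<omega> p \<sigma> I. (-1) ^ card I * \<omega> p \<sigma> I :: (nat \<Rightarrow>\<^sub>0 nat) \<Rightarrow>\<^sub>0 rat"
  show "?\<tau> (\<omega> + \<eta>) = ?\<tau> \<omega> + ?\<tau> \<eta>" for \<omega> \<eta> :: "nat \<Rightarrow> ((nat \<Rightarrow> real) \<Rightarrow> 'a) \<Rightarrow> poly_form"
    by (intro ext) (simp add: distrib_left)
  show "?\<tau> (scal (A_PL X) q \<omega>) = scal (A_PL X) q (?\<tau> \<omega>)" for q \<omega>
    by (intro ext) (simp add: A_PL_def mult.left_commute)
  show "?\<tau> \<omega> = scal (A_PL X) ((-1) ^ k) \<omega>" if \<omega>: "\<omega> \<in> gr (A_PL X) k" for \<omega> k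
  proof (intro ext)
    fix p \<sigma> I
    have "card I = k" if "\<omega> p \<sigma> I \<noteq> 0"
    proof -
      have "singular_simplex p X \<sigma>"
      proof (rule ccontr)
        assume "\<not> singular_simplex p X \<sigma>"
        then have "\<omega> p \<sigma> = 0" using \<omega> by (simp add: gr_A_PL_iff)
        then show False using that by simp
      qed
      then have "\<omega> p \<sigma> \<in> poly_forms p k" using \<omega> by (simp add: gr_A_PL_iff)
      then show ?thesis using that by (auto simp: poly_forms_def)
    qed
    moreover have "mconst ((-1) ^ k) = (-1) ^ k"
      by (cases "even k") (simp_all add: mconst_minus)
    ultimately show "(-1) ^ card I * \<omega> p \<sigma> I = scal (A_PL X) ((-1) ^ k) \<omega> p \<sigma> I"
      by (cases "\<omega> p \<sigma> I = 0") (simp_all add: A_PL_def)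
  qed
qed

lemma evaluate_de_Rham_diff:
  "evaluate n (de_Rham X (\<omega> - \<eta>)) z = evaluate n (de_Rham X \<omega>) z - evaluate n (de_Rham X \<eta>) z"
proof -
  have "de_Rham X (\<omega> - \<eta>) n \<sigma> = de_Rham X \<omega> n \<sigma> - de_Rham X \<eta> n \<sigma>" for \<sigma>
    by (simp add: de_Rham_def form_integral_eq Jint_diff)
  then show ?thesis by (simp add: evaluate_def right_diff_distrib sum_subtractf)
qed

lemma evaluate_de_Rham_scal:
  "evaluate n (de_Rham X (scal (A_PL X) q \<omega>)) z = q * evaluate n (de_Rham X \<omega>) z"
proof -
  have "de_Rham X (scal (A_PL X) q \<omega>) n \<sigma> = q * de_Rham X \<omega> n \<sigma>" for \<sigma>
    by (simp add: de_Rham_def form_integral_eq A_PL_def Jint_mconst_mult)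
  then show ?thesis by (simp add: evaluate_def sum_distrib_left mult.left_commute)
qed

text \<open>The cochain algebra is not graded commutative, so facts about \<open>plain_dga\<close>
  do not apply to it. That zero is a coboundary suffices to see \<open>f x\<close> as a member of
  its class.\<close>

lemma kronecker_representative:
  assumes "kronecker_eq n (coh_map f (cochains X) n b) u r" "x \<in> b" "z \<in> u"
  shows "evaluate n (f x) z = r"
proof -
  have "0 \<in> cobounds (cochains X) n"
  proof (cases "n = 0")
    case False
    have "dif (cochains X) 0 = 0" "0 \<in> gr (cochains X) (n - 1)"
      by (auto simp: cochains_def evaluate_def fun_eq_iff)
    then show ?thesis using False image_eqI[of 0 "dif (cochains X)" 0] by (simp add: cobounds_def)
  qed (simp add: cobounds_def)
  then have "f x + 0 \<in> cls (cochains X) n (f x)" unfolding cls_def by (rule imageI)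
  then have "f x \<in> coh_map f (cochains X) n b" unfolding coh_map_def using assms(2) by (intro UN_I) simp_all
  then show ?thesis using assms(1,3) by (simp add: kronecker_eq_def)
qed

text \<open>Integrality is decisive: both multiples come from integral homology, so
  \<open>k' * k = 1\<close> leaves only \<open>1\<close> and \<open>-1\<close>. The closed form
  \<open>\<omega>\<close> detects the multiples by its integrals.\<close>

lemma homotopy_equivalence_degree:
  assumes M: "closed_sc_manifold n M" "fundamental_class n (mtop M) (orient M) u" "z \<in> u"
    and M': "closed_sc_manifold n M'" "fundamental_class n (mtop M') (orient M') u'" "z' \<in> u'"
    and g: "continuous_map (mtop M) (mtop M') g" and h: "continuous_map (mtop M') (mtop M) h"
    and gh: "homotopic_with (\<lambda>x. True) (mtop M') (mtop M') (g \<circ> h) id"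
    and \<omega>: "\<omega> \<in> cocycles (A_PL (mtop M')) n" and \<omega>1: "evaluate n (de_Rham (mtop M') \<omega>) z' = 1"
  obtains k :: int where "k \<in> {1, -1}" "evaluate n (de_Rham (mtop M') \<omega>) (chain_map n g z) = of_int k"
proof -
  let ?E = "evaluate n (de_Rham (mtop M') \<omega>)"
  have \<omega>': "\<omega> \<in> gr (A_PL (mtop M')) n" "dif (A_PL (mtop M')) \<omega> = 0"
    using \<omega> by (auto simp: cocycles_def)
  note bd = de_Rham_boundary[OF \<omega>']
  \<comment> \<open>The zero cycle is inserted into \<open>fundamental_class_generates\<close> to
    extract that \<open>z\<close> and \<open>z'\<close> are cycles.\<close>
  have zero: "singular_relcycle n (mtop X) {} 0" for X :: "'c oriented_manifold" by simp
  have zero': "singular_relcycle n (mtop X) {} 0" for X :: "'d oriented_manifold" by simp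
  from fundamental_class_generates[OF M zero] have cz: "singular_relcycle n (mtop M) {} z" by blast
  from fundamental_class_generates[OF M' zero'] have cz': "singular_relcycle n (mtop M') {} z'" by blast
  have gz: "singular_relcycle n (mtop M') {} (chain_map n g z)"
    by (rule singular_relcycle_chain_map[OF cz g]) simp
  have hz: "singular_relcycle n (mtop M) {} (chain_map n h z')"
    by (rule singular_relcycle_chain_map[OF cz' h]) simp
  from fundamental_class_generates[OF M' gz] obtain k
    where k: "singular_relboundary n (mtop M') {} (chain_map n g z - frag_cmul k z')" by blast
  from fundamental_class_generates[OF M hz] obtain k'
    where k': "singular_relboundary n (mtop M) {} (chain_map n h z' - frag_cmul k' z)" by blast
  have Ek: "?E (chain_map n g z) = of_int k"
    using bd[OF k] by (simp add: evaluate_diff evaluate_cmul \<omega>1)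
  have "singular_relboundary n (mtop M') {} (chain_map n g (chain_map n h z' - frag_cmul k' z))"
    by (rule singular_relboundary_chain_map[OF k' g]) simp
  from bd[OF this] have "?E (chain_map n g (chain_map n h z')) = of_int k' * of_int k"
    by (simp add: chain_map_diff evaluate_diff evaluate_cmul Ek)
  moreover have "homologous_rel n (mtop M') {} (chain_map n (g \<circ> h) z') (chain_map n id z')"
    by (rule homotopic_imp_homologous_rel_chain_maps[OF homotopic_with_mono[OF gh] cz']) simp
  then have "singular_relboundary n (mtop M') {} (chain_map n g (chain_map n h z') - chain_map n id z')"
    by (simp add: homologous_rel_def chain_map_compose)
  from bd[OF this] have "?E (chain_map n g (chain_map n h z')) = 1"
    using cz' chain_map_ident[of n "mtop M'" z'] by (simp add: evaluate_diff \<omega>1 singular_cycle)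
  ultimately have "of_int (k' * k) = (1 :: rat)" by simp
  then have "k' * k = 1" by (simp only: of_int_eq_1_iff)
  then have "k \<in> {1, -1}" by (auto simp: zmult_eq_1_iff)
  then show ?thesis using Ek that by blast
qed

subsection \<open>Isomorphisms of dgas\<close>

lemma (in plain_dga) carr_sum_gr:
  assumes "x \<in> carr A"
  obtains a N where "\<And>k. a k \<in> gr A k" "\<And>k. k \<ge> N \<Longrightarrow> a k = 0" "x = (\<Sum>k<N. a k)"
proof -
  have "\<exists>a N. (\<forall>k. a k \<in> gr A k) \<and> (\<forall>k\<ge>N. a k = 0) \<and> x = (\<Sum>k<N. a k)"
    using assms
  proof (induction x rule: carr_induct)
    case zero
    show ?case using gr_closed(1) by (intro exI[of _ "\<lambda>_. 0"] exI[of _ 0]) simp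
  next
    case (add k x y)
    then obtain a N where a: "\<forall>k. a k \<in> gr A k" "\<forall>k\<ge>N. a k = 0" "y = (\<Sum>k<N. a k)" by blast
    let ?N = "max N (Suc k)" and ?a = "\<lambda>i. (if i = k then x else 0) + a i"
    have "y = (\<Sum>i<?N. a i)" unfolding a(3) using a(2) by (intro sum.mono_neutral_left) auto
    moreover have "(\<Sum>i<?N. if i = k then x else 0) = x" by (subst sum.delta) (auto simp: less_max_iff_disj)
    ultimately have s: "x + y = (\<Sum>i<?N. ?a i)" by (simp only: sum.distrib)
    have g: "?a i \<in> gr A i" for i
      by (rule gr_closed(2)) (use add(1) a(1) gr_closed(1) in auto)
    have z: "?a i = 0" if "i \<ge> ?N" for i using that a(2) by simp
    show ?case by (intro exI[of _ ?a] exI[of _ ?N] conjI allI impI g z s)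
  qed
  then show ?thesis using that by metis
qed

text \<open>\<open>dga_iso\<close> asks for a bijection of carriers only, so the inverse must be
  shown to preserve degrees: the preimage of a homogeneous \<open>y\<close> is split into
  homogeneous parts, and directness in \<open>B\<close> shows that the part of degree
  \<open>k\<close> alone maps to \<open>y\<close>.\<close>

lemma dga_iso_inverse:
  assumes A: "dga A" and B: "dga B" and f: "dga_iso f A B"
  shows "dga_hom (inv_into (carr A) f) B A"
    and "x \<in> carr A \<Longrightarrow> inv_into (carr A) f (f x) = x"
    and "y \<in> carr B \<Longrightarrow> f (inv_into (carr A) f y) = y"
proof -
  interpret A: plain_dga A by (rule plain_dga.intro[OF A])
  interpret B: plain_dga B by (rule plain_dga.intro[OF B])
  let ?g = "inv_into (carr A) f"
  have hom: "dga_hom f A B" and inj: "inj_on f (carr A)" and surj: "f ` carr A = carr B"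
    using f by (auto simp: dga_iso_def bij_betw_def)
  show gf: "?g (f x) = x" if "x \<in> carr A" for x by (rule inv_into_f_f[OF inj that])
  show fg: "f (?g y) = y" if "y \<in> carr B" for y by (rule f_inv_into_f) (simp add: surj that)
  have gc: "?g y \<in> carr A" if "y \<in> carr B" for y by (rule inv_into_into) (simp add: surj that)
  have gi: "?g y = x" if "x \<in> carr A" "f x = y" for x y using gf[OF that(1)] that(2) by simp
  have gr: "?g y \<in> gr A k" if y: "y \<in> gr B k" for y k
  proof -
    obtain a N where a: "\<And>k. a k \<in> gr A k" "\<And>k. k \<ge> N \<Longrightarrow> a k = 0" "?g y = (\<Sum>k<N. a k)"
      by (rule A.carr_sum_gr[OF gc[OF B.gr_carr[OF y]]], rule that, assumption+)
    let ?N = "max N (Suc k)"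
    have fs: "f (\<Sum>i<M. a i) = (\<Sum>i<M. f (a i))" for M
    proof (induction M)
      case (Suc M)
      have "f ((\<Sum>i<M. a i) + a M) = f (\<Sum>i<M. a i) + f (a M)"
        by (intro dga_homD(2)[OF hom] A.carr_sum A.gr_carr[OF a(1)])
      then show ?case using Suc by simp
    qed (simp add: dga_hom_0[OF A hom])
    have "?g y = (\<Sum>k<?N. a k)" unfolding a(3) using a(2) by (intro sum.mono_neutral_left) auto
    then have "y = (\<Sum>i<?N. f (a i))" using fg[OF B.gr_carr[OF y]] fs by metis
    then have "(\<Sum>i<?N. f (a i) - (if i = k then y else 0)) = 0" by (simp add: sum_subtractf)
    moreover have "\<forall>i\<in>{..<?N}. f (a i) - (if i = k then y else 0) \<in> gr B i"
    proof
      fix i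
      have "f (a i) \<in> gr B i" "(if i = k then y else 0) \<in> gr B i"
        using dga_homD(1)[OF hom a(1)] y B.gr_closed(1) by auto
      then show "f (a i) - (if i = k then y else 0) \<in> gr B i" by (rule B.gr_closed(5))
    qed
    ultimately have "f (a k) - (if k = k then y else 0) = 0"
      by (intro B.direct[of "{..<?N}" "\<lambda>i. f (a i) - (if i = k then y else 0)" k]) simp_all
    then have "?g y = a k" by (intro gi A.gr_carr[OF a(1)]) simp
    then show ?thesis using a(1) by simp
  qed
  show "dga_hom ?g B A"
    unfolding dga_hom_def
  proof (intro conjI allI ballI)
    show "?g ` gr B k \<subseteq> gr A k" for k using gr by blast
    fix x assume x: "x \<in> carr B"
    show "?g (scal B q x) = scal A q (?g x)" for q
      by (rule gi[OF A.carr_closed(3)[OF gc[OF x]]]) (simp add: dga_homD(4)[OF hom gc[OF x]] fg[OF x])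
    show "?g (dif B x) = dif A (?g x)"
      by (rule gi[OF A.carr_dif[OF gc[OF x]]]) (simp add: dga_homD(5)[OF hom gc[OF x], symmetric] fg[OF x] dga_homD(5)[OF hom gc[OF x]])
    fix y assume y: "y \<in> carr B"
    show "?g (x + y) = ?g x + ?g y"
      by (rule gi[OF A.carr_closed(2)[OF gc[OF x] gc[OF y]]])
        (simp add: dga_homD(2)[OF hom gc[OF x] gc[OF y]] fg[OF x] fg[OF y])
    show "?g (prd B x y) = prd A (?g x) (?g y)"
      by (rule gi[OF A.carr_prd[OF gc[OF x] gc[OF y]]])
        (simp add: dga_homD(3)[OF hom gc[OF x] gc[OF y]] fg[OF x] fg[OF y])
  next
    show "?g (unt B) = unt A"
      by (rule gi[OF A.carr_unt dga_homD(6)[OF hom]])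
  qed
qed

subsection \<open>Degrees\<close>

lemma inflexible_degree:
  assumes A: "poincare_dga n A cA" "inflexible n A cA" and F: "dga_hom F A A"
    and y: "y \<in> cA" and d: "F y - scal A \<delta> y \<in> cobounds A n"
  shows "\<delta> \<in> {-1, 0, 1}"
proof (rule ccontr)
  assume \<delta>: "\<delta> \<notin> {-1, 0, 1}"
  have dA: "dga A" and cA: "cA \<in> coh A n" using A(1) by (auto simp: poincare_dga_def simply_connected_dga_def)
  interpret A: plain_dga A by (rule plain_dga.intro[OF dA])
  have yc: "cA = cls A n y" "y \<in> gr A n" using A.coh_cls[OF cA y] by (auto simp: cocycles_def)
  have "coh_map F A n cA = coh_scal A n \<delta> cA"
    unfolding yc(1) coh_map_cls[OF dA dA F yc(2)] A.coh_scal_cls using d by (simp add: A.cls_eq_iff)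
  then show False using A(2) F \<delta> unfolding inflexible_def by blast
qed

lemma poincare_top_class:
  assumes "poincare_dga n A cA" "y \<in> cA" "x \<in> cocycles A n"
  obtains q where "x - scal A q y \<in> cobounds A n"
proof -
  have dA: "dga A" and cA: "cA \<in> coh A n" and bij: "bij_betw (\<lambda>q. coh_scal A n q cA) UNIV (coh A n)"
    using assms(1) by (auto simp: poincare_dga_def simply_connected_dga_def)
  interpret A: plain_dga A by (rule plain_dga.intro[OF dA])
  have "cls A n x \<in> coh A n" using assms(3) by (simp add: coh_def)
  also have "coh A n = (\<lambda>q. coh_scal A n q cA) ` UNIV" using bij by (simp add: bij_betw_def)
  finally obtain q where "cls A n x = coh_scal A n q cA" by blast
  then have "cls A n x = cls A n (scal A q y)" using A.coh_cls[OF cA assms(2)] A.coh_scal_cls by simp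
  then show ?thesis using that by (simp add: A.cls_eq_iff)
qed

lemma iso_representative:
  assumes "dga B" "dga A" "dga_hom f B A" "b \<in> coh B n" "x \<in> b" "cA \<in> coh A n" "y \<in> cA"
    and "coh_map f A n b = coh_scal A n a cA"
  shows "f x - scal A a y \<in> cobounds A n"
proof -
  interpret A: plain_dga A by (rule plain_dga.intro[OF assms(2)])
  interpret B: plain_dga B by (rule plain_dga.intro[OF assms(1)])
  have x: "b = cls B n x" "x \<in> gr B n" using B.coh_cls[OF assms(4,5)] by (auto simp: cocycles_def)
  have y: "cA = cls A n y" using A.coh_cls[OF assms(6,7)] by simp
  show ?thesis
    using assms(8) unfolding x(1) y coh_map_cls[OF assms(1-3) x(2)] A.coh_scal_cls A.cls_eq_iff .
qed

lemma fundamental_class_nonempty: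
  assumes "fundamental_class n X \<mu> u"
  obtains z where "z \<in> u"
proof -
  have "u \<in> carrier (homology_group (int n) X)" using assms by (simp add: fundamental_class_def)
  then obtain z where "u = homologous_rel_set n X {} z" by (auto simp: carrier_relative_homology_group)
  then show ?thesis using that[of z] by (simp add: homologous_rel_refl)
qed

lemma coh_nonempty:
  assumes "dga A" "\<alpha> \<in> coh A k"
  obtains x where "x \<in> \<alpha>" "x \<in> cocycles A k"
proof -
  interpret A: plain_dga A by (rule plain_dga.intro[OF assms(1)])
  obtain x where "x \<in> cocycles A k" "\<alpha> = cls A k x" using assms(2) by (auto simp: coh_def)
  then show ?thesis using that[of x] A.cls_self[of x k] by simp
qed

theorem proposition9p8:
  fixes A :: "'a::ab_group_add dg_algebra" and cA :: "'a set" and n :: nat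
    and a a' :: rat
    and M :: "'m oriented_manifold" and M' :: "'k oriented_manifold"
  assumes "poincare_dga n A cA" and "inflexible n A cA"
    and "a \<noteq> 0" and "a' \<noteq> 0" and "\<bar>a\<bar> \<noteq> \<bar>a'\<bar>"
    and "M \<in> realizing_manifolds n A (coh_scal A n a cA)"
    and "M' \<in> realizing_manifolds n A (coh_scal A n a' cA)"
  shows "\<not> (mtop M) homotopy_equivalent_space (mtop M')"
proof
  assume "(mtop M) homotopy_equivalent_space (mtop M')"
  then obtain g h where g: "continuous_map (mtop M) (mtop M') g" and h: "continuous_map (mtop M') (mtop M) h"
    and gh: "homotopic_with (\<lambda>x. True) (mtop M') (mtop M') (g \<circ> h) id"
    unfolding homotopy_equivalent_space_def by blast
  obtain B :: "'a dg_algebra" and m b f where M: "closed_sc_manifold n M" "minimal_model B m (mtop M)"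
    "dual_fundamental_class n M B m b" "dga_iso f B A" "coh_map f A n b = coh_scal A n a cA"
    using assms(6) unfolding realizing_manifolds_def by blast
  obtain B' :: "'a dg_algebra" and m' b' f' where M': "closed_sc_manifold n M'" "minimal_model B' m' (mtop M')"
    "dual_fundamental_class n M' B' m' b'" "dga_iso f' B' A" "coh_map f' A n b' = coh_scal A n a' cA"
    using assms(7) unfolding realizing_manifolds_def by blast
  have dA: "dga A" and cA: "cA \<in> coh A n"
    using assms(1) by (auto simp: poincare_dga_def simply_connected_dga_def)
  have dB: "dga B" "dga B'" and S: "minimal_sullivan B'" and m: "quasi_iso m B (A_PL (mtop M))"
    and m': "dga_hom m' B' (A_PL (mtop M'))"
    using M(2) M'(2) by (auto simp: minimal_model_def minimal_sullivan_def quasi_iso_def)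
  have f: "dga_hom f B A" "dga_hom f' B' A" using M(4) M'(4) by (auto simp: dga_iso_def)
  obtain u where b: "b \<in> coh B n" and u: "fundamental_class n (mtop M) (orient M) u"
    "kronecker_eq n (coh_map (de_Rham (mtop M) \<circ> m) (cochains (mtop M)) n b) u 1"
    using M(3) by (auto simp: dual_fundamental_class_def)
  obtain u' where b': "b' \<in> coh B' n" and u': "fundamental_class n (mtop M') (orient M') u'"
    "kronecker_eq n (coh_map (de_Rham (mtop M') \<circ> m') (cochains (mtop M')) n b') u' 1"
    using M'(3) by (auto simp: dual_fundamental_class_def)
  obtain z where z: "z \<in> u" by (rule fundamental_class_nonempty[OF u(1)])
  obtain z' where z': "z' \<in> u'" by (rule fundamental_class_nonempty[OF u'(1)])
  obtain x where x: "x \<in> b" "x \<in> cocycles B n" by (rule coh_nonempty[OF dB(1) b])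
  obtain x' where x': "x' \<in> b'" "x' \<in> cocycles B' n" by (rule coh_nonempty[OF dB(2) b'])
  obtain y where y: "y \<in> cA" "y \<in> cocycles A n" by (rule coh_nonempty[OF dA cA])
  interpret A: plain_dga A by (rule plain_dga.intro[OF dA])
  interpret B: plain_dga B by (rule plain_dga.intro[OF dB(1)])
  interpret B': plain_dga B' by (rule plain_dga.intro[OF dB(2)])
  interpret C: plain_dga "A_PL (mtop M)" by (rule plain_dga.intro[OF dga_A_PL])
  interpret P: path_object "A_PL (mtop M)" "\<lambda>\<omega> p \<sigma> I. (-1) ^ card I * \<omega> p \<sigma> I" B m
    by (intro path_object.intro signed_dga_A_PL B.plain_dga_axioms path_object_axioms.intro m)
  let ?E = "\<lambda>\<omega>. evaluate n (de_Rham (mtop M) \<omega>) z"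
  have mx: "?E (m x) = 1"
    using kronecker_representative[OF u(2) x(1) z] by simp
  have mx': "evaluate n (de_Rham (mtop M') (m' x')) z' = 1"
    using kronecker_representative[OF u'(2) x'(1) z'] by simp
  have cz: "singular_relcycle n (mtop M) {} z"
    using fundamental_class_generates[OF M(1) u(1) z, of 0] by auto
  define \<psi> where "\<psi> = apl_pullback (mtop M) g \<circ> m'"
  have \<psi>: "dga_hom \<psi> B' (A_PL (mtop M))"
    unfolding \<psi>_def by (rule dga_hom_comp[OF dB(2) dga_A_PL m' dga_hom_apl_pullback[OF g]])
  obtain \<phi> where \<phi>: "dga_hom \<phi> B' B"
    "\<And>k x. x \<in> cocycles B' k \<Longrightarrow> \<psi> x - m (\<phi> x) \<in> cobounds (A_PL (mtop M)) k"
    using P.homotopy_lift[OF S \<psi>] by blast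
  obtain k :: int where k: "k \<in> {1, -1}"
    and Ek: "evaluate n (de_Rham (mtop M') (m' x')) (chain_map n g z) = of_int k"
    by (rule homotopy_equivalence_degree[OF M(1) u(1) z M'(1) u'(1) z' g h gh
          dga_hom_cocycles[OF dB(2) dga_A_PL m' x'(2)] mx'])
  have E\<psi>: "?E (\<psi> x') = of_int k"
    using de_Rham_pullback[OF g, of n z "m' x'"] cz Ek by (simp add: \<psi>_def singular_cycle)
  have fx: "f x - scal A a y \<in> cobounds A n"
    by (rule iso_representative[OF dB(1) dA f(1) b x(1) cA y(1) M(5)])
  have fx': "f' x' - scal A a' y \<in> cobounds A n"
    by (rule iso_representative[OF dB(2) dA f(2) b' x'(1) cA y(1) M'(5)])
  have \<phi>x': "\<phi> x' \<in> cocycles B n" by (rule dga_hom_cocycles[OF dB(2,1) \<phi>(1) x'(2)])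
  \<comment> \<open>The top cohomology of \<open>A\<close> is a line, so a multiple exists; its
    value is found below by integration.\<close>
  obtain q where q: "f (\<phi> x') - scal A q y \<in> cobounds A n"
    by (rule poincare_top_class[OF assms(1) y(1) dga_hom_cocycles[OF dB(1) dA f(1) \<phi>x']])
  \<comment> \<open>Since \<open>f x\<close> represents \<open>a\<close> times the class of
    \<open>y\<close>, the class of \<open>q y\<close> in \<open>A\<close> corresponds to that of
    \<open>l x\<close> in \<open>B\<close>.\<close>
  define l where "l = q / a"
  have ca: "x \<in> carr B" "x' \<in> carr B'" "\<phi> x' \<in> carr B" "y \<in> carr A"
    using x(2) x'(2) y(2) \<phi>x' A.gr_carr B.gr_carr B'.gr_carr by (auto simp: cocycles_def)
  have lx: "scal B l x \<in> carr B" by (rule B.carr_closed(3)[OF ca(1)])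
  have sx: "\<phi> x' - scal B l x \<in> carr B" by (rule B.carr_closed(5)[OF ca(3) lx])
  have "f (\<phi> x' - scal B l x) = (f (\<phi> x') - scal A q y) - scal A l (f x - scal A a y)"
    unfolding dga_hom_minus(2)[OF dB(1) f(1) ca(3) lx] dga_homD(4)[OF f(1) ca(1)]
    using assms(3) by (simp add: A.V.scale_right_diff_distrib l_def)
  also have "\<dots> \<in> cobounds A n" by (intro A.cobounds_diff q A.cobounds_closed(3) fx)
  finally have "inv_into (carr B) f (f (\<phi> x' - scal B l x)) \<in> cobounds B n"
    by (rule dga_hom_cobounds[OF dA dB(1) dga_iso_inverse(1)[OF dB(1) dA M(4)]])
  then have \<phi>l: "\<phi> x' - scal B l x \<in> cobounds B n"
    unfolding dga_iso_inverse(2)[OF dB(1) dA M(4) sx] .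
  \<comment> \<open>The factor \<open>l\<close> is computed over \<open>M\<close>: the integral of
    \<open>m x\<close> is 1, while \<open>m (\<phi> x')\<close> differs from the pulled back form by
    a coboundary and hence has the integral \<open>k\<close>.\<close>
  have "?E (m (\<phi> x' - scal B l x)) = 0"
    by (rule de_Rham_cobounds[OF dga_hom_cobounds[OF dB(1) dga_A_PL P.m \<phi>l] cz])
  then have "?E (m (\<phi> x')) = l"
    unfolding dga_hom_minus(2)[OF dB(1) P.m ca(3) lx] dga_homD(4)[OF P.m ca(1)]
    by (simp add: evaluate_de_Rham_diff evaluate_de_Rham_scal mx)
  moreover have "?E (\<psi> x' - m (\<phi> x')) = 0"
    by (rule de_Rham_cobounds[OF \<phi>(2)[OF x'(2)] cz])
  ultimately have l: "l = of_int k" using E\<psi> by (simp add: evaluate_de_Rham_diff)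
  let ?i = "inv_into (carr B') f'"
  note i = dga_iso_inverse[OF dB(2) dA M'(4)]
  have F: "dga_hom (f \<circ> \<phi> \<circ> ?i) A A"
    by (intro dga_hom_comp[OF dA dB(2) i(1)] dga_hom_comp[OF dB(2,1) \<phi>(1) f(1)])
  let ?F = "f \<circ> \<phi> \<circ> ?i"
  have fc: "f' x' \<in> carr A" "scal A a' y \<in> carr A"
    using dga_hom_carr[OF dB(2) dA f(2) ca(2)] A.carr_closed(3)[OF ca(4)] by simp_all
  \<comment> \<open>\<open>f' x'\<close> represents \<open>a'\<close> times the class of
    \<open>y\<close>, and \<open>?F\<close> sends it to \<open>f (\<phi> x')\<close>; this expresses
    the class of \<open>?F y\<close> through that of \<open>q y\<close>.\<close>
  have "?F (f' x' - scal A a' y) = f (\<phi> x') - scal A a' (?F y)"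
    unfolding dga_hom_minus(2)[OF dA F fc] dga_homD(4)[OF F ca(4)] using i(2)[OF ca(2)] by simp
  then have 1: "f (\<phi> x') - scal A a' (?F y) \<in> cobounds A n"
    using dga_hom_cobounds[OF dA dA F fx'] by simp
  have "scal A (1 / a') ((f (\<phi> x') - scal A q y) - (f (\<phi> x') - scal A a' (?F y))) \<in> cobounds A n"
    by (intro A.cobounds_closed(3) A.cobounds_diff q 1)
  then have "?F y - scal A (q / a') y \<in> cobounds A n"
    using assms(4) by (simp add: A.V.scale_right_diff_distrib)
  then have "q / a' \<in> {-1, 0, 1}"
    by (rule inflexible_degree[OF assms(1,2) F y(1)])
  moreover have "q = of_int k * a" using l assms(3) by (simp add: l_def field_simps)
  \<comment> \<open>The quotient is \<open>a / a'\<close> up to sign, which is nonzero and of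
    absolute value different from one.\<close>
  ultimately show False
    using k assms(3-5) by (auto simp: field_simps abs_if split: if_splits)
qed

end
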